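(* Let $\gamma>0$, let $$X=\Big\{u:\mathbb{R}^2\to\mathbb{C}:\ \int_{\mathbb{R}^2}\big(|\nabla u|^2+|u|^2+\ln(1+|x|)\,|u|^2\big)\,dx<\infty\Big\},$$ and for $u\in X$ let $$E(u)=\int_{\mathbb{R}^2}|\nabla u|^2\,dx+\frac{\gamma}{4\pi}\int_{\mathbb{R}^2}\int_{\mathbb{R}^2}\ln(|x-y|)\,|u(x)|^2|u(y)|^2\,dx\,dy,\qquad N(u)=\int_{\mathbb{R}^2}|u|^2\,dx,$$ and $e_0(\lambda)=\inf\{E(u):u\in X,\ N(u)=\lambda\}$. Then for every $\lambda>0$ there exists a spherically symmetric decreasing function $u_\lambda\in X$ such that $N(u_\lambda)=\lambda$ and $E(u_\lambda)=e_0(\lambda)$.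
   Context: $\gamma>0$ is a fixed coupling constant. *)

theory Defs
  imports "HOL-Analysis.Analysis"
begin

text \<open>Smooth (C-infinity) real functions on the plane: all iterated partial derivatives
  exist everywhere and are continuous.\<close>
definition smooth_fun :: "(real^2 \<Rightarrow> real) \<Rightarrow> bool" where
  "smooth_fun \<phi> \<longleftrightarrow>
     (\<exists>S. \<phi> \<in> S \<and>
        (\<forall>g\<in>S. continuous_on UNIV g \<and>
           (\<forall>i::2. \<exists>h\<in>S. \<forall>x. ((\<lambda>t. g (x + t *\<^sub>R axis i 1)) has_real_derivative h x) (at 0))))"

definition test_fun :: "(real^2 \<Rightarrow> real) \<Rightarrow> bool" where
  "test_fun \<phi> \<longleftrightarrow> smooth_fun \<phi> \<and> compact (closure {x. \<phi> x \<noteq> 0})"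

definition weak_partial :: "(real^2 \<Rightarrow> complex) \<Rightarrow> 2 \<Rightarrow> (real^2 \<Rightarrow> complex) \<Rightarrow> bool" where
  "weak_partial u i g \<longleftrightarrow>
     (\<forall>\<phi> d\<phi>. test_fun \<phi> \<and>
        (\<forall>x. ((\<lambda>t. \<phi> (x + t *\<^sub>R axis i 1)) has_real_derivative d\<phi> x) (at 0)) \<longrightarrow>
        (\<integral>x. complex_of_real (d\<phi> x) * u x \<partial>lborel) = - (\<integral>x. complex_of_real (\<phi> x) * g x \<partial>lborel))"

definition X_space :: "(real^2 \<Rightarrow> complex) set" where
  "X_space = {u. u \<in> borel_measurable lborel \<and>
     (\<exists>g1 g2. g1 \<in> borel_measurable lborel \<and> g2 \<in> borel_measurable lborel \<and>
        weak_partial u 1 g1 \<and> weak_partial u 2 g2 \<and>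
        (\<integral>\<^sup>+x. ennreal ((cmod (g1 x))\<^sup>2 + (cmod (g2 x))\<^sup>2 + (cmod (u x))\<^sup>2
                 + ln (1 + norm x) * (cmod (u x))\<^sup>2) \<partial>lborel) < \<infinity>)}"

text \<open>Dirichlet energy: integral of |grad u|^2 for the (a.e. unique) weak gradient.\<close>
definition dirichlet :: "(real^2 \<Rightarrow> complex) \<Rightarrow> real" where
  "dirichlet u = (SOME D. \<exists>g1 g2. g1 \<in> borel_measurable lborel \<and> g2 \<in> borel_measurable lborel \<and>
        weak_partial u 1 g1 \<and> weak_partial u 2 g2 \<and>
        D = (\<integral>x. (cmod (g1 x))\<^sup>2 + (cmod (g2 x))\<^sup>2 \<partial>lborel))"

definition mass :: "(real^2 \<Rightarrow> complex) \<Rightarrow> real" where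
  "mass u = (\<integral>x. (cmod (u x))\<^sup>2 \<partial>lborel)"

definition energy :: "real \<Rightarrow> (real^2 \<Rightarrow> complex) \<Rightarrow> real" where
  "energy \<gamma> u = dirichlet u + \<gamma> / (4 * pi) *
     (\<integral>y. (\<integral>x. ln (dist x y) * (cmod (u x))\<^sup>2 * (cmod (u y))\<^sup>2 \<partial>lborel) \<partial>lborel)"

definition e0 :: "real \<Rightarrow> real \<Rightarrow> ereal" where
  "e0 \<gamma> lam = (INF u \<in> {u \<in> X_space. mass u = lam}. ereal (energy \<gamma> u))"

definition sym_decreasing :: "(real^2 \<Rightarrow> complex) \<Rightarrow> bool" where
  "sym_decreasing u \<longleftrightarrow>
     (\<exists>f :: real \<Rightarrow> real. (\<forall>x. u x = complex_of_real (f (norm x))) \<and>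
        (\<forall>r s. 0 \<le> r \<and> r \<le> s \<longrightarrow> f s \<le> f r))"

end

theory Submission
  imports Defs "HOL-Complex_Analysis.Great_Picard"
begin

text \<open>
  The Dirichlet energy of \<open>u\<close> is the limit of the normalised difference energies, the integrals of
  \<open>|u(x + h) - u(x)|\<^sup>2\<close> over all \<open>x\<close> and over \<open>h\<close> in a small disc. Hence passing to \<open>|u|\<close>, to limits,
  to truncations and to polarisations is controlled by pointwise inequalities between differences.

  Existence: after translation, the growth of the logarithm makes a minimising sequence tight, disc
  averages make it compact in \<open>L\<^sup>2\<close>, and the energy is lower semicontinuous.

  Symmetry: polarising a nonnegative minimiser \<open>v\<close> in a line does not raise the Dirichlet energy, and
  it strictly lowers the logarithmic energy unless \<open>v\<close> dominates its reflection on one side of the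
  line, because \<open>ln\<close> is strictly increasing. The lines bisecting the mass in two orthogonal
  directions meet in a centre; with respect to it \<open>v\<close> is almost everywhere a decreasing
  function \<open>f\<close> of the radius.

  The value at the centre must be finite. Comparing \<open>v\<close> with its truncation at height \<open>f(R)\<close> gives
  \<open>f(R/2) \<le> (1 + C R\<^sup>2) f(R)\<close> for small \<open>R\<close>, and iterating this along \<open>R, R/2, R/4, \<dots>\<close> bounds \<open>f\<close>.
\<close>

subsection \<open>Square-integrable functions\<close>

text \<open>The permissive definitions shape the proof. \<open>weak_partial\<close> compares Bochner
  integrals, which are 0 for non-integrable functions, and \<open>dirichlet\<close> chooses among
  all measurable weak gradients. Its value is pinned down by showing that a gradient that is not
  locally integrable would force the square-integrable one to vanish, hence \<open>u\<close> to be
  translation invariant along an axis, which positive mass excludes. Discs make the difference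
  energy isotropic: their second moments are a multiple of the identity, and that multiple is the
  normalisation. In place of a Sobolev inequality, the singularity of the logarithm is controlled by
  a cruder fact: a disc of radius s carries mass at most 2 s (N + D), with N the mass and D the
  Dirichlet energy. So the singular part of the kernel below distance \<delta> has energy of order
  \<delta>, which serves coercivity and lower semicontinuity; the same estimate with \<delta> = 1
  serves the truncation bound. Boundedness matters because a decreasing real profile on [0,
  \<infinity>) is bounded by its value at radius 0, whereas a function known only almost everywhere
  could blow up there.\<close>

definition L2 :: "'a measure \<Rightarrow> ('a \<Rightarrow> 'b::euclidean_space) \<Rightarrow> bool" where
  "L2 M f \<longleftrightarrow> f \<in> borel_measurable M \<and> integrable M (\<lambda>x. (norm (f x))\<^sup>2)"

definition nsq :: "'a measure \<Rightarrow> ('a \<Rightarrow> 'b::euclidean_space) \<Rightarrow> real" where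
  "nsq M f = (\<integral>x. (norm (f x))\<^sup>2 \<partial>M)"

lemma L2_measurable [measurable_dest]: "L2 M f \<Longrightarrow> f \<in> borel_measurable M"
  by (simp add: L2_def)

lemma L2_integrable: "L2 M f \<Longrightarrow> integrable M (\<lambda>x. (norm (f x))\<^sup>2)"
  by (simp add: L2_def)

lemma nsq_nonneg: "0 \<le> nsq M f"
  by (simp add: nsq_def)

lemma nn_integral_nsq: "L2 M f \<Longrightarrow> (\<integral>\<^sup>+x. ennreal ((norm (f x))\<^sup>2) \<partial>M) = ennreal (nsq M f)"
  unfolding nsq_def by (intro nn_integral_eq_integral) (auto simp: L2_def)

lemma L2_nn_integralI:
  assumes "f \<in> borel_measurable M" "(\<integral>\<^sup>+x. ennreal ((norm (f x))\<^sup>2) \<partial>M) \<le> ennreal C" "0 \<le> C"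
  shows "L2 M f" "nsq M f \<le> C"
proof -
  have "(\<integral>\<^sup>+x. ennreal ((norm (f x))\<^sup>2) \<partial>M) < \<infinity>"
    using assms(2) by (simp add: le_less_trans)
  then show "L2 M f"
    using assms(1) unfolding L2_def by (auto intro!: integrableI_bounded)
  from nn_integral_nsq[OF this] assms show "nsq M f \<le> C"
    by (simp add: nsq_nonneg)
qed

lemma norm_add_sq_le: "(norm (x + y))\<^sup>2 \<le> 2 * (norm x)\<^sup>2 + 2 * (norm (y::'b::real_inner))\<^sup>2"
proof -
  have "0 \<le> (norm (x - y))\<^sup>2" by simp
  then show ?thesis by (simp add: power2_norm_eq_inner inner_simps inner_commute)
qed

lemma L2_add: assumes "L2 M f" "L2 M g" shows "L2 M (\<lambda>x. f x + g x)"
proof -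
  have "integrable M (\<lambda>x. (norm (f x + g x))\<^sup>2)"
  proof (rule Bochner_Integration.integrable_bound)
    show "integrable M (\<lambda>x. 2 * (norm (f x))\<^sup>2 + 2 * (norm (g x))\<^sup>2)"
      using assms by (simp add: L2_def)
    show "(\<lambda>x. (norm (f x + g x))\<^sup>2) \<in> borel_measurable M"
      using assms[THEN L2_measurable] by measurable
    show "AE x in M. norm ((norm (f x + g x))\<^sup>2) \<le> norm (2 * (norm (f x))\<^sup>2 + 2 * (norm (g x))\<^sup>2)"
      using norm_add_sq_le[of "f _" "g _"] by (intro AE_I2) (simp add: abs_of_nonneg)
  qed
  then show ?thesis using assms unfolding L2_def by auto
qed

lemma L2_scaleR: "L2 M f \<Longrightarrow> L2 M (\<lambda>x. c *\<^sub>R f x)"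
  by (auto simp: L2_def power_mult_distrib)

lemma nsq_scaleR: "nsq M (\<lambda>x. c *\<^sub>R f x) = c\<^sup>2 * nsq M f"
  by (simp add: nsq_def power_mult_distrib)

lemma L2_diff: "L2 M f \<Longrightarrow> L2 M g \<Longrightarrow> L2 M (\<lambda>x. f x - g x)"
  using L2_add[of M f "\<lambda>x. -1 *\<^sub>R g x"] L2_scaleR[of M g "-1"] by simp

lemma nsq_minus_commute: "nsq M (\<lambda>x. f x - g x) = nsq M (\<lambda>x. g x - f x)"
  by (simp add: nsq_def norm_minus_commute)

lemma nsq_add_le:
  assumes "L2 M f" "L2 M g" shows "nsq M (\<lambda>x. f x + g x) \<le> 2 * nsq M f + 2 * nsq M g"
proof -
  have "nsq M (\<lambda>x. f x + g x) \<le> (\<integral>x. 2 * (norm (f x))\<^sup>2 + 2 * (norm (g x))\<^sup>2 \<partial>M)"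
    unfolding nsq_def using assms L2_add[OF assms] norm_add_sq_le
    by (intro integral_mono) (auto simp: L2_def)
  also have "\<dots> = 2 * nsq M f + 2 * nsq M g"
    using assms by (simp add: nsq_def L2_def)
  finally show ?thesis .
qed

lemma nsq_cong_AE:
  assumes "f \<in> borel_measurable M" "g \<in> borel_measurable M" "AE x in M. f x = g x"
  shows "nsq M f = nsq M g"
  unfolding nsq_def using assms by (intro integral_cong_AE) auto

lemma L2_inner_integrable:
  assumes "L2 M f" "L2 M g" shows "integrable M (\<lambda>x. f x \<bullet> g x)"
proof (rule Bochner_Integration.integrable_bound)
  show "integrable M (\<lambda>x. (norm (f x))\<^sup>2 + (norm (g x))\<^sup>2)"
    using assms by (simp add: L2_def)
  show "(\<lambda>x. f x \<bullet> g x) \<in> borel_measurable M"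
    using assms[THEN L2_measurable] by measurable
  show "AE x in M. norm (f x \<bullet> g x) \<le> norm ((norm (f x))\<^sup>2 + (norm (g x))\<^sup>2)"
  proof (intro AE_I2)
    fix x
    have "\<bar>f x \<bullet> g x\<bar> \<le> norm (f x) * norm (g x)" by (rule Cauchy_Schwarz_ineq2)
    also have "\<dots> \<le> (norm (f x))\<^sup>2 + (norm (g x))\<^sup>2"
      using sum_squares_bound[of "norm (f x)" "norm (g x)"]
        mult_nonneg_nonneg[OF norm_ge_zero[of "f x"] norm_ge_zero[of "g x"]] by linarith
    finally show "norm (f x \<bullet> g x) \<le> norm ((norm (f x))\<^sup>2 + (norm (g x))\<^sup>2)" by simp
  qed
qed

lemma nsq_add:
  assumes "L2 M f" "L2 M g"
  shows "nsq M (\<lambda>x. f x + g x) = nsq M f + 2 * (\<integral>x. f x \<bullet> g x \<partial>M) + nsq M g"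
proof -
  have "nsq M (\<lambda>x. f x + g x) = (\<integral>x. (norm (f x))\<^sup>2 + 2 * (f x \<bullet> g x) + (norm (g x))\<^sup>2 \<partial>M)"
    unfolding nsq_def
    by (intro Bochner_Integration.integral_cong) (auto simp: power2_norm_eq_inner inner_simps inner_commute)
  then show ?thesis
    using assms L2_inner_integrable[OF assms] by (simp add: nsq_def L2_def)
qed

text \<open>The squared norm of \<open>f + t g\<close> is a nonnegative quadratic in
  \<open>t\<close>, so its discriminant is at most 0; a vanishing leading coefficient is a separate
  case.\<close>

lemma L2_Cauchy_Schwarz:
  assumes "L2 M f" "L2 M g"
  shows "\<bar>\<integral>x. f x \<bullet> g x \<partial>M\<bar> \<le> sqrt (nsq M f) * sqrt (nsq M g)"
proof -
  define b where "b = (\<integral>x. f x \<bullet> g x \<partial>M)"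
  have q: "0 \<le> nsq M f + 2 * t * b + t\<^sup>2 * nsq M g" for t
  proof -
    have "nsq M (\<lambda>x. f x + t *\<^sub>R g x) = nsq M f + 2 * (\<integral>x. f x \<bullet> (t *\<^sub>R g x) \<partial>M) + nsq M (\<lambda>x. t *\<^sub>R g x)"
      by (rule nsq_add) (use assms L2_scaleR in auto)
    then show ?thesis
      using nsq_nonneg[of M "\<lambda>x. f x + t *\<^sub>R g x"] by (simp add: nsq_scaleR b_def)
  qed
  have "b\<^sup>2 \<le> nsq M f * nsq M g"
  proof (cases "nsq M g = 0")
    case True
    then have q': "0 \<le> nsq M f + 2 * t * b" for t using q[of t] by simp
    have "b = 0"
    proof (rule ccontr)
      assume "b \<noteq> 0"
      \<comment> \<open>This value of \<open>t\<close> makes the linear expression equal to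
        -1.\<close>
      with q'[of "- (nsq M f + 1) / (2 * b)"] show False by (simp add: field_simps)
    qed
    then show ?thesis using True by simp
  next
    case False
    then have pos: "nsq M g > 0" using nsq_nonneg[of M g] by simp
    from q[of "- b / nsq M g"] have "0 \<le> nsq M f - b\<^sup>2 / nsq M g"
      using pos by (simp add: power2_eq_square field_simps)
    then show ?thesis using pos by (simp add: field_simps)
  qed
  then have "sqrt (b\<^sup>2) \<le> sqrt (nsq M f * nsq M g)" by (rule real_sqrt_le_mono)
  then show ?thesis by (simp add: b_def real_sqrt_mult)
qed

lemma nsq_parallelogram:
  assumes "L2 M f" "L2 M g"
  shows "nsq M (\<lambda>x. (1/2) *\<^sub>R (f x - g x))
     = nsq M f / 2 + nsq M g / 2 - nsq M (\<lambda>x. (1/2) *\<^sub>R (f x + g x))"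
proof -
  have "nsq M (\<lambda>x. f x + (-1) *\<^sub>R g x) = nsq M f + 2 * (\<integral>x. f x \<bullet> ((-1) *\<^sub>R g x) \<partial>M) + nsq M (\<lambda>x. (-1) *\<^sub>R g x)"
    by (rule nsq_add) (use assms L2_scaleR in blast)+
  then have "nsq M (\<lambda>x. f x - g x) = nsq M f - 2 * (\<integral>x. f x \<bullet> g x \<partial>M) + nsq M g"
    using nsq_scaleR[of M "-1" g] by simp
  then show ?thesis
    using nsq_add[OF assms] nsq_scaleR[of M "1/2" "\<lambda>x. f x + g x"] nsq_scaleR[of M "1/2" "\<lambda>x. f x - g x"]
    by (simp add: power2_eq_square field_simps)
qed

section \<open>Completeness and weak limits in L2\<close>

lemma L2_AE_subseq:
  assumes "\<And>n. L2 M (h n)" "L2 M f" "(\<lambda>n. nsq M (\<lambda>x. h n x - f x)) \<longlonglongrightarrow> 0"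
  shows "\<exists>r. strict_mono r \<and> (AE x in M. (\<lambda>n. h (r n) x) \<longlonglongrightarrow> f x)"
proof -
  have "\<exists>r::nat\<Rightarrow>nat. strict_mono r \<and> (AE x in M. (\<lambda>n. (norm (h (r n) x - f x))\<^sup>2) \<longlonglongrightarrow> 0)"
  proof (rule tendsto_L1_AE_subseq)
    show "integrable M (\<lambda>x. (norm (h n x - f x))\<^sup>2)" for n
      using L2_diff[OF assms(1,2)] by (simp add: L2_def)
    show "(\<lambda>n. \<integral>x. norm ((norm (h n x - f x))\<^sup>2) \<partial>M) \<longlonglongrightarrow> 0"
      using assms(3) by (simp add: nsq_def)
  qed
  then obtain r :: "nat \<Rightarrow> nat" where r: "strict_mono r"
    "AE x in M. (\<lambda>n. (norm (h (r n) x - f x))\<^sup>2) \<longlonglongrightarrow> 0" by blast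
  from r(2) have "AE x in M. (\<lambda>n. h (r n) x) \<longlonglongrightarrow> f x"
  proof eventually_elim
    case (elim x)
    from tendsto_real_sqrt[OF this] have "(\<lambda>n. norm (h (r n) x - f x)) \<longlonglongrightarrow> 0" by simp
    then show ?case by (simp add: LIM_zero_cancel tendsto_norm_zero_iff)
  qed
  with r(1) show ?thesis by blast
qed

text \<open>Riesz-Fischer. A subsequence with squared increments below 8^-k converges almost
  everywhere, and Fatou's lemma turns the Cauchy bounds into bounds for the distance to the
  pointwise limit.\<close>

theorem L2_complete:
  fixes h :: "nat \<Rightarrow> 'a \<Rightarrow> 'b::euclidean_space"
  assumes h: "\<And>n. L2 M (h n)"
    and C: "\<And>e. e > 0 \<Longrightarrow> \<exists>N. \<forall>m\<ge>N. \<forall>n\<ge>N. nsq M (\<lambda>x. h m x - h n x) < e"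
  shows "\<exists>f. L2 M f \<and> (\<lambda>n. nsq M (\<lambda>x. h n x - f x)) \<longlonglongrightarrow> 0"
proof -
  have [measurable]: "h n \<in> borel_measurable M" for n using h by (simp add: L2_def)
  \<comment> \<open>The rate 1/8 leaves room for the weight 2^k below: the weighted squares have
    integrals at most 4^-k, and a finite weighted sum forces geometric decay of the increments at
    almost every point.\<close>
  have "\<forall>k. \<exists>N. \<forall>m\<ge>N. \<forall>n\<ge>N. nsq M (\<lambda>x. h m x - h n x) < (1/8)^k"
    using C by simp
  then obtain N where N: "\<And>k m n. m \<ge> N k \<Longrightarrow> n \<ge> N k \<Longrightarrow> nsq M (\<lambda>x. h m x - h n x) < (1/8)^k"
    by metis
  \<comment> \<open>Summing the \<open>N j\<close> makes \<open>r\<close> monotone as well as at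
    least \<open>N k\<close>; the extra \<open>k\<close> makes it unbounded.\<close>
  define r where "r k = (\<Sum>j\<le>k. N j) + k" for k
  have rN: "r k \<ge> N k" for k
    unfolding r_def by (simp add: member_le_sum trans_le_add1)
  have r_inc: "r k \<le> r (Suc k)" for k by (simp add: r_def)
  have r_ge: "r k \<ge> k" for k by (simp add: r_def)
  define d where "d k x = h (r (Suc k)) x - h (r k) x" for k x
  have [measurable]: "d k \<in> borel_measurable M" for k unfolding d_def by measurable
  have dL2: "L2 M (d k)" for k unfolding d_def by (intro L2_diff h)
  have dk: "nsq M (d k) \<le> (1/8)^k" for k
    unfolding d_def using N[of k "r (Suc k)" "r k"] rN[of k] r_inc[of k] by (simp add: less_imp_le)
  have "(\<integral>\<^sup>+x. (\<Sum>k. ennreal (2^k * (norm (d k x))\<^sup>2)) \<partial>M) = (\<Sum>k. \<integral>\<^sup>+x. ennreal (2^k * (norm (d k x))\<^sup>2) \<partial>M)"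
    by (rule nn_integral_suminf) measurable
  also have "\<dots> = (\<Sum>k. ennreal (2^k * nsq M (d k)))"
    by (intro suminf_cong) (simp add: ennreal_mult nn_integral_cmult nn_integral_nsq[OF dL2] nsq_nonneg)
  also have "\<dots> \<le> (\<Sum>k. ennreal ((1/4)^k))"
  proof (intro suminf_le summableI ennreal_leI)
    fix k
    have "2^k * nsq M (d k) \<le> 2^k * (1/8)^k" using dk by simp
    also have "\<dots> = (1/4::real)^k" by (simp flip: power_mult_distrib)
    finally show "2^k * nsq M (d k) \<le> (1/4)^k" .
  qed
  also have "\<dots> < \<infinity>"
    by (subst suminf_ennreal2) (auto simp: summable_geometric)
  finally have fin: "(\<integral>\<^sup>+x. (\<Sum>k. ennreal (2^k * (norm (d k x))\<^sup>2)) \<partial>M) < \<infinity>" .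
  have "AE x in M. (\<Sum>k. ennreal (2^k * (norm (d k x))\<^sup>2)) \<noteq> \<infinity>"
    using fin by (intro nn_integral_PInf_AE) auto
  then have conv: "AE x in M. convergent (\<lambda>k. h (r k) x)"
  proof eventually_elim
    case (elim x)
    define S where "S = enn2real (\<Sum>k. ennreal (2^k * (norm (d k x))\<^sup>2))"
    have S0: "S \<ge> 0" by (simp add: S_def)
    have le: "2^k * (norm (d k x))\<^sup>2 \<le> S" for k
    proof -
      have "ennreal (2^k * (norm (d k x))\<^sup>2) \<le> (\<Sum>k. ennreal (2^k * (norm (d k x))\<^sup>2))"
        using sum_le_suminf[OF summableI, of "{k}" "\<lambda>k. ennreal (2^k * (norm (d k x))\<^sup>2)"]
        by (metis (no_types, lifting) finite.emptyI finite_insert sum.insert sum.empty empty_iff add.right_neutral zero_le)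
      also have "\<dots> = ennreal S" using elim by (simp add: S_def top.not_eq_extremum)
      finally show ?thesis using S0 by simp
    qed
    have "norm (d k x) \<le> sqrt S * (1 / sqrt 2)^k" for k
    proof -
      have "(norm (d k x))\<^sup>2 \<le> S / 2^k" using le[of k] by (simp add: field_simps)
      then have "sqrt ((norm (d k x))\<^sup>2) \<le> sqrt (S / 2^k)" by (rule real_sqrt_le_mono)
      then show ?thesis by (simp add: real_sqrt_divide real_sqrt_power power_divide)
    qed
    moreover have "summable (\<lambda>k. sqrt S * (1 / sqrt 2)^k)"
      by (intro summable_mult summable_geometric) simp
    ultimately have "summable (\<lambda>k. d k x)"
      by (metis summable_comparison_test')
    then have "convergent (\<lambda>k. h (r 0) x + (\<Sum>j<k. d j x))"
      by (intro convergent_add convergent_const) (simp add: summable_iff_convergent)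
    moreover have "h (r 0) x + (\<Sum>j<k. d j x) = h (r k) x" for k
      using sum_lessThan_telescope[of "\<lambda>j. h (r j) x" k] by (simp add: d_def)
    ultimately show ?case by simp
  qed
  define f where "f x = lim (\<lambda>k. h (r k) x)" for x
  have fm [measurable]: "f \<in> borel_measurable M"
    unfolding f_def by (rule borel_measurable_lim_metric) measurable
  have lim: "AE x in M. (\<lambda>k. h (r k) x) \<longlonglongrightarrow> f x"
    using conv unfolding f_def by eventually_elim (simp add: convergent_LIMSEQ_iff)
  have bound: "(\<integral>\<^sup>+x. ennreal ((norm (h m x - f x))\<^sup>2) \<partial>M) \<le> ennreal e"
    if "e > 0" "\<forall>m\<ge>K. \<forall>n\<ge>K. nsq M (\<lambda>x. h m x - h n x) < e" "m \<ge> K" for e K m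
  proof -
    have "(\<integral>\<^sup>+x. ennreal ((norm (h m x - f x))\<^sup>2) \<partial>M)
        = (\<integral>\<^sup>+x. liminf (\<lambda>k. ennreal ((norm (h m x - h (r k) x))\<^sup>2)) \<partial>M)"
    proof (rule nn_integral_cong_AE, use lim in eventually_elim)
      case (elim x)
      have "(\<lambda>k. ennreal ((norm (h m x - h (r k) x))\<^sup>2)) \<longlonglongrightarrow> ennreal ((norm (h m x - f x))\<^sup>2)"
        by (intro tendsto_ennrealI tendsto_intros elim)
      from lim_imp_Liminf[OF sequentially_bot this] show ?case by simp
    qed
    also have "\<dots> \<le> liminf (\<lambda>k. \<integral>\<^sup>+x. ennreal ((norm (h m x - h (r k) x))\<^sup>2) \<partial>M)"
      by (rule nn_integral_liminf) measurable
    also have "\<dots> = liminf (\<lambda>k. ennreal (nsq M (\<lambda>x. h m x - h (r k) x)))"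
      by (simp add: nn_integral_nsq[OF L2_diff[OF h h]])
    also have "\<dots> \<le> ennreal e"
    proof (rule Liminf_le)
      show "\<forall>\<^sub>F k in sequentially. ennreal (nsq M (\<lambda>x. h m x - h (r k) x)) \<le> ennreal e"
        using eventually_ge_at_top[of K]
      proof eventually_elim
        case (elim k)
        then have "r k \<ge> K" using r_ge[of k] by simp
        with that show ?case by (auto intro!: ennreal_leI less_imp_le)
      qed
    qed simp
    finally show ?thesis .
  qed
  from C[of 1] obtain K where K: "\<forall>m\<ge>K. \<forall>n\<ge>K. nsq M (\<lambda>x. h m x - h n x) < 1" by auto
  have "L2 M (\<lambda>x. h K x - f x)"
    using bound[OF _ K order_refl] by (intro L2_nn_integralI(1)[where C=1]) auto
  from L2_diff[OF h[of K] this] have fL2: "L2 M f" by simp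
  have "(\<lambda>n. nsq M (\<lambda>x. h n x - f x)) \<longlonglongrightarrow> 0"
  proof (rule LIMSEQ_I)
    fix e :: real assume "e > 0"
    with C[of "e/2"] obtain K where K: "\<forall>m\<ge>K. \<forall>n\<ge>K. nsq M (\<lambda>x. h m x - h n x) < e/2" by auto
    have "nsq M (\<lambda>x. h n x - f x) \<le> e/2" if "n \<ge> K" for n
      using bound[OF _ K that] \<open>e > 0\<close> by (intro L2_nn_integralI(2)) auto
    then show "\<exists>no. \<forall>n\<ge>no. norm (nsq M (\<lambda>x. h n x - f x) - 0) < e"
    proof (intro exI[of _ K] allI impI)
      fix n assume "K \<le> n"
      with \<open>e > 0\<close> \<open>\<And>n. K \<le> n \<Longrightarrow> nsq M (\<lambda>x. h n x - f x) \<le> e / 2\<close>[of n] nsq_nonneg[of M "\<lambda>x. h n x - f x"]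
      show "norm (nsq M (\<lambda>x. h n x - f x) - 0) < e" by simp
    qed
  qed
  with fL2 show ?thesis by blast
qed

text \<open>Midpoints suffice, since the parallelogram law uses nothing else. The index
  \<open>n\<close> keeps the combinations in the tail, where the pairings are already close to their
  limit.\<close>

inductive_set midpoint_tail :: "(nat \<Rightarrow> 'a \<Rightarrow> 'b::euclidean_space) \<Rightarrow> nat \<Rightarrow> ('a \<Rightarrow> 'b) set"
  for f n where
    base: "k \<ge> n \<Longrightarrow> f k \<in> midpoint_tail f n"
  | mid: "p \<in> midpoint_tail f n \<Longrightarrow> q \<in> midpoint_tail f n \<Longrightarrow> (\<lambda>x. (1/2) *\<^sub>R (p x + q x)) \<in> midpoint_tail f n"

lemma midpoint_tail_antimono: "p \<in> midpoint_tail f n \<Longrightarrow> m \<le> n \<Longrightarrow> p \<in> midpoint_tail f m"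
  by (induction rule: midpoint_tail.induct) (auto intro: midpoint_tail.intros)

text \<open>A bounded sequence of \<open>L\<^sup>2\<close> has norm-convergent midpoint combinations of its tails: those of
  almost minimal norm are Cauchy by the parallelogram law. Their limit is a weak limit.\<close>
theorem L2_weak_limit:
  fixes f :: "nat \<Rightarrow> 'a \<Rightarrow> 'b::euclidean_space"
  assumes f: "\<And>n. L2 M (f n)" and C: "\<And>n. nsq M (f n) \<le> C"
  shows "\<exists>g. L2 M g \<and> nsq M g \<le> C \<and>
    (\<forall>\<phi> l. L2 M \<phi> \<longrightarrow> (\<lambda>n. \<integral>x. \<phi> x \<bullet> f n x \<partial>M) \<longlonglongrightarrow> l \<longrightarrow> (\<integral>x. \<phi> x \<bullet> g x \<partial>M) = l)"
proof -
  let ?K = "midpoint_tail f"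
  have KL2: "L2 M p" if "p \<in> ?K n" for p n
    using that
  proof (induction rule: midpoint_tail.induct)
    case (mid p q)
    then show ?case by (intro L2_scaleR[OF L2_add])
  qed (rule f)
  have KC: "nsq M p \<le> C" if "p \<in> ?K n" for p n
    using that
  proof (induction rule: midpoint_tail.induct)
    case (mid p q)
    have "nsq M (\<lambda>x. (1/2) *\<^sub>R (p x + q x)) \<le> (1/2)\<^sup>2 * (2 * nsq M p + 2 * nsq M q)"
      unfolding nsq_scaleR using nsq_add_le[of M p q] KL2 mid by (intro mult_left_mono) auto
    also have "\<dots> \<le> C" using mid.IH by (simp add: power2_eq_square)
    finally show ?case .
  qed (rule C)
  \<comment> \<open>Being within \<open>e\<close> of \<open>l\<close> is a convex condition on the
    pairing, so it passes from the tail to its midpoint combinations.\<close>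
  have Kw: "\<bar>(\<integral>x. \<phi> x \<bullet> p x \<partial>M) - l\<bar> \<le> e"
    if "p \<in> ?K n" "L2 M \<phi>" "\<And>k. k \<ge> n \<Longrightarrow> \<bar>(\<integral>x. \<phi> x \<bullet> f k x \<partial>M) - l\<bar> \<le> e" for p n \<phi> l e
    using that(1)
  proof (induction rule: midpoint_tail.induct)
    case (mid p q)
    have "(\<integral>x. \<phi> x \<bullet> ((1/2) *\<^sub>R (p x + q x)) \<partial>M) = (1/2) * ((\<integral>x. \<phi> x \<bullet> p x \<partial>M) + (\<integral>x. \<phi> x \<bullet> q x \<partial>M))"
      using L2_inner_integrable[OF that(2) KL2[OF mid(1)]] L2_inner_integrable[OF that(2) KL2[OF mid(2)]]
      by (simp add: inner_simps)
    then show ?case using mid.IH by (simp add: abs_le_iff field_simps)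
  qed (rule that(3))
  \<comment> \<open>The sets shrink with \<open>n\<close>, so these infima increase; bounded by
    \<open>C\<close>, they converge, which makes almost minimal elements Cauchy.\<close>
  define d where "d n = Inf (nsq M ` ?K n)" for n
  have bdd: "bdd_below (nsq M ` ?K n)" for n
    using nsq_nonneg by (intro bdd_belowI[where m=0]) auto
  have fK: "f n \<in> ?K n" for n by (rule midpoint_tail.base) simp
  have dle: "d n \<le> nsq M p" if "p \<in> ?K n" for n p
    unfolding d_def using that bdd by (intro cInf_lower) auto
  have dmono: "d m \<le> d n" if "m \<le> n" for m n
    unfolding d_def using that fK[of n] bdd
    by (intro cInf_superset_mono image_mono subsetI) (auto intro: midpoint_tail_antimono)
  have "\<exists>p\<in>?K n. nsq M p < d n + 1 / Suc n" for n
  proof -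
    have "\<exists>z\<in>nsq M ` ?K n. z < d n + 1 / Suc n"
      by (rule cInf_lessD) (use fK[of n] in \<open>auto simp: d_def\<close>)
    then show ?thesis by blast
  qed
  then obtain h where h: "\<And>n. h n \<in> ?K n" "\<And>n. nsq M (h n) < d n + 1 / Suc n" by metis
  have "convergent d"
  proof (rule Bseq_monoseq_convergent)
    have "0 \<le> d n" for n
      unfolding d_def using fK[of n] nsq_nonneg by (intro cInf_greatest) auto
    moreover have "d n \<le> C" for n
      using dle[OF fK[of n]] C[of n] by simp
    ultimately show "Bseq d" by (intro BseqI'[where K=C]) auto
    show "monoseq d" using dmono by (simp add: monoseq_def)
  qed
  then have Cd: "Cauchy d" by (rule convergent_Cauchy)
  have diff: "nsq M (\<lambda>x. h n x - h m x) \<le> 2 * (d m - d n) + 4 / Suc n" if "n \<le> m" for n m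
  proof -
    \<comment> \<open>For \<open>n \<le> m\<close> both functions lie in the \<open>n\<close>-th
      set, hence so does their midpoint, whose squared norm is at least \<open>d n\<close>.\<close>
    have hm: "h m \<in> ?K n" using midpoint_tail_antimono[OF h(1) that] .
    have "(1/4) * nsq M (\<lambda>x. h n x - h m x) = nsq M (\<lambda>x. (1/2) *\<^sub>R (h n x - h m x))"
      unfolding nsq_scaleR by (simp add: power2_eq_square)
    also have "\<dots> = nsq M (h n) / 2 + nsq M (h m) / 2 - nsq M (\<lambda>x. (1/2) *\<^sub>R (h n x + h m x))"
      by (rule nsq_parallelogram) (use KL2 h in auto)
    also have "\<dots> \<le> (d n + 1 / Suc n) / 2 + (d m + 1 / Suc m) / 2 - d n"
      using h(2)[of n] h(2)[of m] dle[OF midpoint_tail.mid[OF h(1) hm]] by argo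
    finally have "(1/4) * nsq M (\<lambda>x. h n x - h m x)
       \<le> (d n + 1 / Suc n) / 2 + (d m + 1 / Suc m) / 2 - d n" .
    moreover have "1 / real (Suc m) \<le> 1 / real (Suc n)" using that by (simp add: frac_le)
    moreover have "4 / real (Suc n) = 4 * (1 / real (Suc n))" by simp
    ultimately show ?thesis by argo
  qed
  have "\<exists>g. L2 M g \<and> (\<lambda>n. nsq M (\<lambda>x. h n x - g x)) \<longlonglongrightarrow> 0"
  proof (rule L2_complete)
    show "L2 M (h n)" for n using KL2 h by blast
    fix e :: real assume "e > 0"
    obtain N1 where N1: "\<And>m n. m \<ge> N1 \<Longrightarrow> n \<ge> N1 \<Longrightarrow> \<bar>d m - d n\<bar> < e/4"
      using CauchyD[OF Cd, of "e/4"] \<open>e > 0\<close> by auto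
    obtain N2 :: nat where N2: "8 / e < N2" using reals_Archimedean2 by blast
    have one: "nsq M (\<lambda>x. h n x - h m x) < e" if "n \<ge> max N1 N2" "n \<le> m" for n m
    proof -
      have "4 / real (Suc n) < e / 2"
      proof -
        have "8 / e < real (Suc n)" using N2 that(1) by (simp add: le_max_iff_disj)
        then show ?thesis using \<open>e > 0\<close> by (simp add: field_simps)
      qed
      moreover have "\<bar>d m - d n\<bar> < e / 4" using N1[of m n] that by simp
      ultimately show ?thesis using diff[OF that(2)] by argo
    qed
    show "\<exists>N. \<forall>m\<ge>N. \<forall>n\<ge>N. nsq M (\<lambda>x. h m x - h n x) < e"
    proof (intro exI[of _ "max N1 N2"] allI impI)
      fix m n assume "max N1 N2 \<le> m" "max N1 N2 \<le> n"
      then show "nsq M (\<lambda>x. h m x - h n x) < e"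
        using one[of m n] one[of n m] nsq_minus_commute[of M "h m" "h n"] by (cases "m \<le> n") auto
    qed
  qed
  then obtain g where g: "L2 M g" "(\<lambda>n. nsq M (\<lambda>x. h n x - g x)) \<longlonglongrightarrow> 0" by blast
  have pair: "(\<lambda>n. \<integral>x. \<phi> x \<bullet> h n x \<partial>M) \<longlonglongrightarrow> (\<integral>x. \<phi> x \<bullet> g x \<partial>M)" if "L2 M \<phi>" for \<phi>
  proof (rule LIM_zero_cancel, rule Lim_null_comparison)
    have "norm ((\<integral>x. \<phi> x \<bullet> h n x \<partial>M) - (\<integral>x. \<phi> x \<bullet> g x \<partial>M)) \<le> sqrt (nsq M \<phi>) * sqrt (nsq M (\<lambda>x. h n x - g x))" for n
    proof -
      have "(\<integral>x. \<phi> x \<bullet> h n x \<partial>M) - (\<integral>x. \<phi> x \<bullet> g x \<partial>M) = (\<integral>x. \<phi> x \<bullet> (h n x - g x) \<partial>M)"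
        using L2_inner_integrable[OF that KL2[OF h(1)[of n]]] L2_inner_integrable[OF that g(1)]
        by (simp add: inner_diff_right)
      then show ?thesis
        using L2_Cauchy_Schwarz[OF that L2_diff[OF KL2[OF h(1)] g(1)]] by simp
    qed
    then show "\<forall>\<^sub>F n in sequentially. norm ((\<integral>x. \<phi> x \<bullet> h n x \<partial>M) - (\<integral>x. \<phi> x \<bullet> g x \<partial>M))
       \<le> sqrt (nsq M \<phi>) * sqrt (nsq M (\<lambda>x. h n x - g x))" by simp
    show "(\<lambda>n. sqrt (nsq M \<phi>) * sqrt (nsq M (\<lambda>x. h n x - g x))) \<longlonglongrightarrow> 0"
      using tendsto_mult_right_zero[OF tendsto_real_sqrt[OF g(2), simplified], of "sqrt (nsq M \<phi>)"] by simp
  qed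
  have "nsq M g \<le> C"
  proof -
    \<comment> \<open>Expanding the squared norm of \<open>g - h n\<close> bounds the pairing with
      \<open>g\<close>; in the limit that pairing is \<open>nsq M g\<close>, and half of it is
      absorbed on the left.\<close>
    have "(\<integral>x. g x \<bullet> h n x \<partial>M) \<le> (C + nsq M g) / 2" for n
    proof -
      have hL: "L2 M (h n)" using KL2 h by blast
      have "0 \<le> nsq M (\<lambda>x. g x + (-1) *\<^sub>R h n x)" by (rule nsq_nonneg)
      also have "\<dots> = nsq M g + 2 * (\<integral>x. g x \<bullet> ((-1) *\<^sub>R h n x) \<partial>M) + nsq M (\<lambda>x. (-1) *\<^sub>R h n x)"
        by (rule nsq_add[OF g(1) L2_scaleR[OF hL]])
      finally show ?thesis
        using KC[OF h(1)[of n]] nsq_scaleR[of M "-1" "h n"] by simp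
    qed
    then have "(\<integral>x. g x \<bullet> g x \<partial>M) \<le> (C + nsq M g) / 2"
      using pair[OF g(1)] by (intro LIMSEQ_le_const2) auto
    then show ?thesis by (simp add: nsq_def power2_norm_eq_inner)
  qed
  moreover have "(\<integral>x. \<phi> x \<bullet> g x \<partial>M) = l" if \<phi>: "L2 M \<phi>" and l: "(\<lambda>n. \<integral>x. \<phi> x \<bullet> f n x \<partial>M) \<longlonglongrightarrow> l" for \<phi> l
  proof (rule LIMSEQ_unique[OF pair[OF \<phi>]], rule LIMSEQ_I)
    fix e :: real assume "e > 0"
    with LIMSEQ_D[OF l, of "e/2"] obtain N where N: "\<And>n. n \<ge> N \<Longrightarrow> \<bar>(\<integral>x. \<phi> x \<bullet> f n x \<partial>M) - l\<bar> < e/2" by auto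
    have "\<bar>(\<integral>x. \<phi> x \<bullet> h n x \<partial>M) - l\<bar> \<le> e/2" if "n \<ge> N" for n
      by (rule Kw[OF h(1) \<phi>]) (use N that in \<open>auto intro: less_imp_le\<close>)
    with \<open>e > 0\<close> have "\<bar>(\<integral>x. \<phi> x \<bullet> h n x \<partial>M) - l\<bar> < e" if "n \<ge> N" for n
      using that by (metis field_sum_of_halves add_less_same_cancel1 le_less_trans less_add_same_cancel1 half_gt_zero)
    then show "\<exists>no. \<forall>n\<ge>no. norm ((\<integral>x. \<phi> x \<bullet> h n x \<partial>M) - l) < e"
      by (intro exI[of _ N]) simp
  qed
  ultimately show ?thesis using g(1) by blast
qed

subsection \<open>Isometry invariance of Lebesgue measure\<close>

text \<open>The measure is determined by its values on boxes; the preimage of a box is its image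
  under the inverse map, whose Lebesgue measure is that of the box.\<close>

lemma lborel_distr_orthogonal:
  fixes f :: "real^2 \<Rightarrow> real^2"
  assumes f: "orthogonal_transformation f"
  shows "distr lborel borel f = lborel"
proof (rule lborel_eqI[symmetric])
  have [measurable]: "f \<in> borel_measurable borel"
    using f by (intro borel_measurable_continuous_onI linear_continuous_on linear_conv_bounded_linear[THEN iffD1])
      (simp add: orthogonal_transformation_linear)
  fix l u :: "real^2" assume le: "\<And>b. b \<in> Basis \<Longrightarrow> l \<bullet> b \<le> u \<bullet> b"
  have bij: "bij f" using f by (rule orthogonal_transformation_bij)
  have g: "orthogonal_transformation (inv f)" using f by (rule orthogonal_transformation_inv)
  have vim: "f -` box l u = inv f ` box l u" using bij by (simp add: bij_vimage_eq_inv_image)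
  have B: "f -` box l u \<in> sets borel"
    using measurable_sets[OF \<open>f \<in> borel_measurable borel\<close>, of "box l u"] by simp
  have lm: "inv f ` box l u \<in> lmeasurable" by (rule measurable_orthogonal_image[OF g]) simp
  have "emeasure (distr lborel borel f) (box l u) = emeasure lborel (f -` box l u)"
    by (subst emeasure_distr) auto
  also have "\<dots> = emeasure lebesgue (inv f ` box l u)" using B vim by simp
  also have "\<dots> = ennreal (measure lebesgue (inv f ` box l u))" using lm by (rule emeasure_eq_measure2)
  also have "\<dots> = ennreal (measure lebesgue (box l u))" by (subst measure_orthogonal_image[OF g]) auto
  also have "\<dots> = emeasure lborel (box l u)" by (simp add: emeasure_lborel_box_eq measure_def)
  also have "\<dots> = (\<Prod>b\<in>Basis. (u - l) \<bullet> b)" using le by (simp add: emeasure_lborel_box_eq)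
  finally show "emeasure (distr lborel borel f) (box l u) = (\<Prod>b\<in>Basis. (u - l) \<bullet> b)" .
qed simp

text \<open>Only preservation of the measure is recorded, so translations, orthogonal maps and their
  compositions share one set of transfer rules.\<close>

definition lborel_iso :: "(real^2 \<Rightarrow> real^2) \<Rightarrow> bool" where
  "lborel_iso f \<longleftrightarrow> f \<in> borel_measurable borel \<and> distr lborel borel f = lborel"

lemma lborel_iso_measurable [measurable_dest]: "lborel_iso f \<Longrightarrow> f \<in> borel_measurable borel"
  by (simp add: lborel_iso_def)

lemma lborel_iso_nn_integral:
  assumes "lborel_iso f" and [measurable]: "h \<in> borel_measurable borel"
  shows "(\<integral>\<^sup>+x. h (f x) \<partial>lborel) = (\<integral>\<^sup>+x. h x \<partial>lborel)"
proof -
  have [measurable]: "f \<in> borel_measurable borel" and d: "distr lborel borel f = lborel"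
    using assms by (auto simp: lborel_iso_def)
  have "(\<integral>\<^sup>+x. h x \<partial>lborel) = (\<integral>\<^sup>+x. h x \<partial>distr lborel borel f)" by (simp add: d)
  also have "\<dots> = (\<integral>\<^sup>+x. h (f x) \<partial>lborel)" by (rule nn_integral_distr) auto
  finally show ?thesis by simp
qed

lemma lborel_iso_integral:
  fixes h :: "real^2 \<Rightarrow> 'b::{banach,second_countable_topology}"
  assumes "lborel_iso f" and [measurable]: "h \<in> borel_measurable borel"
  shows "(\<integral>x. h (f x) \<partial>lborel) = (\<integral>x. h x \<partial>lborel)"
    and "integrable lborel (\<lambda>x. h (f x)) \<longleftrightarrow> integrable lborel h"
proof -
  have [measurable]: "f \<in> borel_measurable borel" and d: "distr lborel borel f = lborel"
    using assms by (auto simp: lborel_iso_def)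
  show "(\<integral>x. h (f x) \<partial>lborel) = (\<integral>x. h x \<partial>lborel)"
    by (subst (2) d[symmetric], subst integral_distr) auto
  show "integrable lborel (\<lambda>x. h (f x)) \<longleftrightarrow> integrable lborel h"
    by (subst (2) d[symmetric], subst integrable_distr_eq) auto
qed

lemma lborel_iso_AE:
  assumes f: "lborel_iso f" and P: "AE x in lborel. P x"
  shows "AE x in lborel. P (f x)"
proof -
  have [measurable]: "f \<in> borel_measurable borel" and d: "distr lborel borel f = lborel"
    using f by (auto simp: lborel_iso_def)
  from P have "AE x in distr lborel borel f. P x" by (subst d)
  then show ?thesis by (rule AE_distrD[rotated]) simp
qed

lemma lborel_iso_add: "lborel_iso (\<lambda>x. x + c)"
  using lborel_distr_plus[of c] by (simp add: lborel_iso_def add.commute[of _ c])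

lemma lborel_iso_orthogonal: "orthogonal_transformation f \<Longrightarrow> lborel_iso f"
  by (auto simp: lborel_iso_def lborel_distr_orthogonal orthogonal_transformation_linear
      intro!: borel_measurable_continuous_onI linear_continuous_on linear_conv_bounded_linear[THEN iffD1])

lemma lborel_iso_compose:
  assumes "lborel_iso f" "lborel_iso g" shows "lborel_iso (\<lambda>x. f (g x))"
proof -
  have [measurable]: "f \<in> borel_measurable borel" "g \<in> borel_measurable borel"
    using assms by (auto simp: lborel_iso_def)
  have "distr lborel borel (f \<circ> g) = distr (distr lborel borel g) borel f"
    by (rule distr_distr[symmetric]) auto
  then show ?thesis using assms by (simp add: lborel_iso_def comp_def)
qed

lemma lborel_iso_uminus: "lborel_iso uminus"
  by (rule lborel_iso_orthogonal) (simp add: orthogonal_transformation_def linear_iff)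

subsection \<open>Smooth bumps and the fundamental lemma of the calculus of variations\<close>

text \<open>The classical flat function \<open>exp (-1/x)\<close>, with all polynomials in 1/x as
  factors so that the family is stable under differentiation.\<close>

definition flat :: "real poly \<Rightarrow> real \<Rightarrow> real" where
  "flat p x = (if x > 0 then poly p (1/x) * exp (- (1/x)) else 0)"

lemma poly_times_exp_tendsto_0: "((\<lambda>y::real. poly p y * exp (-y)) \<longlongrightarrow> 0) at_top"
proof -
  have "((\<lambda>y::real. \<Sum>i\<le>degree p. coeff p i * (y ^ i / exp y)) \<longlongrightarrow> (\<Sum>i\<le>degree p. coeff p i * 0)) at_top"
    by (intro tendsto_intros tendsto_power_div_exp_0)
  then show ?thesis
    by (simp add: poly_altdef sum_divide_distrib exp_minus field_simps)
qed

lemma flat_over_id_tendsto_0: "((\<lambda>h. flat p h / h) \<longlongrightarrow> 0) (at 0)"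
proof (rule filterlim_split_at)
  have "((\<lambda>h::real. poly (pCons 0 p) (inverse h) * exp (- inverse h)) \<longlongrightarrow> 0) (at_right 0)"
    by (rule filterlim_compose[OF poly_times_exp_tendsto_0 filterlim_inverse_at_top_right])
  moreover have "\<forall>\<^sub>F h in at_right 0. poly (pCons 0 p) (inverse h) * exp (- inverse h) = flat p h / h"
    using eventually_at_right_less[of "0::real"] by eventually_elim (simp add: flat_def field_simps)
  ultimately show "((\<lambda>h. flat p h / h) \<longlongrightarrow> 0) (at_right 0)"
    by (rule Lim_transform_eventually)
  show "((\<lambda>h. flat p h / h) \<longlongrightarrow> 0) (at_left 0)"
    by (rule tendsto_eventually, rule eventually_mono[OF eventually_at_left_field[THEN iffD2, of 0 "\<lambda>h. h < 0"]])
      (auto simp: flat_def intro!: exI[of _ "-1"])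
qed

text \<open>With y = 1/x, the y-derivative of \<open>poly p y * exp (-y)\<close> has the polynomial
  \<open>pderiv p - p\<close>, and dy/dx = -y^2, whence the factor \<open>[:0, 0, 1:]\<close>. At 0
  the difference quotient vanishes because the exponential beats every polynomial.\<close>

lemma DERIV_flat:
  "(flat p has_real_derivative flat ((p - pderiv p) * [:0, 0, 1:]) x) (at x)"
proof (cases x "0::real" rule: linorder_cases)
  case less
  have "((\<lambda>x. 0) has_real_derivative 0) (at x)" by simp
  then have "(flat p has_real_derivative 0) (at x)"
    by (rule has_field_derivative_transform_within_open[where S="{..<0}"]) (use less in \<open>auto simp: flat_def\<close>)
  then show ?thesis using less by (simp add: flat_def)
next
  case equal
  have "((\<lambda>h. (flat p (0 + h) - flat p 0) / h) \<longlongrightarrow> 0) (at 0)"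
    using flat_over_id_tendsto_0[of p] by (simp add: flat_def[of p 0])
  then have "(flat p has_real_derivative 0) (at 0)" by (simp only: DERIV_def)
  then show ?thesis using equal by (simp add: flat_def)
next
  case greater
  have "((\<lambda>x. poly p (1/x) * exp (- (1/x))) has_real_derivative
     poly ((p - pderiv p) * [:0, 0, 1:]) (1/x) * exp (- (1/x))) (at x)"
    using greater by (auto intro!: derivative_eq_intros simp: field_simps power2_eq_square)
  then have "(flat p has_real_derivative poly ((p - pderiv p) * [:0, 0, 1:]) (1/x) * exp (- (1/x))) (at x)"
    by (rule has_field_derivative_transform_within_open[where S="{0<..}"]) (use greater in \<open>auto simp: flat_def\<close>)
  then show ?thesis using greater by (simp add: flat_def)
qed

lemma continuous_flat: "continuous_on S (flat p)"
  using DERIV_flat DERIV_continuous by (intro continuous_at_imp_continuous_on) blast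

lemma flat_smult: "flat (smult c p) x = c * flat p x"
  by (simp add: flat_def)

text \<open>A set closed under partial derivatives is exactly the witness \<open>S\<close> that
  \<open>smooth_fun\<close> asks for, so smoothness of bumps needs no induction on the order of
  differentiation.\<close>

inductive_set smooth_gen :: "(real^2 \<Rightarrow> real) set" where
  base: "(\<lambda>x. flat p (c + s * x $ i)) \<in> smooth_gen"
| add: "f \<in> smooth_gen \<Longrightarrow> g \<in> smooth_gen \<Longrightarrow> (\<lambda>x. f x + g x) \<in> smooth_gen"
| mult: "f \<in> smooth_gen \<Longrightarrow> g \<in> smooth_gen \<Longrightarrow> (\<lambda>x. f x * g x) \<in> smooth_gen"

lemma smooth_gen_partial:
  assumes "g \<in> smooth_gen"
  shows "continuous_on UNIV g \<and>
    (\<exists>h\<in>smooth_gen. \<forall>x. ((\<lambda>t. g (x + t *\<^sub>R axis i 1)) has_real_derivative h x) (at 0))"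
  using assms
proof (induction rule: smooth_gen.induct)
  case (base p c s j)
  let ?q = "smult (s * axis i 1 $ j) ((p - pderiv p) * [:0, 0, 1:])"
  have "continuous_on UNIV (\<lambda>x::real^2. flat p (c + s * x $ j))"
    by (rule continuous_on_compose2[OF continuous_flat[of UNIV]]) (auto intro!: continuous_intros)
  moreover have "((\<lambda>t. flat p (c + s * (x + t *\<^sub>R axis i 1) $ j)) has_real_derivative flat ?q (c + s * x $ j)) (at 0)"
    for x :: "real^2"
  proof -
    have "((\<lambda>t. c + s * (x + t *\<^sub>R axis i 1) $ j) has_real_derivative s * axis i 1 $ j) (at 0)"
      by (auto intro!: derivative_eq_intros)
    from DERIV_chain2[OF DERIV_flat this]
    show ?thesis unfolding flat_smult by (simp add: mult.commute)
  qed
  ultimately show ?case using smooth_gen.base[of ?q c s j] by (intro conjI bexI[of _ "\<lambda>x. flat ?q (c + s * x $ j)"]) auto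
next
  case (add f g)
  then obtain f' g' where fg: "f' \<in> smooth_gen" "g' \<in> smooth_gen"
    "\<And>x. ((\<lambda>t. f (x + t *\<^sub>R axis i 1)) has_real_derivative f' x) (at 0)"
    "\<And>x. ((\<lambda>t. g (x + t *\<^sub>R axis i 1)) has_real_derivative g' x) (at 0)"
    by blast
  show ?case
  proof (intro conjI bexI[OF _ smooth_gen.add[OF fg(1,2)]] allI)
    show "continuous_on UNIV (\<lambda>x. f x + g x)" using add.IH by (intro continuous_on_add) blast+
    show "((\<lambda>t. f (x + t *\<^sub>R axis i 1) + g (x + t *\<^sub>R axis i 1)) has_real_derivative f' x + g' x) (at 0)" for x
      by (rule DERIV_add[OF fg(3,4)])
  qed
next
  case (mult f g)
  then obtain f' g' where fg: "f' \<in> smooth_gen" "g' \<in> smooth_gen"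
    "\<And>x. ((\<lambda>t. f (x + t *\<^sub>R axis i 1)) has_real_derivative f' x) (at 0)"
    "\<And>x. ((\<lambda>t. g (x + t *\<^sub>R axis i 1)) has_real_derivative g' x) (at 0)"
    by blast
  have S: "(\<lambda>x. f x * g' x + f' x * g x) \<in> smooth_gen"
    by (rule smooth_gen.add[OF smooth_gen.mult[OF mult.hyps(1) fg(2)] smooth_gen.mult[OF fg(1) mult.hyps(2)]])
  have "((\<lambda>t. f (x + t *\<^sub>R axis i 1) * g (x + t *\<^sub>R axis i 1)) has_real_derivative f x * g' x + f' x * g x) (at 0)" for x
    using DERIV_mult[OF fg(3)[of x] fg(4)[of x]] by (simp add: algebra_simps)
  moreover have "continuous_on UNIV (\<lambda>x. f x * g x)" using mult.IH by (intro continuous_on_mult) blast+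
  ultimately show ?case using S by (intro conjI bexI[OF _ S] allI)
qed

lemma smooth_gen_smooth: "g \<in> smooth_gen \<Longrightarrow> smooth_fun g"
  unfolding smooth_fun_def using smooth_gen_partial by (intro exI[of _ smooth_gen]) blast

text \<open>A product of one-sided flat cutoffs, positive exactly on the open box with corners
  \<open>a\<close> and \<open>b\<close> when \<open>n > 0\<close>. The steepness \<open>n\<close>
  drives it to the indicator of the box, and translates of bumps are bumps.\<close>

definition bump :: "real \<Rightarrow> real^2 \<Rightarrow> real^2 \<Rightarrow> real^2 \<Rightarrow> real" where
  "bump n a b x = (flat 1 (n * x$1 - n * a$1) * flat 1 (n * b$1 - n * x$1)) *
                  (flat 1 (n * x$2 - n * a$2) * flat 1 (n * b$2 - n * x$2))"

lemma flat_1: "flat 1 x = (if x > 0 then exp (- (1/x)) else 0)"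
  by (simp add: flat_def)

lemma flat_1_bounds: "0 \<le> flat 1 x" "flat 1 x \<le> 1"
  by (auto simp: flat_1)

lemma bump_bounds: "0 \<le> bump n a b x" "bump n a b x \<le> 1"
  unfolding bump_def by (intro mult_nonneg_nonneg flat_1_bounds mult_le_one)+

lemma in_box_2: "x \<in> box a b \<longleftrightarrow> a$1 < x$1 \<and> x$1 < b$1 \<and> a$2 < x$2 \<and> x$2 < (b::real^2)$2"
  by (auto simp: mem_box_cart forall_2)

lemma bump_outside: assumes "n > 0" "x \<notin> box a b" shows "bump n a b x = 0"
proof -
  have f0: "flat 1 (n * s - n * t) = 0" if "s \<le> t" for s t
    using that \<open>n > 0\<close> by (simp add: flat_1)
  from assms(2) have "x$1 \<le> a$1 \<or> b$1 \<le> x$1 \<or> x$2 \<le> a$2 \<or> b$2 \<le> x$2" by (auto simp: in_box_2)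
  then show ?thesis unfolding bump_def using f0 by auto
qed

lemma bump_inside: assumes "n > 0" "x \<in> box a b" shows "bump n a b x > 0"
proof -
  have "flat 1 (n * s - n * t) > 0" if "s > t" for s t
    using that \<open>n > 0\<close> by (simp add: flat_1)
  then show ?thesis using assms(2) unfolding bump_def by (simp add: in_box_2)
qed

lemma bump_smooth_gen: "bump n a b \<in> smooth_gen"
proof -
  have 1: "(\<lambda>x. flat 1 (n * x$i - n * a$i)) \<in> smooth_gen" for i
    using smooth_gen.base[of 1 "- (n * a$i)" n i] by simp
  have 2: "(\<lambda>x. flat 1 (n * b$i - n * x$i)) \<in> smooth_gen" for i
    using smooth_gen.base[of 1 "n * b$i" "-n" i] by simp
  have "bump n a b = (\<lambda>x. (flat 1 (n * x$1 - n * a$1) * flat 1 (n * b$1 - n * x$1)) *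
                  (flat 1 (n * x$2 - n * a$2) * flat 1 (n * b$2 - n * x$2)))"
    by (simp add: bump_def fun_eq_iff)
  then show ?thesis
    using smooth_gen.mult[OF smooth_gen.mult[OF 1[of 1] 2[of 1]] smooth_gen.mult[OF 1[of 2] 2[of 2]]]
    by simp
qed

lemma bump_test_fun: assumes "n > 0" shows "test_fun (bump n a b)"
proof -
  have "{x. bump n a b x \<noteq> 0} \<subseteq> box a b" using bump_outside[OF assms] by blast
  then have "bounded (closure {x. bump n a b x \<noteq> 0})"
    using bounded_box bounded_subset by (intro bounded_closure) blast
  then show ?thesis
    unfolding test_fun_def by (simp add: smooth_gen_smooth[OF bump_smooth_gen] compact_eq_bounded_closed)
qed

lemma bump_measurable [measurable]: "bump n a b \<in> borel_measurable borel"
  using smooth_gen_partial[OF bump_smooth_gen] by (auto intro: borel_measurable_continuous_onI)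

lemma flat_scaled_tendsto: assumes "y > 0" shows "(\<lambda>n. flat 1 (real n * y)) \<longlonglongrightarrow> 1"
proof -
  have "(\<lambda>n. exp (- ((1/y) * (1 / real n)))) \<longlonglongrightarrow> exp (- ((1/y) * 0))"
    by (intro tendsto_intros lim_1_over_n)
  moreover have "\<forall>\<^sub>F n in sequentially. exp (- ((1/y) * (1 / real n))) = flat 1 (real n * y)"
    using eventually_gt_at_top[of 0] by eventually_elim (use assms in \<open>simp add: flat_1 mult.commute\<close>)
  ultimately show ?thesis by (simp add: tendsto_cong)
qed

lemma bump_tendsto: "(\<lambda>n. bump (real n) a b x) \<longlonglongrightarrow> indicator (box a b) x"
proof (cases "x \<in> box a b")
  case True
  then have "(\<lambda>n. bump (real n) a b x) \<longlonglongrightarrow> (1 * 1) * (1 * 1)"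
    unfolding bump_def right_diff_distrib[symmetric]
    by (intro tendsto_mult flat_scaled_tendsto) (auto simp: in_box_2)
  then show ?thesis using True by simp
next
  case False
  have "\<forall>\<^sub>F n in sequentially. bump (real n) a b x = 0"
    using eventually_gt_at_top[of 0] by eventually_elim (use False bump_outside in simp)
  then show ?thesis using False by (simp add: tendsto_eventually)
qed

definition loc_int :: "(real^2 \<Rightarrow> 'b::{banach,second_countable_topology}) \<Rightarrow> bool" where
  "loc_int w \<longleftrightarrow> w \<in> borel_measurable borel \<and> (\<forall>a b. integrable lborel (\<lambda>x. indicator (box a b) x *\<^sub>R w x))"

text \<open>Boxes form an intersection-stable generator, so vanishing integrals spread from boxes to
  all Borel sets; cutting \<open>w\<close> off to a fixed box first provides the integrability this
  needs.\<close>

lemma box_integral_zero_imp_AE_zero: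
  fixes w :: "real^2 \<Rightarrow> 'b::{banach,second_countable_topology}"
  assumes w: "loc_int w"
    and 0: "\<And>a b. (\<integral>x. indicator (box a b) x *\<^sub>R w x \<partial>lborel) = 0"
  shows "AE x in lborel. w x = 0"
proof -
  have [measurable]: "w \<in> borel_measurable borel" using w by (simp add: loc_int_def)
  have *: "AE x in lborel. indicator (box c d) x *\<^sub>R w x = 0" for c d
  proof -
    let ?f = "\<lambda>x. indicator (box c d) x *\<^sub>R w x"
    have int: "integrable lborel ?f" using w by (simp add: loc_int_def)
    have si: "set_integrable lborel A ?f" if "A \<in> sets borel" for A
      using integrable_mult_indicator[OF _ int] that by (simp add: set_integrable_def)
    have bs: "sets borel = sigma_sets UNIV (range (\<lambda>(a, b). box a b :: (real^2) set))"
      by (subst borel_eq_box) simp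
    have "set_lebesgue_integral lborel A ?f = 0" if "A \<in> sigma_sets UNIV (range (\<lambda>(a, b). box a b))" for A
    proof -
      have "Int_stable (range (\<lambda>(a, b). box a b :: (real^2) set))"
        by (auto simp: Int_stable_def box_Int_box)
      moreover have "range (\<lambda>(a, b). box a b :: (real^2) set) \<subseteq> Pow UNIV" by simp
      ultimately show ?thesis using that
      proof (induction rule: sigma_sets_induct_disjoint)
        case (basic A)
        then obtain a b where A: "A = box a b" by auto
        have "set_lebesgue_integral lborel A ?f = (\<integral>x. indicator (A \<inter> box c d) x *\<^sub>R w x \<partial>lborel)"
          by (simp add: set_lebesgue_integral_def indicator_inter_arith mult.commute)
        also have "\<dots> = 0" unfolding A box_Int_box by (rule 0)
        finally show ?case .
      next
        case empty then show ?case by (simp add: set_lebesgue_integral_def)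
      next
        case (compl A)
        have A: "A \<in> sets borel" using compl.hyps bs by simp
        have "set_lebesgue_integral lborel (UNIV - A) ?f = (\<integral>x. ?f x - indicator A x *\<^sub>R ?f x \<partial>lborel)"
          unfolding set_lebesgue_integral_def
          by (intro Bochner_Integration.integral_cong) (auto simp: indicator_def)
        also have "\<dots> = (\<integral>x. ?f x \<partial>lborel) - set_lebesgue_integral lborel A ?f"
          unfolding set_lebesgue_integral_def using si[OF A] int
          by (intro Bochner_Integration.integral_diff) (auto simp: set_integrable_def)
        also have "\<dots> = 0" using compl.IH 0 by simp
        finally show ?case by simp
      next
        case (union A)
        have A: "A i \<in> sets borel" for i using union.hyps bs by auto
        have "set_lebesgue_integral lborel (\<Union>i. A i) ?f = (\<Sum>i. set_lebesgue_integral lborel (A i) ?f)"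
          using A union.hyps by (intro lebesgue_integral_countable_add si) (auto simp: disjoint_family_on_def)
        then show ?case using union.IH by simp
      qed
    qed
    then show ?thesis using sigma_finite_measure.density_zero[OF sigma_finite_lborel int] bs by simp
  qed
  have "AE x in lborel. \<forall>n::nat. indicator (box (\<chi> i. - real n) (\<chi> i. real n)) x *\<^sub>R w x = 0"
    unfolding AE_all_countable using * by blast
  then show ?thesis
  proof eventually_elim
    case (elim x)
    obtain n :: nat where n: "\<bar>x$1\<bar> < n" "\<bar>x$2\<bar> < n"
      using reals_Archimedean2[of "max \<bar>x$1\<bar> \<bar>x$2\<bar>"] by auto
    then have "x \<in> box (\<chi> i. - real n) (\<chi> i. real n)" by (auto simp: in_box_2)
    then show ?case using elim by (metis indicator_simps(1) scaleR_one)
  qed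
qed

lemma loc_int_bump: assumes "loc_int w" "n > 0" shows "integrable lborel (\<lambda>x. bump n a b x *\<^sub>R w x)"
proof (rule Bochner_Integration.integrable_bound)
  show "integrable lborel (\<lambda>x. indicator (box a b) x *\<^sub>R w x)" using assms by (simp add: loc_int_def)
  have [measurable]: "w \<in> borel_measurable borel" using assms by (simp add: loc_int_def)
  show "(\<lambda>x. bump n a b x *\<^sub>R w x) \<in> borel_measurable lborel" by measurable
  show "AE x in lborel. norm (bump n a b x *\<^sub>R w x) \<le> norm (indicator (box a b) x *\<^sub>R w x)"
    using bump_outside[OF assms(2)] bump_bounds[of n a b]
    by (intro AE_I2) (auto simp: indicator_def intro!: mult_left_le_one_le)
qed

text \<open>Bumps of growing steepness converge boundedly to the indicator of a box, so testing
  against bumps alone determines \<open>w\<close>.\<close>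

theorem fundamental_lemma:
  fixes w :: "real^2 \<Rightarrow> 'b::{banach,second_countable_topology}"
  assumes w: "loc_int w"
    and 0: "\<And>n a b. n > 0 \<Longrightarrow> (\<integral>x. bump n a b x *\<^sub>R w x \<partial>lborel) = 0"
  shows "AE x in lborel. w x = 0"
proof (rule box_integral_zero_imp_AE_zero[OF w])
  fix a b
  have [measurable]: "w \<in> borel_measurable borel" using w by (simp add: loc_int_def)
  have "(\<lambda>n. \<integral>x. bump (real (Suc n)) a b x *\<^sub>R w x \<partial>lborel) \<longlonglongrightarrow> (\<integral>x. indicator (box a b) x *\<^sub>R w x \<partial>lborel)"
  proof (rule integral_dominated_convergence)
    show "integrable lborel (\<lambda>x. norm (indicator (box a b) x *\<^sub>R w x))"
      using w by (intro integrable_norm) (simp add: loc_int_def)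
    show "AE x in lborel. (\<lambda>n. bump (real (Suc n)) a b x *\<^sub>R w x) \<longlonglongrightarrow> indicator (box a b) x *\<^sub>R w x"
      by (intro AE_I2 tendsto_scaleR tendsto_const LIMSEQ_Suc[OF bump_tendsto])
    show "AE x in lborel. norm (bump (real (Suc n)) a b x *\<^sub>R w x) \<le> norm (indicator (box a b) x *\<^sub>R w x)" for n
      using bump_outside[of "real (Suc n)" _ a b] bump_bounds[of "real (Suc n)" a b]
      by (intro AE_I2) (auto simp: indicator_def intro!: mult_left_le_one_le)
  qed auto
  then show "(\<integral>x. indicator (box a b) x *\<^sub>R w x \<partial>lborel) = 0"
    using 0 by (simp add: LIMSEQ_const_iff)
qed

subsection \<open>Increments of differentiable functions\<close>

definition has_partials :: "(real^2 \<Rightarrow> real) \<Rightarrow> (2 \<Rightarrow> real^2 \<Rightarrow> real) \<Rightarrow> bool" where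
  "has_partials \<phi> d \<longleftrightarrow>
     (\<forall>i x. ((\<lambda>t. \<phi> (x + t *\<^sub>R axis i 1)) has_real_derivative d i x) (at 0)) \<and>
     (\<forall>i. continuous_on UNIV (d i))"

lemma axis_mvt:
  assumes "has_partials \<phi> d"
  shows "\<exists>s. \<bar>s\<bar> \<le> \<bar>t\<bar> \<and> \<phi> (x + t *\<^sub>R axis i 1) - \<phi> x = t * d i (x + s *\<^sub>R axis i 1)"
proof -
  have D: "((\<lambda>t. \<phi> (x + t *\<^sub>R axis i 1)) has_real_derivative d i (x + s *\<^sub>R axis i 1)) (at s)" for s
  proof -
    have "((\<lambda>t. \<phi> ((x + s *\<^sub>R axis i 1) + t *\<^sub>R axis i 1)) has_real_derivative d i (x + s *\<^sub>R axis i 1)) (at 0)"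
      using assms unfolding has_partials_def by blast
    then have "((\<lambda>t. \<phi> (x + (t + s) *\<^sub>R axis i 1)) has_real_derivative d i (x + s *\<^sub>R axis i 1)) (at 0)"
      by (simp add: algebra_simps)
    then show ?thesis using DERIV_shift[of "\<lambda>t. \<phi> (x + t *\<^sub>R axis i 1)" "d i (x + s *\<^sub>R axis i 1)" 0 s] by simp
  qed
  consider "t = 0" | "t > 0" | "t < 0" by linarith
  then show ?thesis
  proof cases
    case 1 then show ?thesis by auto
  next
    case 2
    from MVT2[OF this, of "\<lambda>t. \<phi> (x + t *\<^sub>R axis i 1)" "\<lambda>s. d i (x + s *\<^sub>R axis i 1)"] D
    obtain s where "0 < s" "s < t" "\<phi> (x + t *\<^sub>R axis i 1) - \<phi> (x + 0 *\<^sub>R axis i 1) = (t - 0) * d i (x + s *\<^sub>R axis i 1)"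
      by blast
    then show ?thesis by (intro exI[of _ s]) auto
  next
    case 3
    from MVT2[OF this, of "\<lambda>t. \<phi> (x + t *\<^sub>R axis i 1)" "\<lambda>s. d i (x + s *\<^sub>R axis i 1)"] D
    obtain s where "t < s" "s < 0" "\<phi> (x + 0 *\<^sub>R axis i 1) - \<phi> (x + t *\<^sub>R axis i 1) = (0 - t) * d i (x + s *\<^sub>R axis i 1)"
      by blast
    then show ?thesis by (intro exI[of _ s]) auto
  qed
qed

lemma vec2_axis: "(h::real^2) = h$1 *\<^sub>R axis 1 1 + h$2 *\<^sub>R axis 2 1"
  by (simp add: vec_eq_iff axis_def forall_2)

lemma norm_sq_2: "(norm (h::real^2))\<^sup>2 = (h$1)\<^sup>2 + (h$2)\<^sup>2"
  by (simp add: norm_vec_def L2_set_def sum_2)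

lemma norm_axis_partial: "\<bar>s\<bar> \<le> \<bar>h$2\<bar> \<Longrightarrow> norm (h$1 *\<^sub>R axis 1 1 + s *\<^sub>R axis 2 1 :: real^2) \<le> norm (h::real^2)"
  by (rule power2_le_imp_le) (simp_all add: norm_sq_2 axis_def abs_le_square_iff)

text \<open>The increment is split along a staircase of two axis-parallel segments, each treated by
  the mean value theorem; both intermediate points stay within \<open>norm h\<close> of
  \<open>x\<close>.\<close>

lemma increment_partials:
  assumes "has_partials \<phi> d"
  shows "\<exists>p q. norm (p - x) \<le> norm h \<and> norm (q - x) \<le> norm h \<and> \<phi> (x + h) - \<phi> x = h$1 * d 1 p + h$2 * d 2 q"
proof -
  obtain s where s: "\<bar>s\<bar> \<le> \<bar>h$1\<bar>" "\<phi> (x + h$1 *\<^sub>R axis 1 1) - \<phi> x = h$1 * d 1 (x + s *\<^sub>R axis 1 1)"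
    using axis_mvt[OF assms, of "h$1" x 1] by blast
  obtain r where r: "\<bar>r\<bar> \<le> \<bar>h$2\<bar>"
    "\<phi> ((x + h$1 *\<^sub>R axis 1 1) + h$2 *\<^sub>R axis 2 1) - \<phi> (x + h$1 *\<^sub>R axis 1 1) = h$2 * d 2 ((x + h$1 *\<^sub>R axis 1 1) + r *\<^sub>R axis 2 1)"
    using axis_mvt[OF assms, of "h$2" "x + h$1 *\<^sub>R axis 1 1" 2] by blast
  have e: "(x + h$1 *\<^sub>R axis 1 1) + h$2 *\<^sub>R axis 2 1 = x + h" using vec2_axis[of h] by (simp add: add.assoc)
  have "norm (s *\<^sub>R axis 1 1 :: real^2) \<le> norm h"
    using s(1) component_le_norm_cart[of h 1] by simp
  moreover have "norm (h$1 *\<^sub>R axis 1 1 + r *\<^sub>R axis 2 1 :: real^2) \<le> norm h"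
    by (rule norm_axis_partial[OF r(1)])
  moreover have "\<phi> (x + h) - \<phi> x = h$1 * d 1 (x + s *\<^sub>R axis 1 1) + h$2 * d 2 ((x + h$1 *\<^sub>R axis 1 1) + r *\<^sub>R axis 2 1)"
    using s(2) r(2) unfolding e by simp
  ultimately show ?thesis
    by (intro exI[of _ "x + s *\<^sub>R axis 1 1"] exI[of _ "(x + h$1 *\<^sub>R axis 1 1) + r *\<^sub>R axis 2 1"])
      (simp add: algebra_simps)
qed

text \<open>Quantitative form of differentiability: the oscillation of the partials bounds the
  error, which later gives an estimate uniform in \<open>x\<close> for test functions.\<close>

lemma increment_partials_error:
  assumes "has_partials \<phi> d"
    and e: "\<And>i y. norm (y - x) \<le> norm h \<Longrightarrow> \<bar>d i y - d i x\<bar> \<le> e"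
  shows "\<bar>\<phi> (x + h) - \<phi> x - (h$1 * d 1 x + h$2 * d 2 x)\<bar> \<le> 2 * e * norm h"
proof -
  obtain p q where pq: "norm (p - x) \<le> norm h" "norm (q - x) \<le> norm h"
      "\<phi> (x + h) - \<phi> x = h$1 * d 1 p + h$2 * d 2 q"
    using increment_partials[OF assms(1)] by blast
  have "\<phi> (x + h) - \<phi> x - (h$1 * d 1 x + h$2 * d 2 x) = h$1 * (d 1 p - d 1 x) + h$2 * (d 2 q - d 2 x)"
    using pq(3) by (simp add: algebra_simps)
  also have "\<bar>\<dots>\<bar> \<le> \<bar>h$1\<bar> * \<bar>d 1 p - d 1 x\<bar> + \<bar>h$2\<bar> * \<bar>d 2 q - d 2 x\<bar>"
    by (metis abs_mult abs_triangle_ineq)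
  also have "\<dots> \<le> norm h * e + norm h * e"
    using e[OF pq(1)] e[OF pq(2)] component_le_norm_cart[of h] by (intro add_mono mult_mono) auto
  finally show ?thesis by simp
qed

lemma has_partials_has_derivative:
  assumes "has_partials \<phi> d"
  shows "(\<phi> has_derivative (\<lambda>h. h$1 * d 1 x + h$2 * d 2 x)) (at x)"
  unfolding has_derivative_at_alt
proof (intro conjI allI impI)
  show "bounded_linear (\<lambda>h::real^2. h $ 1 * d 1 x + h $ 2 * d 2 x)"
    by (intro bounded_linear_add bounded_linear_mult_const bounded_linear_vec_nth)
  fix e :: real assume "e > 0"
  have "\<exists>r>0. \<forall>y. dist y x < r \<longrightarrow> dist (d i y) (d i x) < e/2" for i
    using assms \<open>e > 0\<close> unfolding has_partials_def continuous_on_iff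
    by (metis UNIV_I half_gt_zero)
  then obtain r where r: "\<And>i. r i > 0" "\<And>i y. dist y x < r i \<Longrightarrow> dist (d i y) (d i x) < e/2" by metis
  show "\<exists>s>0. \<forall>y. norm (y - x) < s \<longrightarrow>
      norm (\<phi> y - \<phi> x - ((y - x) $ 1 * d 1 x + (y - x) $ 2 * d 2 x)) \<le> e * norm (y - x)"
  proof (intro exI[of _ "min (r 1) (r 2)"] conjI allI impI)
    show "0 < min (r 1) (r 2)" using r(1) by simp
    fix y assume y: "norm (y - x) < min (r 1) (r 2)"
    have "\<bar>d i z - d i x\<bar> \<le> e/2" if "norm (z - x) \<le> norm (y - x)" for i z
    proof -
      have "i = 1 \<or> i = 2" by (rule exhaust_2)
      then have "dist z x < r i" using that y by (auto simp: dist_norm)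
      then show ?thesis using r(2)[of z i] by (simp add: dist_real_def)
    qed
    from increment_partials_error[OF assms, of x "y - x", OF this]
    show "norm (\<phi> y - \<phi> x - ((y - x) $ 1 * d 1 x + (y - x) $ 2 * d 2 x)) \<le> e * norm (y - x)"
      by simp
  qed
qed

lemma increment_integral:
  assumes P: "has_partials \<phi> d"
  shows "(\<integral>t. indicator {0..1} t *\<^sub>R (h$1 * d 1 (x + t *\<^sub>R h) + h$2 * d 2 (x + t *\<^sub>R h)) \<partial>lborel) = \<phi> (x + h) - \<phi> x"
proof -
  let ?f = "\<lambda>t. h$1 * d 1 (x + t *\<^sub>R h) + h$2 * d 2 (x + t *\<^sub>R h)"
  have D: "((\<lambda>t. \<phi> (x + t *\<^sub>R h)) has_vector_derivative ?f t) (at t within S)" for t S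
  proof -
    have "((\<lambda>t. x + t *\<^sub>R h) has_derivative (\<lambda>s. s *\<^sub>R h)) (at t)"
      by (auto intro!: derivative_eq_intros)
    from has_derivative_compose[OF this has_partials_has_derivative[OF P]]
    have "((\<lambda>t. \<phi> (x + t *\<^sub>R h)) has_vector_derivative ?f t) (at t)"
      unfolding has_vector_derivative_def by (rule has_derivative_eq_rhs) (auto simp: algebra_simps)
    then show ?thesis by (rule has_vector_derivative_at_within)
  qed
  have c: "continuous_on UNIV (d i)" for i using P by (simp add: has_partials_def)
  have "continuous_on {0..1} ?f"
    by (intro continuous_intros continuous_on_compose2[OF c]) auto
  from integral_FTC_Icc[OF zero_le_one D this]
  show ?thesis by (simp add: mult.commute)
qed

lemma partial_zero_outside:
  assumes "has_partials \<phi> d" "x \<notin> closure {x. \<phi> x \<noteq> 0}"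
  shows "d i x = 0"
proof -
  let ?U = "- closure {x. \<phi> x \<noteq> 0}"
  have 0: "\<phi> y = 0" if "y \<in> ?U" for y using that closure_subset[of "{x. \<phi> x \<noteq> 0}"] by blast
  have D: "(\<phi> has_derivative (\<lambda>h. h$1 * d 1 x + h$2 * d 2 x)) (at x)"
    using has_partials_has_derivative[OF assms(1)] .
  have "((\<lambda>_. 0) has_derivative (\<lambda>h. h$1 * d 1 x + h$2 * d 2 x)) (at x)"
  proof (rule has_derivative_transform_within_open[OF D, of ?U])
    show "open ?U" by (simp add: open_Compl)
    show "x \<in> ?U" using assms(2) by blast
  qed (rule 0)
  then have "(\<lambda>h. h$1 * d 1 x + h$2 * d 2 x) = (\<lambda>h::real^2. 0)"
    by (rule has_derivative_unique) simp
  from fun_cong[OF this, of "axis 1 1"] fun_cong[OF this, of "axis 2 1"]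
  have "d 1 x = 0" "d 2 x = 0" by (simp_all add: axis_def)
  then show ?thesis using exhaust_2[of i] by auto
qed

lemma test_fun_partials:
  assumes "test_fun \<phi>"
  obtains d R B where "has_partials \<phi> d" "continuous_on UNIV \<phi>" "R > 0" "B > 0"
    "\<And>x. norm x \<ge> R \<Longrightarrow> \<phi> x = 0" "\<And>x i. norm x \<ge> R \<Longrightarrow> d i x = 0"
    "\<And>x. \<bar>\<phi> x\<bar> \<le> B" "\<And>x i. \<bar>d i x\<bar> \<le> B"
proof -
  from assms obtain S where S: "\<phi> \<in> S" "\<And>g. g \<in> S \<Longrightarrow> continuous_on UNIV g"
    "\<And>g i. g \<in> S \<Longrightarrow> \<exists>h\<in>S. \<forall>x. ((\<lambda>t. g (x + t *\<^sub>R axis i 1)) has_real_derivative h x) (at 0)"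
    and cpt: "compact (closure {x. \<phi> x \<noteq> 0})"
    unfolding test_fun_def smooth_fun_def by blast
  from S(3)[OF S(1)] obtain d where d: "\<And>i. d i \<in> S"
    "\<And>i x. ((\<lambda>t. \<phi> (x + t *\<^sub>R axis i 1)) has_real_derivative d i x) (at 0)" by metis
  have P: "has_partials \<phi> d" using d S(2) by (simp add: has_partials_def)
  from compact_imp_bounded[OF cpt] obtain R0 where R0: "\<And>x. x \<in> closure {x. \<phi> x \<noteq> 0} \<Longrightarrow> norm x \<le> R0"
    unfolding bounded_iff by blast
  define R where "R = max R0 0 + 1"
  have out: "x \<notin> closure {x. \<phi> x \<noteq> 0}" if "norm x \<ge> R" for x
    using R0[of x] that unfolding R_def by linarith
  have z: "\<phi> x = 0" if "norm x \<ge> R" for x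
    using out[OF that] closure_subset[of "{x. \<phi> x \<noteq> 0}"] by blast
  have zd: "d i x = 0" if "norm x \<ge> R" for x i
    using partial_zero_outside[OF P out[OF that]] .
  have bd: "\<exists>B>0. \<forall>x. \<bar>g x\<bar> \<le> B" if "continuous_on UNIV g" "\<And>x. norm x \<ge> R \<Longrightarrow> g x = 0" for g :: "real^2 \<Rightarrow> real"
  proof -
    have "compact (g ` cball 0 R)"
      using that(1) continuous_on_subset by (intro compact_continuous_image) auto
    then obtain B where B: "\<And>x. x \<in> cball 0 R \<Longrightarrow> \<bar>g x\<bar> \<le> B"
      using compact_imp_bounded[of "g ` cball 0 R"] unfolding bounded_iff by (metis imageI real_norm_def)
    have "\<bar>g x\<bar> \<le> \<bar>B\<bar> + 1" for x
      using B[of x] that(2)[of x] by (cases "norm x \<le> R") auto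
    then show ?thesis by (intro exI[of _ "\<bar>B\<bar> + 1"]) auto
  qed
  obtain B0 where B0: "B0 > 0" "\<And>x. \<bar>\<phi> x\<bar> \<le> B0" using bd[of \<phi>] S z by blast
  obtain B1 where B1: "B1 > 0" "\<And>x. \<bar>d 1 x\<bar> \<le> B1" using bd[of "d 1"] S(2)[OF d(1)] zd by blast
  obtain B2 where B2: "B2 > 0" "\<And>x. \<bar>d 2 x\<bar> \<le> B2" using bd[of "d 2"] S(2)[OF d(1)] zd by blast
  have d12: "\<bar>d i x\<bar> \<le> B0 + B1 + B2" for i x
    using exhaust_2[of i] B0(1) B1(1) B2(1) B1(2)[of x] B2(2)[of x] by auto
  show ?thesis
    by (rule that[OF P, of R "B0 + B1 + B2"])
      (use S(2)[OF S(1)] B0(1) B1(1) B2(1) z zd d12 in \<open>auto simp: R_def intro: order_trans[OF B0(2)]\<close>)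
qed

lemma has_partials_unique:
  assumes "has_partials \<phi> d" "\<And>x. ((\<lambda>t. \<phi> (x + t *\<^sub>R axis i 1)) has_real_derivative e x) (at 0)"
  shows "e = d i"
proof
  show "e x = d i x" for x
    using assms(1) by (intro DERIV_unique[OF assms(2)]) (simp add: has_partials_def)
qed

lemma weak_partialD:
  assumes "weak_partial u i g" "test_fun \<phi>" "has_partials \<phi> d"
  shows "(\<integral>x. d i x *\<^sub>R u x \<partial>lborel) = - (\<integral>x. \<phi> x *\<^sub>R g x \<partial>lborel)"
proof -
  have "\<forall>x. ((\<lambda>t. \<phi> (x + t *\<^sub>R axis i 1)) has_real_derivative d i x) (at 0)"
    using assms(3) by (simp add: has_partials_def)
  with assms(1)[unfolded weak_partial_def, rule_format, of \<phi> "d i"] assms(2)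
  show ?thesis by (simp add: scaleR_conv_of_real)
qed

lemma weak_partialI:
  assumes "\<And>\<phi> d. test_fun \<phi> \<Longrightarrow> has_partials \<phi> d \<Longrightarrow>
    (\<integral>x. d i x *\<^sub>R u x \<partial>lborel) = - (\<integral>x. \<phi> x *\<^sub>R g x \<partial>lborel)"
  shows "weak_partial u i g"
  unfolding weak_partial_def scaleR_conv_of_real[symmetric]
proof (intro allI impI)
  fix \<phi> e assume *: "test_fun \<phi> \<and> (\<forall>x. ((\<lambda>t. \<phi> (x + t *\<^sub>R axis i 1)) has_real_derivative e x) (at 0))"
  then obtain d where d: "has_partials \<phi> d" by (metis test_fun_partials)
  from * has_partials_unique[OF d, of i e] have "e = d i" by blast
  with assms[OF _ d] * show "(\<integral>x. e x *\<^sub>R u x \<partial>lborel) = - (\<integral>x. \<phi> x *\<^sub>R g x \<partial>lborel)" by simp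
qed

subsection \<open>Translates of functions with a weak gradient\<close>

lemma pair_integrableI:
  fixes f :: "'a::euclidean_space \<times> 'b::euclidean_space \<Rightarrow> 'c::{banach,second_countable_topology}"
  assumes f [measurable]: "f \<in> borel_measurable (lborel \<Otimes>\<^sub>M lborel)"
    and le: "(\<integral>\<^sup>+s. \<integral>\<^sup>+x. ennreal (norm (f (s, x))) \<partial>lborel \<partial>lborel) \<le> ennreal K"
  shows "integrable (lborel \<Otimes>\<^sub>M lborel) f"
proof (rule integrableI_bounded[OF f])
  have "(\<integral>\<^sup>+p. ennreal (norm (f p)) \<partial>(lborel \<Otimes>\<^sub>M lborel)) = (\<integral>\<^sup>+s. \<integral>\<^sup>+x. ennreal (norm (f (s, x))) \<partial>lborel \<partial>lborel)"
    by (rule lborel.nn_integral_fst[symmetric]) measurable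
  with le show "(\<integral>\<^sup>+p. ennreal (norm (f p)) \<partial>(lborel \<Otimes>\<^sub>M lborel)) < \<infinity>"
    by (simp add: le_less_trans)
qed

lemma L2_loc_int:
  fixes f :: "real^2 \<Rightarrow> 'b::euclidean_space"
  assumes "L2 lborel f" shows "loc_int f"
  unfolding loc_int_def
proof (intro conjI allI)
  show m [measurable]: "f \<in> borel_measurable borel" using assms by (simp add: L2_def)
  fix a b
  show "integrable lborel (\<lambda>x. indicator (box a b) x *\<^sub>R f x)"
  proof (rule Bochner_Integration.integrable_bound)
    show "integrable lborel (\<lambda>x. indicat_real (box a b) x + (norm (f x))\<^sup>2)"
      using assms by (intro Bochner_Integration.integrable_add) (auto simp: L2_def emeasure_lborel_box_eq)
    show "AE x in lborel. norm (indicat_real (box a b) x *\<^sub>R f x) \<le> norm (indicat_real (box a b) x + (norm (f x))\<^sup>2)"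
    proof (intro AE_I2)
      fix x
      have "norm (f x) \<le> 1 + (norm (f x))\<^sup>2"
        using sum_squares_bound[of 1 "norm (f x)"] by (simp) (smt (verit) norm_ge_zero)
      then show "norm (indicat_real (box a b) x *\<^sub>R f x) \<le> norm (indicat_real (box a b) x + (norm (f x))\<^sup>2)"
        by (auto simp: indicator_def)
    qed
  qed measurable
qed

lemma loc_int_add: "loc_int f \<Longrightarrow> loc_int g \<Longrightarrow> loc_int (\<lambda>x. f x + g x)"
  by (auto simp: loc_int_def scaleR_add_right)

lemma loc_int_diff: "loc_int f \<Longrightarrow> loc_int g \<Longrightarrow> loc_int (\<lambda>x. f x - g x)"
  by (auto simp: loc_int_def scaleR_diff_right)

lemma loc_int_scaleR: assumes "loc_int f" shows "loc_int (\<lambda>x. c *\<^sub>R f x)"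
proof -
  have "integrable lborel (\<lambda>x. c *\<^sub>R (indicator (box a b) x *\<^sub>R f x))" for a b
    using assms by (intro integrable_scaleR_right) (simp add: loc_int_def)
  then show ?thesis using assms by (auto simp: loc_int_def mult.commute)
qed

lemma loc_int_shift:
  assumes "loc_int f" shows "loc_int (\<lambda>x. f (x + h))"
proof -
  have [measurable]: "f \<in> borel_measurable borel" using assms by (simp add: loc_int_def)
  have "integrable lborel (\<lambda>x. indicator (box a b) x *\<^sub>R f (x + h))" for a b
  proof -
    have "integrable lborel (\<lambda>x. indicator (box (a + h) (b + h)) x *\<^sub>R f x)"
      using assms by (simp add: loc_int_def)
    then have "integrable lborel (\<lambda>x. indicator (box (a + h) (b + h)) (x + h) *\<^sub>R f (x + h))"
      by (subst lborel_iso_integral(2)[OF lborel_iso_add, where h="\<lambda>x. indicator (box (a + h) (b + h)) x *\<^sub>R f x"]) auto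
    moreover have "indicator (box (a + h) (b + h)) (x + h) = (indicator (box a b) x :: real)" for x
      by (auto simp: indicator_def in_box_2)
    ultimately show ?thesis by simp
  qed
  then show ?thesis by (simp add: loc_int_def)
qed

lemma indicator_box_enlarge:
  assumes "x \<in> box a b" "norm (y - x) \<le> r"
  shows "y \<in> box (a - (\<chi> i. r)) (b + (\<chi> i. r) :: real^2)"
  using assms component_le_norm_cart[of "y - x" 1] component_le_norm_cart[of "y - x" 2]
  by (auto simp: in_box_2)

text \<open>The points \<open>x + t h\<close> with \<open>x\<close> in a box stay in one larger box,
  so local integrability of \<open>G\<close> is enough for exchanging the segment integral with the
  space integral.\<close>

lemma segment_pair_integrable:
  fixes G :: "real^2 \<Rightarrow> 'b::{banach,second_countable_topology}" and p :: "real^2 \<Rightarrow> real"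
  assumes G: "loc_int G" and p [measurable]: "p \<in> borel_measurable borel"
    and pb: "\<And>x. \<bar>p x\<bar> \<le> indicator (box a b) x"
  shows "integrable (lborel \<Otimes>\<^sub>M lborel) (\<lambda>(t, x). (indicator {0..1::real} t * p x) *\<^sub>R G (x + t *\<^sub>R h))"
proof -
  have [measurable]: "G \<in> borel_measurable borel" using G by (simp add: loc_int_def)
  let ?B = "box (a - (\<chi> i. norm h)) (b + (\<chi> i. norm h))"
  define K where "K = (\<integral>x. norm (indicator ?B x *\<^sub>R G x) \<partial>lborel)"
  have int: "integrable lborel (\<lambda>x. indicator ?B x *\<^sub>R G x)" using G unfolding loc_int_def by blast
  have K: "(\<integral>\<^sup>+x. ennreal (norm (indicator ?B x *\<^sub>R G x)) \<partial>lborel) = ennreal K"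
    unfolding K_def using int by (intro nn_integral_eq_integral integrable_norm AE_I2 norm_ge_zero)
  have inner: "(\<integral>\<^sup>+x. ennreal (norm ((indicator {0..1::real} t * p x) *\<^sub>R G (x + t *\<^sub>R h))) \<partial>lborel)
      \<le> indicator {0..1} t * ennreal K" for t
  proof (cases "t \<in> {0..1}")
    case True
    have "(\<integral>\<^sup>+x. ennreal (norm ((indicator {0..1::real} t * p x) *\<^sub>R G (x + t *\<^sub>R h))) \<partial>lborel)
       \<le> (\<integral>\<^sup>+x. ennreal (norm (indicator ?B (x + t *\<^sub>R h) *\<^sub>R G (x + t *\<^sub>R h))) \<partial>lborel)"
    proof (intro nn_integral_mono ennreal_leI)
      fix x
      have "\<bar>p x\<bar> \<le> indicator ?B (x + t *\<^sub>R h)"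
      proof (cases "x \<in> box a b")
        case xb: True
        have "norm (x + t *\<^sub>R h - x) \<le> norm h" using True by (simp add: mult_left_le_one_le)
        from indicator_box_enlarge[OF xb this] show ?thesis using pb[of x] xb by simp
      qed (use pb[of x] in auto)
      then show "norm ((indicator {0..1::real} t * p x) *\<^sub>R G (x + t *\<^sub>R h)) \<le> norm (indicator ?B (x + t *\<^sub>R h) *\<^sub>R G (x + t *\<^sub>R h))"
        using True by (simp add: mult_right_mono)
    qed
    also have "\<dots> = ennreal K"
      unfolding K[symmetric]
      by (rule lborel_iso_nn_integral[OF lborel_iso_add, where h="\<lambda>x. ennreal (norm (indicator ?B x *\<^sub>R G x))"]) measurable
    finally show ?thesis using True by simp
  qed simp
  have "(\<integral>\<^sup>+t. \<integral>\<^sup>+x. ennreal (norm ((indicator {0..1::real} t * p x) *\<^sub>R G (x + t *\<^sub>R h))) \<partial>lborel \<partial>lborel)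
     \<le> (\<integral>\<^sup>+t. indicator {0..1::real} t * ennreal K \<partial>lborel)"
    by (intro nn_integral_mono inner)
  also have "\<dots> = ennreal K"
    by (subst nn_integral_multc) auto
  finally show ?thesis
    by (intro pair_integrableI[where K=K]) (auto simp: case_prod_unfold)
qed

text \<open>For a test function the increment along \<open>h\<close> is the integral of its
  derivative over the segment. Duality carries this to \<open>u\<close>: the shift moves to the
  bump, the increment of the bump becomes a segment integral, and the weak identity is applied for
  each parameter \<open>t\<close>. The exceptional null set depends on \<open>h\<close>.\<close>

theorem weak_gradient_increment:
  fixes u g1 g2 :: "real^2 \<Rightarrow> complex"
  assumes u: "loc_int u" and g1: "loc_int g1" and g2: "loc_int g2"
    and w1: "weak_partial u 1 g1" and w2: "weak_partial u 2 g2"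
  shows "AE x in lborel. u (x + h) - u x =
    (\<integral>t. indicator {0..1} t *\<^sub>R (h$1 *\<^sub>R g1 (x + t *\<^sub>R h) + h$2 *\<^sub>R g2 (x + t *\<^sub>R h)) \<partial>lborel)"
proof -
  define G where "G x = h$1 *\<^sub>R g1 x + h$2 *\<^sub>R g2 x" for x
  have G: "loc_int G" unfolding G_def by (intro loc_int_add loc_int_scaleR g1 g2)
  have [measurable]: "u \<in> borel_measurable borel" "g1 \<in> borel_measurable borel" "g2 \<in> borel_measurable borel"
    "G \<in> borel_measurable borel"
    using u g1 g2 G by (auto simp: loc_int_def)
  define A where "A x = (\<integral>t. indicator {0..1} t *\<^sub>R G (x + t *\<^sub>R h) \<partial>lborel)" for x
  have Am [measurable]: "A \<in> borel_measurable borel" unfolding A_def by measurable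
  have A: "loc_int A"
    unfolding loc_int_def
  proof (intro conjI allI)
    fix a b
    from segment_pair_integrable[OF G, of "indicator (box a b)" a b h]
    have "integrable lborel (\<lambda>x. \<integral>t. (indicator {0..1::real} t * indicator (box a b) x) *\<^sub>R G (x + t *\<^sub>R h) \<partial>lborel)"
      by (intro lborel_pair.integrable_snd) auto
    moreover have "(\<integral>t. (indicator {0..1::real} t * indicator (box a b) x) *\<^sub>R G (x + t *\<^sub>R h) \<partial>lborel)
       = indicator (box a b) x *\<^sub>R A x" for x
      unfolding A_def by (subst integral_scaleR_right[symmetric]) (simp add: mult.commute)
    ultimately show "integrable lborel (\<lambda>x. indicator (box a b) x *\<^sub>R A x)" by simp
  qed (rule Am)
  have "AE x in lborel. u (x + h) - u x - A x = 0"
  proof (rule fundamental_lemma)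
    show "loc_int (\<lambda>x. u (x + h) - u x - A x)"
      by (intro loc_int_diff loc_int_shift u A)
    fix n :: real and a b :: "real^2" assume n: "n > 0"
    let ?f = "bump n a b"
    have tf: "test_fun ?f" by (rule bump_test_fun[OF n])
    obtain d R B where d: "has_partials ?f d" and RB: "R > 0" "B > 0"
      "\<And>x i. norm x \<ge> R \<Longrightarrow> d i x = 0" "\<And>x i. \<bar>d i x\<bar> \<le> B"
      by (rule test_fun_partials[OF tf]) blast
    have [measurable]: "d i \<in> borel_measurable borel" for i
      using d by (auto simp: has_partials_def intro: borel_measurable_continuous_onI)
    have shift: "?f (x - c) = bump n (a + c) (b + c) x" for x c
      by (simp add: bump_def algebra_simps)
    define D where "D x = h$1 * d 1 x + h$2 * d 2 x" for x
    have [measurable]: "D \<in> borel_measurable borel" unfolding D_def by measurable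
    \<comment> \<open>A translate of a bump is again a bump, so the weak identity applies to it
      directly and produces a translate of \<open>G\<close>.\<close>
    have inner: "(\<integral>x. D (x - c) *\<^sub>R u x \<partial>lborel) = - (\<integral>x. ?f x *\<^sub>R G (x + c) \<partial>lborel)" for c
    proof -
      let ?fc = "bump n (a + c) (b + c)"
      have pc: "has_partials ?fc (\<lambda>i x. d i (x - c))"
        unfolding has_partials_def
      proof (intro conjI allI)
        fix i x
        have "((\<lambda>t. ?f ((x - c) + t *\<^sub>R axis i 1)) has_real_derivative d i (x - c)) (at 0)"
          using d unfolding has_partials_def by blast
        moreover have "?f ((x - c) + t *\<^sub>R axis i 1) = ?fc (x + t *\<^sub>R axis i 1)" for t
          using shift[of "x + t *\<^sub>R axis i 1" c] by (simp add: algebra_simps)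
        ultimately show "((\<lambda>t. ?fc (x + t *\<^sub>R axis i 1)) has_real_derivative d i (x - c)) (at 0)" by simp
      next
        fix i
        have "continuous_on UNIV (d i)" using d by (simp add: has_partials_def)
        then show "continuous_on UNIV (\<lambda>x. d i (x - c))"
          by (rule continuous_on_compose2) (auto intro!: continuous_intros)
      qed
      have iu: "integrable lborel (\<lambda>x. d i (x - c) *\<^sub>R u x)" for i
      proof (rule Bochner_Integration.integrable_bound)
        let ?C = "box (- (\<chi> i. R + norm c)) ((\<chi> i. R + norm c) :: real^2)"
        show "integrable lborel (\<lambda>x. B *\<^sub>R (indicator ?C x *\<^sub>R u x))"
          using u by (intro integrable_scaleR_right) (simp add: loc_int_def)
        show "AE x in lborel. norm (d i (x - c) *\<^sub>R u x) \<le> norm (B *\<^sub>R (indicator ?C x *\<^sub>R u x))"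
        proof (intro AE_I2)
          fix x
          show "norm (d i (x - c) *\<^sub>R u x) \<le> norm (B *\<^sub>R (indicator ?C x *\<^sub>R u x))"
          proof (cases "norm (x - c) \<ge> R")
            case False
            then have "norm x < R + norm c" using norm_triangle_ineq[of "x - c" c] by simp
            then have "x \<in> ?C" using component_le_norm_cart[of x 1] component_le_norm_cart[of x 2]
              by (auto simp: in_box_2)
            then show ?thesis using RB(4)[of i "x - c"] RB(2) by (simp add: mult_right_mono)
          qed (simp add: RB(3))
        qed
      qed measurable
      have ig: "integrable lborel (\<lambda>x. ?fc x *\<^sub>R g1 x)" "integrable lborel (\<lambda>x. ?fc x *\<^sub>R g2 x)"
        by (intro loc_int_bump g1 g2 n)+
      have "(\<integral>x. D (x - c) *\<^sub>R u x \<partial>lborel) = (\<integral>x. h$1 *\<^sub>R (d 1 (x - c) *\<^sub>R u x) + h$2 *\<^sub>R (d 2 (x - c) *\<^sub>R u x) \<partial>lborel)"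
        by (simp add: D_def scaleR_add_left)
      also have "\<dots> = h$1 *\<^sub>R (\<integral>x. d 1 (x - c) *\<^sub>R u x \<partial>lborel) + h$2 *\<^sub>R (\<integral>x. d 2 (x - c) *\<^sub>R u x \<partial>lborel)"
        by (subst Bochner_Integration.integral_add) (auto intro!: integrable_scaleR_right iu simp del: scaleR_scaleR)
      also have "\<dots> = - (h$1 *\<^sub>R (\<integral>x. ?fc x *\<^sub>R g1 x \<partial>lborel) + h$2 *\<^sub>R (\<integral>x. ?fc x *\<^sub>R g2 x \<partial>lborel))"
        using weak_partialD[OF w1 bump_test_fun[OF n] pc] weak_partialD[OF w2 bump_test_fun[OF n] pc] by simp
      also have "\<dots> = - (\<integral>x. h$1 *\<^sub>R (?fc x *\<^sub>R g1 x) + h$2 *\<^sub>R (?fc x *\<^sub>R g2 x) \<partial>lborel)"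
        by (subst Bochner_Integration.integral_add) (auto intro!: integrable_scaleR_right ig simp del: scaleR_scaleR)
      also have "\<dots> = - (\<integral>x. ?fc x *\<^sub>R G x \<partial>lborel)"
        by (simp add: G_def scaleR_add_right mult.commute)
      also have "(\<integral>x. ?fc x *\<^sub>R G x \<partial>lborel) = (\<integral>x. ?fc (x + c) *\<^sub>R G (x + c) \<partial>lborel)"
        by (rule lborel_iso_integral(1)[OF lborel_iso_add, symmetric, where h="\<lambda>x. ?fc x *\<^sub>R G x"]) measurable
      also have "\<dots> = (\<integral>x. ?f x *\<^sub>R G (x + c) \<partial>lborel)"
        using shift[of "_ + c" c] by simp
      finally show ?thesis .
    qed
    \<comment> \<open>Domination on a box enlarged by \<open>norm h\<close> justifies Fubini's
      theorem on the side where the derivative falls on the bump.\<close>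
    have F1: "integrable (lborel \<Otimes>\<^sub>M lborel) (\<lambda>(t, x). (indicator {0..1::real} t * D (x - t *\<^sub>R h)) *\<^sub>R u x)"
    proof -
      let ?C = "box (- (\<chi> i. R + norm h)) ((\<chi> i. R + norm h) :: real^2)"
      define K where "K = (\<integral>x. norm (indicator ?C x *\<^sub>R u x) \<partial>lborel)"
      have K: "(\<integral>\<^sup>+x. ennreal (norm (indicator ?C x *\<^sub>R u x)) \<partial>lborel) = ennreal K"
        unfolding K_def using u[unfolded loc_int_def]
        by (intro nn_integral_eq_integral integrable_norm AE_I2 norm_ge_zero) blast
      let ?b = "2 * norm h * B"
      have "(\<integral>\<^sup>+x. ennreal (norm ((indicator {0..1::real} t * D (x - t *\<^sub>R h)) *\<^sub>R u x)) \<partial>lborel)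
         \<le> indicator {0..1} t * (ennreal ?b * ennreal K)" for t
      proof (cases "t \<in> {0..1}")
        case True
        have "(\<integral>\<^sup>+x. ennreal (norm ((indicator {0..1::real} t * D (x - t *\<^sub>R h)) *\<^sub>R u x)) \<partial>lborel)
          \<le> (\<integral>\<^sup>+x. ennreal ?b * ennreal (norm (indicator ?C x *\<^sub>R u x)) \<partial>lborel)"
        proof (intro nn_integral_mono)
          fix x
          have "norm (D (x - t *\<^sub>R h)) \<le> ?b * indicator ?C x"
          proof (cases "norm (x - t *\<^sub>R h) \<ge> R")
            case True then show ?thesis using RB by (simp add: D_def)
          next
            case False
            have "norm (t *\<^sub>R h) \<le> norm h" using True by (simp add: mult_left_le_one_le)
            then have "norm x < R + norm h" using False norm_triangle_ineq[of "x - t *\<^sub>R h" "t *\<^sub>R h"] by simp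
            then have xC: "x \<in> ?C" using component_le_norm_cart[of x 1] component_le_norm_cart[of x 2]
              by (auto simp: in_box_2)
            have "\<bar>D (x - t *\<^sub>R h)\<bar> \<le> \<bar>h$1\<bar> * \<bar>d 1 (x - t *\<^sub>R h)\<bar> + \<bar>h$2\<bar> * \<bar>d 2 (x - t *\<^sub>R h)\<bar>"
              unfolding D_def by (metis abs_mult abs_triangle_ineq)
            also have "\<dots> \<le> norm h * B + norm h * B"
              using RB component_le_norm_cart[of h] by (intro add_mono mult_mono) auto
            finally show ?thesis using xC by (simp add: mult_ac)
          qed
          then have "norm (D (x - t *\<^sub>R h)) * norm (u x) \<le> ?b * indicator ?C x * norm (u x)"
            by (intro mult_right_mono) auto
          then show "ennreal (norm ((indicator {0..1::real} t * D (x - t *\<^sub>R h)) *\<^sub>R u x)) \<le> ennreal ?b * ennreal (norm (indicator ?C x *\<^sub>R u x))"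
            using True RB(2) by (subst ennreal_mult[symmetric]) (auto intro!: ennreal_leI simp: mult.assoc)
        qed
        also have "\<dots> = ennreal ?b * ennreal K"
          unfolding K[symmetric] by (rule nn_integral_cmult) measurable
        finally show ?thesis using True by simp
      qed simp
      then have "(\<integral>\<^sup>+t. \<integral>\<^sup>+x. ennreal (norm ((indicator {0..1::real} t * D (x - t *\<^sub>R h)) *\<^sub>R u x)) \<partial>lborel \<partial>lborel)
        \<le> (\<integral>\<^sup>+t. indicator {0..1::real} t * (ennreal ?b * ennreal K) \<partial>lborel)"
        by (intro nn_integral_mono)
      also have "\<dots> = ennreal (?b * K)"
        using RB(2) by (subst nn_integral_multc) (auto simp: ennreal_mult K_def)
      finally show ?thesis by (intro pair_integrableI[where K="?b * K"]) (auto simp: case_prod_unfold)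
    qed
    have "(\<integral>x. ?f x *\<^sub>R (u (x + h) - u x) \<partial>lborel)
        = (\<integral>x. ?f x *\<^sub>R u (x + h) \<partial>lborel) - (\<integral>x. ?f x *\<^sub>R u x \<partial>lborel)"
      unfolding scaleR_diff_right
      by (intro Bochner_Integration.integral_diff loc_int_bump loc_int_shift u n)
    also have "(\<integral>x. ?f x *\<^sub>R u (x + h) \<partial>lborel) = (\<integral>x. ?f (x - h) *\<^sub>R u x \<partial>lborel)"
      using lborel_iso_integral(1)[OF lborel_iso_add[of h], where h="\<lambda>x. ?f (x - h) *\<^sub>R u x"] by simp
    also have "(\<integral>x. ?f (x - h) *\<^sub>R u x \<partial>lborel) - (\<integral>x. ?f x *\<^sub>R u x \<partial>lborel) = (\<integral>x. (?f (x - h) - ?f x) *\<^sub>R u x \<partial>lborel)"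
      unfolding scaleR_diff_left shift
      by (intro Bochner_Integration.integral_diff[symmetric] loc_int_bump u n)
    also have "\<dots> = (\<integral>x. - (\<integral>t. (indicator {0..1::real} t * D (x - t *\<^sub>R h)) *\<^sub>R u x \<partial>lborel) \<partial>lborel)"
    proof (intro Bochner_Integration.integral_cong refl)
      fix x
      have "?f (x - h) - ?f x = (\<integral>t. indicator {0..1} t *\<^sub>R ((-h)$1 * d 1 (x + t *\<^sub>R (-h)) + (-h)$2 * d 2 (x + t *\<^sub>R (-h))) \<partial>lborel)"
        using increment_integral[OF d, of "-h" x] by simp
      also have "\<dots> = (\<integral>t. - (indicator {0..1} t * D (x - t *\<^sub>R h)) \<partial>lborel)"
        by (intro Bochner_Integration.integral_cong) (auto simp: D_def algebra_simps)
      finally have *: "?f (x - h) - ?f x = - (\<integral>t. indicator {0..1} t * D (x - t *\<^sub>R h) \<partial>lborel)" by simp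
      have c: "continuous_on UNIV (d i)" for i using d by (simp add: has_partials_def)
      have "continuous_on {0..1} (\<lambda>t. D (x - t *\<^sub>R h))"
        unfolding D_def by (intro continuous_intros continuous_on_compose2[OF c]) auto
      then have "integrable lborel (\<lambda>t. indicator {0..1} t * D (x - t *\<^sub>R h))"
        using borel_integrable_atLeastAtMost'[of 0 1 "\<lambda>t. D (x - t *\<^sub>R h)"] by (simp add: set_integrable_def)
      then have "(\<integral>t. (indicator {0..1::real} t * D (x - t *\<^sub>R h)) *\<^sub>R u x \<partial>lborel) = (\<integral>t. indicator {0..1} t * D (x - t *\<^sub>R h) \<partial>lborel) *\<^sub>R u x"
        by (intro integral_scaleR_left) simp
      then show "(?f (x - h) - ?f x) *\<^sub>R u x = - (\<integral>t. (indicator {0..1::real} t * D (x - t *\<^sub>R h)) *\<^sub>R u x \<partial>lborel)"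
        unfolding * by simp
    qed
    also have "\<dots> = - (\<integral>t. \<integral>x. (indicator {0..1::real} t * D (x - t *\<^sub>R h)) *\<^sub>R u x \<partial>lborel \<partial>lborel)"
      using lborel_pair.Fubini_integral[OF F1] by simp
    also have "\<dots> = - (\<integral>t. - (\<integral>x. (indicator {0..1::real} t * ?f x) *\<^sub>R G (x + t *\<^sub>R h) \<partial>lborel) \<partial>lborel)"
      by (simp add: inner flip: scaleR_scaleR)
    also have "\<dots> = (\<integral>t. \<integral>x. (indicator {0..1::real} t * ?f x) *\<^sub>R G (x + t *\<^sub>R h) \<partial>lborel \<partial>lborel)"
      by simp
    also have "\<dots> = (\<integral>x. \<integral>t. (indicator {0..1::real} t * ?f x) *\<^sub>R G (x + t *\<^sub>R h) \<partial>lborel \<partial>lborel)"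
    proof (rule lborel_pair.Fubini_integral[symmetric])
      have "\<bar>?f x\<bar> \<le> indicator (box a b) x" for x
        using bump_bounds[of n a b x] bump_outside[OF n, of x a b] by (cases "x \<in> box a b") auto
      from segment_pair_integrable[OF G _ this]
      show "integrable (lborel \<Otimes>\<^sub>M lborel) (\<lambda>(t, x). (indicator {0..1::real} t * ?f x) *\<^sub>R G (x + t *\<^sub>R h))"
        by simp
    qed
    also have "\<dots> = (\<integral>x. ?f x *\<^sub>R A x \<partial>lborel)"
      unfolding A_def by (subst integral_scaleR_right[symmetric]) (simp add: mult.commute)
    finally have "(\<integral>x. ?f x *\<^sub>R (u (x + h) - u x) \<partial>lborel) = (\<integral>x. ?f x *\<^sub>R A x \<partial>lborel)" .
    moreover have "(\<integral>x. ?f x *\<^sub>R (u (x + h) - u x - A x) \<partial>lborel)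
       = (\<integral>x. ?f x *\<^sub>R (u (x + h) - u x) \<partial>lborel) - (\<integral>x. ?f x *\<^sub>R A x \<partial>lborel)"
      unfolding scaleR_diff_right[of _ _ "A _"]
      by (intro Bochner_Integration.integral_diff loc_int_bump loc_int_diff loc_int_shift u A n)
    ultimately show "(\<integral>x. ?f x *\<^sub>R (u (x + h) - u x - A x) \<partial>lborel) = 0" by simp
  qed
  then show ?thesis by (simp add: A_def G_def)
qed

lemma norm_integral_unit_interval_le:
  fixes q :: "real \<Rightarrow> 'b::euclidean_space"
  assumes [measurable]: "q \<in> borel_measurable borel"
  shows "ennreal ((norm (\<integral>t. indicator {0..1} t *\<^sub>R q t \<partial>lborel))\<^sup>2)
     \<le> (\<integral>\<^sup>+t. indicator {0..1} t * ennreal ((norm (q t))\<^sup>2) \<partial>lborel)" (is "_ \<le> ?R")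
proof (cases "?R = \<infinity>")
  case False
  define C where "C = enn2real ?R"
  have C: "?R = ennreal C" "C \<ge> 0" using False by (auto simp: C_def top.not_eq_extremum)
  let ?g = "\<lambda>t. norm (indicator {0..1::real} t *\<^sub>R q t)"
  have "(\<integral>\<^sup>+t. ennreal ((norm (?g t))\<^sup>2) \<partial>lborel) = ?R"
    by (intro nn_integral_cong) (auto simp: indicator_def)
  then have g: "L2 lborel ?g" "nsq lborel ?g \<le> C"
    using C L2_nn_integralI[of ?g lborel C] by auto
  let ?i = "indicator {0..1} :: real \<Rightarrow> real"
  have sq: "(?i t)\<^sup>2 = ?i t" for t by (simp add: indicator_def)
  have i: "L2 lborel ?i" "nsq lborel ?i = 1" by (auto simp: L2_def nsq_def sq)
  have "norm (\<integral>t. indicator {0..1} t *\<^sub>R q t \<partial>lborel) \<le> (\<integral>t. ?g t \<partial>lborel)"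
    by (rule integral_norm_bound)
  also have "\<dots> = (\<integral>t. ?i t \<bullet> ?g t \<partial>lborel)"
    by (intro Bochner_Integration.integral_cong) (auto simp: indicator_def)
  also have "\<dots> \<le> sqrt 1 * sqrt C"
    using L2_Cauchy_Schwarz[OF i(1) g(1)] g(2) i(2) by (simp) (smt (verit) real_sqrt_le_iff)
  finally have "(norm (\<integral>t. indicator {0..1} t *\<^sub>R q t \<partial>lborel))\<^sup>2 \<le> (sqrt C)\<^sup>2"
    by (intro power_mono) auto
  then show ?thesis using C by (simp add: ennreal_leI)
qed simp

text \<open>Averaging the directional derivative along a segment does not increase its L2 norm:
  Cauchy-Schwarz on the segment, then Tonelli and translation invariance.\<close>

lemma translate_sq_le:
  fixes u g1 g2 :: "real^2 \<Rightarrow> complex"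
  assumes u: "loc_int u" and g1: "loc_int g1" and g2: "loc_int g2"
    and w: "weak_partial u 1 g1" "weak_partial u 2 g2"
  shows "(\<integral>\<^sup>+x. ennreal ((norm (u (x + h) - u x))\<^sup>2) \<partial>lborel)
      \<le> (\<integral>\<^sup>+x. ennreal ((norm (h$1 *\<^sub>R g1 x + h$2 *\<^sub>R g2 x))\<^sup>2) \<partial>lborel)"
proof -
  define G where "G x = h$1 *\<^sub>R g1 x + h$2 *\<^sub>R g2 x" for x
  have [measurable]: "u \<in> borel_measurable borel" "g1 \<in> borel_measurable borel" "g2 \<in> borel_measurable borel"
    using u g1 g2 by (auto simp: loc_int_def)
  have [measurable]: "G \<in> borel_measurable borel" unfolding G_def by measurable
  have "(\<integral>\<^sup>+x. ennreal ((norm (u (x + h) - u x))\<^sup>2) \<partial>lborel)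
     \<le> (\<integral>\<^sup>+x. \<integral>\<^sup>+t. indicator {0..1::real} t * ennreal ((norm (G (x + t *\<^sub>R h)))\<^sup>2) \<partial>lborel \<partial>lborel)"
  proof (rule nn_integral_mono_AE, use weak_gradient_increment[OF u g1 g2 w, of h] in eventually_elim)
    case (elim x)
    show ?case unfolding elim using norm_integral_unit_interval_le[of "\<lambda>t. G (x + t *\<^sub>R h)"]
      by (simp add: G_def)
  qed
  also have "\<dots> = (\<integral>\<^sup>+t. \<integral>\<^sup>+x. indicator {0..1::real} t * ennreal ((norm (G (x + t *\<^sub>R h)))\<^sup>2) \<partial>lborel \<partial>lborel)"
    by (rule lborel_pair.Fubini') measurable
  also have "\<dots> = (\<integral>\<^sup>+t. indicator {0..1::real} t * (\<integral>\<^sup>+x. ennreal ((norm (G x))\<^sup>2) \<partial>lborel) \<partial>lborel)"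
    by (simp add: nn_integral_cmult lborel_iso_nn_integral[OF lborel_iso_add, where h="\<lambda>x. ennreal ((norm (G x))\<^sup>2)"])
  also have "\<dots> = (\<integral>\<^sup>+x. ennreal ((norm (G x))\<^sup>2) \<partial>lborel)"
    by (subst nn_integral_multc) auto
  finally show ?thesis by (simp add: G_def)
qed

subsection \<open>Isotropic difference energies\<close>

text \<open>Second moment of the disc in one coordinate. By symmetry the other coordinate gives the
  same value and the mixed moment vanishes, so this is the factor between the disc integral of
  \<open>(h . z)^2\<close> and \<open>|z|^2\<close>.\<close>

definition mom :: "real \<Rightarrow> real" where
  "mom \<epsilon> = (\<integral>h. indicator (ball 0 \<epsilon>) (h::real^2) * (h$1)\<^sup>2 \<partial>lborel)"

lemma ball_measurable [measurable]: "ball (c::real^2) r \<in> sets borel"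
  by simp

lemma vec_nth_measurable [measurable (raw)]:
  fixes f :: "'a \<Rightarrow> real^2"
  assumes "f \<in> borel_measurable M" shows "(\<lambda>x. f x $ i) \<in> borel_measurable M"
  by (rule measurable_compose[OF assms borel_measurable_continuous_onI]) (intro continuous_intros)

lemma integrable_ball_mult:
  fixes p :: "real^2 \<Rightarrow> real"
  assumes "p \<in> borel_measurable borel" "\<And>h. h \<in> ball 0 \<epsilon> \<Longrightarrow> \<bar>p h\<bar> \<le> C"
  shows "integrable lborel (\<lambda>h. indicator (ball 0 \<epsilon>) h * p h)"
proof (rule Bochner_Integration.integrable_bound)
  show "integrable lborel (\<lambda>h::real^2. C * indicator (ball 0 \<epsilon>) h)"
    using emeasure_lborel_ball_finite by (intro integrable_mult_right integrable_real_indicator) auto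
  show "AE x in lborel. norm (indicator (ball 0 \<epsilon>) x * p x) \<le> norm (C * indicator (ball 0 \<epsilon>) x)"
    using assms(2) by (intro AE_I2) (fastforce simp: indicator_def)
  show "(\<lambda>h. indicator (ball 0 \<epsilon>) h * p h) \<in> borel_measurable lborel"
    using assms(1) by (intro borel_measurable_times borel_measurable_indicator) auto
qed

lemma ball_monomial_integrable: "integrable lborel (\<lambda>h::real^2. indicator (ball 0 \<epsilon>) h * (h$i * h$j))"
proof (rule integrable_ball_mult[where C="\<epsilon>\<^sup>2"])
  fix h :: "real^2" assume "h \<in> ball 0 \<epsilon>"
  then have "norm h \<le> \<epsilon>" by simp
  then have "\<bar>h$i\<bar> \<le> \<epsilon>" "\<bar>h$j\<bar> \<le> \<epsilon>" using component_le_norm_cart[of h] by (meson order_trans)+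
  then show "\<bar>h$i * h$j\<bar> \<le> \<epsilon>\<^sup>2" unfolding abs_mult power2_eq_square by (intro mult_mono) auto
qed measurable

text \<open>Swapping the coordinates equates the two diagonal moments; reflecting one coordinate
  changes the sign of the mixed moment.\<close>

lemma ball_moment: "(\<integral>h. indicator (ball 0 \<epsilon>) (h::real^2) * (h$i * h$j) \<partial>lborel) = (if i = j then mom \<epsilon> else 0)"
proof -
  let ?F = "\<lambda>i j (h::real^2). indicator (ball 0 \<epsilon>) h * (h$i * h$j)"
  let ?s = "\<lambda>h::real^2. (\<chi> i. if i = 1 then h$2 else h$1) :: real^2"
  let ?r = "\<lambda>h::real^2. (\<chi> i. if i = 1 then - h$1 else h$2) :: real^2"
  have ns: "norm (?s h) = norm h" and nr: "norm (?r h) = norm h" for h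
    by (rule power2_eq_imp_eq; simp add: norm_sq_2)+
  have s: "lborel_iso ?s" and r: "lborel_iso ?r"
    by (rule lborel_iso_orthogonal; simp add: orthogonal_transformation ns nr linear_iff vec_eq_iff)+
  have "(\<integral>h. ?F 2 2 h \<partial>lborel) = (\<integral>h. ?F 2 2 (?s h) \<partial>lborel)"
    by (rule lborel_iso_integral(1)[OF s, symmetric]) measurable
  also have "\<dots> = mom \<epsilon>" unfolding mom_def
    by (intro Bochner_Integration.integral_cong) (auto simp: indicator_def ns power2_eq_square)
  finally have 22: "(\<integral>h. ?F 2 2 h \<partial>lborel) = mom \<epsilon>" .
  have "(\<integral>h. ?F 1 2 h \<partial>lborel) = (\<integral>h. ?F 1 2 (?r h) \<partial>lborel)"
    by (rule lborel_iso_integral(1)[OF r, symmetric]) measurable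
  also have "\<dots> = (\<integral>h. - ?F 1 2 h \<partial>lborel)"
    by (intro Bochner_Integration.integral_cong) (auto simp: indicator_def nr)
  finally have 12: "(\<integral>h. ?F 1 2 h \<partial>lborel) = 0" by simp
  have 11: "(\<integral>h. ?F 1 1 h \<partial>lborel) = mom \<epsilon>" by (simp add: mom_def power2_eq_square)
  show ?thesis using exhaust_2[of i] exhaust_2[of j] 11 12 22 by (auto simp: mult.commute)
qed

lemma mom_pos: assumes "\<epsilon> > 0" shows "mom \<epsilon> > 0"
proof -
  \<comment> \<open>On this smaller disc the first coordinate is at least
    \<open>\<epsilon>/4\<close>.\<close>
  let ?B = "ball ((\<epsilon>/2) *\<^sub>R axis 1 1) (\<epsilon>/4) :: (real^2) set"
  have le: "indicator ?B x * (\<epsilon>/4)\<^sup>2 \<le> indicator (ball 0 \<epsilon>) x * (x$1)\<^sup>2" for x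
  proof (cases "x \<in> ?B")
    case True
    then have n: "norm (x - (\<epsilon>/2) *\<^sub>R axis 1 1) < \<epsilon>/4" by (simp add: dist_norm norm_minus_commute)
    have "norm x \<le> norm (x - (\<epsilon>/2) *\<^sub>R axis 1 1) + norm ((\<epsilon>/2) *\<^sub>R axis 1 1 :: real^2)"
      using norm_triangle_ineq[of "x - (\<epsilon>/2) *\<^sub>R axis 1 1" "(\<epsilon>/2) *\<^sub>R axis 1 1"] by simp
    then have "x \<in> ball 0 \<epsilon>" using n assms by simp
    moreover have "\<bar>x$1 - \<epsilon>/2\<bar> < \<epsilon>/4"
      using n component_le_norm_cart[of "x - (\<epsilon>/2) *\<^sub>R axis 1 1" 1] by (simp add: axis_def)
    then have "\<epsilon>/4 \<le> x$1" by linarith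
    ultimately show ?thesis using True assms by (simp add: power_mono)
  qed simp
  have fin: "emeasure lborel ?B < \<infinity>" by (rule emeasure_lborel_ball_finite)
  have "0 < measure lborel ?B * (\<epsilon>/4)\<^sup>2" using assms content_ball_pos by (intro mult_pos_pos) auto
  also have "\<dots> = (\<integral>x. indicator ?B x * (\<epsilon>/4)\<^sup>2 \<partial>lborel)" by simp
  also have "\<dots> \<le> mom \<epsilon>"
    unfolding mom_def using ball_monomial_integrable[of \<epsilon> 1 1] le fin
    by (intro integral_mono integrable_mult_left integrable_real_indicator) (auto simp: power2_eq_square)
  finally show ?thesis .
qed

text \<open>Left unnormalised and with values in \<open>ennreal\<close>, so that the pointwise
  comparisons of differences apply before any finiteness is known.\<close>

definition J :: "real \<Rightarrow> (real^2 \<Rightarrow> 'b::euclidean_space) \<Rightarrow> ennreal" where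
  "J \<epsilon> v = (\<integral>\<^sup>+x. \<integral>\<^sup>+h. indicator (ball 0 \<epsilon>) h * ennreal ((norm (v (x + h) - v x))\<^sup>2) \<partial>lborel \<partial>lborel)"

lemma J_commute:
  assumes [measurable]: "v \<in> borel_measurable borel"
  shows "J \<epsilon> v = (\<integral>\<^sup>+h. indicator (ball 0 \<epsilon>) h * (\<integral>\<^sup>+x. ennreal ((norm (v (x + h) - v x))\<^sup>2) \<partial>lborel) \<partial>lborel)"
proof -
  have "J \<epsilon> v = (\<integral>\<^sup>+h. \<integral>\<^sup>+x. indicator (ball 0 \<epsilon>) h * ennreal ((norm (v (x + h) - v x))\<^sup>2) \<partial>lborel \<partial>lborel)"
    unfolding J_def by (rule lborel_pair.Fubini') measurable
  then show ?thesis by (simp add: nn_integral_cmult)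
qed

lemma nn_ball_quadratic:
  fixes z1 z2 :: "'b::euclidean_space"
  shows "(\<integral>\<^sup>+h. indicator (ball 0 \<epsilon>) (h::real^2) * ennreal ((norm (h$1 *\<^sub>R z1 + h$2 *\<^sub>R z2))\<^sup>2) \<partial>lborel)
     = ennreal (mom \<epsilon> * ((norm z1)\<^sup>2 + (norm z2)\<^sup>2))"
proof -
  let ?F = "\<lambda>i j (h::real^2). indicator (ball 0 \<epsilon>) h * (h$i * h$j) :: real"
  let ?q = "\<lambda>h::real^2. ?F 1 1 h * (norm z1)\<^sup>2 + ?F 1 2 h * (2 * (z1 \<bullet> z2)) + ?F 2 2 h * (norm z2)\<^sup>2"
  have q: "?q h = indicator (ball 0 \<epsilon>) h * (norm (h$1 *\<^sub>R z1 + h$2 *\<^sub>R z2))\<^sup>2" for h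
    by (simp add: power2_norm_eq_inner inner_simps inner_commute algebra_simps)
  have int: "integrable lborel ?q"
    by (intro Bochner_Integration.integrable_add integrable_mult_left ball_monomial_integrable)
  have "(\<integral>\<^sup>+h. indicator (ball 0 \<epsilon>) (h::real^2) * ennreal ((norm (h$1 *\<^sub>R z1 + h$2 *\<^sub>R z2))\<^sup>2) \<partial>lborel)
    = (\<integral>\<^sup>+h. ennreal (?q h) \<partial>lborel)"
    unfolding q by (intro nn_integral_cong) (auto simp: indicator_def)
  also have "\<dots> = ennreal (\<integral>h. ?q h \<partial>lborel)"
    using int by (intro nn_integral_eq_integral) (auto simp: q)
  also have "(\<integral>h. ?q h \<partial>lborel) = mom \<epsilon> * (norm z1)\<^sup>2 + mom \<epsilon> * (norm z2)\<^sup>2"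
    by (simp add: ball_monomial_integrable ball_moment)
  finally show ?thesis by (simp add: distrib_left)
qed

text \<open>Valid at every scale, not only in the limit: each translate is bounded by a directional
  derivative, and integration over the disc makes the directions isotropic.\<close>

theorem J_le_weak_gradient:
  fixes u g1 g2 :: "real^2 \<Rightarrow> complex"
  assumes u: "loc_int u" and g1: "loc_int g1" and g2: "loc_int g2"
    and w: "weak_partial u 1 g1" "weak_partial u 2 g2"
  shows "J \<epsilon> u \<le> (\<integral>\<^sup>+x. ennreal (mom \<epsilon> * ((norm (g1 x))\<^sup>2 + (norm (g2 x))\<^sup>2)) \<partial>lborel)"
proof -
  have [measurable]: "u \<in> borel_measurable borel" "g1 \<in> borel_measurable borel" "g2 \<in> borel_measurable borel"
    using u g1 g2 by (auto simp: loc_int_def)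
  have "J \<epsilon> u \<le> (\<integral>\<^sup>+h. indicator (ball 0 \<epsilon>) (h::real^2) * (\<integral>\<^sup>+x. ennreal ((norm (h$1 *\<^sub>R g1 x + h$2 *\<^sub>R g2 x))\<^sup>2) \<partial>lborel) \<partial>lborel)"
    unfolding J_commute[OF \<open>u \<in> borel_measurable borel\<close>]
    by (intro nn_integral_mono mult_left_mono translate_sq_le[OF u g1 g2 w]) auto
  also have "\<dots> = (\<integral>\<^sup>+h. \<integral>\<^sup>+x. indicator (ball 0 \<epsilon>) (h::real^2) * ennreal ((norm (h$1 *\<^sub>R g1 x + h$2 *\<^sub>R g2 x))\<^sup>2) \<partial>lborel \<partial>lborel)"
    by (simp add: nn_integral_cmult)
  also have "\<dots> = (\<integral>\<^sup>+x. \<integral>\<^sup>+h. indicator (ball 0 \<epsilon>) (h::real^2) * ennreal ((norm (h$1 *\<^sub>R g1 x + h$2 *\<^sub>R g2 x))\<^sup>2) \<partial>lborel \<partial>lborel)"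
    by (rule lborel_pair.Fubini') measurable
  also have "\<dots> = (\<integral>\<^sup>+x. ennreal (mom \<epsilon> * ((norm (g1 x))\<^sup>2 + (norm (g2 x))\<^sup>2)) \<partial>lborel)"
    by (simp add: nn_ball_quadratic)
  finally show ?thesis .
qed

subsection \<open>The Dirichlet energy is well defined\<close>

text \<open>All translates of a box along the axis carry the same mass, and this mass tends to 0 as
  they move off to infinity.\<close>

lemma L2_translation_invariant_zero:
  fixes u :: "real^2 \<Rightarrow> complex"
  assumes u: "L2 lborel u" and inv: "\<And>t. AE x in lborel. u (x + t *\<^sub>R axis i 1) = u x"
  shows "AE x in lborel. u x = 0"
proof -
  have [measurable]: "u \<in> borel_measurable borel" using u by (simp add: L2_def)
  let ?v = "\<lambda>x. (norm (u x))\<^sup>2"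
  have vint: "integrable lborel ?v" using u by (simp add: L2_def)
  have "AE x in lborel. ?v x = 0"
  proof (rule box_integral_zero_imp_AE_zero)
    show "loc_int ?v" using integrable_mult_indicator[OF _ vint] by (auto simp: loc_int_def)
    fix a b :: "real^2"
    let ?c = "\<lambda>n::nat. real n *\<^sub>R axis i 1 :: real^2"
    have eq: "(\<integral>x. indicator (box a b) (x - ?c n) *\<^sub>R ?v x \<partial>lborel) = (\<integral>x. indicator (box a b) x *\<^sub>R ?v x \<partial>lborel)" for n
    proof -
      have "(\<integral>x. indicator (box a b) (x - ?c n) *\<^sub>R ?v x \<partial>lborel) = (\<integral>x. indicator (box a b) (x + ?c n - ?c n) *\<^sub>R ?v (x + ?c n) \<partial>lborel)"
        by (rule lborel_iso_integral(1)[OF lborel_iso_add, symmetric, where h="\<lambda>x. indicator (box a b) (x - ?c n) *\<^sub>R ?v x"]) measurable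
      also have "\<dots> = (\<integral>x. indicator (box a b) x *\<^sub>R ?v x \<partial>lborel)"
        by (rule integral_cong_AE; (measurable)?) (use inv[of "real n"] in eventually_elim, simp)
      finally show ?thesis .
    qed
    have "(\<lambda>n. \<integral>x. indicator (box a b) (x - ?c n) *\<^sub>R ?v x \<partial>lborel) \<longlonglongrightarrow> (\<integral>x. 0 \<partial>(lborel::(real^2) measure))"
    proof (rule integral_dominated_convergence[OF _ _ vint])
      show "AE x in lborel. (\<lambda>n. indicator (box a b) (x - ?c n) *\<^sub>R ?v x) \<longlonglongrightarrow> 0"
      proof (intro AE_I2 tendsto_eventually)
        fix x
        obtain N :: nat where N: "x$i - a$i < N" using reals_Archimedean2 by blast
        show "\<forall>\<^sub>F n in sequentially. indicator (box a b) (x - ?c n) *\<^sub>R ?v x = 0"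
          using eventually_ge_at_top[of N]
        proof eventually_elim
          case (elim n)
          then have "(x - ?c n)$i < a$i" using N by simp
          then have "x - ?c n \<notin> box a b" unfolding mem_box_cart using less_asym by blast
          then show ?case by simp
        qed
      qed
      show "AE x in lborel. norm (indicator (box a b) (x - ?c n) *\<^sub>R ?v x) \<le> ?v x" for n
        by (auto simp: indicator_def)
    qed measurable
    then show "(\<integral>x. indicator (box a b) x *\<^sub>R ?v x \<partial>lborel) = 0"
      unfolding eq by (simp add: LIMSEQ_const_iff)
  qed
  then show ?thesis by simp
qed

lemma smooth_gen_test_fun: "f \<in> smooth_gen \<Longrightarrow> bounded {x. f x \<noteq> 0} \<Longrightarrow> test_fun f"
  by (simp add: test_fun_def smooth_gen_smooth compact_eq_bounded_closed bounded_closure)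

lemma weak_partial_integral_eq:
  assumes "weak_partial u i g" "weak_partial u i h" "test_fun \<phi>"
  shows "(\<integral>x. \<phi> x *\<^sub>R g x \<partial>lborel) = (\<integral>x. \<phi> x *\<^sub>R h x \<partial>lborel)"
proof -
  obtain d where "has_partials \<phi> d" using test_fun_partials[OF assms(3)] by metis
  from weak_partialD[OF assms(1,3) this] weak_partialD[OF assms(2,3) this] show ?thesis by simp
qed

text \<open>\<open>h\<close> is only measurable, and where its product with a test function is not
  integrable the Bochner integral is 0 by convention. If \<open>h\<close> is not locally integrable,
  this convention forces every bump pairing of \<open>g\<close> to vanish, which is the case
  excluded by \<open>nz\<close>.\<close>

lemma weak_partial_AE_unique:
  fixes u :: "real^2 \<Rightarrow> complex"
  assumes w: "weak_partial u i g" "weak_partial u i h"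
    and g: "loc_int g" and h: "h \<in> borel_measurable borel"
    and nz: "\<not> (AE x in lborel. g x = 0)"
  shows "AE x in lborel. h x = g x"
proof (cases "loc_int h")
  case True
  have "AE x in lborel. h x - g x = 0"
  proof (rule fundamental_lemma[OF loc_int_diff[OF True g]])
    fix n :: real and a b :: "real^2" assume n: "n > 0"
    have "(\<integral>x. bump n a b x *\<^sub>R (h x - g x) \<partial>lborel) = (\<integral>x. bump n a b x *\<^sub>R h x \<partial>lborel) - (\<integral>x. bump n a b x *\<^sub>R g x \<partial>lborel)"
      unfolding scaleR_diff_right by (intro Bochner_Integration.integral_diff loc_int_bump True g n)
    then show "(\<integral>x. bump n a b x *\<^sub>R (h x - g x) \<partial>lborel) = 0"
      using weak_partial_integral_eq[OF w bump_test_fun[OF n, of a b]] by simp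
  qed
  then show ?thesis by simp
next
  case False
  note h [measurable]
  from False h obtain a b where ab: "\<not> integrable lborel (\<lambda>x. indicator (box a b) x *\<^sub>R h x)"
    by (auto simp: loc_int_def)
  text \<open>Here the Bochner integral of \<open>f0 *\<^sub>R h\<close> has the default value 0, and so has the integral
    of \<open>(\<psi> + f0) *\<^sub>R h\<close> whenever \<open>\<psi> *\<^sub>R h\<close> is integrable.\<close>
  define f0 where "f0 = bump 1 (a - (\<chi> i. 1)) (b + (\<chi> i. 1))"
  have f0: "test_fun f0" "f0 \<in> smooth_gen" unfolding f0_def by (simp_all add: bump_test_fun bump_smooth_gen)
  have [measurable]: "f0 \<in> borel_measurable borel" unfolding f0_def by simp
  have "\<exists>c>0. \<forall>x\<in>cbox a b. c \<le> f0 x"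
  proof (cases "cbox a b = {}")
    case False
    have "continuous_on (cbox a b) f0"
      using smooth_gen_partial[OF f0(2)] continuous_on_subset by blast
    from continuous_attains_inf[OF compact_cbox False this]
    obtain x where x: "x \<in> cbox a b" "\<And>y. y \<in> cbox a b \<Longrightarrow> f0 x \<le> f0 y" by blast
    have "x \<in> box (a - (\<chi> i. 1)) (b + (\<chi> i. 1))" using x(1) by (auto simp: in_box_2 mem_box_cart forall_2)
    then have "f0 x > 0" unfolding f0_def by (intro bump_inside) auto
    with x(2) show ?thesis by blast
  qed (auto intro: exI[of _ 1])
  then obtain c where c: "c > 0" "\<And>x. x \<in> cbox a b \<Longrightarrow> c \<le> f0 x" by blast
  have nf0: "\<not> integrable lborel (\<lambda>x. f0 x *\<^sub>R h x)"
  proof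
    assume i: "integrable lborel (\<lambda>x. f0 x *\<^sub>R h x)"
    have "integrable lborel (\<lambda>x. indicator (box a b) x *\<^sub>R h x)"
    proof (rule Bochner_Integration.integrable_bound)
      show "integrable lborel (\<lambda>x. (1/c) *\<^sub>R (f0 x *\<^sub>R h x))" using i by (rule integrable_scaleR_right)
      show "AE x in lborel. norm (indicator (box a b) x *\<^sub>R h x) \<le> norm ((1/c) *\<^sub>R (f0 x *\<^sub>R h x))"
      proof (intro AE_I2)
        fix x
        have "indicator (box a b) x \<le> (1/c) * \<bar>f0 x\<bar>"
          using c(1) c(2)[of x] box_subset_cbox[of a b] by (auto simp: indicator_def field_simps)
        then have "indicator (box a b) x * norm (h x) \<le> (1/c) * \<bar>f0 x\<bar> * norm (h x)"
          by (rule mult_right_mono) simp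
        then show "norm (indicator (box a b) x *\<^sub>R h x) \<le> norm ((1/c) *\<^sub>R (f0 x *\<^sub>R h x))"
          using c(1) by (simp add: mult_ac)
      qed
    qed measurable
    with ab show False by simp
  qed
  have f0g: "(\<integral>x. f0 x *\<^sub>R g x \<partial>lborel) = 0"
    using weak_partial_integral_eq[OF w f0(1)] not_integrable_integral_eq[OF nf0] by simp
  have "AE x in lborel. g x = 0"
  proof (rule fundamental_lemma[OF g])
    fix n :: real and a' b' :: "real^2" assume n: "n > 0"
    let ?p = "bump n a' b'"
    show "(\<integral>x. ?p x *\<^sub>R g x \<partial>lborel) = 0"
    proof (cases "integrable lborel (\<lambda>x. ?p x *\<^sub>R h x)")
      case False
      then show ?thesis
        using weak_partial_integral_eq[OF w bump_test_fun[OF n]] not_integrable_integral_eq[OF False] by simp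
    next
      case True
      let ?s = "\<lambda>x. ?p x + f0 x"
      have "{x. ?s x \<noteq> 0} \<subseteq> box a' b' \<union> box (a - (\<chi> i. 1)) (b + (\<chi> i. 1))"
        using bump_outside[OF n, of _ a' b'] bump_outside[of 1 _ "a - (\<chi> i. 1)" "b + (\<chi> i. 1)"] unfolding f0_def by force
      then have "bounded {x. ?s x \<noteq> 0}" by (rule bounded_subset[rotated]) (simp add: bounded_Un bounded_box)
      then have ts: "test_fun ?s"
        by (intro smooth_gen_test_fun smooth_gen.add bump_smooth_gen f0(2))
      have ns: "\<not> integrable lborel (\<lambda>x. ?s x *\<^sub>R h x)"
      proof
        assume "integrable lborel (\<lambda>x. ?s x *\<^sub>R h x)"
        from Bochner_Integration.integrable_diff[OF this True] nf0 show False by (simp add: scaleR_add_left)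
      qed
      have "(\<integral>x. ?s x *\<^sub>R g x \<partial>lborel) = 0"
        using weak_partial_integral_eq[OF w ts] not_integrable_integral_eq[OF ns] by simp
      moreover have "(\<integral>x. ?s x *\<^sub>R g x \<partial>lborel) = (\<integral>x. ?p x *\<^sub>R g x \<partial>lborel) + (\<integral>x. f0 x *\<^sub>R g x \<partial>lborel)"
        unfolding scaleR_add_left f0_def by (intro Bochner_Integration.integral_add loc_int_bump g n) simp_all
      ultimately show ?thesis using f0g by simp
    qed
  qed
  with nz show ?thesis by blast
qed

text \<open>Every measurable competitor in the choice agrees almost everywhere with the
  square-integrable gradient once neither component of the latter vanishes. A vanishing component
  would make \<open>u\<close> invariant under all translations along that axis, hence zero.\<close>

theorem dirichlet_eq:
  fixes u g1 g2 :: "real^2 \<Rightarrow> complex"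
  assumes u: "L2 lborel u" "nsq lborel u > 0" and g: "L2 lborel g1" "L2 lborel g2"
    and w: "weak_partial u 1 g1" "weak_partial u 2 g2"
  shows "dirichlet u = nsq lborel g1 + nsq lborel g2"
proof -
  note l = L2_loc_int[OF u(1)] L2_loc_int[OF g(1)] L2_loc_int[OF g(2)]
  have [measurable]: "g1 \<in> borel_measurable borel" "g2 \<in> borel_measurable borel" "u \<in> borel_measurable borel"
    using u g by (auto simp: L2_def)
  have nu: "\<not> (AE x in lborel. u x = 0)"
  proof
    assume "AE x in lborel. u x = 0"
    then have "nsq lborel u = nsq lborel (\<lambda>x::real^2. 0::complex)" by (intro nsq_cong_AE[where g="\<lambda>x. 0"]) auto
    with u(2) show False by (simp add: nsq_def)
  qed
  have nz: "\<not> (AE x in lborel. gi x = 0)" if gi: "gi = (if i = 1 then g1 else g2)" for gi and i :: 2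
  proof
    assume z: "AE x in lborel. gi x = 0"
    have "AE x in lborel. u (x + t *\<^sub>R axis i 1) = u x" for t
    proof -
      let ?h = "t *\<^sub>R axis i 1 :: real^2"
      have "(\<integral>\<^sup>+x. ennreal ((norm (u (x + ?h) - u x))\<^sup>2) \<partial>lborel)
        \<le> (\<integral>\<^sup>+x. ennreal ((norm (?h$1 *\<^sub>R g1 x + ?h$2 *\<^sub>R g2 x))\<^sup>2) \<partial>lborel)"
        by (rule translate_sq_le[OF l w])
      also have "\<dots> = (\<integral>\<^sup>+x. 0 \<partial>(lborel::(real^2) measure))"
        by (rule nn_integral_cong_AE, use z in eventually_elim)
          (use gi exhaust_2[of i] in \<open>auto simp: axis_def split: if_splits\<close>)
      finally have "(\<integral>\<^sup>+x. ennreal ((norm (u (x + ?h) - u x))\<^sup>2) \<partial>lborel) = 0" by simp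
      then have "AE x in lborel. ennreal ((norm (u (x + ?h) - u x))\<^sup>2) = 0"
        by (subst (asm) nn_integral_0_iff_AE) auto
      then show ?thesis by eventually_elim simp
    qed
    from L2_translation_invariant_zero[OF u(1) this] nu show False by blast
  qed
  have "(SOME D. \<exists>h1 h2. h1 \<in> borel_measurable lborel \<and> h2 \<in> borel_measurable lborel \<and>
        weak_partial u 1 h1 \<and> weak_partial u 2 h2 \<and>
        D = (\<integral>x. (cmod (h1 x))\<^sup>2 + (cmod (h2 x))\<^sup>2 \<partial>lborel)) = nsq lborel g1 + nsq lborel g2"
  proof (rule some_equality)
    have "nsq lborel g1 + nsq lborel g2 = (\<integral>x. (cmod (g1 x))\<^sup>2 + (cmod (g2 x))\<^sup>2 \<partial>lborel)"
      unfolding nsq_def using g by (simp add: L2_def)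
    then show "\<exists>h1 h2. h1 \<in> borel_measurable lborel \<and> h2 \<in> borel_measurable lborel \<and>
        weak_partial u 1 h1 \<and> weak_partial u 2 h2 \<and>
        nsq lborel g1 + nsq lborel g2 = (\<integral>x. (cmod (h1 x))\<^sup>2 + (cmod (h2 x))\<^sup>2 \<partial>lborel)"
      using w by (intro exI[of _ g1] exI[of _ g2]) auto
    fix D assume "\<exists>h1 h2. h1 \<in> borel_measurable lborel \<and> h2 \<in> borel_measurable lborel \<and>
        weak_partial u 1 h1 \<and> weak_partial u 2 h2 \<and> D = (\<integral>x. (cmod (h1 x))\<^sup>2 + (cmod (h2 x))\<^sup>2 \<partial>lborel)"
    then obtain h1 h2 where h [measurable]: "h1 \<in> borel_measurable borel" "h2 \<in> borel_measurable borel"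
      and hw: "weak_partial u 1 h1" "weak_partial u 2 h2"
      and D: "D = (\<integral>x. (cmod (h1 x))\<^sup>2 + (cmod (h2 x))\<^sup>2 \<partial>lborel)" by auto
    have e1: "AE x in lborel. h1 x = g1 x"
      by (rule weak_partial_AE_unique[OF w(1) hw(1) l(2) h(1)]) (rule nz[of _ 1], simp)
    have e2: "AE x in lborel. h2 x = g2 x"
      by (rule weak_partial_AE_unique[OF w(2) hw(2) l(3) h(2)]) (rule nz[of _ 2], simp)
    have "D = (\<integral>x. (cmod (g1 x))\<^sup>2 + (cmod (g2 x))\<^sup>2 \<partial>lborel)"
      unfolding D by (rule integral_cong_AE; (measurable)?) (use e1 e2 in eventually_elim, simp)
    then show "D = nsq lborel g1 + nsq lborel g2"
      unfolding nsq_def using g by (simp add: L2_def)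
  qed
  then show ?thesis by (simp add: dirichlet_def)
qed

section \<open>Recovering a weak gradient from bounded difference energies\<close>

lemma test_fun_L2:
  fixes f :: "real^2 \<Rightarrow> real"
  assumes [measurable]: "f \<in> borel_measurable borel" and "\<And>x. norm x \<ge> R \<Longrightarrow> f x = 0" "\<And>x. \<bar>f x\<bar> \<le> B"
  shows "L2 lborel f"
proof -
  have "integrable lborel (\<lambda>x. indicator (ball 0 R) x * (f x)\<^sup>2)"
  proof (rule integrable_ball_mult[where C="B\<^sup>2"])
    fix h
    have "\<bar>f h\<bar>\<^sup>2 \<le> B\<^sup>2" using assms(3)[of h] by (intro power_mono) auto
    then show "\<bar>(f h)\<^sup>2\<bar> \<le> B\<^sup>2" by simp
  qed measurable
  moreover have "indicator (ball 0 R) x * (f x)\<^sup>2 = (norm (f x))\<^sup>2" for x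
    using assms(2)[of x] by (cases "norm x \<ge> R") auto
  ultimately show ?thesis by (simp add: L2_def)
qed

lemma L2_shift: "L2 lborel f \<Longrightarrow> L2 lborel (\<lambda>x::real^2. f (x + h))"
  using lborel_iso_integral(2)[OF lborel_iso_add[of h], of "\<lambda>x. (norm (f x))\<^sup>2"] by (auto simp: L2_def)

lemma nsq_shift: "f \<in> borel_measurable borel \<Longrightarrow> nsq lborel (\<lambda>x::real^2. f (x + h)) = nsq lborel f"
  using lborel_iso_integral(1)[OF lborel_iso_add[of h], of "\<lambda>x. (norm (f x))\<^sup>2"] by (auto simp: nsq_def)

text \<open>Slope of the least-squares linear fit on the disc to the increments
  \<open>v (x + h) - v x\<close> as a function of \<open>h\<close>.\<close>

definition disc_gradient :: "real \<Rightarrow> (real^2 \<Rightarrow> real) \<Rightarrow> real^2 \<Rightarrow> real^2" where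
  "disc_gradient \<epsilon> v x = (1 / mom \<epsilon>) *\<^sub>R (\<integral>h. (indicator (ball 0 \<epsilon>) h * (v (x + h) - v x)) *\<^sub>R h \<partial>lborel)"

lemma disc_gradient_measurable [measurable]:
  assumes [measurable]: "v \<in> borel_measurable borel"
  shows "disc_gradient \<epsilon> v \<in> borel_measurable borel"
  unfolding disc_gradient_def by measurable

text \<open>Bessel's inequality: up to the factor \<open>mom \<epsilon>\<close>, the coordinates are orthonormal on the disc.\<close>
lemma disc_gradient_bessel:
  assumes [measurable]: "v \<in> borel_measurable borel" and e: "\<epsilon> > 0"
  shows "ennreal (mom \<epsilon> * (norm (disc_gradient \<epsilon> v x))\<^sup>2)
     \<le> (\<integral>\<^sup>+h. indicator (ball 0 \<epsilon>) h * ennreal ((norm (v (x + h) - v x))\<^sup>2) \<partial>lborel)" (is "_ \<le> ?R")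
proof (cases "?R = \<infinity>")
  case False
  define C where "C = enn2real ?R"
  have C: "?R = ennreal C" "C \<ge> 0" using False by (auto simp: C_def top.not_eq_extremum)
  let ?i = "indicator (ball 0 \<epsilon>) :: real^2 \<Rightarrow> real"
  define f where "f h = ?i h * (v (x + h) - v x)" for h
  have [measurable]: "f \<in> borel_measurable borel" unfolding f_def by measurable
  have "(\<integral>\<^sup>+h. ennreal ((norm (f h))\<^sup>2) \<partial>lborel) = ?R"
    by (intro nn_integral_cong) (auto simp: indicator_def f_def)
  then have f: "L2 lborel f" "nsq lborel f \<le> C"
    using C L2_nn_integralI[of f lborel C] by auto
  define \<alpha> where "\<alpha> = disc_gradient \<epsilon> v x"
  define e where "e h = ?i h * (h$1 * \<alpha>$1 + h$2 * \<alpha>$2)" for h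
  have [measurable]: "e \<in> borel_measurable borel" unfolding e_def by measurable
  have "(\<integral>\<^sup>+h. ennreal ((norm (e h))\<^sup>2) \<partial>lborel) = ennreal (mom \<epsilon> * (norm \<alpha>)\<^sup>2)"
    unfolding norm_sq_2 using nn_ball_quadratic[of \<epsilon> "\<alpha>$1" "\<alpha>$2"]
    by (subst (asm) nn_integral_cong[where v="\<lambda>h. ennreal ((norm (e h))\<^sup>2)"]) (auto simp: indicator_def e_def)
  then have eL: "L2 lborel e" "nsq lborel e \<le> mom \<epsilon> * (norm \<alpha>)\<^sup>2"
    using L2_nn_integralI[of e lborel "mom \<epsilon> * (norm \<alpha>)\<^sup>2"] mom_pos[OF \<open>\<epsilon> > 0\<close>] by auto
  have iL: "L2 lborel ?i" by (rule test_fun_L2[where R=\<epsilon> and B=1]) (auto simp: indicator_def)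
  have fi: "integrable lborel f"
    using L2_inner_integrable[OF f(1) iL]
    by (rule Bochner_Integration.integrable_cong[THEN iffD1, rotated 2]) (auto simp: f_def indicator_def)
  have fh: "integrable lborel (\<lambda>h. f h *\<^sub>R h)"
  proof (rule Bochner_Integration.integrable_bound)
    show "integrable lborel (\<lambda>h. \<epsilon> * f h)" using fi by (rule integrable_mult_right)
    show "AE h in lborel. norm (f h *\<^sub>R h) \<le> norm (\<epsilon> * f h)"
      using \<open>\<epsilon> > 0\<close> by (intro AE_I2) (auto simp: f_def indicator_def abs_mult mult.commute intro!: mult_right_mono)
  qed measurable
  have "mom \<epsilon> * (norm \<alpha>)\<^sup>2 = \<alpha> \<bullet> (mom \<epsilon> *\<^sub>R \<alpha>)" by (simp add: power2_norm_eq_inner)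
  also have "mom \<epsilon> *\<^sub>R \<alpha> = (\<integral>h. f h *\<^sub>R h \<partial>lborel)"
    using mom_pos[OF \<open>\<epsilon> > 0\<close>] by (simp add: \<alpha>_def disc_gradient_def f_def)
  also have "\<alpha> \<bullet> \<dots> = (\<integral>h. \<alpha> \<bullet> (f h *\<^sub>R h) \<partial>lborel)"
    by (rule integral_inner_right[symmetric]) (rule fh)
  also have "\<dots> = (\<integral>h. f h \<bullet> e h \<partial>lborel)"
    by (intro Bochner_Integration.integral_cong)
      (auto simp: e_def f_def indicator_def inner_vec_def sum_2 algebra_simps)
  also have "\<dots> \<le> sqrt (nsq lborel f) * sqrt (nsq lborel e)"
    using L2_Cauchy_Schwarz[OF f(1) eL(1)] by simp
  also have "\<dots> \<le> sqrt C * sqrt (mom \<epsilon> * (norm \<alpha>)\<^sup>2)"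
    using f(2) eL(2) C(2) by (intro mult_mono) (auto simp: nsq_nonneg)
  finally have le: "mom \<epsilon> * (norm \<alpha>)\<^sup>2 \<le> sqrt C * sqrt (mom \<epsilon> * (norm \<alpha>)\<^sup>2)" .
  have "mom \<epsilon> * (norm \<alpha>)\<^sup>2 \<le> C"
  proof (cases "mom \<epsilon> * (norm \<alpha>)\<^sup>2 = 0")
    case False
    define s where "s = sqrt (mom \<epsilon> * (norm \<alpha>)\<^sup>2)"
    have nn: "0 \<le> mom \<epsilon> * (norm \<alpha>)\<^sup>2" using mom_pos[OF \<open>\<epsilon> > 0\<close>] by simp
    then have "mom \<epsilon> * (norm \<alpha>)\<^sup>2 > 0" using False by linarith
    then have s: "s > 0" "s * s = mom \<epsilon> * (norm \<alpha>)\<^sup>2" by (auto simp: s_def)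
    from le have "s * s \<le> sqrt C * s" unfolding s s_def[symmetric] .
    then have "s \<le> sqrt C" using s(1) by (rule mult_right_le_imp_le)
    then have "s * s \<le> sqrt C * sqrt C" using s C(2) by (intro mult_mono) auto
    then show ?thesis using s C by simp
  qed (use C in linarith)
  then show ?thesis using C by (simp add: \<alpha>_def ennreal_leI)
qed simp

lemma disc_gradient_L2:
  assumes v: "v \<in> borel_measurable borel" and e: "\<epsilon> > 0" and C: "J \<epsilon> v \<le> ennreal (mom \<epsilon> * C)" "C \<ge> 0"
  shows "L2 lborel (disc_gradient \<epsilon> v)" "nsq lborel (disc_gradient \<epsilon> v) \<le> C"
proof -
  have m: "mom \<epsilon> > 0" by (rule mom_pos[OF e])
  have "ennreal (mom \<epsilon>) * (\<integral>\<^sup>+x. ennreal ((norm (disc_gradient \<epsilon> v x))\<^sup>2) \<partial>lborel)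
     = (\<integral>\<^sup>+x. ennreal (mom \<epsilon> * (norm (disc_gradient \<epsilon> v x))\<^sup>2) \<partial>lborel)"
    using m v by (subst nn_integral_cmult[symmetric]) (auto simp: ennreal_mult)
  also have "\<dots> \<le> J \<epsilon> v"
    unfolding J_def by (intro nn_integral_mono disc_gradient_bessel v e)
  also have "\<dots> \<le> ennreal (mom \<epsilon>) * ennreal C" using C m by (simp add: ennreal_mult)
  finally have "(\<integral>\<^sup>+x. ennreal ((norm (disc_gradient \<epsilon> v x))\<^sup>2) \<partial>lborel) \<le> ennreal C"
    using m by (simp add: ennreal_mult_le_mult_iff)
  with v C show "L2 lborel (disc_gradient \<epsilon> v)" "nsq lborel (disc_gradient \<epsilon> v) \<le> C"
    by (auto intro!: L2_nn_integralI)
qed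

text \<open>Fubini's theorem moves the averaging onto the test function. Let \<open>\<Psi> h\<close>
  be the pairing of \<open>\<phi>\<close> with the increment of \<open>v\<close>; a change of
  variables gives \<open>\<Psi> h = - h . a + o(norm h)\<close>, where \<open>a\<close> pairs the
  partials of \<open>\<phi>\<close> with \<open>v\<close>, and the second moments of the disc pick
  out \<open>- a i\<close>.\<close>

lemma disc_gradient_pairing:
  assumes v: "L2 lborel v" and tf: "test_fun \<phi>" and P: "has_partials \<phi> d"
    and eps: "\<And>n. eps n > 0" "eps \<longlonglongrightarrow> 0"
  shows "(\<lambda>n. \<integral>x. \<phi> x * disc_gradient (eps n) v x $ i \<partial>lborel) \<longlonglongrightarrow> - (\<integral>x. d i x * v x \<partial>lborel)"
proof -
  have [measurable]: "v \<in> borel_measurable borel" using v by (simp add: L2_def)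
  obtain d' R B where d': "has_partials \<phi> d'" and cont: "continuous_on UNIV \<phi>" and R: "R > 0" and B: "B > 0"
    and z: "\<And>x. norm x \<ge> R \<Longrightarrow> \<phi> x = 0" and zd': "\<And>x i. norm x \<ge> R \<Longrightarrow> d' i x = 0"
    and b: "\<And>x. \<bar>\<phi> x\<bar> \<le> B" and bd': "\<And>x i. \<bar>d' i x\<bar> \<le> B"
    by (rule test_fun_partials[OF tf]) blast
  have "d' i = d i" for i
    using P by (intro has_partials_unique[OF P]) (use d' in \<open>auto simp: has_partials_def\<close>)
  then have zd: "\<And>x i. norm x \<ge> R \<Longrightarrow> d i x = 0" and bd: "\<And>x i. \<bar>d i x\<bar> \<le> B"
    using zd' bd' by metis+
  have dc: "continuous_on UNIV (d i)" for i using P by (simp add: has_partials_def)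
  have [measurable]: "\<phi> \<in> borel_measurable borel" "d i \<in> borel_measurable borel" for i
    using cont dc by (auto intro: borel_measurable_continuous_onI)
  have pL: "L2 lborel \<phi>" by (rule test_fun_L2[OF _ z b]) simp
  have dL: "L2 lborel (d i)" for i by (rule test_fun_L2[OF _ zd bd]) simp
  define \<Psi> where "\<Psi> h = (\<integral>x. \<phi> x * (v (x + h) - v x) \<partial>lborel)" for h
  have [measurable]: "\<Psi> \<in> borel_measurable borel" unfolding \<Psi>_def by measurable
  define a where "a i = (\<integral>x. d i x * v x \<partial>lborel)" for i
  let ?i = "\<lambda>e. indicator (ball 0 e) :: real^2 \<Rightarrow> real"
  have iL: "L2 lborel (?i e)" for e by (rule test_fun_L2[where R=e and B=1]) (auto simp: indicator_def)
  define K where "K = (\<integral>x. ?i (R + 1) x * \<bar>v x\<bar> \<partial>lborel)"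
  have vL: "L2 lborel (\<lambda>x. \<bar>v x\<bar>)" using v by (simp add: L2_def)
  have Kint: "integrable lborel (\<lambda>x. ?i (R + 1) x * \<bar>v x\<bar>)"
    using L2_inner_integrable[OF iL vL, of "R + 1"] by simp
  have K0: "K \<ge> 0" unfolding K_def by (intro integral_nonneg_AE) (auto simp: indicator_def)
  have pv: "integrable lborel (\<lambda>x. \<phi> x * v x)" using L2_inner_integrable[OF pL v] by simp
  have pvs: "integrable lborel (\<lambda>x. \<phi> (x - h) * v x)" for h
    using L2_inner_integrable[OF L2_shift[OF pL, of "-h"] v] by simp
  have dv: "integrable lborel (\<lambda>x. d i x * v x)" for i using L2_inner_integrable[OF dL v] by simp
  \<comment> \<open>Only the increments of \<open>\<phi>\<close> are expanded, so no regularity of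
    \<open>v\<close> enters: the error is the oscillation of the partials times the integral of
    \<open>|v|\<close> over a fixed disc.\<close>
  have err: "\<bar>\<Psi> h + (h$1 * a 1 + h$2 * a 2)\<bar> \<le> 2 * e * norm h * K"
    if e: "\<And>i x y. norm x \<le> R + 1 \<Longrightarrow> norm (y - x) \<le> norm h \<Longrightarrow> \<bar>d i y - d i x\<bar> \<le> e" and h: "norm h \<le> 1" for e h
  proof -
    have e0: "e \<ge> 0" using e[of 0 0 1] R by simp
    have i2: "integrable lborel (\<lambda>x. h$1 * (d 1 x * v x) + h$2 * (d 2 x * v x))"
      by (rule Bochner_Integration.integrable_add[OF integrable_mult_right[OF dv] integrable_mult_right[OF dv]])
    have i3: "integrable lborel (\<lambda>x. \<bar>\<phi> (x - h) * v x - \<phi> x * v x + (h$1 * (d 1 x * v x) + h$2 * (d 2 x * v x))\<bar>)"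
      by (rule integrable_abs[OF Bochner_Integration.integrable_add[OF Bochner_Integration.integrable_diff[OF pvs pv] i2]])
    have "\<Psi> h = (\<integral>x. \<phi> x * v (x + h) \<partial>lborel) - (\<integral>x. \<phi> x * v x \<partial>lborel)"
      unfolding \<Psi>_def right_diff_distrib
      using L2_inner_integrable[OF pL L2_shift[OF v, of h]] pv by (intro Bochner_Integration.integral_diff) auto
    also have "(\<integral>x. \<phi> x * v (x + h) \<partial>lborel) = (\<integral>x. \<phi> (x - h) * v x \<partial>lborel)"
      using lborel_iso_integral(1)[OF lborel_iso_add[of h], where h="\<lambda>x. \<phi> (x - h) * v x"] by simp
    finally have Psi: "\<Psi> h + (h$1 * a 1 + h$2 * a 2) = (\<integral>x. \<phi> (x - h) * v x - \<phi> x * v x + (h$1 * (d 1 x * v x) + h$2 * (d 2 x * v x)) \<partial>lborel)"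
      unfolding a_def
      by (subst Bochner_Integration.integral_add[OF Bochner_Integration.integrable_diff[OF pvs pv] i2],
          subst Bochner_Integration.integral_diff[OF pvs pv],
          subst Bochner_Integration.integral_add[OF integrable_mult_right[OF dv] integrable_mult_right[OF dv]])
        (simp only: integral_mult_right_zero)
    have "\<bar>\<Psi> h + (h$1 * a 1 + h$2 * a 2)\<bar> \<le> (\<integral>x. \<bar>\<phi> (x - h) * v x - \<phi> x * v x + (h$1 * (d 1 x * v x) + h$2 * (d 2 x * v x))\<bar> \<partial>lborel)"
      unfolding Psi by (rule integral_abs_bound)
    also have "\<dots> \<le> (\<integral>x. 2 * e * norm h * (?i (R + 1) x * \<bar>v x\<bar>) \<partial>lborel)"
    proof (rule integral_mono[OF i3 integrable_mult_right[OF Kint]])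
      fix x
      have eq: "\<phi> (x - h) * v x - \<phi> x * v x + (h$1 * (d 1 x * v x) + h$2 * (d 2 x * v x))
         = (\<phi> (x + (-h)) - \<phi> x - ((-h)$1 * d 1 x + (-h)$2 * d 2 x)) * v x"
        by (simp add: algebra_simps)
      show "\<bar>\<phi> (x - h) * v x - \<phi> x * v x + (h$1 * (d 1 x * v x) + h$2 * (d 2 x * v x))\<bar> \<le> 2 * e * norm h * (?i (R + 1) x * \<bar>v x\<bar>)"
      proof (cases "norm x < R + 1")
        case True
        have "\<bar>\<phi> (x + (-h)) - \<phi> x - ((-h)$1 * d 1 x + (-h)$2 * d 2 x)\<bar> \<le> 2 * e * norm (-h)"
          by (rule increment_partials_error[OF P]) (use e True in auto)
        then have "\<bar>\<phi> (x + (-h)) - \<phi> x - ((-h)$1 * d 1 x + (-h)$2 * d 2 x)\<bar> * \<bar>v x\<bar> \<le> 2 * e * norm h * \<bar>v x\<bar>"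
          by (intro mult_right_mono) auto
        then show ?thesis unfolding eq abs_mult using True by simp
      next
        case False
        have "norm (x - h) \<ge> R" using False h norm_triangle_ineq2[of x h] by simp
        then show ?thesis using False z[of x] z[of "x - h"] zd[of x] e0 by simp
      qed
    qed
    also have "\<dots> = 2 * e * norm h * K" by (simp add: K_def)
    finally show ?thesis .
  qed
  have fub: "(\<integral>x. \<phi> x * disc_gradient \<epsilon> v x $ i \<partial>lborel) = (1 / mom \<epsilon>) * (\<integral>h. ?i \<epsilon> h * (h$i * \<Psi> h) \<partial>lborel)" if "\<epsilon> > 0" for \<epsilon>
  proof -
    let ?F = "\<lambda>h x. (?i \<epsilon> h * (\<phi> x * (v (x + h) - v x))) *\<^sub>R h"
    \<comment> \<open>For fixed \<open>h\<close> the integral over \<open>x\<close> has a bound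
      independent of \<open>h\<close>, obtained from \<open>r \<le> 1 + r^2\<close> on the support
      of \<open>\<phi>\<close>.\<close>
    have intF: "integrable (lborel \<Otimes>\<^sub>M lborel) (case_prod ?F)"
    proof -
      define K2 where "K2 = B * (measure lborel (ball (0::real^2) R) + 4 * nsq lborel v)"
      have K2: "(\<integral>\<^sup>+x. ennreal (\<bar>\<phi> x\<bar> * \<bar>v (x + h) - v x\<bar>) \<partial>lborel) \<le> ennreal K2" for h
      proof -
        have "(\<integral>\<^sup>+x. ennreal (\<bar>\<phi> x\<bar> * \<bar>v (x + h) - v x\<bar>) \<partial>lborel)
           \<le> (\<integral>\<^sup>+x. ennreal (B * (?i R x + (2 * (norm (v (x + h)))\<^sup>2 + 2 * (norm (v x))\<^sup>2))) \<partial>lborel)"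
        proof (intro nn_integral_mono ennreal_leI)
          fix x
          have "\<bar>v (x + h) - v x\<bar> \<le> 1 + (norm (v (x + h) - v x))\<^sup>2"
            using sum_squares_bound[of 1 "\<bar>v (x + h) - v x\<bar>"] by (simp) (smt (verit) zero_le_power2)
          also have "\<dots> \<le> 1 + (2 * (norm (v (x + h)))\<^sup>2 + 2 * (norm (v x))\<^sup>2)"
            using norm_add_sq_le[of "v (x + h)" "- v x"] by simp
          finally have *: "\<bar>v (x + h) - v x\<bar> \<le> 1 + (2 * (norm (v (x + h)))\<^sup>2 + 2 * (norm (v x))\<^sup>2)" .
          show "\<bar>\<phi> x\<bar> * \<bar>v (x + h) - v x\<bar> \<le> B * (?i R x + (2 * (norm (v (x + h)))\<^sup>2 + 2 * (norm (v x))\<^sup>2))"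
          proof (cases "norm x < R")
            case True
            then show ?thesis using mult_mono[OF b[of x] *] B by simp
          next
            case False
            then show ?thesis using z[of x] B by simp
          qed
        qed
        also have "\<dots> = ennreal (\<integral>x. B * (?i R x + (2 * (norm (v (x + h)))\<^sup>2 + 2 * (norm (v x))\<^sup>2)) \<partial>lborel)"
        proof (rule nn_integral_eq_integral)
          show "integrable lborel (\<lambda>x. B * (?i R x + (2 * (norm (v (x + h)))\<^sup>2 + 2 * (norm (v x))\<^sup>2)))"
            using L2_integrable[OF v] L2_integrable[OF L2_shift[OF v, of h]] emeasure_lborel_ball_finite[of "0::real^2" R]
            by (intro integrable_mult_right Bochner_Integration.integrable_add integrable_real_indicator) auto
        qed (use B in auto)
        also have "(\<integral>x. B * (?i R x + (2 * (norm (v (x + h)))\<^sup>2 + 2 * (norm (v x))\<^sup>2)) \<partial>lborel) = K2"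
          using L2_integrable[OF v] L2_integrable[OF L2_shift[OF v, of h]] emeasure_lborel_ball_finite[of "0::real^2" R]
            nsq_shift[of v h]
          by (simp add: K2_def nsq_def)
        finally show ?thesis .
      qed
      have "(\<integral>\<^sup>+h. \<integral>\<^sup>+x. ennreal (norm (?F h x)) \<partial>lborel \<partial>lborel) \<le> (\<integral>\<^sup>+h. ennreal (\<epsilon> * K2) * indicator (ball (0::real^2) \<epsilon>) h \<partial>lborel)"
      proof (intro nn_integral_mono)
        fix h
        have "(\<integral>\<^sup>+x. ennreal (norm (?F h x)) \<partial>lborel) = ennreal (?i \<epsilon> h * norm h) * (\<integral>\<^sup>+x. ennreal (\<bar>\<phi> x\<bar> * \<bar>v (x + h) - v x\<bar>) \<partial>lborel)"
          by (subst nn_integral_cmult[symmetric])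
            (auto simp: abs_mult mult_ac ennreal_mult[symmetric] intro!: nn_integral_cong)
        also have "\<dots> \<le> ennreal (?i \<epsilon> h * norm h) * ennreal K2" by (intro mult_left_mono K2) simp
        also have "\<dots> \<le> ennreal (\<epsilon> * K2) * indicator (ball 0 \<epsilon>) h"
          using that B nsq_nonneg[of lborel v]
          by (auto simp: indicator_def K2_def ennreal_mult[symmetric] intro!: ennreal_leI mult_right_mono)
        finally show "(\<integral>\<^sup>+x. ennreal (norm (?F h x)) \<partial>lborel) \<le> ennreal (\<epsilon> * K2) * indicator (ball 0 \<epsilon>) h" .
      qed
      also have "\<dots> = ennreal (\<epsilon> * K2 * measure lborel (ball (0::real^2) \<epsilon>))"
      proof -
        have "emeasure lborel (ball (0::real^2) \<epsilon>) = ennreal (measure lborel (ball (0::real^2) \<epsilon>))"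
          using emeasure_lborel_ball_finite[of "0::real^2" \<epsilon>] by (intro emeasure_eq_ennreal_measure) auto
        then show ?thesis
          using that B nsq_nonneg[of lborel v] by (simp add: nn_integral_cmult K2_def ennreal_mult)
      qed
      finally show ?thesis
        by (intro pair_integrableI[where K="\<epsilon> * K2 * measure lborel (ball (0::real^2) \<epsilon>)"]) (auto simp: case_prod_unfold)
    qed
    have intFi: "integrable (lborel \<Otimes>\<^sub>M lborel) (\<lambda>(h, x). ?i \<epsilon> h * (h$i * (\<phi> x * (v (x + h) - v x))))"
    proof -
      have "integrable (lborel \<Otimes>\<^sub>M lborel) (\<lambda>p. case_prod ?F p \<bullet> axis i 1)"
        using intF by (rule integrable_inner_left)
      then show ?thesis by (simp add: case_prod_unfold inner_axis mult_ac)
    qed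
    have in_x: "AE x in lborel. integrable lborel (\<lambda>h. ?F h x)"
      using lborel_pair.AE_integrable_snd[OF intF] by simp
    have "(\<integral>x. \<phi> x * disc_gradient \<epsilon> v x $ i \<partial>lborel)
       = (\<integral>x. (1 / mom \<epsilon>) * (\<integral>h. ?i \<epsilon> h * (h$i * (\<phi> x * (v (x + h) - v x))) \<partial>lborel) \<partial>lborel)"
    proof (rule integral_cong_AE; (measurable)?)
      show "AE x in lborel. \<phi> x * disc_gradient \<epsilon> v x $ i
         = (1 / mom \<epsilon>) * (\<integral>h. ?i \<epsilon> h * (h$i * (\<phi> x * (v (x + h) - v x))) \<partial>lborel)"
        using in_x
      proof eventually_elim
        case (elim x)
        have "\<phi> x *\<^sub>R (\<integral>h. (?i \<epsilon> h * (v (x + h) - v x)) *\<^sub>R h \<partial>lborel) = (\<integral>h. ?F h x \<partial>lborel)"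
          by (subst integral_scaleR_right[symmetric]) (simp add: mult_ac)
        from arg_cong[OF this, of "\<lambda>z. z $ i"]
        have "\<phi> x * disc_gradient \<epsilon> v x $ i = (1 / mom \<epsilon>) * ((\<integral>h. ?F h x \<partial>lborel) \<bullet> axis i 1)"
          unfolding disc_gradient_def by (simp add: inner_axis)
        also have "(\<integral>h. ?F h x \<partial>lborel) \<bullet> axis i 1 = (\<integral>h. ?F h x \<bullet> axis i 1 \<partial>lborel)"
          by (rule integral_inner_left[symmetric]) (rule elim)
        also have "\<dots> = (\<integral>h. ?i \<epsilon> h * (h$i * (\<phi> x * (v (x + h) - v x))) \<partial>lborel)"
          by (intro Bochner_Integration.integral_cong) (auto simp: inner_axis mult_ac)
        finally show ?case .
      qed
    qed
    also have "\<dots> = (1 / mom \<epsilon>) * (\<integral>x. \<integral>h. ?i \<epsilon> h * (h$i * (\<phi> x * (v (x + h) - v x))) \<partial>lborel \<partial>lborel)"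
      by simp
    also have "\<dots> = (1 / mom \<epsilon>) * (\<integral>h. \<integral>x. ?i \<epsilon> h * (h$i * (\<phi> x * (v (x + h) - v x))) \<partial>lborel \<partial>lborel)"
      by (subst lborel_pair.Fubini_integral[OF intFi]) simp
    also have "\<dots> = (1 / mom \<epsilon>) * (\<integral>h. ?i \<epsilon> h * (h$i * \<Psi> h) \<partial>lborel)"
      by (simp add: \<Psi>_def)
    finally show ?thesis .
  qed
  show ?thesis
  proof (rule LIMSEQ_I)
    fix r :: real assume r: "r > 0"
    \<comment> \<open>Keeps the final error \<open>4 * e * K\<close> below \<open>r\<close>;
      \<open>K + 1\<close> avoids division by zero.\<close>
    define e where "e = r / (8 * (K + 1))"
    have e: "e > 0" "4 * e * K < r"
      using r K0 by (auto simp: e_def field_simps) (smt (verit) mult_nonneg_nonneg)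
    \<comment> \<open>Points of norm at most \<open>R + 1\<close> are moved by at most 1, so uniform
      continuity is needed only up to radius \<open>R + 2\<close>.\<close>
    have "\<exists>\<delta>>0. \<forall>x\<in>cball 0 (R+2). \<forall>y\<in>cball 0 (R+2). dist y x < \<delta> \<longrightarrow> dist (d j y) (d j x) < e" for j
    proof -
      have "uniformly_continuous_on (cball 0 (R+2)) (d j)"
        by (intro compact_uniformly_continuous continuous_on_subset[OF dc]) auto
      then show ?thesis using e(1) unfolding uniformly_continuous_on_def by blast
    qed
    then obtain \<delta> where \<delta>: "\<And>j. \<delta> j > 0"
      "\<And>j x y. x \<in> cball 0 (R+2) \<Longrightarrow> y \<in> cball 0 (R+2) \<Longrightarrow> dist y x < \<delta> j \<Longrightarrow> dist (d j y) (d j x) < e"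
      by metis
    define \<eta> where "\<eta> = min 1 (min (\<delta> 1) (\<delta> 2))"
    have \<eta>: "\<eta> > 0" "\<eta> \<le> 1" using \<delta>(1) by (auto simp: \<eta>_def)
    have \<eta>d: "\<eta> \<le> \<delta> j" for j using exhaust_2[of j] by (auto simp: \<eta>_def)
    have errh: "\<bar>\<Psi> h + (h$1 * a 1 + h$2 * a 2)\<bar> \<le> 2 * e * norm h * K" if "norm h < \<eta>" for h
    proof (rule err)
      show "norm h \<le> 1" using that \<eta> by simp
      fix j :: 2 and x y :: "real^2" assume "norm x \<le> R + 1" "norm (y - x) \<le> norm h"
      moreover have "norm y \<le> norm x + norm (y - x)" using norm_triangle_ineq[of x "y - x"] by simp
      ultimately show "\<bar>d j y - d j x\<bar> \<le> e"
        using \<delta>(2)[of x y j] that \<eta>(2) \<eta>d[of j] by (auto simp: dist_norm dist_real_def)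
    qed
    have main: "\<bar>(\<integral>x. \<phi> x * disc_gradient \<epsilon> v x $ i \<partial>lborel) + a i\<bar> \<le> 4 * e * K" if "\<epsilon> > 0" "\<epsilon> < \<eta>" for \<epsilon>
    proof -
      define E where "E h = \<Psi> h + (h$1 * a 1 + h$2 * a 2)" for h
      have [measurable]: "E \<in> borel_measurable borel" unfolding E_def by measurable
      have Eb: "\<bar>h$i * E h\<bar> \<le> 2 * e * K * (norm h)\<^sup>2" if "h \<in> ball 0 \<epsilon>" for h
      proof -
        have "\<bar>h$i * E h\<bar> \<le> norm h * (2 * e * norm h * K)"
          unfolding abs_mult E_def using that \<open>\<epsilon> < \<eta>\<close> component_le_norm_cart[of h i] by (intro mult_mono errh) auto
        then show ?thesis by (simp add: power2_eq_square mult_ac)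
      qed
      have Ei: "integrable lborel (\<lambda>h. ?i \<epsilon> h * (h$i * E h))"
      proof (rule integrable_ball_mult)
        fix h :: "real^2" assume h: "h \<in> ball 0 \<epsilon>"
        have "2 * e * K * (norm h)\<^sup>2 \<le> 2 * e * K * \<epsilon>\<^sup>2"
          using h e(1) K0 by (intro mult_left_mono power_mono) auto
        with Eb[OF h] show "\<bar>h$i * E h\<bar> \<le> 2 * e * K * \<epsilon>\<^sup>2" by simp
      qed measurable
      have qi: "integrable lborel (\<lambda>h. ?i \<epsilon> h * (h$i * (h$1 * a 1 + h$2 * a 2)))"
        using ball_monomial_integrable[of \<epsilon> i 1, THEN integrable_mult_left, of "a 1"]
          ball_monomial_integrable[of \<epsilon> i 2, THEN integrable_mult_left, of "a 2"]
        by (auto dest: Bochner_Integration.integrable_add simp: algebra_simps)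
      have qv: "(\<integral>h. ?i \<epsilon> h * (h$i * (h$1 * a 1 + h$2 * a 2)) \<partial>lborel) = mom \<epsilon> * a i"
      proof -
        have "(\<integral>h. ?i \<epsilon> h * (h$i * (h$1 * a 1 + h$2 * a 2)) \<partial>lborel)
           = (\<integral>h. ?i \<epsilon> h * (h$i * h$1) * a 1 + ?i \<epsilon> h * (h$i * h$2) * a 2 \<partial>lborel)"
          by (intro Bochner_Integration.integral_cong) (auto simp: algebra_simps)
        also have "\<dots> = (if i = 1 then mom \<epsilon> else 0) * a 1 + (if i = 2 then mom \<epsilon> else 0) * a 2"
          by (subst Bochner_Integration.integral_add) (auto intro!: integrable_mult_left ball_monomial_integrable simp: ball_moment)
        finally show ?thesis using exhaust_2[of i] by auto
      qed
      \<comment> \<open>The linear part is evaluated exactly by \<open>ball_moment\<close>; the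
        remainder is at most a small constant times the square of \<open>norm h\<close>, hence at
        most that constant times \<open>2 * mom \<epsilon>\<close> after integration.\<close>
      have "(\<integral>h. ?i \<epsilon> h * (h$i * \<Psi> h) \<partial>lborel) = (\<integral>h. ?i \<epsilon> h * (h$i * E h) - ?i \<epsilon> h * (h$i * (h$1 * a 1 + h$2 * a 2)) \<partial>lborel)"
        by (intro Bochner_Integration.integral_cong) (auto simp: E_def algebra_simps)
      also have "\<dots> = (\<integral>h. ?i \<epsilon> h * (h$i * E h) \<partial>lborel) - mom \<epsilon> * a i"
        using Ei qi qv by simp
      finally have *: "(\<integral>x. \<phi> x * disc_gradient \<epsilon> v x $ i \<partial>lborel) + a i = (1 / mom \<epsilon>) * (\<integral>h. ?i \<epsilon> h * (h$i * E h) \<partial>lborel)"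
        using fub[OF that(1)] mom_pos[OF that(1)] by (simp add: field_simps)
      have "\<bar>\<integral>h. ?i \<epsilon> h * (h$i * E h) \<partial>lborel\<bar> \<le> (\<integral>h. \<bar>?i \<epsilon> h * (h$i * E h)\<bar> \<partial>lborel)"
        by (rule integral_abs_bound)
      also have "\<dots> \<le> (\<integral>h. 2 * e * K * (?i \<epsilon> h * (h$1 * h$1) + ?i \<epsilon> h * (h$2 * h$2)) \<partial>lborel)"
      proof (rule integral_mono)
        show "integrable lborel (\<lambda>h. \<bar>?i \<epsilon> h * (h$i * E h)\<bar>)" using Ei by (rule integrable_abs)
        show "integrable lborel (\<lambda>h. 2 * e * K * (?i \<epsilon> h * (h$1 * h$1) + ?i \<epsilon> h * (h$2 * h$2)))"
          by (intro integrable_mult_right Bochner_Integration.integrable_add ball_monomial_integrable)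
        fix h :: "real^2"
        show "\<bar>?i \<epsilon> h * (h$i * E h)\<bar> \<le> 2 * e * K * (?i \<epsilon> h * (h$1 * h$1) + ?i \<epsilon> h * (h$2 * h$2))"
          using Eb[of h] norm_sq_2[of h] by (cases "h \<in> ball 0 \<epsilon>") (auto simp: power2_eq_square)
      qed
      also have "\<dots> = 2 * e * K * (2 * mom \<epsilon>)"
        by (subst integral_mult_right_zero, subst Bochner_Integration.integral_add)
          (auto intro!: ball_monomial_integrable simp: ball_moment)
      finally have "(1 / mom \<epsilon>) * \<bar>\<integral>h. ?i \<epsilon> h * (h$i * E h) \<partial>lborel\<bar> \<le> (1 / mom \<epsilon>) * (2 * e * K * (2 * mom \<epsilon>))"
        using mom_pos[OF that(1)] by (intro mult_left_mono) auto
      then show ?thesis using mom_pos[OF that(1)] unfolding * by (simp add: abs_mult)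
    qed
    from LIMSEQ_D[OF eps(2) \<eta>(1)] obtain N where N: "\<And>n. n \<ge> N \<Longrightarrow> \<bar>eps n\<bar> < \<eta>" by auto
    show "\<exists>N. \<forall>n\<ge>N. norm ((\<integral>x. \<phi> x * disc_gradient (eps n) v x $ i \<partial>lborel) - - (\<integral>x. d i x * v x \<partial>lborel)) < r"
    proof (intro exI[of _ N] allI impI)
      fix n assume "n \<ge> N"
      then have "eps n < \<eta>" using N[of n] eps(1)[of n] by simp
      from main[OF eps(1) this] e(2)
      show "norm ((\<integral>x. \<phi> x * disc_gradient (eps n) v x $ i \<partial>lborel) - - (\<integral>x. d i x * v x \<partial>lborel)) < r"
        by (simp add: a_def)
    qed
  qed
qed

text \<open>Bessel's inequality bounds the disc gradients in L2 by \<open>C\<close>, so they have a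
  weak limit; its pairings with test functions are identified by
  \<open>disc_gradient_pairing\<close>, which makes it the weak gradient, and the bound is
  inherited.\<close>

theorem weak_gradient_from_J:
  fixes v :: "real^2 \<Rightarrow> real"
  assumes v: "L2 lborel v" and eps: "\<And>n. eps n > 0" "eps \<longlonglongrightarrow> 0"
    and C: "\<And>n. J (eps n) v \<le> ennreal (mom (eps n) * C)" "C \<ge> 0"
  shows "\<exists>g1 g2. L2 lborel g1 \<and> L2 lborel g2 \<and>
     weak_partial (\<lambda>x. complex_of_real (v x)) 1 (\<lambda>x. complex_of_real (g1 x)) \<and>
     weak_partial (\<lambda>x. complex_of_real (v x)) 2 (\<lambda>x. complex_of_real (g2 x)) \<and>
     nsq lborel g1 + nsq lborel g2 \<le> C"
proof -
  have vm: "v \<in> borel_measurable borel" using v by (simp add: L2_def)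
  note G = disc_gradient_L2[OF vm eps(1) C]
  from L2_weak_limit[of lborel "\<lambda>n. disc_gradient (eps n) v" C, OF G]
  obtain g :: "real^2 \<Rightarrow> real^2" where g: "L2 lborel g" "nsq lborel g \<le> C"
    and lim: "\<And>\<phi> l. L2 lborel \<phi> \<Longrightarrow> (\<lambda>n. \<integral>x. \<phi> x \<bullet> disc_gradient (eps n) v x \<partial>lborel) \<longlonglongrightarrow> l
       \<Longrightarrow> (\<integral>x. \<phi> x \<bullet> g x \<partial>lborel) = l"
    by blast
  have [measurable]: "g \<in> borel_measurable borel" using g by (simp add: L2_def)
  have gi: "L2 lborel (\<lambda>x. g x $ i)" for i
    unfolding L2_def
  proof (intro conjI)
    show "integrable lborel (\<lambda>x. (norm (g x $ i))\<^sup>2)"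
    proof (rule Bochner_Integration.integrable_bound[OF L2_integrable[OF g(1)]])
      show "AE x in lborel. norm ((norm (g x $ i))\<^sup>2) \<le> norm ((norm (g x))\<^sup>2)"
        using component_le_norm_cart[of "g _" i] by (intro AE_I2) (simp flip: abs_le_square_iff)
    qed measurable
  qed measurable
  have wp: "weak_partial (\<lambda>x. complex_of_real (v x)) i (\<lambda>x. complex_of_real (g x $ i))" for i
  proof (rule weak_partialI)
    fix \<phi> d assume tf: "test_fun \<phi>" and P: "has_partials \<phi> d"
    obtain R B where cont: "continuous_on UNIV \<phi>"
      and z: "\<And>x. norm x \<ge> R \<Longrightarrow> \<phi> x = 0" and b: "\<And>x. \<bar>\<phi> x\<bar> \<le> B"
      by (rule test_fun_partials[OF tf]) blast
    have [measurable]: "\<phi> \<in> borel_measurable borel" using cont by (rule borel_measurable_continuous_onI)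
    have "L2 lborel \<phi>" by (rule test_fun_L2[OF _ z b]) simp
    then have pL: "L2 lborel (\<lambda>x. \<phi> x *\<^sub>R (axis i 1 :: real^2))"
      by (auto simp: L2_def)
    have "(\<integral>x. (\<phi> x *\<^sub>R (axis i 1 :: real^2)) \<bullet> g x \<partial>lborel) = - (\<integral>x. d i x * v x \<partial>lborel)"
      by (rule lim[OF pL]) (use disc_gradient_pairing[OF v tf P eps, of i] in \<open>simp add: inner_axis'\<close>)
    then have "(\<integral>x. \<phi> x * g x $ i \<partial>lborel) = - (\<integral>x. d i x * v x \<partial>lborel)"
      by (simp add: inner_axis')
    then have "complex_of_real (\<integral>x. d i x * v x \<partial>lborel) = - complex_of_real (\<integral>x. \<phi> x * g x $ i \<partial>lborel)"
      by simp
    then show "(\<integral>x. d i x *\<^sub>R complex_of_real (v x) \<partial>lborel) = - (\<integral>x. \<phi> x *\<^sub>R complex_of_real (g x $ i) \<partial>lborel)"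
      by (simp add: scaleR_conv_of_real flip: of_real_mult)
  qed
  have "nsq lborel g = nsq lborel (\<lambda>x. g x $ 1) + nsq lborel (\<lambda>x. g x $ 2)"
    unfolding nsq_def norm_sq_2 using gi[of 1] gi[of 2] by (simp add: L2_def)
  with g(2) gi wp show ?thesis by (intro exI[of _ "\<lambda>x. g x $ 1"] exI[of _ "\<lambda>x. g x $ 2"]) auto
qed

subsection \<open>The Dirichlet energy as a limit of difference energies\<close>

text \<open>A lower limit is available before convergence is known. By \<open>Dn_bounds_J\<close> it
  dominates the normalised energies at all scales, so for square-integrable \<open>v\<close> it is
  the limit.\<close>

definition Dn :: "(real^2 \<Rightarrow> real) \<Rightarrow> ennreal" where
  "Dn v = liminf (\<lambda>n. J (1 / real (Suc n)) v / ennreal (mom (1 / real (Suc n))))"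

lemma L2_of_real: "L2 M v \<Longrightarrow> L2 M (\<lambda>x. complex_of_real (v x))"
  by (auto simp: L2_def)

lemma nsq_of_real: "nsq M (\<lambda>x. complex_of_real (v x)) = nsq M v"
  by (simp add: nsq_def)

lemma J_of_real: "J \<epsilon> (\<lambda>x. complex_of_real (v x)) = J \<epsilon> v"
  unfolding J_def by (simp flip: of_real_diff)

lemma nn_integral_sum_nsq:
  assumes "L2 M g1" "L2 M g2" "c \<ge> 0"
  shows "(\<integral>\<^sup>+x. ennreal (c * ((norm (g1 x))\<^sup>2 + (norm (g2 x))\<^sup>2)) \<partial>M) = ennreal (c * (nsq M g1 + nsq M g2))"
proof -
  have "(\<integral>\<^sup>+x. ennreal (c * ((norm (g1 x))\<^sup>2 + (norm (g2 x))\<^sup>2)) \<partial>M) = ennreal (\<integral>x. c * ((norm (g1 x))\<^sup>2 + (norm (g2 x))\<^sup>2) \<partial>M)"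
    using assms by (intro nn_integral_eq_integral) (auto simp: L2_def)
  then show ?thesis using assms by (simp add: L2_def nsq_def)
qed

lemma J_le_gradient:
  fixes u :: "real^2 \<Rightarrow> complex"
  assumes "L2 lborel u" "L2 lborel g1" "L2 lborel g2" "weak_partial u 1 g1" "weak_partial u 2 g2" "\<epsilon> > 0"
  shows "J \<epsilon> u \<le> ennreal (mom \<epsilon> * (nsq lborel g1 + nsq lborel g2))"
  using J_le_weak_gradient[OF L2_loc_int L2_loc_int L2_loc_int, OF assms(1-5), of \<epsilon>]
    nn_integral_sum_nsq[OF assms(2,3), of "mom \<epsilon>"] mom_pos[OF assms(6)] by simp

lemma Dn_le:
  assumes "\<And>n. J (1 / real (Suc n)) v \<le> ennreal (mom (1 / real (Suc n)) * D)" "D \<ge> 0"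
  shows "Dn v \<le> ennreal D"
  unfolding Dn_def
proof (rule Liminf_le)
  show "\<forall>\<^sub>F n in sequentially. J (1 / real (Suc n)) v / ennreal (mom (1 / real (Suc n))) \<le> ennreal D"
  proof (intro always_eventually allI)
    fix n
    have m: "mom (1 / real (Suc n)) > 0" by (rule mom_pos) simp
    have "J (1 / real (Suc n)) v / ennreal (mom (1 / real (Suc n)))
       \<le> ennreal (mom (1 / real (Suc n)) * D) / ennreal (mom (1 / real (Suc n)))"
      by (intro divide_right_mono_ennreal assms)
    also have "\<dots> = ennreal D" using m assms(2) by (simp add: divide_ennreal)
    finally show "J (1 / real (Suc n)) v / ennreal (mom (1 / real (Suc n))) \<le> ennreal D" .
  qed
qed simp

text \<open>A strict bound on the lower limit holds along some scales tending to 0, which is all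
  that \<open>weak_gradient_from_J\<close> requires.\<close>

lemma Dn_gradient_approx:
  assumes v: "L2 lborel v" and c: "Dn v < ennreal c"
  shows "\<exists>g1 g2. L2 lborel g1 \<and> L2 lborel g2 \<and>
     weak_partial (\<lambda>x. complex_of_real (v x)) 1 (\<lambda>x. complex_of_real (g1 x)) \<and>
     weak_partial (\<lambda>x. complex_of_real (v x)) 2 (\<lambda>x. complex_of_real (g2 x)) \<and>
     nsq lborel g1 + nsq lborel g2 \<le> c"
proof -
  have c0: "c \<ge> 0" using c by (metis ennreal_neg linorder_not_less nle_le zero_le)
  have "\<exists>n\<ge>N. J (1 / real (Suc n)) v / ennreal (mom (1 / real (Suc n))) < ennreal c" for N
  proof (rule ccontr)
    assume "\<not> (\<exists>n\<ge>N. J (1 / real (Suc n)) v / ennreal (mom (1 / real (Suc n))) < ennreal c)"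
    then have "\<forall>\<^sub>F n in sequentially. ennreal c \<le> J (1 / real (Suc n)) v / ennreal (mom (1 / real (Suc n)))"
      by (auto simp: eventually_sequentially not_less)
    then have "ennreal c \<le> Dn v" unfolding Dn_def by (rule Liminf_bounded)
    with c show False by simp
  qed
  then obtain r where r: "\<And>N. r N \<ge> N" "\<And>N. J (1 / real (Suc (r N))) v / ennreal (mom (1 / real (Suc (r N)))) < ennreal c"
    by metis
  show ?thesis
  proof (rule weak_gradient_from_J[OF v, where eps="\<lambda>N. 1 / real (Suc (r N))"])
    show "0 < 1 / real (Suc (r n))" for n by simp
    show "(\<lambda>N. 1 / real (Suc (r N))) \<longlonglongrightarrow> 0"
    proof (rule tendsto_sandwich[OF _ _ tendsto_const LIMSEQ_Suc[OF lim_1_over_n]])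
      show "\<forall>\<^sub>F N in sequentially. 1 / real (Suc (r N)) \<le> 1 / real (Suc N)"
        using r(1) by (intro always_eventually allI) (simp add: frac_le)
    qed auto
    fix n
    let ?m = "mom (1 / real (Suc (r n)))"
    have m: "?m > 0" by (rule mom_pos) simp
    have "J (1 / real (Suc (r n))) v = ennreal ?m * (J (1 / real (Suc (r n))) v / ennreal ?m)"
      using m by (subst ennreal_times_divide, subst mult.commute, subst mult_divide_eq_ennreal) auto
    also have "\<dots> \<le> ennreal ?m * ennreal c" using r(2)[of n] by (intro mult_left_mono) auto
    finally show "J (1 / real (Suc (r n))) v \<le> ennreal (?m * c)" using m c0 by (simp add: ennreal_mult)
  qed (rule c0)
qed

text \<open>Self-improvement: a bound along small scales produces a weak gradient of energy at most
  \<open>D\<close> up to an arbitrarily small error, and this gradient controls the difference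
  energy at every scale.\<close>

theorem Dn_bounds_J:
  assumes v: "L2 lborel v" and D: "Dn v \<le> ennreal D" "D \<ge> 0" and e: "\<epsilon> > 0"
  shows "J \<epsilon> v \<le> ennreal (mom \<epsilon> * D)"
proof (rule ennreal_le_epsilon)
  fix r :: real assume "r > 0"
  let ?c = "D + r / mom \<epsilon>"
  have m: "mom \<epsilon> > 0" by (rule mom_pos[OF e])
  have "Dn v < ennreal ?c" using D \<open>r > 0\<close> m by (auto intro!: le_less_trans[OF D(1)] ennreal_lessI add_nonneg_pos)
  from Dn_gradient_approx[OF v this] obtain g1 g2 where g: "L2 lborel g1" "L2 lborel g2"
     "weak_partial (\<lambda>x. complex_of_real (v x)) 1 (\<lambda>x. complex_of_real (g1 x))"
     "weak_partial (\<lambda>x. complex_of_real (v x)) 2 (\<lambda>x. complex_of_real (g2 x))"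
     "nsq lborel g1 + nsq lborel g2 \<le> ?c" by blast
  have "J \<epsilon> v \<le> ennreal (mom \<epsilon> * (nsq lborel g1 + nsq lborel g2))"
    using J_le_gradient[OF L2_of_real[OF v] L2_of_real[OF g(1)] L2_of_real[OF g(2)] g(3,4) e]
    by (simp add: J_of_real nsq_of_real)
  also have "\<dots> \<le> ennreal (mom \<epsilon> * ?c)" using g(5) m by (intro ennreal_leI mult_left_mono) auto
  also have "\<dots> = ennreal (mom \<epsilon> * D) + ennreal r" using m D(2) \<open>r > 0\<close> by (simp add: distrib_left flip: ennreal_plus)
  finally show "J \<epsilon> v \<le> ennreal (mom \<epsilon> * D) + ennreal r" .
qed

theorem Dn_gradient:
  assumes v: "L2 lborel v" and D: "Dn v \<le> ennreal D" "D \<ge> 0"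
  shows "\<exists>g1 g2. L2 lborel g1 \<and> L2 lborel g2 \<and>
     weak_partial (\<lambda>x. complex_of_real (v x)) 1 (\<lambda>x. complex_of_real (g1 x)) \<and>
     weak_partial (\<lambda>x. complex_of_real (v x)) 2 (\<lambda>x. complex_of_real (g2 x)) \<and>
     nsq lborel g1 + nsq lborel g2 \<le> D"
proof (rule weak_gradient_from_J[OF v, where eps="\<lambda>n. 1 / real (Suc n)"])
  show "(\<lambda>n. 1 / real (Suc n)) \<longlonglongrightarrow> 0" by (rule LIMSEQ_Suc[OF lim_1_over_n])
qed (use Dn_bounds_J[OF v D] D in auto)

text \<open>A bound for a single shift rather than for a disc average: the gradient from
  \<open>Dn_gradient\<close> bounds each translate, and Cauchy-Schwarz in the plane bounds the
  directional derivative.\<close>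

theorem Dn_translate:
  assumes v: "L2 lborel v" and D: "Dn v \<le> ennreal D" "D \<ge> 0"
  shows "nsq lborel (\<lambda>x. v (x + h) - v x) \<le> (norm h)\<^sup>2 * D"
proof -
  from Dn_gradient[OF v D] obtain g1 g2 where g: "L2 lborel g1" "L2 lborel g2"
     "weak_partial (\<lambda>x. complex_of_real (v x)) 1 (\<lambda>x. complex_of_real (g1 x))"
     "weak_partial (\<lambda>x. complex_of_real (v x)) 2 (\<lambda>x. complex_of_real (g2 x))"
     "nsq lborel g1 + nsq lborel g2 \<le> D" by blast
  have "(\<integral>\<^sup>+x. ennreal ((norm (v (x + h) - v x))\<^sup>2) \<partial>lborel)
     = (\<integral>\<^sup>+x. ennreal ((norm (complex_of_real (v (x + h)) - complex_of_real (v x)))\<^sup>2) \<partial>lborel)"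
    by (simp flip: of_real_diff)
  also have "\<dots> \<le> (\<integral>\<^sup>+x. ennreal ((norm (h$1 *\<^sub>R complex_of_real (g1 x) + h$2 *\<^sub>R complex_of_real (g2 x)))\<^sup>2) \<partial>lborel)"
    by (rule translate_sq_le[OF L2_loc_int L2_loc_int L2_loc_int g(3,4)]) (intro L2_of_real v g)+
  also have "\<dots> \<le> (\<integral>\<^sup>+x. ennreal ((norm h)\<^sup>2 * ((norm (g1 x))\<^sup>2 + (norm (g2 x))\<^sup>2)) \<partial>lborel)"
  proof (intro nn_integral_mono ennreal_leI)
    fix x
    have "(h$1 * g1 x + h$2 * g2 x)\<^sup>2 \<le> ((h$1)\<^sup>2 + (h$2)\<^sup>2) * ((g1 x)\<^sup>2 + (g2 x)\<^sup>2)"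
      using zero_le_power2[of "h$1 * g2 x - h$2 * g1 x"] by (simp add: power2_eq_square algebra_simps)
    moreover have "h$1 *\<^sub>R complex_of_real (g1 x) + h$2 *\<^sub>R complex_of_real (g2 x) = complex_of_real (h$1 * g1 x + h$2 * g2 x)"
      by (simp add: scaleR_conv_of_real)
    ultimately show "(norm (h$1 *\<^sub>R complex_of_real (g1 x) + h$2 *\<^sub>R complex_of_real (g2 x)))\<^sup>2 \<le> (norm h)\<^sup>2 * ((norm (g1 x))\<^sup>2 + (norm (g2 x))\<^sup>2)"
      by (simp add: norm_sq_2 del: of_real_add of_real_mult)
  qed
  also have "\<dots> = ennreal ((norm h)\<^sup>2 * (nsq lborel g1 + nsq lborel g2))"
    by (rule nn_integral_sum_nsq) (use g in auto)
  also have "\<dots> \<le> ennreal ((norm h)\<^sup>2 * D)" using g(5) by (intro ennreal_leI mult_left_mono) auto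
  finally show ?thesis
    using v D(2) by (intro L2_nn_integralI(2)) (auto simp: L2_def)
qed

subsection \<open>Admissible profiles\<close>

text \<open>The working class of real functions, nonnegative at every point. It contains the moduli
  of elements of \<open>X_space\<close> of positive mass and is stable under translation,
  nonnegative scaling, polarisation and truncation.\<close>

definition admissible :: "(real^2 \<Rightarrow> real) \<Rightarrow> bool" where
  "admissible v \<longleftrightarrow> L2 lborel v \<and> (\<forall>x. 0 \<le> v x) \<and> Dn v < \<infinity> \<and>
     integrable lborel (\<lambda>x. ln (1 + norm x) * (v x)\<^sup>2)"

definition DD :: "(real^2 \<Rightarrow> real) \<Rightarrow> real" where "DD v = enn2real (Dn v)"

lemma DD_nonneg: "DD v \<ge> 0" by (simp add: DD_def)

lemma ennreal_DD: "Dn v < \<infinity> \<Longrightarrow> ennreal (DD v) = Dn v"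
  by (simp add: DD_def top.not_eq_extremum)

lemma DD_le: "Dn v \<le> ennreal D \<Longrightarrow> D \<ge> 0 \<Longrightarrow> DD v \<le> D"
  unfolding DD_def by (metis enn2real_ennreal enn2real_mono ennreal_less_top)

lemma admissibleD:
  assumes "admissible v"
  shows "L2 lborel v" "v \<in> borel_measurable borel" "\<And>x. 0 \<le> v x" "Dn v \<le> ennreal (DD v)"
    "integrable lborel (\<lambda>x. ln (1 + norm x) * (v x)\<^sup>2)" "integrable lborel (\<lambda>x. (v x)\<^sup>2)"
  using assms ennreal_DD[of v] by (auto simp: admissible_def L2_def)

text \<open>Equality of the two Dirichlet energies needs both directions: the weak limit gives a
  gradient of energy at most \<open>DD v\<close>, and \<open>J_le_gradient\<close> gives the reverse
  bound.\<close>

lemma admissible_in_X: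
  assumes v: "admissible v" and pos: "nsq lborel v > 0"
  shows "(\<lambda>x. complex_of_real (v x)) \<in> X_space" (is "?u \<in> _")
    and "dirichlet (\<lambda>x. complex_of_real (v x)) = DD v"
    and "mass (\<lambda>x. complex_of_real (v x)) = nsq lborel v"
proof -
  note a = admissibleD[OF v]
  from Dn_gradient[OF a(1,4) DD_nonneg] obtain g1 g2 where g: "L2 lborel g1" "L2 lborel g2"
     "weak_partial ?u 1 (\<lambda>x. complex_of_real (g1 x))" "weak_partial ?u 2 (\<lambda>x. complex_of_real (g2 x))"
     "nsq lborel g1 + nsq lborel g2 \<le> DD v" by blast
  note gc = L2_of_real[OF g(1)] L2_of_real[OF g(2)]
  have [measurable]: "v \<in> borel_measurable borel" "g1 \<in> borel_measurable borel" "g2 \<in> borel_measurable borel"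
    using a g by (auto simp: L2_def)
  have "(\<integral>\<^sup>+x. ennreal ((cmod (complex_of_real (g1 x)))\<^sup>2 + (cmod (complex_of_real (g2 x)))\<^sup>2 + (cmod (?u x))\<^sup>2
                 + ln (1 + norm x) * (cmod (?u x))\<^sup>2) \<partial>lborel) < \<infinity>"
  proof -
    have "integrable lborel (\<lambda>x. (g1 x)\<^sup>2 + (g2 x)\<^sup>2 + (v x)\<^sup>2 + ln (1 + norm x) * (v x)\<^sup>2)"
      using g a by (intro Bochner_Integration.integrable_add) (auto simp: L2_def)
    then have "(\<integral>\<^sup>+x. ennreal (norm ((g1 x)\<^sup>2 + (g2 x)\<^sup>2 + (v x)\<^sup>2 + ln (1 + norm x) * (v x)\<^sup>2)) \<partial>lborel) < \<infinity>"
      by (simp add: integrable_iff_bounded)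
    then show ?thesis by (simp add: abs_of_nonneg)
  qed
  then show "?u \<in> X_space"
    unfolding X_space_def mem_Collect_eq using g
    by (intro conjI exI[of _ "\<lambda>x. complex_of_real (g1 x)"] exI[of _ "\<lambda>x. complex_of_real (g2 x)"]) auto
  have D: "dirichlet ?u = nsq lborel g1 + nsq lborel g2"
    using dirichlet_eq[OF L2_of_real[OF a(1)] _ gc g(3,4)] pos by (simp add: nsq_of_real)
  have "Dn v \<le> ennreal (nsq lborel g1 + nsq lborel g2)"
  proof (rule Dn_le)
    show "J (1 / real (Suc n)) v \<le> ennreal (mom (1 / real (Suc n)) * (nsq lborel g1 + nsq lborel g2))" for n
      using J_le_gradient[OF L2_of_real[OF a(1)] gc g(3,4), of "1 / real (Suc n)"]
      by (simp add: J_of_real nsq_of_real)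
  qed (simp add: nsq_nonneg)
  from DD_le[OF this] g(5) D show "dirichlet ?u = DD v" by (simp add: nsq_nonneg)
  show "mass ?u = nsq lborel v" by (simp add: mass_def nsq_def)
qed

text \<open>The reverse triangle inequality shrinks every difference, hence every \<open>J\<close>,
  in place of a chain rule for the modulus. Positive mass makes \<open>dirichlet u\<close> well
  defined.\<close>

lemma cmod_admissible:
  assumes u: "u \<in> X_space" and pos: "mass u > 0"
  shows "admissible (\<lambda>x. cmod (u x))" "nsq lborel (\<lambda>x. cmod (u x)) = mass u"
    "DD (\<lambda>x. cmod (u x)) \<le> dirichlet u"
proof -
  from u obtain g1 g2 where [measurable]: "u \<in> borel_measurable borel" "g1 \<in> borel_measurable borel" "g2 \<in> borel_measurable borel"
    and w: "weak_partial u 1 g1" "weak_partial u 2 g2"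
    and fin: "(\<integral>\<^sup>+x. ennreal ((cmod (g1 x))\<^sup>2 + (cmod (g2 x))\<^sup>2 + (cmod (u x))\<^sup>2
                 + ln (1 + norm x) * (cmod (u x))\<^sup>2) \<partial>lborel) < \<infinity>"
    by (auto simp: X_space_def)
  have int: "integrable lborel f"
    if [measurable]: "f \<in> borel_measurable borel"
      and "\<And>x. \<bar>f x\<bar> \<le> (cmod (g1 x))\<^sup>2 + (cmod (g2 x))\<^sup>2 + (cmod (u x))\<^sup>2 + ln (1 + norm x) * (cmod (u x))\<^sup>2" for f :: "real^2 \<Rightarrow> real"
  proof (rule integrableI_bounded)
    have "(\<integral>\<^sup>+x. ennreal (norm (f x)) \<partial>lborel) \<le> (\<integral>\<^sup>+x. ennreal ((cmod (g1 x))\<^sup>2 + (cmod (g2 x))\<^sup>2 + (cmod (u x))\<^sup>2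
                 + ln (1 + norm x) * (cmod (u x))\<^sup>2) \<partial>lborel)"
      using that(2) by (intro nn_integral_mono ennreal_leI) simp
    with fin show "(\<integral>\<^sup>+x. ennreal (norm (f x)) \<partial>lborel) < \<infinity>" by (rule le_less_trans[rotated])
  qed simp
  have u2: "L2 lborel u" and g12: "L2 lborel g1" "L2 lborel g2"
    unfolding L2_def by (auto intro!: int)
  have "integrable lborel (\<lambda>x. ln (1 + norm x) * (cmod (u x))\<^sup>2)" by (auto intro!: int)
  moreover have vL: "L2 lborel (\<lambda>x. cmod (u x))" using u2 by (simp add: L2_def)
  moreover have Dn: "Dn (\<lambda>x. cmod (u x)) \<le> ennreal (nsq lborel g1 + nsq lborel g2)"
  proof (rule Dn_le)
    fix n
    have "J (1 / real (Suc n)) (\<lambda>x. cmod (u x)) \<le> J (1 / real (Suc n)) u"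
      unfolding J_def
    proof (intro nn_integral_mono mult_left_mono ennreal_leI)
      fix x h
      have "\<bar>cmod (u (x + h)) - cmod (u x)\<bar>\<^sup>2 \<le> (cmod (u (x + h) - u x))\<^sup>2"
        by (intro power_mono norm_triangle_ineq3) simp
      then show "(norm (cmod (u (x + h)) - cmod (u x)))\<^sup>2 \<le> (cmod (u (x + h) - u x))\<^sup>2" by simp
    qed simp
    also have "\<dots> \<le> ennreal (mom (1 / real (Suc n)) * (nsq lborel g1 + nsq lborel g2))"
      by (rule J_le_gradient[OF u2 g12 w]) simp
    finally show "J (1 / real (Suc n)) (\<lambda>x. cmod (u x)) \<le> \<dots>" .
  qed (simp add: nsq_nonneg)
  ultimately show "admissible (\<lambda>x. cmod (u x))"
    unfolding admissible_def by (auto intro: le_less_trans)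
  show "nsq lborel (\<lambda>x. cmod (u x)) = mass u" by (simp add: nsq_def mass_def)
  have "dirichlet u = nsq lborel g1 + nsq lborel g2"
    by (rule dirichlet_eq[OF u2 _ g12 w]) (use pos in \<open>simp add: nsq_def mass_def\<close>)
  with DD_le[OF Dn] show "DD (\<lambda>x. cmod (u x)) \<le> dirichlet u" by (simp add: nsq_nonneg)
qed

subsection \<open>The logarithmic interaction\<close>

lemma emeasure_ball_2: "r \<ge> 0 \<Longrightarrow> emeasure lborel (ball (c::real^2) r) = ennreal (pi * r\<^sup>2)"
  using emeasure_ball[of r c] unit_ball_vol_2 by simp

lemma nn_integral_sq:
  assumes "L2 lborel (v :: real^2 \<Rightarrow> real)" shows "(\<integral>\<^sup>+x. ennreal ((v x)\<^sup>2) \<partial>lborel) = ennreal (nsq lborel v)"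
  using nn_integral_nsq[OF assms] by simp

text \<open>Comparing \<open>v x\<close> with the values \<open>v (x + h)\<close> for \<open>h\<close> in the disc of radius \<open>sqrt s\<close>, most of which
  lie outside \<open>ball y s\<close>.\<close>
lemma local_mass_ball:
  assumes v: "L2 lborel v" and D: "Dn v \<le> ennreal D" "D \<ge> 0" and s: "s > 0"
  shows "(\<integral>\<^sup>+x. indicator (ball y s) x * ennreal ((v x)\<^sup>2) \<partial>lborel) \<le> ennreal (2 * s * (nsq lborel v + D))"
proof -
  have [measurable]: "v \<in> borel_measurable borel" using v by (simp add: L2_def)
  \<comment> \<open>This radius balances the terms: the disc of shifts has area \<open>pi s\<close>,
    the disc around \<open>y\<close> has area \<open>pi s^2\<close>, and squared translation norms
    are at most \<open>s D\<close>. Both contributions are of order \<open>s^2\<close>, and division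
    by \<open>pi s\<close> leaves order \<open>s\<close>.\<close>
  define t where "t = sqrt s"
  have t: "t > 0" "t\<^sup>2 = s" using s by (auto simp: t_def)
  let ?N = "nsq lborel v" and ?A = "\<integral>\<^sup>+x. indicator (ball y s) x * ennreal ((v x)\<^sup>2) \<partial>lborel"
  let ?s = "indicator (ball y s) :: real^2 \<Rightarrow> ennreal" and ?t = "indicator (ball 0 t) :: real^2 \<Rightarrow> ennreal"
  have "ennreal (pi * s) * ?A = (\<integral>\<^sup>+x. \<integral>\<^sup>+h. ?s x * ?t h * ennreal ((v x)\<^sup>2) \<partial>lborel \<partial>lborel)"
  proof -
    have "(\<integral>\<^sup>+h. ?s x * ?t h * ennreal ((v x)\<^sup>2) \<partial>lborel) = ennreal (pi * s) * (?s x * ennreal ((v x)\<^sup>2))" for x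
    proof -
      have "(\<integral>\<^sup>+h. ?s x * ?t h * ennreal ((v x)\<^sup>2) \<partial>lborel) = (\<integral>\<^sup>+h. (?s x * ennreal ((v x)\<^sup>2)) * ?t h \<partial>lborel)"
        by (simp add: mult_ac)
      also have "\<dots> = (?s x * ennreal ((v x)\<^sup>2)) * ennreal (pi * s)"
        using t by (subst nn_integral_cmult_indicator) (auto simp: emeasure_ball_2)
      finally show ?thesis by (simp add: mult_ac)
    qed
    then show ?thesis by (simp add: nn_integral_cmult)
  qed
  \<comment> \<open>In the first term the restriction on \<open>h\<close> is dropped, leaving the
    area of the disc around \<open>y\<close> times the full mass; in the second the restriction on
    \<open>x\<close> is dropped, leaving \<open>J t v\<close>.\<close>
  also have "\<dots> \<le> (\<integral>\<^sup>+x. \<integral>\<^sup>+h. (2 * ?s x) * ennreal ((v (x + h))\<^sup>2) + 2 * (?t h * ennreal ((norm (v (x + h) - v x))\<^sup>2)) \<partial>lborel \<partial>lborel)"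
  proof (intro nn_integral_mono)
    fix x h
    have "(v x)\<^sup>2 \<le> 2 * (v (x + h))\<^sup>2 + 2 * (norm (v (x + h) - v x))\<^sup>2"
      using norm_add_sq_le[of "v (x + h)" "v x - v (x + h)"] by (simp add: power2_commute)
    then have "ennreal ((v x)\<^sup>2) \<le> ennreal (2 * (v (x + h))\<^sup>2 + 2 * (norm (v (x + h) - v x))\<^sup>2)" by (rule ennreal_leI)
    also have "\<dots> = 2 * ennreal ((v (x + h))\<^sup>2) + 2 * ennreal ((norm (v (x + h) - v x))\<^sup>2)"
      by (simp add: ennreal_mult)
    finally show "?s x * ?t h * ennreal ((v x)\<^sup>2) \<le> (2 * ?s x) * ennreal ((v (x + h))\<^sup>2) + 2 * (?t h * ennreal ((norm (v (x + h) - v x))\<^sup>2))"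
      by (auto simp: indicator_def)
  qed
  also have "\<dots> = (\<integral>\<^sup>+x. (2 * ?s x) * ennreal ?N \<partial>lborel) + 2 * J t v"
  proof -
    have sh: "(\<integral>\<^sup>+h. ennreal ((v (x + h))\<^sup>2) \<partial>lborel) = ennreal ?N" for x
    proof -
      have "(\<integral>\<^sup>+h. ennreal ((v (h + x))\<^sup>2) \<partial>lborel) = ennreal ?N"
        using lborel_iso_nn_integral[OF lborel_iso_add[of x], where h="\<lambda>h. ennreal ((v h)\<^sup>2)"]
        by (simp add: nn_integral_sq[OF v])
      then show ?thesis by (simp only: add.commute)
    qed
    have "(\<integral>\<^sup>+h. (2 * ?s x) * ennreal ((v (x + h))\<^sup>2) + 2 * (?t h * ennreal ((norm (v (x + h) - v x))\<^sup>2)) \<partial>lborel)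
       = (2 * ?s x) * ennreal ?N + 2 * (\<integral>\<^sup>+h. ?t h * ennreal ((norm (v (x + h) - v x))\<^sup>2) \<partial>lborel)" for x
      by (simp add: nn_integral_add nn_integral_cmult sh)
    then show ?thesis by (simp add: nn_integral_add nn_integral_cmult J_def sh)
  qed
  also have "(\<integral>\<^sup>+x. (2 * ?s x) * ennreal ?N \<partial>lborel) = ennreal (2 * (pi * s\<^sup>2) * ?N)"
    using s nsq_nonneg[of lborel v]
    by (simp add: nn_integral_multc nn_integral_cmult emeasure_ball_2 ennreal_mult)
  also have "J t v \<le> (\<integral>\<^sup>+h. ennreal (s * D) * ?t h \<partial>lborel)"
    unfolding J_commute[OF \<open>v \<in> borel_measurable borel\<close>]
  proof (intro nn_integral_mono)
    fix h :: "real^2"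
    have "(\<integral>\<^sup>+x. ennreal ((norm (v (x + h) - v x))\<^sup>2) \<partial>lborel) \<le> ennreal (s * D)" if "h \<in> ball 0 t"
    proof -
      have "(\<integral>\<^sup>+x. ennreal ((norm (v (x + h) - v x))\<^sup>2) \<partial>lborel) = ennreal (nsq lborel (\<lambda>x. v (x + h) - v x))"
        by (rule nn_integral_nsq[OF L2_diff[OF L2_shift[OF v] v]])
      also have "\<dots> \<le> ennreal ((norm h)\<^sup>2 * D)" by (intro ennreal_leI Dn_translate[OF v D])
      also have "\<dots> \<le> ennreal (s * D)"
        using power_mono[of "norm h" t 2] that t(2) D(2) by (intro ennreal_leI mult_right_mono) auto
      finally show ?thesis .
    qed
    then show "?t h * (\<integral>\<^sup>+x. ennreal ((norm (v (x + h) - v x))\<^sup>2) \<partial>lborel) \<le> ennreal (s * D) * ?t h"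
      by (auto simp: indicator_def)
  qed
  also have "(\<integral>\<^sup>+h. ennreal (s * D) * ?t h \<partial>lborel) = ennreal (s * D * (pi * s))"
    using t s D(2) by (subst nn_integral_cmult_indicator) (auto simp: emeasure_ball_2 ennreal_mult)
  also have "ennreal (2 * (pi * s\<^sup>2) * ?N) + 2 * ennreal (s * D * (pi * s)) = ennreal (pi * s) * ennreal (2 * s * (?N + D))"
    using s D(2) nsq_nonneg[of lborel v]
    unfolding ennreal_numeral[symmetric]
    by (subst ennreal_mult[symmetric], simp, simp, subst ennreal_plus[symmetric], simp, simp,
        subst ennreal_mult[symmetric]) (simp_all add: algebra_simps power2_eq_square del: ennreal_plus)
  finally have "ennreal (pi * s) * ?A \<le> ennreal (pi * s) * ennreal (2 * s * (?N + D))"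
    by (simp add: add_left_mono mult_left_mono)
  then show ?thesis using s by (simp add: ennreal_mult_le_mult_iff)
qed

text \<open>The logarithm is the integral of \<open>1/s\<close> from \<open>r\<close> to
  \<open>\<delta>\<close>. Only an inequality holds: at \<open>r = 0\<close> division by zero makes
  the left side 0 while the right side diverges.\<close>

lemma log_layer_cake:
  assumes "\<delta> > 0" "r \<ge> 0"
  shows "ennreal (max 0 (ln (\<delta> / r))) \<le> (\<integral>\<^sup>+s. indicator {0<..\<delta>} s * indicator {r..} s * ennreal (1 / s) \<partial>lborel)"
proof (cases "0 < r \<and> r < \<delta>")
  case True
  have "(\<integral>\<^sup>+s. ennreal (1 / s) * indicator {r..\<delta>} s \<partial>lborel) = ennreal (ln \<delta> - ln r)"
    by (rule nn_integral_FTC_Icc) (use True in \<open>auto intro!: derivative_eq_intros\<close>)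
  moreover have "ennreal (1 / s) * indicator {r..\<delta>} s = indicator {0<..\<delta>} s * indicator {r..} s * ennreal (1 / s)" for s
    using True by (auto simp: indicator_def)
  moreover have "max 0 (ln (\<delta> / r)) = ln \<delta> - ln r" using True by (simp add: ln_div)
  ultimately show ?thesis by simp
next
  case False
  then consider "r = 0" | "r \<ge> \<delta>" using assms by force
  then have "max 0 (ln (\<delta> / r)) = 0"
    using assms by cases auto
  then show ?thesis by simp
qed

text \<open>The layer cake leaves the mass of a disc of radius \<open>s\<close> divided by
  \<open>s\<close>, which \<open>local_mass_ball\<close> bounds by a constant; integration up to
  \<open>\<delta>\<close> gives a bound of order \<open>\<delta>\<close>, uniform in
  \<open>y\<close>.\<close>

lemma log_tail:
  assumes v: "L2 lborel v" and D: "Dn v \<le> ennreal D" "D \<ge> 0" and \<delta>: "\<delta> > 0"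
  shows "(\<integral>\<^sup>+x. ennreal (max 0 (ln (\<delta> / dist x y)) * (v x)\<^sup>2) \<partial>lborel) \<le> ennreal (4 * \<delta> * (nsq lborel v + D))"
proof -
  have [measurable]: "v \<in> borel_measurable borel" using v by (simp add: L2_def)
  let ?N = "nsq lborel v"
  have "(\<integral>\<^sup>+x. ennreal (max 0 (ln (\<delta> / dist x y)) * (v x)\<^sup>2) \<partial>lborel)
     \<le> (\<integral>\<^sup>+x. \<integral>\<^sup>+s. (indicator {0<..\<delta>} s * indicator {dist x y..} s * ennreal (1 / s)) * ennreal ((v x)\<^sup>2) \<partial>lborel \<partial>lborel)"
  proof (intro nn_integral_mono)
    fix x
    have "ennreal (max 0 (ln (\<delta> / dist x y)) * (v x)\<^sup>2) = ennreal (max 0 (ln (\<delta> / dist x y))) * ennreal ((v x)\<^sup>2)"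
      by (simp add: ennreal_mult)
    also have "\<dots> \<le> (\<integral>\<^sup>+s. indicator {0<..\<delta>} s * indicator {dist x y..} s * ennreal (1 / s) \<partial>lborel) * ennreal ((v x)\<^sup>2)"
      by (intro mult_right_mono log_layer_cake \<delta>) auto
    also have "\<dots> = (\<integral>\<^sup>+s. (indicator {0<..\<delta>} s * indicator {dist x y..} s * ennreal (1 / s)) * ennreal ((v x)\<^sup>2) \<partial>lborel)"
      by (rule nn_integral_multc[symmetric]) measurable
    finally show "ennreal (max 0 (ln (\<delta> / dist x y)) * (v x)\<^sup>2) \<le> \<dots>" .
  qed
  also have "\<dots> = (\<integral>\<^sup>+x. \<integral>\<^sup>+s. indicator {0<..\<delta>} s * ennreal (1 / s) * (indicator {p. dist (fst p) y \<le> snd p} (x, s) * ennreal ((v x)\<^sup>2)) \<partial>lborel \<partial>lborel)"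
    by (intro nn_integral_cong) (auto simp: indicator_def)
  also have "\<dots> = (\<integral>\<^sup>+s. \<integral>\<^sup>+x. indicator {0<..\<delta>} s * ennreal (1 / s) * (indicator {p. dist (fst p) y \<le> snd p} (x, s) * ennreal ((v x)\<^sup>2)) \<partial>lborel \<partial>lborel)"
    by (rule lborel_pair.Fubini') measurable
  also have "\<dots> \<le> (\<integral>\<^sup>+s. ennreal (4 * (?N + D)) * indicator {0<..\<delta>} s \<partial>lborel)"
  proof (intro nn_integral_mono)
    fix s :: real
    show "(\<integral>\<^sup>+x. indicator {0<..\<delta>} s * ennreal (1 / s) * (indicator {p. dist (fst p) y \<le> snd p} (x, s) * ennreal ((v x)\<^sup>2)) \<partial>lborel)
       \<le> ennreal (4 * (?N + D)) * indicator {0<..\<delta>} s"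
    proof (cases "s \<in> {0<..\<delta>}")
      case True
      then have s: "s > 0" by simp
      \<comment> \<open>The closed disc of radius \<open>s\<close> is enlarged to the open disc of
        radius \<open>2 * s\<close>, which turns the constant 2 into 4.\<close>
      have "(\<integral>\<^sup>+x. indicator {0<..\<delta>} s * ennreal (1 / s) * (indicator {p. dist (fst p) y \<le> snd p} (x, s) * ennreal ((v x)\<^sup>2)) \<partial>lborel)
        \<le> (\<integral>\<^sup>+x. ennreal (1 / s) * (indicator (ball y (2 * s)) x * ennreal ((v x)\<^sup>2)) \<partial>lborel)"
        using s True by (intro nn_integral_mono) (auto simp: indicator_def dist_commute)
      also have "\<dots> = ennreal (1 / s) * (\<integral>\<^sup>+x. indicator (ball y (2 * s)) x * ennreal ((v x)\<^sup>2) \<partial>lborel)"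
        by (rule nn_integral_cmult) measurable
      also have "\<dots> \<le> ennreal (1 / s) * ennreal (2 * (2 * s) * (?N + D))"
        using s by (intro mult_left_mono local_mass_ball[OF v D]) auto
      also have "\<dots> = ennreal (4 * (?N + D))"
        using s D(2) nsq_nonneg[of lborel v] by (subst ennreal_mult[symmetric]) auto
      finally show ?thesis using True by simp
    qed simp
  qed
  also have "\<dots> = ennreal (4 * \<delta> * (?N + D))"
    using \<delta> D(2) nsq_nonneg[of lborel v]
    by (subst nn_integral_cmult_indicator, simp, simp del: ennreal_plus, subst ennreal_mult[symmetric])
      (auto simp: mult_ac simp del: ennreal_plus)
  finally show ?thesis .
qed

text \<open>The kernel is a parameter because \<open>ln\<close>, its positive part, its singular
  part, shifted cutoffs and constants are all compared with one another.\<close>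

definition IK :: "(real \<Rightarrow> real) \<Rightarrow> (real^2 \<Rightarrow> real) \<Rightarrow> real" where
  "IK \<kappa> v = (\<integral>p. \<kappa> (dist (fst p) (snd p)) * (v (fst p))\<^sup>2 * (v (snd p))\<^sup>2 \<partial>(lborel \<Otimes>\<^sub>M lborel))"

definition log_moment :: "(real^2 \<Rightarrow> real) \<Rightarrow> real" where
  "log_moment v = (\<integral>x. ln (1 + norm x) * (v x)\<^sup>2 \<partial>lborel)"

lemma log_moment_nonneg: "log_moment v \<ge> 0"
  unfolding log_moment_def by (intro integral_nonneg_AE) auto

lemma ln_dist_le: "max 0 (ln (dist x y)) \<le> ln (1 + norm x) + ln (1 + norm (y::real^2))"
proof (cases "x = y")
  case False
  have "dist x y \<le> norm x + norm y" unfolding dist_norm by (rule norm_triangle_ineq4)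
  also have "\<dots> \<le> (1 + norm x) * (1 + norm y)" by (simp add: algebra_simps)
  finally have "ln (dist x y) \<le> ln ((1 + norm x) * (1 + norm y))"
    using False by (intro ln_mono) auto
  also have "\<dots> = ln (1 + norm x) + ln (1 + norm y)"
    by (rule ln_mult_pos) (auto simp: add_pos_nonneg)
  finally show ?thesis by simp
qed simp

lemma abs_ln_split: assumes "(r::real) \<ge> 0" shows "\<bar>ln r\<bar> = max 0 (ln r) + max 0 (ln (1 / r))"
  using assms by (cases "r = 0") (auto simp: ln_div max_def)

lemma potential_bound:
  assumes v: "admissible v"
  shows "(\<integral>\<^sup>+x. ennreal (\<bar>ln (dist x y)\<bar> * (v x)\<^sup>2) \<partial>lborel)
     \<le> ennreal (4 * (nsq lborel v + DD v) + log_moment v + ln (1 + norm y) * nsq lborel v)"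
proof -
  note a = admissibleD[OF v]
  have [measurable]: "v \<in> borel_measurable borel" by (rule a)
  let ?N = "nsq lborel v"
  have "(\<integral>\<^sup>+x. ennreal (\<bar>ln (dist x y)\<bar> * (v x)\<^sup>2) \<partial>lborel)
    \<le> (\<integral>\<^sup>+x. ennreal (max 0 (ln (1 / dist x y)) * (v x)\<^sup>2) + ennreal (ln (1 + norm x) * (v x)\<^sup>2 + ln (1 + norm y) * (v x)\<^sup>2) \<partial>lborel)"
  proof (intro nn_integral_mono)
    fix x
    have "\<bar>ln (dist x y)\<bar> * (v x)\<^sup>2 \<le> (max 0 (ln (1 / dist x y)) + (ln (1 + norm x) + ln (1 + norm y))) * (v x)\<^sup>2"
      using ln_dist_le[of x y] abs_ln_split[of "dist x y"] by (intro mult_right_mono) auto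
    then have "ennreal (\<bar>ln (dist x y)\<bar> * (v x)\<^sup>2) \<le> ennreal (max 0 (ln (1 / dist x y)) * (v x)\<^sup>2 + (ln (1 + norm x) * (v x)\<^sup>2 + ln (1 + norm y) * (v x)\<^sup>2))"
      by (intro ennreal_leI) (simp add: algebra_simps)
    also have "\<dots> = ennreal (max 0 (ln (1 / dist x y)) * (v x)\<^sup>2) + ennreal (ln (1 + norm x) * (v x)\<^sup>2 + ln (1 + norm y) * (v x)\<^sup>2)"
      by (intro ennreal_plus) auto
    finally show "ennreal (\<bar>ln (dist x y)\<bar> * (v x)\<^sup>2) \<le> \<dots>" .
  qed
  also have "\<dots> = (\<integral>\<^sup>+x. ennreal (max 0 (ln (1 / dist x y)) * (v x)\<^sup>2) \<partial>lborel) + (\<integral>\<^sup>+x. ennreal (ln (1 + norm x) * (v x)\<^sup>2 + ln (1 + norm y) * (v x)\<^sup>2) \<partial>lborel)"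
    by (rule nn_integral_add) measurable
  also have "(\<integral>\<^sup>+x. ennreal (ln (1 + norm x) * (v x)\<^sup>2 + ln (1 + norm y) * (v x)\<^sup>2) \<partial>lborel)
     = ennreal (\<integral>x. ln (1 + norm x) * (v x)\<^sup>2 + ln (1 + norm y) * (v x)\<^sup>2 \<partial>lborel)"
    using a by (intro nn_integral_eq_integral Bochner_Integration.integrable_add integrable_mult_right) auto
  also have "(\<integral>x. ln (1 + norm x) * (v x)\<^sup>2 + ln (1 + norm y) * (v x)\<^sup>2 \<partial>lborel) = log_moment v + ln (1 + norm y) * ?N"
    using a by (simp add: log_moment_def nsq_def)
  also have "(\<integral>\<^sup>+x. ennreal (max 0 (ln (1 / dist x y)) * (v x)\<^sup>2) \<partial>lborel) \<le> ennreal (4 * 1 * (?N + DD v))"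
    by (rule log_tail[OF a(1,4) DD_nonneg]) simp
  finally show ?thesis
    using nsq_nonneg[of lborel v] DD_nonneg[of v] log_moment_nonneg[of v]
    by (simp add: add_right_mono add.assoc flip: ennreal_plus)
qed

text \<open>The potential at \<open>y\<close> grows only like \<open>ln (1 + norm y)\<close>, and
  the log moment of \<open>v\<close> absorbs this growth in the outer integral.\<close>

lemma IK_integrable:
  assumes v: "admissible v" and [measurable]: "\<kappa> \<in> borel_measurable borel"
    and \<kappa>: "\<And>r. r \<ge> 0 \<Longrightarrow> \<bar>\<kappa> r\<bar> \<le> a + \<bar>ln r\<bar>" and a0: "a \<ge> 0"
  shows "integrable (lborel \<Otimes>\<^sub>M lborel) (\<lambda>p. \<kappa> (dist (fst p) (snd p)) * (v (fst p))\<^sup>2 * (v (snd p))\<^sup>2)"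
proof -
  note ad = admissibleD[OF v]
  have [measurable]: "v \<in> borel_measurable borel" by (rule ad)
  let ?N = "nsq lborel v"
  define K0 where "K0 = a * ?N + (4 * (?N + DD v) + log_moment v)"
  have K00: "K0 \<ge> 0" unfolding K0_def using a0 nsq_nonneg[of lborel v] DD_nonneg[of v] log_moment_nonneg[of v] by simp
  have "(\<integral>\<^sup>+y. \<integral>\<^sup>+x. ennreal (norm (\<kappa> (dist y x) * (v y)\<^sup>2 * (v x)\<^sup>2)) \<partial>lborel \<partial>lborel)
     \<le> (\<integral>\<^sup>+y. ennreal (K0 * (v y)\<^sup>2 + ?N * (ln (1 + norm y) * (v y)\<^sup>2)) \<partial>lborel)"
  proof (intro nn_integral_mono)
    fix y
    have "(\<integral>\<^sup>+x. ennreal (norm (\<kappa> (dist y x) * (v y)\<^sup>2 * (v x)\<^sup>2)) \<partial>lborel)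
      \<le> (\<integral>\<^sup>+x. ennreal ((v y)\<^sup>2) * (ennreal a * ennreal ((v x)\<^sup>2) + ennreal (\<bar>ln (dist x y)\<bar> * (v x)\<^sup>2)) \<partial>lborel)"
    proof (intro nn_integral_mono)
      fix x
      have "norm (\<kappa> (dist y x) * (v y)\<^sup>2 * (v x)\<^sup>2) \<le> (v y)\<^sup>2 * (a * (v x)\<^sup>2 + \<bar>ln (dist x y)\<bar> * (v x)\<^sup>2)"
      proof -
        have "\<bar>\<kappa> (dist y x)\<bar> * ((v y)\<^sup>2 * (v x)\<^sup>2) \<le> (a + \<bar>ln (dist x y)\<bar>) * ((v y)\<^sup>2 * (v x)\<^sup>2)"
          using \<kappa>[of "dist y x"] by (intro mult_right_mono) (auto simp: dist_commute)
        then show ?thesis by (simp add: abs_mult algebra_simps)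
      qed
      then have "ennreal (norm (\<kappa> (dist y x) * (v y)\<^sup>2 * (v x)\<^sup>2)) \<le> ennreal ((v y)\<^sup>2 * (a * (v x)\<^sup>2 + \<bar>ln (dist x y)\<bar> * (v x)\<^sup>2))"
        by (rule ennreal_leI)
      also have "\<dots> = ennreal ((v y)\<^sup>2) * (ennreal a * ennreal ((v x)\<^sup>2) + ennreal (\<bar>ln (dist x y)\<bar> * (v x)\<^sup>2))"
        using a0 by (simp add: ennreal_mult)
      finally show "ennreal (norm (\<kappa> (dist y x) * (v y)\<^sup>2 * (v x)\<^sup>2)) \<le> \<dots>" .
    qed
    also have "\<dots> = ennreal ((v y)\<^sup>2) * (ennreal a * ennreal ?N + (\<integral>\<^sup>+x. ennreal (\<bar>ln (dist x y)\<bar> * (v x)\<^sup>2) \<partial>lborel))"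
      by (simp add: nn_integral_cmult nn_integral_add nn_integral_sq[OF ad(1)])
    also have "\<dots> \<le> ennreal ((v y)\<^sup>2) * (ennreal a * ennreal ?N + ennreal (4 * (?N + DD v) + log_moment v + ln (1 + norm y) * ?N))"
      by (intro mult_left_mono add_left_mono potential_bound[OF v]) auto
    also have "\<dots> = ennreal (K0 * (v y)\<^sup>2 + ?N * (ln (1 + norm y) * (v y)\<^sup>2))"
    proof -
      have "ennreal a * ennreal ?N + ennreal (4 * (?N + DD v) + log_moment v + ln (1 + norm y) * ?N) = ennreal (K0 + ln (1 + norm y) * ?N)"
        using a0 nsq_nonneg[of lborel v] DD_nonneg[of v] log_moment_nonneg[of v]
        by (subst ennreal_mult[symmetric], simp, simp, subst ennreal_plus[symmetric]) (auto simp: K0_def add.assoc)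
      then show ?thesis
        using K00 nsq_nonneg[of lborel v] by (simp add: ennreal_mult[symmetric] algebra_simps)
    qed
    finally show "(\<integral>\<^sup>+x. ennreal (norm (\<kappa> (dist y x) * (v y)\<^sup>2 * (v x)\<^sup>2)) \<partial>lborel) \<le> \<dots>" .
  qed
  also have "\<dots> = ennreal (\<integral>y. K0 * (v y)\<^sup>2 + ?N * (ln (1 + norm y) * (v y)\<^sup>2) \<partial>lborel)"
    using ad K00 nsq_nonneg[of lborel v]
    by (intro nn_integral_eq_integral Bochner_Integration.integrable_add integrable_mult_right) auto
  finally show ?thesis
    by (intro pair_integrableI) (auto simp: case_prod_unfold)
qed

lemma IK_mono:
  assumes "admissible v"
    "\<kappa> \<in> borel_measurable borel" "\<And>r. r \<ge> 0 \<Longrightarrow> \<bar>\<kappa> r\<bar> \<le> a + \<bar>ln r\<bar>" "a \<ge> 0"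
    "\<kappa>' \<in> borel_measurable borel" "\<And>r. r \<ge> 0 \<Longrightarrow> \<bar>\<kappa>' r\<bar> \<le> b + \<bar>ln r\<bar>" "b \<ge> 0"
    "\<And>r. r \<ge> 0 \<Longrightarrow> \<kappa> r \<le> \<kappa>' r"
  shows "IK \<kappa> v \<le> IK \<kappa>' v"
  unfolding IK_def
  by (intro integral_mono IK_integrable[OF assms(1-4)] IK_integrable[OF assms(1,5-7)] mult_right_mono assms(8)) auto

text \<open>Schur-type bound: for a nonnegative kernel, a uniform bound on the potential only has to
  be multiplied by the mass.\<close>

lemma IK_le:
  assumes v: "admissible v" and [measurable]: "\<kappa> \<in> borel_measurable borel"
    and \<kappa>: "\<And>r. r \<ge> 0 \<Longrightarrow> 0 \<le> \<kappa> r"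
    and B: "\<And>y. (\<integral>\<^sup>+x. ennreal (\<kappa> (dist x y) * (v x)\<^sup>2) \<partial>lborel) \<le> ennreal B" "B \<ge> 0"
  shows "IK \<kappa> v \<le> B * nsq lborel v"
proof -
  note ad = admissibleD[OF v]
  have [measurable]: "v \<in> borel_measurable borel" by (rule ad)
  let ?f = "\<lambda>p. \<kappa> (dist (fst p) (snd p)) * (v (fst p))\<^sup>2 * (v (snd p))\<^sup>2"
  have "(\<integral>\<^sup>+p. ennreal (?f p) \<partial>(lborel \<Otimes>\<^sub>M lborel)) = (\<integral>\<^sup>+y. \<integral>\<^sup>+x. ennreal (?f (y, x)) \<partial>lborel \<partial>lborel)"
    by (rule lborel.nn_integral_fst[symmetric]) measurable
  also have "\<dots> = (\<integral>\<^sup>+y. ennreal ((v y)\<^sup>2) * (\<integral>\<^sup>+x. ennreal (\<kappa> (dist x y) * (v x)\<^sup>2) \<partial>lborel) \<partial>lborel)"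
    using \<kappa> by (subst nn_integral_cmult[symmetric])
      (auto simp: ennreal_mult[symmetric] dist_commute mult_ac intro!: nn_integral_cong)
  also have "\<dots> \<le> (\<integral>\<^sup>+y. ennreal ((v y)\<^sup>2) * ennreal B \<partial>lborel)"
    by (intro nn_integral_mono mult_left_mono B) auto
  also have "\<dots> = ennreal (B * nsq lborel v)"
    using B(2) nsq_nonneg[of lborel v] by (subst nn_integral_multc) (auto simp: nn_integral_sq[OF ad(1)] ennreal_mult mult.commute)
  finally have "(\<integral>\<^sup>+p. ennreal (?f p) \<partial>(lborel \<Otimes>\<^sub>M lborel)) \<le> ennreal (B * nsq lborel v)" .
  from enn2real_mono[OF this ennreal_less_top]
  have "enn2real (\<integral>\<^sup>+p. ennreal (?f p) \<partial>(lborel \<Otimes>\<^sub>M lborel)) \<le> B * nsq lborel v"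
    using B(2) nsq_nonneg[of lborel v] by simp
  moreover have "IK \<kappa> v = enn2real (\<integral>\<^sup>+p. ennreal (?f p) \<partial>(lborel \<Otimes>\<^sub>M lborel))"
    unfolding IK_def using \<kappa> by (intro integral_eq_nn_integral) auto
  ultimately show ?thesis by simp
qed

lemma IK_log_tail_le:
  assumes v: "admissible v" and "\<delta> > 0"
  shows "IK (\<lambda>r. max 0 (ln (\<delta> / r))) v \<le> 4 * \<delta> * (nsq lborel v + DD v) * nsq lborel v"
  using log_tail[OF admissibleD(1,4)[OF v] DD_nonneg \<open>\<delta> > 0\<close>] assms(2) nsq_nonneg[of lborel v] DD_nonneg[of v]
  by (intro IK_le[OF v]) auto

lemma IK_const:
  assumes v: "admissible v" shows "IK (\<lambda>_. c) v = c * (nsq lborel v)\<^sup>2"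
proof -
  note ad = admissibleD[OF v]
  have int: "integrable (lborel \<Otimes>\<^sub>M lborel) (\<lambda>(x, y). c * (v x)\<^sup>2 * (v y)\<^sup>2)"
    using IK_integrable[OF v, of "\<lambda>_. c" "\<bar>c\<bar>"] by (simp add: case_prod_unfold)
  have "IK (\<lambda>_. c) v = (\<integral>x. \<integral>y. c * (v x)\<^sup>2 * (v y)\<^sup>2 \<partial>lborel \<partial>lborel)"
    unfolding IK_def using lborel_pair.integral_fst[OF int] by (simp add: case_prod_unfold)
  then show ?thesis by (simp add: nsq_def power2_eq_square)
qed

lemma log_tail_dominated:
  assumes "\<delta> > 0" "r \<ge> 0" shows "\<bar>max 0 (ln (\<delta> / r))\<bar> \<le> \<bar>ln \<delta>\<bar> + \<bar>ln (r::real)\<bar>"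
  using assms by (cases "r = 0") (auto simp: ln_div)

text \<open>Pointwise \<open>ln r \<ge> max 0 (ln r) - ln (1 / \<delta>) - max 0 (ln (\<delta> /
  r))\<close>: the singularity at 0 sits in the last term, whose energy carries the factor
  \<open>\<delta>\<close>.\<close>

lemma IK_ln_lower:
  assumes v: "admissible v" and \<delta>: "0 < \<delta>" "\<delta> \<le> 1"
  shows "IK ln v \<ge> IK (\<lambda>r. max 0 (ln r)) v - ln (1 / \<delta>) * (nsq lborel v)\<^sup>2 - 4 * \<delta> * (nsq lborel v + DD v) * nsq lborel v"
proof -
  let ?t = "\<lambda>r. max 0 (ln (\<delta> / r))"
  have i1: "integrable (lborel \<Otimes>\<^sub>M lborel) (\<lambda>p. max 0 (ln (dist (fst p) (snd p))) * (v (fst p))\<^sup>2 * (v (snd p))\<^sup>2)"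
    by (rule IK_integrable[OF v, where a=0]) auto
  have i2: "integrable (lborel \<Otimes>\<^sub>M lborel) (\<lambda>p. ln (1 / \<delta>) * (v (fst p))\<^sup>2 * (v (snd p))\<^sup>2)"
    by (rule IK_integrable[OF v, where \<kappa>="\<lambda>_. ln (1 / \<delta>)" and a="\<bar>ln (1 / \<delta>)\<bar>"]) auto
  have i3: "integrable (lborel \<Otimes>\<^sub>M lborel) (\<lambda>p. ?t (dist (fst p) (snd p)) * (v (fst p))\<^sup>2 * (v (snd p))\<^sup>2)"
    by (rule IK_integrable[OF v, where a="\<bar>ln \<delta>\<bar>"]) (use log_tail_dominated[OF \<delta>(1)] in auto)
  have pt: "max 0 (ln r) - ln (1 / \<delta>) - ?t r \<le> ln r" if "r \<ge> 0" for r
    using that \<delta> by (cases "r = 0") (auto simp: ln_div max_def ln_le_zero_iff)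
  have "IK (\<lambda>r. max 0 (ln r)) v - IK (\<lambda>_. ln (1 / \<delta>)) v - IK ?t v
     = (\<integral>p. max 0 (ln (dist (fst p) (snd p))) * (v (fst p))\<^sup>2 * (v (snd p))\<^sup>2 - ln (1 / \<delta>) * (v (fst p))\<^sup>2 * (v (snd p))\<^sup>2
          - ?t (dist (fst p) (snd p)) * (v (fst p))\<^sup>2 * (v (snd p))\<^sup>2 \<partial>(lborel \<Otimes>\<^sub>M lborel))"
    unfolding IK_def
    by (subst Bochner_Integration.integral_diff[OF Bochner_Integration.integrable_diff[OF i1 i2] i3],
        subst Bochner_Integration.integral_diff[OF i1 i2]) (rule refl)
  also have "\<dots> = IK (\<lambda>r. max 0 (ln r) - ln (1 / \<delta>) - ?t r) v"
    unfolding IK_def by (intro Bochner_Integration.integral_cong) (auto simp: algebra_simps)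
  also have "\<dots> \<le> IK ln v"
  proof (rule IK_mono[OF v, where a="2 * \<bar>ln \<delta>\<bar>" and b=0])
    fix r :: real assume "r \<ge> 0"
    then show "\<bar>max 0 (ln r) - ln (1 / \<delta>) - ?t r\<bar> \<le> 2 * \<bar>ln \<delta>\<bar> + \<bar>ln r\<bar>"
    proof (cases "r = 0")
      case False
      have "\<bar>max 0 L + d - max 0 (d - L)\<bar> \<le> 2 * \<bar>d\<bar> + \<bar>L\<bar>" if "d \<le> 0" for L d :: real
        using that by (auto simp: max_def abs_le_iff)
      from this[of "ln \<delta>" "ln r"] show ?thesis using \<delta> False \<open>r \<ge> 0\<close> by (simp add: ln_div)
    qed (use \<delta> in \<open>simp add: ln_div\<close>)
  qed (use pt in auto)
  finally show ?thesis
    using IK_log_tail_le[OF v \<delta>(1)] IK_const[OF v, of "ln (1 / \<delta>)"] by linarith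
qed

lemma energy_eq:
  assumes "admissible (\<lambda>x. cmod (u x))"
  shows "energy \<gamma> u = dirichlet u + \<gamma> / (4 * pi) * IK ln (\<lambda>x. cmod (u x))"
proof -
  have int: "integrable (lborel \<Otimes>\<^sub>M lborel) (\<lambda>(x, y). ln (dist x y) * (cmod (u x))\<^sup>2 * (cmod (u y))\<^sup>2)"
    using IK_integrable[OF assms, of ln 0] by (simp add: case_prod_unfold)
  show ?thesis
    unfolding energy_def IK_def using lborel_pair.integral_snd[OF int] by (simp add: case_prod_unfold)
qed

subsection \<open>Invariances and a priori bounds\<close>

lemma pair_iso_distr:
  assumes "lborel_iso \<sigma>" "lborel_iso \<tau>"
  shows "distr (lborel \<Otimes>\<^sub>M lborel) (borel \<Otimes>\<^sub>M borel) (\<lambda>(x, y). (\<sigma> x, \<tau> y)) = lborel \<Otimes>\<^sub>M lborel"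
proof -
  have [measurable]: "\<sigma> \<in> borel_measurable borel" "\<tau> \<in> borel_measurable borel"
    using assms by (auto simp: lborel_iso_def)
  have "distr lborel borel \<sigma> \<Otimes>\<^sub>M distr lborel borel \<tau> = distr (lborel \<Otimes>\<^sub>M lborel) (borel \<Otimes>\<^sub>M borel) (\<lambda>(x, y). (\<sigma> x, \<tau> y))"
    using assms by (intro pair_measure_distr) (auto simp: lborel_iso_def sigma_finite_lborel)
  then show ?thesis using assms by (simp add: lborel_iso_def)
qed

lemma pair_iso_measurable:
  assumes "lborel_iso \<sigma>" "lborel_iso \<tau>"
  shows "(\<lambda>(x, y). (\<sigma> x, \<tau> y)) \<in> (lborel \<Otimes>\<^sub>M lborel) \<rightarrow>\<^sub>M (borel \<Otimes>\<^sub>M borel)"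
proof -
  have [measurable]: "\<sigma> \<in> borel_measurable borel" "\<tau> \<in> borel_measurable borel"
    using assms by (auto simp: lborel_iso_def)
  show ?thesis by measurable
qed

lemma pair_iso_integral:
  fixes f :: "(real^2) \<times> (real^2) \<Rightarrow> real"
  assumes "lborel_iso \<sigma>" "lborel_iso \<tau>" and f: "f \<in> borel_measurable (borel \<Otimes>\<^sub>M borel)"
  shows "(\<integral>p. f (\<sigma> (fst p), \<tau> (snd p)) \<partial>(lborel \<Otimes>\<^sub>M lborel)) = (\<integral>p. f p \<partial>(lborel \<Otimes>\<^sub>M lborel))"
    and "integrable (lborel \<Otimes>\<^sub>M lborel) (\<lambda>p. f (\<sigma> (fst p), \<tau> (snd p))) \<longleftrightarrow> integrable (lborel \<Otimes>\<^sub>M lborel) f"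
  using integral_distr[OF pair_iso_measurable[OF assms(1,2)] f] integrable_distr_eq[OF pair_iso_measurable[OF assms(1,2)] f]
  unfolding pair_iso_distr[OF assms(1,2)] by (simp_all add: case_prod_unfold)

lemma pair_iso_nn_integral:
  fixes f :: "(real^2) \<times> (real^2) \<Rightarrow> ennreal"
  assumes "lborel_iso \<sigma>" "lborel_iso \<tau>" and f: "f \<in> borel_measurable (borel \<Otimes>\<^sub>M borel)"
  shows "(\<integral>\<^sup>+p. f (\<sigma> (fst p), \<tau> (snd p)) \<partial>(lborel \<Otimes>\<^sub>M lborel)) = (\<integral>\<^sup>+p. f p \<partial>(lborel \<Otimes>\<^sub>M lborel))"
  using nn_integral_distr[OF pair_iso_measurable[OF assms(1,2)], of f] f
  unfolding pair_iso_distr[OF assms(1,2)] by (simp add: case_prod_unfold)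

lemma IK_shift:
  assumes [measurable]: "v \<in> borel_measurable borel" "\<kappa> \<in> borel_measurable borel"
  shows "IK \<kappa> (\<lambda>x. v (x + c)) = IK \<kappa> v"
  unfolding IK_def
  using pair_iso_integral(1)[OF lborel_iso_add[of c] lborel_iso_add[of c],
      where f="\<lambda>p. \<kappa> (dist (fst p) (snd p)) * (v (fst p))\<^sup>2 * (v (snd p))\<^sup>2"]
  by (simp add: dist_norm)

lemma J_shift:
  assumes [measurable]: "v \<in> borel_measurable borel"
  shows "J \<epsilon> (\<lambda>x. v (x + c)) = J \<epsilon> v"
  unfolding J_def
  using lborel_iso_nn_integral[OF lborel_iso_add[of c], where h="\<lambda>x. \<integral>\<^sup>+h. indicator (ball 0 \<epsilon>) h * ennreal ((norm (v (x + h) - v x))\<^sup>2) \<partial>lborel"]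
  by (simp add: add_ac)

lemma Dn_shift: "v \<in> borel_measurable borel \<Longrightarrow> Dn (\<lambda>x. v (x + c)) = Dn v"
  by (simp add: Dn_def J_shift)

lemma ln_norm_add_le: "ln (1 + norm (x + c)) \<le> ln (1 + norm x) + ln (1 + norm c)" for x c :: "real^2"
proof -
  have "1 + norm (x + c) \<le> (1 + norm x) * (1 + norm c)"
    using norm_triangle_ineq[of x c] mult_nonneg_nonneg[OF norm_ge_zero[of x] norm_ge_zero[of c]]
    unfolding distrib_left distrib_right by linarith
  then have "ln (1 + norm (x + c)) \<le> ln ((1 + norm x) * (1 + norm c))" by (intro ln_mono) (auto simp: add_pos_nonneg)
  also have "\<dots> = ln (1 + norm x) + ln (1 + norm c)" by (rule ln_mult_pos) (auto simp: add_pos_nonneg)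
  finally show ?thesis .
qed

lemma log_moment_shift:
  assumes v: "admissible v"
  shows "integrable lborel (\<lambda>x. ln (1 + norm x) * (v (x + c))\<^sup>2)"
    and "log_moment (\<lambda>x. v (x + c)) = (\<integral>x. ln (1 + norm (x - c)) * (v x)\<^sup>2 \<partial>lborel)"
proof -
  note ad = admissibleD[OF v]
  have [measurable]: "v \<in> borel_measurable borel" by (rule ad)
  have "integrable lborel (\<lambda>x. ln (1 + norm (x - c)) * (v x)\<^sup>2)"
  proof (rule Bochner_Integration.integrable_bound)
    show "integrable lborel (\<lambda>x. ln (1 + norm x) * (v x)\<^sup>2 + ln (1 + norm c) * (v x)\<^sup>2)"
      using ad by (intro Bochner_Integration.integrable_add integrable_mult_right)
    show "AE x in lborel. norm (ln (1 + norm (x - c)) * (v x)\<^sup>2) \<le> norm (ln (1 + norm x) * (v x)\<^sup>2 + ln (1 + norm c) * (v x)\<^sup>2)"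
    proof (intro AE_I2)
      fix x
      have "ln (1 + norm (x - c)) * (v x)\<^sup>2 \<le> (ln (1 + norm x) + ln (1 + norm c)) * (v x)\<^sup>2"
        using ln_norm_add_le[of x "-c"] by (intro mult_right_mono) auto
      then show "norm (ln (1 + norm (x - c)) * (v x)\<^sup>2) \<le> norm (ln (1 + norm x) * (v x)\<^sup>2 + ln (1 + norm c) * (v x)\<^sup>2)"
        by (simp add: distrib_right)
    qed
  qed measurable
  then show "integrable lborel (\<lambda>x. ln (1 + norm x) * (v (x + c))\<^sup>2)"
    using lborel_iso_integral(2)[OF lborel_iso_add[of c], where h="\<lambda>x. ln (1 + norm (x - c)) * (v x)\<^sup>2"] by simp
  show "log_moment (\<lambda>x. v (x + c)) = (\<integral>x. ln (1 + norm (x - c)) * (v x)\<^sup>2 \<partial>lborel)"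
    unfolding log_moment_def
    using lborel_iso_integral(1)[OF lborel_iso_add[of c], where h="\<lambda>x. ln (1 + norm (x - c)) * (v x)\<^sup>2"] by simp
qed

lemma admissible_shift:
  assumes v: "admissible v" shows "admissible (\<lambda>x. v (x + c))"
  using v log_moment_shift(1)[OF v, of c] L2_shift[of v c] Dn_shift[of v c]
  by (auto simp: admissible_def L2_def)

lemma J_scale:
  assumes [measurable]: "v \<in> borel_measurable borel"
  shows "J \<epsilon> (\<lambda>x. s * v x) = ennreal (s\<^sup>2) * J \<epsilon> (v :: real^2 \<Rightarrow> real)"
proof -
  have "J \<epsilon> (\<lambda>x. s * v x) = (\<integral>\<^sup>+x. \<integral>\<^sup>+h. ennreal (s\<^sup>2) * (indicator (ball 0 \<epsilon>) h * ennreal ((norm (v (x + h) - v x))\<^sup>2)) \<partial>lborel \<partial>lborel)"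
    unfolding J_def
    by (intro nn_integral_cong) (auto simp: indicator_def ennreal_mult[symmetric] power_mult_distrib simp flip: right_diff_distrib)
  then show ?thesis by (simp add: nn_integral_cmult J_def)
qed

lemma admissible_scale:
  assumes v: "admissible v" and s: "s \<ge> 0"
  shows "admissible (\<lambda>x. s * v x)" "DD (\<lambda>x. s * v x) \<le> s\<^sup>2 * DD v"
    "nsq lborel (\<lambda>x. s * v x) = s\<^sup>2 * nsq lborel v" "IK \<kappa> (\<lambda>x. s * v x) = s^4 * IK \<kappa> v"
proof -
  note ad = admissibleD[OF v]
  have D: "Dn (\<lambda>x. s * v x) \<le> ennreal (s\<^sup>2 * DD v)"
  proof (rule Dn_le)
    fix n
    let ?e = "1 / real (Suc n)"
    have "J ?e (\<lambda>x. s * v x) = ennreal (s\<^sup>2) * J ?e v" by (rule J_scale[OF ad(2)])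
    also have "\<dots> \<le> ennreal (s\<^sup>2) * ennreal (mom ?e * DD v)"
      by (intro mult_left_mono Dn_bounds_J[OF ad(1,4) DD_nonneg]) auto
    also have "\<dots> = ennreal (mom ?e * (s\<^sup>2 * DD v))"
      using mom_pos[of ?e] DD_nonneg[of v] by (subst ennreal_mult[symmetric]) (auto simp: mult_ac)
    finally show "J ?e (\<lambda>x. s * v x) \<le> ennreal (mom ?e * (s\<^sup>2 * DD v))" .
  qed (simp add: DD_nonneg)
  then show "DD (\<lambda>x. s * v x) \<le> s\<^sup>2 * DD v" by (rule DD_le) (simp add: DD_nonneg)
  have "integrable lborel (\<lambda>x. s\<^sup>2 * (ln (1 + norm x) * (v x)\<^sup>2))" using ad(5) by (rule integrable_mult_right)
  then have "integrable lborel (\<lambda>x. ln (1 + norm x) * (s * v x)\<^sup>2)" by (simp add: power_mult_distrib mult_ac)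
  moreover have "L2 lborel (\<lambda>x. s * v x)" using L2_scaleR[OF ad(1), of s] by simp
  ultimately show "admissible (\<lambda>x. s * v x)"
    using D s ad(3) le_less_trans[OF D] by (auto simp: admissible_def)
  show "nsq lborel (\<lambda>x. s * v x) = s\<^sup>2 * nsq lborel v" using nsq_scaleR[of lborel s v] by simp
  have "IK \<kappa> (\<lambda>x. s * v x) = (\<integral>p. s^4 * (\<kappa> (dist (fst p) (snd p)) * (v (fst p))\<^sup>2 * (v (snd p))\<^sup>2) \<partial>(lborel \<Otimes>\<^sub>M lborel))"
    unfolding IK_def by (intro Bochner_Integration.integral_cong) (auto simp: power_mult_distrib power4_eq_xxxx power2_eq_square)
  then show "IK \<kappa> (\<lambda>x. s * v x) = s^4 * IK \<kappa> v" by (simp add: IK_def)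
qed

text \<open>For \<open>\<epsilon> \<le> 1\<close> the increments vanish unless
  \<open>norm x < 2\<close>; that disc has area 4 pi, and the disc integral of the square of
  \<open>norm h\<close> is \<open>2 * mom \<epsilon>\<close>.\<close>

lemma J_lipschitz_compact:
  fixes v :: "real^2 \<Rightarrow> real"
  assumes [measurable]: "v \<in> borel_measurable borel" and L: "\<And>x y. \<bar>v x - v y\<bar> \<le> norm (x - y)"
    and z: "\<And>x. norm x \<ge> 1 \<Longrightarrow> v x = 0" and e: "0 < \<epsilon>" "\<epsilon> \<le> 1"
  shows "J \<epsilon> v \<le> ennreal (mom \<epsilon> * (8 * pi))"
proof -
  let ?i = "indicator (ball 0 \<epsilon>) :: real^2 \<Rightarrow> ennreal"
  have "J \<epsilon> v \<le> (\<integral>\<^sup>+x. \<integral>\<^sup>+h. indicator (ball 0 2) (x::real^2) * (?i h * ennreal ((norm h)\<^sup>2)) \<partial>lborel \<partial>lborel)"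
    unfolding J_def
  proof (intro nn_integral_mono)
    fix x h :: "real^2"
    show "?i h * ennreal ((norm (v (x + h) - v x))\<^sup>2) \<le> indicator (ball 0 2) x * (?i h * ennreal ((norm h)\<^sup>2))"
    proof (cases "h \<in> ball 0 \<epsilon>")
      case True
      show ?thesis
      proof (cases "norm x < 2")
        case False
        have "norm (x + h) \<ge> 1" using norm_triangle_ineq2[of x "-h"] False True e by simp
        then show ?thesis using z[of x] z[of "x + h"] False by simp
      next
        case xx: True
        have "(norm (v (x + h) - v x))\<^sup>2 \<le> (norm h)\<^sup>2" using L[of "x + h" x] by (intro power_mono) auto
        then show ?thesis using True xx by (simp add: ennreal_leI)
      qed
    qed simp
  qed
  also have "\<dots> = (\<integral>\<^sup>+x. indicator (ball (0::real^2) 2) x * ennreal (mom \<epsilon> * 2) \<partial>lborel)"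
  proof -
    have "(\<integral>\<^sup>+h. ?i h * ennreal ((norm h)\<^sup>2) \<partial>lborel) = ennreal (mom \<epsilon> * 2)"
      using nn_ball_quadratic[of \<epsilon> "axis 1 1 :: real^2" "axis 2 1"] by (simp flip: vec2_axis)
    then show ?thesis by (simp add: nn_integral_cmult)
  qed
  also have "\<dots> = ennreal (mom \<epsilon> * (8 * pi))"
    using mom_pos[OF e(1)] by (subst nn_integral_multc) (auto simp: emeasure_ball_2 ennreal_mult[symmetric] mult_ac)
  finally show ?thesis .
qed

text \<open>A cone rescaled to the prescribed mass; it makes the infimum range over a nonempty
  set.\<close>

lemma admissible_exists:
  assumes "lam > 0" shows "\<exists>v. admissible v \<and> nsq lborel v = lam"
proof -
  define w where "w x = max 0 (1 - norm x)" for x :: "real^2"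
  have [measurable]: "w \<in> borel_measurable borel" unfolding w_def by measurable
  have L: "\<bar>w x - w y\<bar> \<le> norm (x - y)" for x y
    using norm_triangle_ineq3[of x y] by (auto simp: w_def max_def)
  have z: "w x = 0" if "norm x \<ge> 1" for x using that by (simp add: w_def)
  have b: "\<bar>w x\<bar> \<le> 1" for x by (simp add: w_def)
  have wL: "L2 lborel w" by (rule test_fun_L2[OF _ z b]) simp
  have D: "Dn w \<le> ennreal (8 * pi)"
    by (rule Dn_le) (auto intro!: J_lipschitz_compact L z)
  have "integrable lborel (\<lambda>x. ln (1 + norm x) * (w x)\<^sup>2)"
  proof (rule Bochner_Integration.integrable_bound)
    show "integrable lborel (\<lambda>x. (norm (w x))\<^sup>2)" using wL by (simp add: L2_def)
    show "AE x in lborel. norm (ln (1 + norm x) * (w x)\<^sup>2) \<le> norm ((norm (w x))\<^sup>2)"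
    proof (intro AE_I2)
      fix x :: "real^2"
      show "norm (ln (1 + norm x) * (w x)\<^sup>2) \<le> norm ((norm (w x))\<^sup>2)"
      proof (cases "norm x \<ge> 1")
        case False
        have "ln (1 + norm x) \<le> norm x" by (rule ln_add_one_self_le_self) simp
        then have "ln (1 + norm x) * (w x)\<^sup>2 \<le> 1 * (w x)\<^sup>2" using False by (intro mult_right_mono) auto
        then show ?thesis by simp
      qed (simp add: z)
    qed
  qed measurable
  with wL D have adm: "admissible w"
    by (auto simp: admissible_def w_def le_less_trans)
  have "nsq lborel w > 0"
  proof (rule ccontr)
    assume "\<not> nsq lborel w > 0"
    then have "(\<integral>\<^sup>+x. ennreal ((norm (w x))\<^sup>2) \<partial>lborel) = 0"
      using nn_integral_nsq[OF wL] nsq_nonneg[of lborel w] by simp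
    then have "AE x in lborel. ennreal ((norm (w x))\<^sup>2) = 0" by (subst (asm) nn_integral_0_iff_AE) auto
    then have "AE x in lborel. x \<notin> ball (0::real^2) 1" by eventually_elim (auto simp: w_def)
    then have "emeasure lborel (ball (0::real^2) 1) = 0"
      by (subst (asm) AE_iff_measurable[OF _ refl]) (auto simp: ball_def)
    then show False using emeasure_ball_2[of 1 0] by simp
  qed
  then have "nsq lborel (\<lambda>x. sqrt (lam / nsq lborel w) * w x) = lam"
    using assms by (subst admissible_scale(3)[OF adm]) auto
  moreover have "admissible (\<lambda>x. sqrt (lam / nsq lborel w) * w x)"
    by (rule admissible_scale(1)[OF adm]) (use assms nsq_nonneg[of lborel w] in auto)
  ultimately show ?thesis by blast
qed

section \<open>Coercivity of the functional and choice of a good centre\<close>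

definition FF :: "real \<Rightarrow> (real^2 \<Rightarrow> real) \<Rightarrow> real" where
  "FF c v = DD v + c * IK ln v"

lemma IK_pos_nonneg: "IK (\<lambda>r. max 0 (ln r)) v \<ge> 0"
  unfolding IK_def by (intro integral_nonneg_AE AE_I2) auto

lemma FF_coercive:
  assumes "c > 0" "lam > 0"
  shows "\<exists>C0\<ge>0. \<forall>v. admissible v \<longrightarrow> nsq lborel v = lam \<longrightarrow>
     DD v / 2 + c * IK (\<lambda>r. max 0 (ln r)) v - C0 \<le> FF c v"
proof -
  \<comment> \<open>Ensures \<open>8 * c * lam * \<delta> \<le> 1\<close>, so the singular part
    costs at most \<open>(lam + DD v) / 2\<close> and half of the Dirichlet energy survives.\<close>
  define \<delta> where "\<delta> = min 1 (1 / (8 * c * lam))"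
  have \<delta>: "0 < \<delta>" "\<delta> \<le> 1" using assms by (auto simp: \<delta>_def)
  have "8 * c * lam * \<delta> \<le> 8 * c * lam * (1 / (8 * c * lam))"
    using assms by (intro mult_left_mono) (auto simp: \<delta>_def)
  then have \<delta>c: "8 * c * lam * \<delta> \<le> 1" using assms by simp
  define C0 where "C0 = c * (ln (1 / \<delta>) * lam\<^sup>2) + lam / 2"
  have "C0 \<ge> 0" using assms \<delta> unfolding C0_def by (intro add_nonneg_nonneg mult_nonneg_nonneg) auto
  moreover have "DD v / 2 + c * IK (\<lambda>r. max 0 (ln r)) v - C0 \<le> FF c v" if v: "admissible v" "nsq lborel v = lam" for v
  proof -
    have "c * IK ln v \<ge> c * (IK (\<lambda>r. max 0 (ln r)) v - ln (1 / \<delta>) * lam\<^sup>2 - 4 * \<delta> * (lam + DD v) * lam)"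
      using IK_ln_lower[OF v(1) \<delta>] v(2) assms by (intro mult_left_mono) auto
    moreover have "c * (4 * \<delta> * (lam + DD v) * lam) \<le> (lam + DD v) / 2"
    proof -
      have "c * (4 * \<delta> * (lam + DD v) * lam) = (8 * c * lam * \<delta>) * ((lam + DD v) / 2)" by (simp add: algebra_simps)
      also have "\<dots> \<le> 1 * ((lam + DD v) / 2)" using \<delta>c assms DD_nonneg[of v] by (intro mult_right_mono) auto
      finally show ?thesis by simp
    qed
    ultimately show ?thesis unfolding FF_def C0_def by (simp add: algebra_simps add_divide_distrib)
  qed
  ultimately show ?thesis by blast
qed

text \<open>Averaging the log moment about \<open>y\<close> with weight \<open>(v y)^2\<close> gives
  the interaction with kernel \<open>ln (1 + r)\<close>, which is at most \<open>ln 2\<close> plus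
  the positive part of \<open>ln r\<close>. Some centre does no worse than the average; the added 1
  makes the contradiction strict.\<close>

lemma good_centre:
  assumes v: "admissible v" and lam: "nsq lborel v = lam" "lam > 0"
  shows "\<exists>y. log_moment (\<lambda>x. v (x + y)) \<le> (ln 2 * lam\<^sup>2 + IK (\<lambda>r. max 0 (ln r)) v + 1) / lam"
proof (rule ccontr)
  note ad = admissibleD[OF v]
  have [measurable]: "v \<in> borel_measurable borel" by (rule ad)
  let ?P = "IK (\<lambda>r. max 0 (ln r)) v"
  define K where "K = (ln 2 * lam\<^sup>2 + ?P + 1) / lam"
  assume "\<not> ?thesis"
  then have big: "log_moment (\<lambda>x. v (x + y)) > K" for y by (auto simp: K_def not_le)
  have K0: "K \<ge> 0" unfolding K_def using lam IK_pos_nonneg[of v] by simp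
  let ?k = "\<lambda>r. ln (1 + r)"
  have kb: "\<bar>?k r\<bar> \<le> ln 2 + \<bar>ln r\<bar>" if "r \<ge> 0" for r :: real
  proof (cases "r \<le> 1")
    case True
    then have "ln (1 + r) \<le> ln 2" "ln (1 + r) \<ge> 0" using that by (auto intro!: ln_mono)
    then show ?thesis by linarith
  next
    case False
    then have "ln (1 + r) \<le> ln (2 * r)" by (intro ln_mono) auto
    also have "\<dots> = ln 2 + ln r" using False by (intro ln_mult_pos) auto
    finally have "ln (1 + r) \<le> ln 2 + ln r" .
    moreover have "ln (1 + r) \<ge> 0" using that by simp
    ultimately show ?thesis by linarith
  qed
  have kb2: "?k r \<le> ln 2 + max 0 (ln r)" if "r \<ge> 0" for r :: real
    using kb[OF that] kb[of 1] that
  proof (cases "r \<le> 1")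
    case True
    then have "ln (1 + r) \<le> ln 2" using that by (intro ln_mono) auto
    then show ?thesis by simp
  qed auto
  have int: "integrable (lborel \<Otimes>\<^sub>M lborel) (\<lambda>p. ?k (dist (fst p) (snd p)) * (v (fst p))\<^sup>2 * (v (snd p))\<^sup>2)"
    by (rule IK_integrable[OF v]) (use kb in auto)
  have "IK ?k v \<le> IK (\<lambda>r. ln 2 + max 0 (ln r)) v"
    by (rule IK_mono[OF v, where a="ln 2" and b="ln 2"]) (use kb kb2 in \<open>auto simp: abs_le_iff\<close>)
  also have "\<dots> = ln 2 * lam\<^sup>2 + ?P"
  proof -
    have "IK (\<lambda>r. ln 2 + max 0 (ln r)) v = (\<integral>p. ln 2 * (v (fst p))\<^sup>2 * (v (snd p))\<^sup>2 + max 0 (ln (dist (fst p) (snd p))) * (v (fst p))\<^sup>2 * (v (snd p))\<^sup>2 \<partial>(lborel \<Otimes>\<^sub>M lborel))"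
      unfolding IK_def by (intro Bochner_Integration.integral_cong) (auto simp: algebra_simps)
    also have "\<dots> = IK (\<lambda>_. ln 2) v + ?P"
      unfolding IK_def
      by (rule Bochner_Integration.integral_add)
        (rule IK_integrable[OF v, where \<kappa>="\<lambda>_. ln 2" and a="ln 2"] IK_integrable[OF v, where \<kappa>="\<lambda>r. max 0 (ln r)" and a=0]; auto)+
    finally show ?thesis using IK_const[OF v, of "ln 2"] lam by simp
  qed
  finally have up: "IK ?k v \<le> ln 2 * lam\<^sup>2 + ?P" .
  have "IK ?k v = (\<integral>y. \<integral>x. ?k (dist x y) * (v x)\<^sup>2 * (v y)\<^sup>2 \<partial>lborel \<partial>lborel)"
    unfolding IK_def using lborel_pair.integral_snd[of "\<lambda>x y. ?k (dist x y) * (v x)\<^sup>2 * (v y)\<^sup>2"] int by (simp add: case_prod_unfold)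
  also have "\<dots> = (\<integral>y. log_moment (\<lambda>x. v (x + y)) * (v y)\<^sup>2 \<partial>lborel)"
    by (simp add: log_moment_shift(2)[OF v] dist_norm)
  also have "\<dots> \<ge> (\<integral>y. K * (v y)\<^sup>2 \<partial>lborel)"
  proof (rule integral_mono)
    have "integrable lborel (\<lambda>y. \<integral>x. ?k (dist x y) * (v x)\<^sup>2 * (v y)\<^sup>2 \<partial>lborel)"
      using int by (intro lborel_pair.integrable_snd) (simp add: case_prod_unfold)
    then show "integrable lborel (\<lambda>y. log_moment (\<lambda>x. v (x + y)) * (v y)\<^sup>2)"
      by (simp add: log_moment_shift(2)[OF v] dist_norm)
    show "integrable lborel (\<lambda>y. K * (v y)\<^sup>2)" using ad(6) by (rule integrable_mult_right)
    show "K * (v y)\<^sup>2 \<le> log_moment (\<lambda>x. v (x + y)) * (v y)\<^sup>2" for y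
      using big[of y] by (intro mult_right_mono) auto
  qed
  finally have "K * lam \<le> IK ?k v" using lam by (simp add: nsq_def)
  with up lam show False by (simp add: K_def)
qed

subsection \<open>Disc averages and compactness\<close>

definition disc_int :: "real \<Rightarrow> (real^2 \<Rightarrow> real) \<Rightarrow> real^2 \<Rightarrow> real" where
  "disc_int r v x = (\<integral>h. indicator (ball 0 r) h * v (x + h) \<partial>lborel)"

definition disc_avg :: "real \<Rightarrow> (real^2 \<Rightarrow> real) \<Rightarrow> real^2 \<Rightarrow> real" where
  "disc_avg r v x = disc_int r v x / (pi * r\<^sup>2)"

lemma disc_int_measurable [measurable]:
  assumes [measurable]: "v \<in> borel_measurable borel"
  shows "disc_int r v \<in> borel_measurable borel" "disc_avg r v \<in> borel_measurable borel"
  unfolding disc_int_def disc_avg_def by measurable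

lemma indicator_ball_L2:
  assumes "r \<ge> 0"
  shows "L2 lborel (indicator (ball (0::real^2) r) :: real^2 \<Rightarrow> real)"
    "nsq lborel (indicator (ball (0::real^2) r) :: real^2 \<Rightarrow> real) = pi * r\<^sup>2"
proof -
  show "L2 lborel (indicator (ball (0::real^2) r) :: real^2 \<Rightarrow> real)"
    by (rule test_fun_L2[where R=r and B=1]) (auto simp: indicator_def)
  have "(norm (indicator (ball (0::real^2) r) x :: real))\<^sup>2 = indicator (ball 0 r) x" for x :: "real^2"
    by (simp add: indicator_def)
  then show "nsq lborel (indicator (ball (0::real^2) r) :: real^2 \<Rightarrow> real) = pi * r\<^sup>2"
    using emeasure_ball_2[OF assms, of 0] assms by (simp add: nsq_def measure_def)
qed

lemma shift_left_L2: "L2 lborel v \<Longrightarrow> L2 lborel (\<lambda>h::real^2. v (x + h))"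
  using L2_shift[of v x] by (simp add: add.commute)

lemma nsq_shift_left: "v \<in> borel_measurable borel \<Longrightarrow> nsq lborel (\<lambda>h::real^2. v (x + h)) = nsq lborel v"
  using nsq_shift[of v x] by (simp add: add.commute)

lemma disc_int_bound:
  assumes v: "L2 lborel v" and r: "r \<ge> 0"
  shows "\<bar>disc_int r v x\<bar> \<le> sqrt pi * r * sqrt (nsq lborel v)"
  using L2_Cauchy_Schwarz[OF indicator_ball_L2(1)[OF r] shift_left_L2[OF v, of x]] nsq_shift_left[of v x] v r
  by (simp add: disc_int_def indicator_ball_L2(2) real_sqrt_mult L2_def)

lemma disc_int_diff:
  assumes v: "L2 lborel v" and w: "L2 lborel w" and r: "r \<ge> 0"
  shows "disc_int r v x - disc_int r w y = (\<integral>h. indicator (ball 0 r) h * (v (x + h) - w (y + h)) \<partial>lborel)"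
  unfolding disc_int_def right_diff_distrib
  using L2_inner_integrable[OF indicator_ball_L2(1)[OF r] shift_left_L2[OF v, of x]]
    L2_inner_integrable[OF indicator_ball_L2(1)[OF r] shift_left_L2[OF w, of y]]
  by (intro Bochner_Integration.integral_diff[symmetric]) auto

text \<open>A difference of disc integrals is the disc integral of a difference of translates, whose
  L2 norm is at most linear in the shift.\<close>

lemma disc_int_lipschitz:
  assumes v: "L2 lborel v" and D: "Dn v \<le> ennreal D" "D \<ge> 0" and r: "r \<ge> 0"
  shows "\<bar>disc_int r v x - disc_int r v y\<bar> \<le> sqrt pi * r * sqrt D * norm (x - y)"
proof -
  let ?w = "\<lambda>z. v (z + (x - y)) - v z"
  have w: "L2 lborel ?w" by (intro L2_diff L2_shift v)
  have "nsq lborel ?w \<le> (norm (x - y))\<^sup>2 * D" by (rule Dn_translate[OF v D])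
  then have sw: "sqrt (nsq lborel ?w) \<le> norm (x - y) * sqrt D"
    by (metis abs_norm_cancel real_sqrt_abs real_sqrt_le_iff real_sqrt_mult)
  have "disc_int r v x - disc_int r v y = disc_int r ?w y"
  proof -
    have "disc_int r ?w y = (\<integral>h. indicator (ball 0 r) h * (v (x + h) - v (y + h)) \<partial>lborel)"
      unfolding disc_int_def
    proof (intro Bochner_Integration.integral_cong refl)
      fix h
      have "y + h + (x - y) = x + h" by simp
      then show "indicator (ball 0 r) h * ?w (y + h) = indicator (ball 0 r) h * (v (x + h) - v (y + h))" by metis
    qed
    then show ?thesis using disc_int_diff[OF v v r] by simp
  qed
  also have "\<bar>disc_int r ?w y\<bar> \<le> sqrt pi * r * sqrt (nsq lborel ?w)" by (rule disc_int_bound[OF w r])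
  also have "\<dots> \<le> sqrt pi * r * (norm (x - y) * sqrt D)" using r sw by (intro mult_left_mono) auto
  finally show ?thesis by (simp add: mult_ac)
qed

lemma mom_le: assumes "r > 0" shows "mom r \<le> r\<^sup>2 * (pi * r\<^sup>2)"
proof -
  have "mom r \<le> (\<integral>h. r\<^sup>2 * indicator (ball (0::real^2) r) h \<partial>lborel)"
    unfolding mom_def
  proof (rule integral_mono)
    show "integrable lborel (\<lambda>h::real^2. indicator (ball 0 r) h * (h$1)\<^sup>2)"
      using ball_monomial_integrable[of r 1 1] by (simp add: power2_eq_square)
    show "integrable lborel (\<lambda>h::real^2. r\<^sup>2 * indicator (ball 0 r) h)"
      using emeasure_lborel_ball_finite[of "0::real^2" r] by (intro integrable_mult_right integrable_real_indicator) auto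
    fix h :: "real^2"
    have "h \<in> ball 0 r \<Longrightarrow> (h$1)\<^sup>2 \<le> r\<^sup>2"
      using component_le_norm_cart[of h 1] assms by (simp flip: abs_le_square_iff)
    then show "indicator (ball 0 r) h * (h$1)\<^sup>2 \<le> r\<^sup>2 * indicator (ball 0 r) h" by (simp add: indicator_def)
  qed
  also have "\<dots> = r\<^sup>2 * (pi * r\<^sup>2)" using emeasure_ball_2[of r 0] assms by (simp add: measure_def)
  finally show ?thesis .
qed

text \<open>Cauchy-Schwarz on the disc bounds the squared error by the mean squared increment, which
  integrates to \<open>J r v\<close> over the area; the rate depends on \<open>v\<close> only
  through \<open>D\<close>.\<close>

lemma disc_avg_approx:
  assumes v: "L2 lborel v" and D: "Dn v \<le> ennreal D" "D \<ge> 0" and r: "r > 0"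
  shows "L2 lborel (\<lambda>x. disc_avg r v x - v x)" "nsq lborel (\<lambda>x. disc_avg r v x - v x) \<le> r\<^sup>2 * D"
proof -
  have [measurable]: "v \<in> borel_measurable borel" using v by (simp add: L2_def)
  let ?i = "indicator (ball (0::real^2) r)" and ?m = "pi * r\<^sup>2"
  have m: "?m > 0" using r by simp
  have pt: "ennreal ((norm (disc_avg r v x - v x))\<^sup>2) \<le> ennreal (1 / ?m) * (\<integral>\<^sup>+h. ?i h * ennreal ((norm (v (x + h) - v x))\<^sup>2) \<partial>lborel)"
    (is "_ \<le> _ * ?R") for x
  proof (cases "?R = \<infinity>")
    case True then show ?thesis using r by (simp add: ennreal_mult_top)
  next
    case False
    define C where "C = enn2real ?R"
    have C: "?R = ennreal C" "C \<ge> 0" using False by (auto simp: C_def top.not_eq_extremum)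
    define q :: "real^2 \<Rightarrow> real" where "q h = ?i h * (v (x + h) - v x)" for h
    have [measurable]: "q \<in> borel_measurable borel" unfolding q_def by measurable
    have "(\<integral>\<^sup>+h. ennreal ((norm (q h))\<^sup>2) \<partial>lborel) = ?R"
      by (intro nn_integral_cong) (auto simp: indicator_def q_def)
    then have q: "L2 lborel q" "nsq lborel q \<le> C" using C L2_nn_integralI[of q lborel C] by auto
    have i0: "integrable lborel (\<lambda>h. ?i h * v x :: real)"
      using emeasure_lborel_ball_finite[of "0::real^2" r] by (intro integrable_mult_left integrable_real_indicator) auto
    have "(\<integral>h. ?i h \<bullet> q h \<partial>lborel) = (\<integral>h. ?i h * v (x + h) - ?i h * v x \<partial>lborel)"
      by (intro Bochner_Integration.integral_cong) (auto simp: q_def indicator_def)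
    also have "\<dots> = disc_int r v x - ?m * v x"
      unfolding disc_int_def
      using i0 L2_inner_integrable[OF indicator_ball_L2(1) shift_left_L2[OF v, of x], of r] r emeasure_ball_2[of r 0]
      by (subst Bochner_Integration.integral_diff) (auto simp: measure_def)
    finally have "\<bar>disc_int r v x - ?m * v x\<bar> \<le> sqrt ?m * sqrt (nsq lborel q)"
      using L2_Cauchy_Schwarz[OF indicator_ball_L2(1) q(1), of r] indicator_ball_L2(2)[of r] r by simp
    also have "\<dots> \<le> sqrt ?m * sqrt C" using q(2) m by (intro mult_left_mono) auto
    finally have "(disc_int r v x - ?m * v x)\<^sup>2 \<le> (sqrt ?m * sqrt C)\<^sup>2" by (rule abs_le_square_iff[THEN iffD1, OF order_trans]) simp
    then have le: "(disc_int r v x - ?m * v x)\<^sup>2 \<le> ?m * C" using m C by (simp add: power_mult_distrib)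
    have "(norm (disc_avg r v x - v x))\<^sup>2 = (disc_int r v x - ?m * v x)\<^sup>2 / ?m\<^sup>2"
      using r by (simp add: disc_avg_def power_divide[symmetric] diff_divide_distrib)
    also have "\<dots> \<le> ?m * C / ?m\<^sup>2" using le by (intro divide_right_mono) auto
    also have "\<dots> = (1 / ?m) * C" using m by (simp add: power2_eq_square)
    finally have "ennreal ((norm (disc_avg r v x - v x))\<^sup>2) \<le> ennreal ((1 / ?m) * C)" by (rule ennreal_leI)
    also have "\<dots> = ennreal (1 / ?m) * ennreal C" using C m by (intro ennreal_mult) auto
    finally show ?thesis using C by simp
  qed
  have "(\<integral>\<^sup>+x. ennreal ((norm (disc_avg r v x - v x))\<^sup>2) \<partial>lborel)
     \<le> (\<integral>\<^sup>+x. ennreal (1 / ?m) * (\<integral>\<^sup>+h. ?i h * ennreal ((norm (v (x + h) - v x))\<^sup>2) \<partial>lborel) \<partial>lborel)"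
    by (intro nn_integral_mono pt)
  also have "\<dots> = ennreal (1 / ?m) * J r v" unfolding J_def by (rule nn_integral_cmult) measurable
  also have "\<dots> \<le> ennreal (1 / ?m) * ennreal (mom r * D)" by (intro mult_left_mono Dn_bounds_J[OF v D r]) auto
  also have "\<dots> = ennreal (mom r * D / ?m)" using m mom_pos[OF r] D(2) by (subst ennreal_mult[symmetric]) auto
  also have "\<dots> \<le> ennreal (r\<^sup>2 * D)"
  proof (rule ennreal_leI)
    have "mom r * D / ?m \<le> r\<^sup>2 * ?m * D / ?m" using mom_le[OF r] D(2) m by (intro divide_right_mono mult_right_mono) auto
    then show "mom r * D / ?m \<le> r\<^sup>2 * D" using r by simp
  qed
  finally have *: "(\<integral>\<^sup>+x. ennreal ((norm (disc_avg r v x - v x))\<^sup>2) \<partial>lborel) \<le> ennreal (r\<^sup>2 * D)" .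
  show "L2 lborel (\<lambda>x. disc_avg r v x - v x)" "nsq lborel (\<lambda>x. disc_avg r v x - v x) \<le> r\<^sup>2 * D"
    using * D(2) by (auto intro!: L2_nn_integralI[where C="r\<^sup>2 * D"])
qed

lemma four_sq_le: "(a + b + c + d)\<^sup>2 \<le> 4 * (a\<^sup>2 + b\<^sup>2 + c\<^sup>2 + (d::real)\<^sup>2)"
  using zero_le_power2[of "a - b"] zero_le_power2[of "a - c"] zero_le_power2[of "a - d"]
    zero_le_power2[of "b - c"] zero_le_power2[of "b - d"] zero_le_power2[of "c - d"]
  by (simp add: power2_eq_square algebra_simps)

lemma integral_combination:
  fixes s t :: real
  assumes "integrable M f1" "integrable M f2" "integrable M f3" "integrable M f4" "integrable M f5" "integrable M f6"
  shows "(\<integral>x. s * (f1 x + f2 x + f3 x + f4 x) + t * (f5 x + f6 x) \<partial>M)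
    = s * (integral\<^sup>L M f1 + integral\<^sup>L M f2 + integral\<^sup>L M f3 + integral\<^sup>L M f4) + t * (integral\<^sup>L M f5 + integral\<^sup>L M f6)"
  using assms by simp

text \<open>Disc averages of a fixed radius are bounded and equi-Lipschitz, so a diagonal
  subsequence makes them converge at every point for every radius \<open>1 / (j + 1)\<close>. For
  the L2 distance of two terms, averaging costs \<open>r^2 * D\<close>, the averages converge on
  discs by dominated convergence, and outside a large disc the log moment controls the mass.\<close>

theorem compactness:
  fixes w :: "nat \<Rightarrow> real^2 \<Rightarrow> real"
  assumes w: "\<And>n. admissible (w n)" and lam: "\<And>n. nsq lborel (w n) = lam"
    and D: "\<And>n. DD (w n) \<le> D" and K: "\<And>n. log_moment (w n) \<le> K"
  shows "\<exists>k v. strict_mono k \<and> L2 lborel v \<and> (\<lambda>n. nsq lborel (\<lambda>x. w (k n) x - v x)) \<longlonglongrightarrow> 0"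
proof -
  have wL: "L2 lborel (w n)" for n by (rule admissibleD(1)[OF w])
  have wm [measurable]: "w n \<in> borel_measurable borel" for n by (rule admissibleD(2)[OF w])
  have lam0: "lam \<ge> 0" using lam[of 0] nsq_nonneg by metis
  have D0: "D \<ge> 0" using D[of 0] DD_nonneg[of "w 0"] by linarith
  have K0: "K \<ge> 0" using K[of 0] log_moment_nonneg[of "w 0"] by linarith
  have Dn: "Dn (w n) \<le> ennreal D" for n
    using admissibleD(4)[OF w, of n] D[of n] by (meson ennreal_leI order_trans)
  let ?r = "\<lambda>j::nat. 1 / real (Suc j)"
  obtain Q :: "(real^2) set" where Q: "countable Q" and "UNIV \<subseteq> closure Q"
    using separable[of "UNIV :: (real^2) set"] by metis
  then have Qd: "x \<in> closure Q" for x by blast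
  have bd: "norm (disc_int (?r (snd p)) (w n) (fst p)) \<le> sqrt pi * sqrt lam" for n and p :: "(real^2) \<times> nat"
  proof -
    have "\<bar>disc_int (?r (snd p)) (w n) (fst p)\<bar> \<le> sqrt pi * ?r (snd p) * sqrt lam"
      using disc_int_bound[OF wL, of "?r (snd p)" n "fst p"] lam by simp
    also have "\<dots> \<le> sqrt pi * 1 * sqrt lam" using lam0 by (intro mult_right_mono mult_left_mono) auto
    finally show ?thesis by simp
  qed
  \<comment> \<open>The diagonal selection runs over the countable set of pairs of a dense point and
    a radius index.\<close>
  obtain k where k: "strict_mono (k::nat\<Rightarrow>nat)"
    and kc: "\<And>p. p \<in> Q \<times> UNIV \<Longrightarrow> \<exists>l. (\<lambda>n. disc_int (?r (snd p)) (w (k n)) (fst p)) \<longlonglongrightarrow> l"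
    using function_convergent_subsequence[of "Q \<times> (UNIV::nat set)" "\<lambda>n p. disc_int (?r (snd p)) (w n) (fst p)" "sqrt pi * sqrt lam"]
      Q bd by auto
  have conv: "convergent (\<lambda>n. disc_int (?r j) (w (k n)) x)" for j x
  proof (rule Cauchy_convergent, rule CauchyI)
    fix e :: real assume "e > 0"
    define L where "L = sqrt pi * ?r j * sqrt D + 1"
    have L: "L > 0" unfolding L_def using D0 by (intro add_nonneg_pos mult_nonneg_nonneg) auto
    obtain q where q: "q \<in> Q" "dist q x < e / (4 * L)"
      using Qd[of x] \<open>e > 0\<close> L unfolding closure_approachable by (meson divide_pos_pos mult_pos_pos zero_less_numeral)
    have lip: "\<bar>disc_int (?r j) (w n) x - disc_int (?r j) (w n) q\<bar> < e / 4" for n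
    proof -
      have "\<bar>disc_int (?r j) (w n) x - disc_int (?r j) (w n) q\<bar> \<le> sqrt pi * ?r j * sqrt D * norm (x - q)"
        by (rule disc_int_lipschitz[OF wL Dn D0]) simp
      also have "\<dots> \<le> L * norm (x - q)" unfolding L_def by (intro mult_right_mono) auto
      also have "\<dots> < L * (e / (4 * L))" using q(2) L by (intro mult_strict_left_mono) (auto simp: dist_norm norm_minus_commute)
      finally show ?thesis using L by simp
    qed
    have "Cauchy (\<lambda>n. disc_int (?r j) (w (k n)) q)"
      using kc[of "(q, j)"] q(1) by (intro convergent_Cauchy) (simp add: convergent_def)
    then obtain N where N: "\<And>m n. m \<ge> N \<Longrightarrow> n \<ge> N \<Longrightarrow> norm (disc_int (?r j) (w (k m)) q - disc_int (?r j) (w (k n)) q) < e / 2"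
      using CauchyD[of _ "e/2"] \<open>e > 0\<close> by (metis half_gt_zero)
    show "\<exists>M. \<forall>m\<ge>M. \<forall>n\<ge>M. norm (disc_int (?r j) (w (k m)) x - disc_int (?r j) (w (k n)) x) < e"
    proof (intro exI[of _ N] allI impI)
      fix m n assume "m \<ge> N" "n \<ge> N"
      from N[OF this] lip[of "k m"] lip[of "k n"]
      show "norm (disc_int (?r j) (w (k m)) x - disc_int (?r j) (w (k n)) x) < e"
        unfolding real_norm_def by linarith
    qed
  qed
  define a where "a j x = lim (\<lambda>n. disc_avg (?r j) (w (k n)) x)" for j x
  have avlim: "(\<lambda>n. disc_avg (?r j) (w (k n)) x) \<longlonglongrightarrow> a j x" for j x
  proof -
    have "convergent (\<lambda>n. disc_int (?r j) (w (k n)) x * inverse (pi * (?r j)\<^sup>2))"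
      by (intro convergent_mult conv convergent_const)
    then have "convergent (\<lambda>n. disc_avg (?r j) (w (k n)) x)"
      by (simp only: disc_avg_def divide_inverse[of "disc_int _ _ _"])
    then show ?thesis unfolding a_def by (simp add: convergent_LIMSEQ_iff)
  qed
  have [measurable]: "a j \<in> borel_measurable borel" for j
    unfolding a_def by (rule borel_measurable_lim_metric) measurable
  have ball0: "(\<lambda>n. \<integral>x. indicator (ball 0 R) x * (disc_avg (?r j) (w (k n)) x - a j x)\<^sup>2 \<partial>lborel) \<longlonglongrightarrow> 0"
    and balli: "integrable lborel (\<lambda>x. indicator (ball 0 R) x * (disc_avg (?r j) (w (k n)) x - a j x)\<^sup>2)" for R j n
  proof -
    define B where "B = sqrt pi * sqrt lam / (pi * (?r j)\<^sup>2)"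
    have avb: "\<bar>disc_avg (?r j) (w n) x\<bar> \<le> B" for n x
      using bd[of "(x, j)" n] unfolding disc_avg_def B_def by (simp add: divide_right_mono)
    have ab: "\<bar>a j x\<bar> \<le> B" for x
      by (rule LIMSEQ_le_const2[OF tendsto_rabs[OF avlim[of j x]]]) (use avb in auto)
    have sqb: "(disc_avg (?r j) (w (k n)) x - a j x)\<^sup>2 \<le> (2 * B)\<^sup>2" for n x
    proof -
      have "\<bar>disc_avg (?r j) (w (k n)) x - a j x\<bar> \<le> 2 * B" using avb[of "k n" x] ab[of x] by linarith
      then show ?thesis by (rule abs_le_square_iff[THEN iffD1, OF order_trans]) simp
    qed
    show "integrable lborel (\<lambda>x. indicator (ball 0 R) x * (disc_avg (?r j) (w (k n)) x - a j x)\<^sup>2)" for n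
      by (rule integrable_ball_mult[where C="(2 * B)\<^sup>2"]) (use sqb in auto)
    have "(\<lambda>n. \<integral>x. indicator (ball 0 R) x * (disc_avg (?r j) (w (k n)) x - a j x)\<^sup>2 \<partial>lborel) \<longlonglongrightarrow> (\<integral>x. indicator (ball (0::real^2) R) x * 0 \<partial>lborel)"
    proof (rule integral_dominated_convergence)
      show "integrable lborel (\<lambda>x. indicator (ball (0::real^2) R) x * (2 * B)\<^sup>2)"
        by (rule integrable_ball_mult[where C="(2 * B)\<^sup>2"]) auto
      show "AE x in lborel. (\<lambda>n. indicator (ball 0 R) x * (disc_avg (?r j) (w (k n)) x - a j x)\<^sup>2) \<longlonglongrightarrow> indicator (ball (0::real^2) R) x * 0"
      proof (intro AE_I2 tendsto_mult tendsto_const)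
        fix x
        have "(\<lambda>n. (disc_avg (?r j) (w (k n)) x - a j x)\<^sup>2) \<longlonglongrightarrow> (a j x - a j x)\<^sup>2" by (intro tendsto_intros avlim)
        then show "(\<lambda>n. (disc_avg (?r j) (w (k n)) x - a j x)\<^sup>2) \<longlonglongrightarrow> 0" by simp
      qed
      show "AE x in lborel. norm (indicator (ball 0 R) x * (disc_avg (?r j) (w (k n)) x - a j x)\<^sup>2) \<le> indicator (ball 0 R) x * (2 * B)\<^sup>2" for n
        using sqb by (intro AE_I2) (auto simp: indicator_def)
    qed measurable
    then show "(\<lambda>n. \<integral>x. indicator (ball 0 R) x * (disc_avg (?r j) (w (k n)) x - a j x)\<^sup>2 \<partial>lborel) \<longlonglongrightarrow> 0" by simp
  qed
  define \<delta> where "\<delta> R j n = (\<integral>x. indicator (ball 0 R) x * (disc_avg (?r j) (w (k n)) x - a j x)\<^sup>2 \<partial>lborel)" for R j n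
  \<comment> \<open>Inside radius \<open>R\<close> there are two averaging errors and two distances
    of averages to their limit; outside, \<open>ln (1 + norm x) / ln (1 + R)\<close> is at least
    1.\<close>
  have est: "nsq lborel (\<lambda>x. w (k m) x - w (k n) x) \<le> 4 * ((?r j)\<^sup>2 * D + \<delta> R j m + \<delta> R j n + (?r j)\<^sup>2 * D) + 4 * K / ln (1 + R)"
    if R: "R > 0" for m n j R
  proof -
    let ?A = "\<lambda>n x. disc_avg (?r j) (w (k n)) x"
    have lR: "ln (1 + R) > 0" using R by simp
    have i1: "integrable lborel (\<lambda>x. (?A n x - w (k n) x)\<^sup>2)" and n1: "(\<integral>x. (?A n x - w (k n) x)\<^sup>2 \<partial>lborel) \<le> (?r j)\<^sup>2 * D" for n
      using disc_avg_approx[OF wL Dn D0, of "?r j" "k n"] by (auto simp: L2_def nsq_def)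
    have i2: "integrable lborel (\<lambda>x. ln (1 + norm x) * (w (k n) x)\<^sup>2)" for n by (rule admissibleD(5)[OF w])
    let ?g = "\<lambda>x. 4 * ((?A m x - w (k m) x)\<^sup>2 + indicator (ball 0 R) x * (?A m x - a j x)\<^sup>2 + indicator (ball 0 R) x * (?A n x - a j x)\<^sup>2 + (?A n x - w (k n) x)\<^sup>2)
        + (2 / ln (1 + R)) * (ln (1 + norm x) * (w (k m) x)\<^sup>2 + ln (1 + norm x) * (w (k n) x)\<^sup>2)"
    have ig: "integrable lborel ?g"
      by (intro Bochner_Integration.integrable_add integrable_mult_right i1 i2 balli)
    have "nsq lborel (\<lambda>x. w (k m) x - w (k n) x) \<le> (\<integral>x. ?g x \<partial>lborel)"
      unfolding nsq_def
    proof (rule integral_mono[OF L2_integrable[OF L2_diff[OF wL wL]] ig])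
      fix x
      show "(norm (w (k m) x - w (k n) x))\<^sup>2 \<le> ?g x"
      proof (cases "norm x < R")
        case True
        have "(w (k m) x - w (k n) x)\<^sup>2 = ((w (k m) x - ?A m x) + (?A m x - a j x) + (a j x - ?A n x) + (?A n x - w (k n) x))\<^sup>2" by simp
        also have "\<dots> \<le> 4 * ((w (k m) x - ?A m x)\<^sup>2 + (?A m x - a j x)\<^sup>2 + (a j x - ?A n x)\<^sup>2 + (?A n x - w (k n) x)\<^sup>2)"
          by (rule four_sq_le)
        also have "\<dots> \<le> ?g x" using True lR by (simp add: power2_commute)
        finally show ?thesis by simp
      next
        case False
        have l: "1 \<le> ln (1 + norm x) / ln (1 + R)" using False R lR by (simp add: ln_mono)
        have "(norm (w (k m) x - w (k n) x))\<^sup>2 \<le> 2 * (w (k m) x)\<^sup>2 + 2 * (w (k n) x)\<^sup>2"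
          using norm_add_sq_le[of "w (k m) x" "- w (k n) x"] by simp
        also have "\<dots> = 1 * (2 * ((w (k m) x)\<^sup>2 + (w (k n) x)\<^sup>2))" by simp
        also have "\<dots> \<le> (ln (1 + norm x) / ln (1 + R)) * (2 * ((w (k m) x)\<^sup>2 + (w (k n) x)\<^sup>2))"
          by (rule mult_right_mono[OF l]) simp
        also have "\<dots> = (2 / ln (1 + R)) * (ln (1 + norm x) * (w (k m) x)\<^sup>2 + ln (1 + norm x) * (w (k n) x)\<^sup>2)"
          by (simp add: field_simps)
        also have "\<dots> \<le> ?g x" by simp
        finally show ?thesis .
      qed
    qed
    also have "\<dots> = 4 * ((\<integral>x. (?A m x - w (k m) x)\<^sup>2 \<partial>lborel) + \<delta> R j m + \<delta> R j n + (\<integral>x. (?A n x - w (k n) x)\<^sup>2 \<partial>lborel))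
        + (2 / ln (1 + R)) * (log_moment (w (k m)) + log_moment (w (k n)))"
      unfolding \<delta>_def log_moment_def
      by (rule integral_combination) (rule i1 i2 balli)+
    also have "\<dots> \<le> 4 * ((?r j)\<^sup>2 * D + \<delta> R j m + \<delta> R j n + (?r j)\<^sup>2 * D) + (2 / ln (1 + R)) * (K + K)"
      using n1[of m] n1[of n] K[of "k m"] K[of "k n"] lR by (intro add_mono mult_left_mono) auto
    finally show ?thesis by simp
  qed
  have "\<exists>v. L2 lborel v \<and> (\<lambda>n. nsq lborel (\<lambda>x. w (k n) x - v x)) \<longlonglongrightarrow> 0"
  proof (rule L2_complete)
    show "L2 lborel (w (k n))" for n by (rule wL)
    fix e :: real assume e: "e > 0"
    obtain R where R: "R > 0" "4 * K / ln (1 + R) < e / 4"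
    proof
      \<comment> \<open>Chosen so that \<open>ln (1 + ?R)\<close> equals
        \<open>16 * K / e + 1\<close>.\<close>
      let ?R = "exp (16 * K / e + 1) - 1"
      show "?R > 0" using K0 e by (simp add: add_nonneg_pos)
      have "16 * K / e + 1 > 0" using K0 e by (simp add: add_nonneg_pos)
      then show "4 * K / ln (1 + ?R) < e / 4" using e K0 by (simp add: field_simps)
    qed
    obtain j :: nat where j: "8 * ((?r j)\<^sup>2 * D) < e / 4"
    proof -
      obtain j :: nat where "32 * D / e < j" using reals_Archimedean2 by blast
      then have jj: "32 * D / e < real (Suc j)" by simp
      have "8 * ((?r j)\<^sup>2 * D) \<le> 8 * (?r j * D)"
        using D0 power_decreasing[of 1 2 "?r j"] by (intro mult_left_mono mult_right_mono) auto
      also have "\<dots> < e / 4" using jj e by (simp add: field_simps)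
      finally show ?thesis by (rule that)
    qed
    obtain N where N: "\<And>n. n \<ge> N \<Longrightarrow> \<delta> R j n < e / 16"
      using order_tendstoD(2)[OF ball0[of R j], of "e/16"] e unfolding \<delta>_def eventually_sequentially by auto
    show "\<exists>N. \<forall>m\<ge>N. \<forall>n\<ge>N. nsq lborel (\<lambda>x. w (k m) x - w (k n) x) < e"
    proof (intro exI[of _ N] allI impI)
      fix m n assume "m \<ge> N" "n \<ge> N"
      then have N': "\<delta> R j m < e / 16" "\<delta> R j n < e / 16" using N by auto
      define A where "A = (?r j)\<^sup>2 * D"
      define B where "B = 4 * K / ln (1 + R)"
      define X where "X = nsq lborel (\<lambda>x. w (k m) x - w (k n) x)"
      have "X \<le> 4 * (A + \<delta> R j m + \<delta> R j n + A) + B"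
        unfolding X_def A_def B_def by (rule est[OF R(1)])
      moreover have "8 * A < e / 4" "B < e / 4" using j R(2) by (simp_all only: A_def B_def)
      ultimately have "X < e" using N' by (simp add: field_simps)
      then show "nsq lborel (\<lambda>x. w (k m) x - w (k n) x) < e" by (simp only: X_def)
    qed
  qed
  with k show ?thesis by blast
qed

subsection \<open>Existence of a minimiser\<close>

lemma lborel_iso_add_left: "lborel_iso (\<lambda>h. x + h)"
  using lborel_iso_add[of x] by (simp add: add.commute)

lemma AE_lborel_pair:
  assumes "AE x in lborel. P (x :: real^2)"
  shows "AE p in lborel \<Otimes>\<^sub>M lborel. P (fst p) \<and> P (snd p)"
proof -
  from AE_E3[OF assms] obtain N where N: "N \<in> null_sets lborel" "\<And>x. x \<notin> N \<Longrightarrow> P x" by auto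
  have "N \<times> UNIV \<union> UNIV \<times> N \<in> null_sets (lborel \<Otimes>\<^sub>M lborel)"
    using N(1) by (intro null_sets.Un) (auto simp: null_sets_def lborel.emeasure_pair_measure_Times)
  then show ?thesis
  proof (rule AE_I', intro subsetI)
    fix p assume "p \<in> {p \<in> space (lborel \<Otimes>\<^sub>M lborel). \<not> (P (fst p) \<and> P (snd p))}"
    then have "fst p \<in> N \<or> snd p \<in> N" using N(2) by blast
    then show "p \<in> N \<times> UNIV \<union> UNIV \<times> N" by (cases p) auto
  qed
qed

lemma nn_fatou_AE:
  assumes [measurable]: "\<And>n. f n \<in> borel_measurable M"
    and lim: "AE x in M. (\<lambda>n. f n x) \<longlonglongrightarrow> (g x :: ennreal)"
  shows "(\<integral>\<^sup>+x. g x \<partial>M) \<le> liminf (\<lambda>n. \<integral>\<^sup>+x. f n x \<partial>M)"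
proof -
  have "(\<integral>\<^sup>+x. g x \<partial>M) = (\<integral>\<^sup>+x. liminf (\<lambda>n. f n x) \<partial>M)"
    by (rule nn_integral_cong_AE, use lim in eventually_elim) (metis lim_imp_Liminf sequentially_bot)
  also have "\<dots> \<le> liminf (\<lambda>n. \<integral>\<^sup>+x. f n x \<partial>M)" by (rule nn_integral_liminf) measurable
  finally show ?thesis .
qed

lemma J_fatou:
  fixes z :: "nat \<Rightarrow> real^2 \<Rightarrow> real"
  assumes [measurable]: "\<And>n. z n \<in> borel_measurable borel" "v \<in> borel_measurable borel"
    and lim: "AE x in lborel. (\<lambda>n. z n x) \<longlonglongrightarrow> v x"
  shows "J \<epsilon> v \<le> liminf (\<lambda>n. J \<epsilon> (z n))"
proof -
  let ?q = "\<lambda>u x. \<integral>\<^sup>+h. indicator (ball 0 \<epsilon>) h * ennreal ((norm (u (x + h) - u x :: real))\<^sup>2) \<partial>lborel"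
  have "J \<epsilon> v \<le> (\<integral>\<^sup>+x. liminf (\<lambda>n. ?q (z n) x) \<partial>lborel)"
    unfolding J_def
  proof (rule nn_integral_mono_AE, use lim in eventually_elim)
    case (elim x)
    show "?q v x \<le> liminf (\<lambda>n. ?q (z n) x)"
    proof (rule nn_fatou_AE)
      show "AE h in lborel. (\<lambda>n. indicator (ball 0 \<epsilon>) h * ennreal ((norm (z n (x + h) - z n x))\<^sup>2))
         \<longlonglongrightarrow> indicator (ball 0 \<epsilon>) h * ennreal ((norm (v (x + h) - v x))\<^sup>2)"
        using lborel_iso_AE[OF lborel_iso_add_left lim, of x]
      proof eventually_elim
        case e2: (elim h)
        have "(\<lambda>n. ennreal ((norm (z n (x + h) - z n x))\<^sup>2)) \<longlonglongrightarrow> ennreal ((norm (v (x + h) - v x))\<^sup>2)"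
          by (intro tendsto_ennrealI tendsto_intros elim e2)
        then show ?case by (cases "h \<in> ball 0 \<epsilon>") auto
      qed
    qed measurable
  qed
  also have "\<dots> \<le> liminf (\<lambda>n. \<integral>\<^sup>+x. ?q (z n) x \<partial>lborel)"
    by (rule nn_integral_liminf) measurable
  finally show ?thesis by (simp add: J_def)
qed

text \<open>Fatou's lemma requires a nonnegative kernel; the logarithm will be brought to this form
  by a cutoff and an added constant.\<close>

lemma IK_fatou:
  fixes z :: "nat \<Rightarrow> real^2 \<Rightarrow> real"
  assumes z: "\<And>n. admissible (z n)" and v: "admissible v"
    and lim: "AE x in lborel. (\<lambda>n. z n x) \<longlonglongrightarrow> v x"
    and [measurable]: "\<kappa> \<in> borel_measurable borel"
    and \<kappa>: "\<And>r. r \<ge> 0 \<Longrightarrow> 0 \<le> \<kappa> r" "\<And>r. r \<ge> 0 \<Longrightarrow> \<bar>\<kappa> r\<bar> \<le> a + \<bar>ln r\<bar>" "a \<ge> 0"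
    and C: "\<And>n. IK \<kappa> (z n) \<le> C n" "C \<longlonglongrightarrow> C'"
  shows "IK \<kappa> v \<le> C'"
proof -
  have [measurable]: "z n \<in> borel_measurable borel" "v \<in> borel_measurable borel" for n
    using admissibleD(2) z v by auto
  let ?f = "\<lambda>u p. \<kappa> (dist (fst p) (snd p)) * (u (fst p))\<^sup>2 * (u (snd p))\<^sup>2 :: real"
  have nn: "(\<integral>\<^sup>+p. ennreal (?f u p) \<partial>(lborel \<Otimes>\<^sub>M lborel)) = ennreal (IK \<kappa> u)" if "admissible u" for u
    unfolding IK_def using \<kappa>(1) by (intro nn_integral_eq_integral IK_integrable[OF that _ \<kappa>(2,3)]) auto
  have C0: "0 \<le> C n" for n
  proof -
    have "0 \<le> IK \<kappa> (z n)" unfolding IK_def using \<kappa>(1) by (intro integral_nonneg_AE AE_I2) auto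
    then show ?thesis using C(1)[of n] by linarith
  qed
  have C'0: "0 \<le> C'" by (rule LIMSEQ_le_const[OF C(2)]) (use C0 in auto)
  have "ennreal (IK \<kappa> v) \<le> liminf (\<lambda>n. \<integral>\<^sup>+p. ennreal (?f (z n) p) \<partial>(lborel \<Otimes>\<^sub>M lborel))"
    unfolding nn[OF v, symmetric]
  proof (rule nn_fatou_AE)
    show "AE p in lborel \<Otimes>\<^sub>M lborel. (\<lambda>n. ennreal (?f (z n) p)) \<longlonglongrightarrow> ennreal (?f v p)"
      using AE_lborel_pair[OF lim]
    proof eventually_elim
      case (elim p)
      then show ?case by (intro tendsto_ennrealI tendsto_intros) auto
    qed
  qed measurable
  also have "\<dots> = liminf (\<lambda>n. ennreal (IK \<kappa> (z n)))" by (simp add: nn[OF z])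
  also have "\<dots> \<le> liminf (\<lambda>n. ennreal (C n))" by (intro Liminf_mono always_eventually allI ennreal_leI C)
  also have "\<dots> = ennreal C'" by (intro lim_imp_Liminf tendsto_ennrealI C) simp
  finally show ?thesis using C'0 by simp
qed

text \<open>Direct method. The logarithm is unbounded below, so Fatou's lemma alone does not give
  lower semicontinuity; the uniform Dirichlet bound makes the singular part uniformly small.\<close>

theorem minimiser_exists:
  assumes c: "c > 0" and lam: "lam > 0"
  shows "\<exists>v. admissible v \<and> nsq lborel v = lam \<and> (\<forall>w. admissible w \<longrightarrow> nsq lborel w = lam \<longrightarrow> FF c v \<le> FF c w)"
proof -
  obtain C0 where C0: "C0 \<ge> 0" "\<And>v. admissible v \<Longrightarrow> nsq lborel v = lam \<Longrightarrow>
     DD v / 2 + c * IK (\<lambda>r. max 0 (ln r)) v - C0 \<le> FF c v"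
    using FF_coercive[OF c lam] by blast
  define S where "S = {v. admissible v \<and> nsq lborel v = lam}"
  have ne: "FF c ` S \<noteq> {}" using admissible_exists[OF lam] by (auto simp: S_def)
  have bdd: "bdd_below (FF c ` S)"
  proof (rule bdd_belowI2[where m="- C0"])
    fix v assume "v \<in> S"
    then show "- C0 \<le> FF c v"
      using C0(2)[of v] mult_nonneg_nonneg[OF less_imp_le[OF c] IK_pos_nonneg[of v]] DD_nonneg[of v]
      by (auto simp: S_def)
  qed
  define m where "m = Inf (FF c ` S)"
  have mle: "m \<le> FF c v" if "v \<in> S" for v unfolding m_def using that bdd by (intro cInf_lower) auto
  have "\<exists>v\<in>S. FF c v < m + 1 / real (Suc n)" for n
    using cInf_lessD[OF ne, of "m + 1 / real (Suc n)"] by (auto simp: m_def)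
  then obtain v0 where v0: "\<And>n. v0 n \<in> S" "\<And>n. FF c (v0 n) < m + 1 / real (Suc n)" by metis
  have a0: "admissible (v0 n)" "nsq lborel (v0 n) = lam" for n using v0(1)[of n] by (auto simp: S_def)
  have up: "FF c (v0 n) < m + 1" for n
  proof -
    have "1 / real (Suc n) \<le> 1" by simp
    then show ?thesis using v0(2)[of n] by linarith
  qed
  define Kd where "Kd = 2 * (m + 1 + C0)"
  define p where "p n = IK (\<lambda>r. max 0 (ln r)) (v0 n)" for n
  have p: "DD (v0 n) / 2 + c * p n - C0 \<le> FF c (v0 n)" "p n \<ge> 0" for n
    unfolding p_def by (rule C0(2)[OF a0], rule IK_pos_nonneg)
  have Kd: "DD (v0 n) \<le> Kd" for n
    using p[of n] up[of n] mult_nonneg_nonneg[OF less_imp_le[OF c] p(2)[of n]] unfolding Kd_def by (simp add: field_simps)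
  have Kp: "p n \<le> (m + 1 + C0) / c" for n
  proof -
    have "c * p n \<le> m + 1 + C0" using p[of n] up[of n] DD_nonneg[of "v0 n"] by (simp add: field_simps)
    then show ?thesis using c by (simp add: field_simps)
  qed
  define Kl where "Kl = (ln 2 * lam\<^sup>2 + (m + 1 + C0) / c + 1) / lam"
  have "\<exists>y. log_moment (\<lambda>x. v0 n (x + y)) \<le> Kl" for n
  proof -
    obtain y where "log_moment (\<lambda>x. v0 n (x + y)) \<le> (ln 2 * lam\<^sup>2 + p n + 1) / lam"
      unfolding p_def using good_centre[OF a0 lam] by blast
    also have "\<dots> \<le> Kl" unfolding Kl_def using Kp[of n] lam by (intro divide_right_mono) auto
    finally show ?thesis by blast
  qed
  then obtain y where y: "\<And>n. log_moment (\<lambda>x. v0 n (x + y n)) \<le> Kl" by metis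
  define w where "w n x = v0 n (x + y n)" for n x
  have m0: "v0 n \<in> borel_measurable borel" for n by (rule admissibleD(2)[OF a0(1)])
  have wa: "admissible (w n)" for n unfolding w_def by (rule admissible_shift[OF a0(1)])
  have wn: "nsq lborel (w n) = lam" for n unfolding w_def using nsq_shift[OF m0] a0(2) by simp
  have wD: "DD (w n) = DD (v0 n)" for n unfolding w_def DD_def by (simp add: Dn_shift[OF m0])
  have wI: "IK ln (w n) = IK ln (v0 n)" for n unfolding w_def by (rule IK_shift[OF m0]) simp
  have wF: "FF c (w n) = FF c (v0 n)" for n by (simp add: FF_def wD wI)
  have wK: "log_moment (w n) \<le> Kl" for n unfolding w_def by (rule y)
  obtain k v1 where k: "strict_mono (k::nat\<Rightarrow>nat)" and v1: "L2 lborel v1" "(\<lambda>n. nsq lborel (\<lambda>x. w (k n) x - v1 x)) \<longlonglongrightarrow> 0"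
    using compactness[where w=w and lam=lam and D=Kd and K=Kl, OF wa wn Kd[folded wD] wK] by blast
  \<comment> \<open>The terms are nonnegative, so taking the modulus of the limit does not increase
    distances, and it supplies the pointwise sign that \<open>admissible\<close> demands.\<close>
  define v where "v x = \<bar>v1 x\<bar>" for x
  have "v = (\<lambda>x. \<bar>v1 x\<bar>)" by (simp add: fun_eq_iff v_def)
  then have vL: "L2 lborel v" using v1(1) by (auto simp: L2_def)
  have wL: "L2 lborel (w n)" for n by (rule admissibleD(1)[OF wa])
  have [measurable]: "v \<in> borel_measurable borel" using vL by (simp add: L2_def)
  have [measurable]: "w n \<in> borel_measurable borel" for n by (rule admissibleD(2)[OF wa])
  have lim0: "(\<lambda>n. nsq lborel (\<lambda>x. w (k n) x - v x)) \<longlonglongrightarrow> 0"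
  proof (rule tendsto_sandwich[OF _ _ tendsto_const v1(2)])
    show "\<forall>\<^sub>F n in sequentially. nsq lborel (\<lambda>x. w (k n) x - v x) \<le> nsq lborel (\<lambda>x. w (k n) x - v1 x)"
    proof (intro always_eventually allI)
      fix n
      show "nsq lborel (\<lambda>x. w (k n) x - v x) \<le> nsq lborel (\<lambda>x. w (k n) x - v1 x)"
        unfolding nsq_def
      proof (rule integral_mono[OF L2_integrable[OF L2_diff[OF wL vL]] L2_integrable[OF L2_diff[OF wL v1(1)]]])
        fix x
        have "\<bar>w (k n) x - v x\<bar> \<le> \<bar>w (k n) x - v1 x\<bar>"
          using admissibleD(3)[OF wa, of "k n" x] by (simp add: v_def)
        then show "(norm (w (k n) x - v x))\<^sup>2 \<le> (norm (w (k n) x - v1 x))\<^sup>2" by (simp add: abs_le_square_iff)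
      qed
    qed
  qed (simp add: nsq_nonneg)
  obtain r1 where r1: "strict_mono (r1::nat\<Rightarrow>nat)" "AE x in lborel. (\<lambda>n. w (k (r1 n)) x) \<longlonglongrightarrow> v x"
    using L2_AE_subseq[of lborel "\<lambda>n. w (k n)" v] wL vL lim0 by blast
  \<comment> \<open>The Dirichlet energies are made to converge on their own, so that the
    logarithmic energies converge as well, to \<open>(m - Ds) / c\<close>.\<close>
  have "\<exists>l\<in>{0..Kd}. \<exists>r. strict_mono r \<and> ((\<lambda>n. DD (w (k (r1 n)))) \<circ> r) \<longlonglongrightarrow> l"
  proof -
    have "\<forall>n. DD (w (k (r1 n))) \<in> {0..Kd}" using DD_nonneg Kd wD by auto
    then show ?thesis
      by (rule mp[OF compact_Icc[of 0 Kd, unfolded compact_def, THEN spec, of "\<lambda>n. DD (w (k (r1 n)))"]])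
  qed
  then obtain Ds r2 where Ds: "Ds \<ge> 0" and r2: "strict_mono (r2::nat\<Rightarrow>nat)" "(\<lambda>n. DD (w (k (r1 (r2 n))))) \<longlonglongrightarrow> Ds"
    by (auto simp: comp_def)
  define s where "s n = k (r1 (r2 n))" for n
  have s: "strict_mono s" unfolding s_def using k r1(1) r2(1) by (simp add: strict_mono_def)
  define z where "z n = w (s n)" for n
  have za: "admissible (z n)" and zn: "nsq lborel (z n) = lam" and zK: "log_moment (z n) \<le> Kl" for n
    unfolding z_def by (rule wa wn wK)+
  have [measurable]: "z n \<in> borel_measurable borel" for n unfolding z_def by measurable
  have zlim: "AE x in lborel. (\<lambda>n. z n x) \<longlonglongrightarrow> v x"
    using r1(2)
  proof eventually_elim
    case (elim x)
    from LIMSEQ_subseq_LIMSEQ[OF this r2(1)] show ?case by (simp add: z_def s_def comp_def)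
  qed
  have zD: "(\<lambda>n. DD (z n)) \<longlonglongrightarrow> Ds" using r2(2) by (simp add: z_def s_def)
  have zF: "(\<lambda>n. FF c (z n)) \<longlonglongrightarrow> m"
  proof (rule tendsto_sandwich[of "\<lambda>_. m" _ _ "\<lambda>n. m + 1 / real (Suc n)"])
    show "\<forall>\<^sub>F n in sequentially. m \<le> FF c (z n)" using mle za zn by (auto simp: S_def)
    show "\<forall>\<^sub>F n in sequentially. FF c (z n) \<le> m + 1 / real (Suc n)"
    proof (intro always_eventually allI)
      fix n
      have "FF c (z n) \<le> m + 1 / real (Suc (s n))" using v0(2)[of "s n"] wF[of "s n"] by (simp add: z_def)
      also have "\<dots> \<le> m + 1 / real (Suc n)" using seq_suble[OF s, of n] by (simp add: frac_le)
      finally show "FF c (z n) \<le> m + 1 / real (Suc n)" .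
    qed
    show "(\<lambda>n. m + 1 / real (Suc n)) \<longlonglongrightarrow> m"
      using tendsto_add[OF tendsto_const[of m] LIMSEQ_Suc[OF lim_1_over_n]] by simp
  qed simp
  have zI: "(\<lambda>n. IK ln (z n)) \<longlonglongrightarrow> (m - Ds) / c"
  proof -
    have "(\<lambda>n. (FF c (z n) - DD (z n)) / c) \<longlonglongrightarrow> (m - Ds) / c" by (intro tendsto_intros zF zD) (use c in simp)
    then show ?thesis using c by (simp add: FF_def)
  qed
  \<comment> \<open>Norm convergence keeps the mass: the difference of two squares is the difference
    times the sum, estimated by Cauchy-Schwarz.\<close>
  have vn: "nsq lborel v = lam"
  proof -
    have "(\<lambda>n. nsq lborel (\<lambda>x. z n x - v x)) \<longlonglongrightarrow> 0"
      using LIMSEQ_subseq_LIMSEQ[OF LIMSEQ_subseq_LIMSEQ[OF lim0 r1(1)] r2(1)] by (simp add: comp_def z_def s_def)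
    then have sq: "(\<lambda>n. sqrt (nsq lborel (\<lambda>x. z n x - v x))) \<longlonglongrightarrow> 0"
      using tendsto_real_sqrt by fastforce
    have zL: "L2 lborel (z n)" for n unfolding z_def by (rule wL)
    have "\<bar>nsq lborel v - lam\<bar> \<le> (sqrt lam + sqrt (nsq lborel v)) * sqrt (nsq lborel (\<lambda>x. z n x - v x))" for n
    proof -
      have "nsq lborel v - lam = - ((\<integral>x. z n x \<bullet> (z n x - v x) \<partial>lborel) + (\<integral>x. v x \<bullet> (z n x - v x) \<partial>lborel))"
      proof -
        have "(\<integral>x. z n x \<bullet> (z n x - v x) \<partial>lborel) + (\<integral>x. v x \<bullet> (z n x - v x) \<partial>lborel)
          = (\<integral>x. z n x \<bullet> (z n x - v x) + v x \<bullet> (z n x - v x) \<partial>lborel)"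
          by (intro Bochner_Integration.integral_add[symmetric] L2_inner_integrable L2_diff zL vL)
        also have "\<dots> = (\<integral>x. (norm (z n x))\<^sup>2 - (norm (v x))\<^sup>2 \<partial>lborel)"
          by (intro Bochner_Integration.integral_cong) (auto simp: power2_eq_square algebra_simps)
        also have "\<dots> = lam - nsq lborel v"
          using L2_integrable[OF zL[of n]] L2_integrable[OF vL] zn[of n] by (simp add: nsq_def)
        finally show ?thesis by simp
      qed
      also have "\<bar>\<dots>\<bar> \<le> \<bar>\<integral>x. z n x \<bullet> (z n x - v x) \<partial>lborel\<bar> + \<bar>\<integral>x. v x \<bullet> (z n x - v x) \<partial>lborel\<bar>" by linarith
      also have "\<dots> \<le> sqrt lam * sqrt (nsq lborel (\<lambda>x. z n x - v x)) + sqrt (nsq lborel v) * sqrt (nsq lborel (\<lambda>x. z n x - v x))"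
        using L2_Cauchy_Schwarz[OF zL[of n] L2_diff[OF zL[of n] vL]] L2_Cauchy_Schwarz[OF vL L2_diff[OF zL[of n] vL]] zn[of n]
        by (intro add_mono) auto
      finally show ?thesis by (simp add: distrib_right)
    qed
    then have "\<bar>nsq lborel v - lam\<bar> \<le> (sqrt lam + sqrt (nsq lborel v)) * 0"
      by (intro LIMSEQ_le_const[OF tendsto_mult[OF tendsto_const sq]]) auto
    then show ?thesis by simp
  qed
  have Dnv: "Dn v \<le> ennreal Ds"
  proof (rule Dn_le)
    fix n
    let ?e = "1 / real (Suc n)"
    have "J ?e v \<le> liminf (\<lambda>i. J ?e (z i))" by (rule J_fatou[OF _ _ zlim]) measurable
    also have "\<dots> \<le> liminf (\<lambda>i. ennreal (mom ?e * DD (z i)))"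
      by (intro Liminf_mono always_eventually allI Dn_bounds_J admissibleD(1,4)[OF za] DD_nonneg) simp
    also have "\<dots> = ennreal (mom ?e * Ds)" by (intro lim_imp_Liminf tendsto_ennrealI tendsto_intros zD) simp
    finally show "J ?e v \<le> ennreal (mom ?e * Ds)" .
  qed (rule Ds)
  have Kl0: "Kl \<ge> 0" using wK[of 0] log_moment_nonneg[of "w 0"] by linarith
  have "(\<integral>\<^sup>+x. ennreal (ln (1 + norm x) * (v x)\<^sup>2) \<partial>lborel) \<le> liminf (\<lambda>n. \<integral>\<^sup>+x. ennreal (ln (1 + norm x) * (z n x)\<^sup>2) \<partial>lborel)"
  proof (rule nn_fatou_AE)
    show "AE x in lborel. (\<lambda>n. ennreal (ln (1 + norm x) * (z n x)\<^sup>2)) \<longlonglongrightarrow> ennreal (ln (1 + norm x) * (v x)\<^sup>2)"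
      using zlim by eventually_elim (intro tendsto_ennrealI tendsto_intros)
  qed measurable
  also have "\<dots> = liminf (\<lambda>n. ennreal (log_moment (z n)))"
    unfolding log_moment_def using admissibleD(5)[OF za] by (subst nn_integral_eq_integral) auto
  also have "\<dots> \<le> liminf (\<lambda>n. ennreal Kl)" by (intro Liminf_mono always_eventually allI ennreal_leI zK)
  also have "\<dots> = ennreal Kl" by (simp add: Liminf_const)
  finally have lmf: "(\<integral>\<^sup>+x. ennreal (ln (1 + norm x) * (v x)\<^sup>2) \<partial>lborel) \<le> ennreal Kl" .
  have "integrable lborel (\<lambda>x. ln (1 + norm x) * (v x)\<^sup>2)"
  proof (rule integrableI_nonneg)
    show "(\<integral>\<^sup>+x. ennreal (ln (1 + norm x) * (v x)\<^sup>2) \<partial>lborel) < \<infinity>" using lmf by (simp add: le_less_trans)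
  qed auto
  then have va: "admissible v"
    unfolding admissible_def using vL Dnv by (auto simp: v_def le_less_trans)
  have DDv: "DD v \<le> Ds" by (rule DD_le[OF Dnv Ds])
  text \<open>Cutting the kernel off at distance \<open>\<delta>\<close> makes it bounded below, and the error is uniformly small.\<close>
  have cut: "IK ln v \<le> (m - Ds) / c + 4 * \<delta> * (lam + Kd) * lam" if \<delta>: "0 < \<delta>" "\<delta> \<le> 1" for \<delta>
  proof -
    let ?t = "\<lambda>r. max 0 (ln (\<delta> / r))"
    let ?k = "\<lambda>r. ln r + ?t r + ln (1 / \<delta>)"
    have kpos: "0 \<le> ?k r" if "r \<ge> 0" for r
      using that \<delta> by (cases "r = 0") (auto simp: ln_div)
    have kb: "\<bar>?k r\<bar> \<le> 2 * \<bar>ln \<delta>\<bar> + \<bar>ln r\<bar>" if "r \<ge> 0" for r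
    proof (cases "r = 0")
      case False
      have "\<bar>L + max 0 (d - L) - d\<bar> \<le> 2 * \<bar>d\<bar> + \<bar>L\<bar>" for L d :: real by (auto simp: max_def abs_le_iff)
      from this[of "ln r" "ln \<delta>"] show ?thesis using \<delta> False that by (simp add: ln_div)
    qed (use \<delta> in \<open>simp add: ln_div\<close>)
    have expand: "IK ?k u = IK ln u + IK ?t u + ln (1 / \<delta>) * lam\<^sup>2" if u: "admissible u" "nsq lborel u = lam" for u
    proof -
      have i1: "integrable (lborel \<Otimes>\<^sub>M lborel) (\<lambda>p. ln (dist (fst p) (snd p)) * (u (fst p))\<^sup>2 * (u (snd p))\<^sup>2)"
        by (rule IK_integrable[OF u(1), where a=0]) auto
      have i2: "integrable (lborel \<Otimes>\<^sub>M lborel) (\<lambda>p. ln (1 / \<delta>) * (u (fst p))\<^sup>2 * (u (snd p))\<^sup>2)"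
        by (rule IK_integrable[OF u(1), where \<kappa>="\<lambda>_. ln (1 / \<delta>)" and a="\<bar>ln (1 / \<delta>)\<bar>"]) auto
      have i3: "integrable (lborel \<Otimes>\<^sub>M lborel) (\<lambda>p. ?t (dist (fst p) (snd p)) * (u (fst p))\<^sup>2 * (u (snd p))\<^sup>2)"
        by (rule IK_integrable[OF u(1), where a="\<bar>ln \<delta>\<bar>"]) (use log_tail_dominated[OF \<delta>(1)] in auto)
      have "IK ?k u = (\<integral>p. ln (dist (fst p) (snd p)) * (u (fst p))\<^sup>2 * (u (snd p))\<^sup>2 + ?t (dist (fst p) (snd p)) * (u (fst p))\<^sup>2 * (u (snd p))\<^sup>2
          + ln (1 / \<delta>) * (u (fst p))\<^sup>2 * (u (snd p))\<^sup>2 \<partial>(lborel \<Otimes>\<^sub>M lborel))"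
        unfolding IK_def by (intro Bochner_Integration.integral_cong) (auto simp: algebra_simps)
      also have "\<dots> = IK ln u + IK ?t u + IK (\<lambda>_. ln (1 / \<delta>)) u"
        unfolding IK_def
        by (subst Bochner_Integration.integral_add[OF Bochner_Integration.integrable_add[OF i1 i3] i2],
            subst Bochner_Integration.integral_add[OF i1 i3]) (rule refl)
      finally show ?thesis using IK_const[OF u(1), of "ln (1 / \<delta>)"] u(2) by simp
    qed
    have tb: "IK ?t (z n) \<le> 4 * \<delta> * (lam + Kd) * lam" for n
    proof -
      have "IK ?t (z n) \<le> 4 * \<delta> * (lam + DD (z n)) * lam" using IK_log_tail_le[OF za \<delta>(1), of n] zn[of n] by simp
      also have "\<dots> \<le> 4 * \<delta> * (lam + Kd) * lam"
        using Kd[of "s n"] wD[of "s n"] \<delta> lam by (intro mult_right_mono mult_left_mono) (auto simp: z_def)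
      finally show ?thesis .
    qed
    have "IK ?k v \<le> (m - Ds) / c + 4 * \<delta> * (lam + Kd) * lam + ln (1 / \<delta>) * lam\<^sup>2"
    proof (rule IK_fatou[OF za va zlim _ kpos kb])
      show "(\<lambda>n. IK ln (z n) + 4 * \<delta> * (lam + Kd) * lam + ln (1 / \<delta>) * lam\<^sup>2)
         \<longlonglongrightarrow> (m - Ds) / c + 4 * \<delta> * (lam + Kd) * lam + ln (1 / \<delta>) * lam\<^sup>2"
        by (intro tendsto_add zI tendsto_const)
      show "IK ?k (z n) \<le> IK ln (z n) + 4 * \<delta> * (lam + Kd) * lam + ln (1 / \<delta>) * lam\<^sup>2" for n
        using expand[OF za zn, of n] tb[of n] by linarith
    qed auto
    moreover have "IK ?t v \<ge> 0" unfolding IK_def by (intro integral_nonneg_AE AE_I2) auto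
    ultimately show ?thesis using expand[OF va vn] by linarith
  qed
  have "IK ln v \<le> (m - Ds) / c"
  proof (rule field_le_epsilon)
    fix e :: real assume e: "e > 0"
    define B where "B = 4 * (lam + Kd) * lam + 1"
    have Kd0: "Kd \<ge> 0" using Kd[of 0] DD_nonneg[of "v0 0"] by linarith
    have B: "B > 0" unfolding B_def using lam Kd0 by (intro add_nonneg_pos mult_nonneg_nonneg) auto
    define \<delta> where "\<delta> = min 1 (e / B)"
    have \<delta>: "0 < \<delta>" "\<delta> \<le> 1" using e B by (auto simp: \<delta>_def)
    have "4 * \<delta> * (lam + Kd) * lam \<le> \<delta> * B" using \<delta> by (simp add: B_def algebra_simps)
    also have "\<dots> \<le> (e / B) * B" using B by (intro mult_right_mono) (auto simp: \<delta>_def)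
    also have "\<dots> = e" using B by simp
    finally show "IK ln v \<le> (m - Ds) / c + e" using cut[OF \<delta>] by linarith
  qed
  then have "c * IK ln v \<le> m - Ds" using c by (simp add: field_simps)
  then have "FF c v \<le> m" using DDv by (simp add: FF_def)
  with mle va vn show ?thesis by (intro exI[of _ v]) (force simp: S_def)
qed

subsection \<open>Polarisation\<close>

text \<open>Reflection in the line \<open>x . e = t\<close>, for a unit vector
  \<open>e\<close>.\<close>

definition hrefl :: "real^2 \<Rightarrow> real \<Rightarrow> real^2 \<Rightarrow> real^2" where
  "hrefl e t x = x - (2 * (x \<bullet> e - t)) *\<^sub>R e"

text \<open>Two-point rearrangement: the larger value of each mirror pair goes to the side
  \<open>x . e < t\<close>. On the line the two values coincide, so it may be counted with either
  side.\<close>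

definition polar :: "real^2 \<Rightarrow> real \<Rightarrow> (real^2 \<Rightarrow> real) \<Rightarrow> real^2 \<Rightarrow> real" where
  "polar e t v x = (if x \<bullet> e < t then max (v x) (v (hrefl e t x)) else min (v x) (v (hrefl e t x)))"

lemma unit_inner: "norm (e::real^2) = 1 \<Longrightarrow> e \<bullet> e = 1"
  by (simp add: norm_eq_1)

lemma hrefl_inner: "norm e = 1 \<Longrightarrow> hrefl e t x \<bullet> e = 2 * t - x \<bullet> e"
  by (simp add: hrefl_def inner_diff_left unit_inner algebra_simps)

lemma hrefl_refl: assumes "norm e = 1" shows "hrefl e t (hrefl e t x) = x"
proof -
  have "hrefl e t (hrefl e t x) = hrefl e t x - (2 * (2 * t - x \<bullet> e - t)) *\<^sub>R e"
    by (subst hrefl_def) (simp only: hrefl_inner[OF assms])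
  also have "\<dots> = x - (2 * (x \<bullet> e - t) + 2 * (2 * t - x \<bullet> e - t)) *\<^sub>R e"
    by (simp only: hrefl_def scaleR_left_distrib diff_diff_eq)
  finally show ?thesis by simp
qed

lemma hrefl_boundary: "x \<bullet> e = t \<Longrightarrow> hrefl e t x = x"
  by (simp add: hrefl_def)

text \<open>The sign of the product of the signed distances to the line decides whether
  \<open>y\<close> or its mirror image is nearer to \<open>x\<close>; the comparisons of kernels
  rest on this.\<close>

lemma dist_sq_hrefl: assumes "norm e = 1"
  shows "(dist x (hrefl e t y))\<^sup>2 = (dist x y)\<^sup>2 + 4 * ((x \<bullet> e - t) * (y \<bullet> e - t))"
proof -
  have eq: "x - hrefl e t y = (x - y) + (2 * (y \<bullet> e - t)) *\<^sub>R e" by (simp add: hrefl_def)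
  have "(dist x (hrefl e t y))\<^sup>2 = (norm ((x - y) + (2 * (y \<bullet> e - t)) *\<^sub>R e))\<^sup>2" by (simp only: dist_norm eq)
  also have "\<dots> = (norm (x - y))\<^sup>2 + 2 * (2 * (y \<bullet> e - t)) * ((x - y) \<bullet> e) + (2 * (y \<bullet> e - t))\<^sup>2"
  proof -
    have "(norm (d + s *\<^sub>R e))\<^sup>2 = (norm d)\<^sup>2 + 2 * s * (d \<bullet> e) + s\<^sup>2" for d s
    proof -
      have "(norm (d + s *\<^sub>R e))\<^sup>2 = d \<bullet> d + s * (d \<bullet> e) + s * (e \<bullet> d) + s * s * (e \<bullet> e)"
        unfolding power2_norm_eq_inner inner_add_left inner_add_right inner_scaleR_left inner_scaleR_right
        by (simp add: algebra_simps)
      then show ?thesis unfolding unit_inner[OF assms] inner_commute[of e d]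
        by (simp add: dot_square_norm power2_eq_square)
    qed
    then show ?thesis .
  qed
  also have "\<dots> = (dist x y)\<^sup>2 + 4 * ((x \<bullet> e - t) * (y \<bullet> e - t))"
  proof -
    have "2 * (2 * (b - t)) * (a - b) + (2 * (b - t))\<^sup>2 = 4 * ((a - t) * (b - t))" for a b :: real
      by (simp add: power2_eq_square algebra_simps)
    then show ?thesis by (simp add: dist_norm inner_diff_left)
  qed
  finally show ?thesis .
qed

lemma dist_hrefl_refl: assumes "norm e = 1" shows "dist (hrefl e t x) (hrefl e t y) = dist x y"
proof -
  have "(dist (hrefl e t x) (hrefl e t y))\<^sup>2 = (dist (hrefl e t x) y)\<^sup>2 + 4 * ((hrefl e t x \<bullet> e - t) * (y \<bullet> e - t))"
    by (rule dist_sq_hrefl[OF assms])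
  also have "(dist (hrefl e t x) y)\<^sup>2 = (dist x y)\<^sup>2 + 4 * ((y \<bullet> e - t) * (x \<bullet> e - t))"
    using dist_sq_hrefl[OF assms, of y t x] by (simp add: dist_commute)
  finally have "(dist (hrefl e t x) (hrefl e t y))\<^sup>2 = (dist x y)\<^sup>2" by (simp add: hrefl_inner[OF assms] algebra_simps)
  then show ?thesis by (simp add: power2_eq_iff_nonneg)
qed

lemma dist_hrefl_commute: "norm e = 1 \<Longrightarrow> dist (hrefl e t x) y = dist x (hrefl e t y)"
  using dist_hrefl_refl[of e t "hrefl e t x" y] by (simp add: hrefl_refl)

lemma hrefl_iso: assumes "norm e = 1" shows "lborel_iso (hrefl e t)"
proof -
  have "orthogonal_transformation (hrefl e 0)"
    unfolding orthogonal_transformation_isometry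
    using dist_hrefl_refl[OF assms, of 0] by (simp add: hrefl_def[of e 0 0])
  from lborel_iso_compose[OF lborel_iso_add[of "(2 * t) *\<^sub>R e"] lborel_iso_orthogonal[OF this]]
  have "lborel_iso (\<lambda>x. hrefl e 0 x + (2 * t) *\<^sub>R e)" .
  moreover have "hrefl e 0 x + (2 * t) *\<^sub>R e = hrefl e t x" for x by (simp add: hrefl_def algebra_simps)
  ultimately show ?thesis by simp
qed

text \<open>Ordering two pairs alike maximises the sum of products, ordering them oppositely
  minimises it. The exact gain is kept because the equality case is needed.\<close>

lemma rearrange_two:
  fixes a a' b b' :: real
  shows "max a a' * max b b' + min a a' * min b b' - (a * b + a' * b') = max 0 (- ((a - a') * (b - b')))"
    and "max a a' * min b b' + min a a' * max b b' - (a * b + a' * b') = - max 0 ((a - a') * (b - b'))"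
proof -
  have *: "0 \<le> (a - a') * (b - b')" if "(a' \<le> a \<and> b' \<le> b) \<or> (a \<le> a' \<and> b \<le> b')"
    using that by (auto intro: mult_nonneg_nonneg mult_nonpos_nonpos)
  have **: "(a - a') * (b - b') \<le> 0" if "(a' \<le> a \<and> b \<le> b') \<or> (a \<le> a' \<and> b' \<le> b)"
    using that by (auto intro: mult_nonneg_nonpos mult_nonpos_nonneg)
  consider "a' \<le> a" "b' \<le> b" | "a' \<le> a" "b \<le> b'" | "a \<le> a'" "b' \<le> b" | "a \<le> a'" "b \<le> b'" by linarith
  then show "max a a' * max b b' + min a a' * min b b' - (a * b + a' * b') = max 0 (- ((a - a') * (b - b')))"
    by cases (use * ** in \<open>auto simp: max_absorb1 max_absorb2 min_absorb1 min_absorb2 algebra_simps\<close>)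
  consider "a' \<le> a" "b' \<le> b" | "a' \<le> a" "b \<le> b'" | "a \<le> a'" "b' \<le> b" | "a \<le> a'" "b \<le> b'" by linarith
  then show "max a a' * min b b' + min a a' * max b b' - (a * b + a' * b') = - max 0 ((a - a') * (b - b'))"
    by cases (use * ** in \<open>auto simp: max_absorb1 max_absorb2 min_absorb1 min_absorb2 algebra_simps\<close>)
qed

lemma polar_pair:
  assumes "norm e = 1"
  shows "x \<bullet> e < t \<Longrightarrow> polar e t v x = max (v x) (v (hrefl e t x)) \<and> polar e t v (hrefl e t x) = min (v x) (v (hrefl e t x))"
    and "\<not> x \<bullet> e < t \<Longrightarrow> polar e t v x = min (v x) (v (hrefl e t x)) \<and> polar e t v (hrefl e t x) = max (v x) (v (hrefl e t x))"
proof -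
  show "x \<bullet> e < t \<Longrightarrow> polar e t v x = max (v x) (v (hrefl e t x)) \<and> polar e t v (hrefl e t x) = min (v x) (v (hrefl e t x))"
    by (simp add: polar_def hrefl_inner[OF assms] hrefl_refl[OF assms] min.commute)
  assume "\<not> x \<bullet> e < t"
  then consider "x \<bullet> e = t" | "x \<bullet> e > t" by linarith
  then show "polar e t v x = min (v x) (v (hrefl e t x)) \<and> polar e t v (hrefl e t x) = max (v x) (v (hrefl e t x))"
    by cases (simp_all add: polar_def hrefl_boundary hrefl_inner[OF assms] hrefl_refl[OF assms] max.commute)
qed

lemma polar_sum:
  assumes "norm e = 1"
  shows "g (polar e t v x) + g (polar e t v (hrefl e t x)) = g (v x) + (g (v (hrefl e t x)) :: real)"
proof -
  have "polar e t v x = v x \<and> polar e t v (hrefl e t x) = v (hrefl e t x) \<or>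
      polar e t v x = v (hrefl e t x) \<and> polar e t v (hrefl e t x) = v x"
  proof (cases "x \<bullet> e < t")
    case True
    from polar_pair(1)[OF assms True, of v] show ?thesis by (metis linear max_absorb1 max_absorb2 min_absorb1 min_absorb2)
  next
    case False
    from polar_pair(2)[OF assms False, of v] show ?thesis by (metis linear max_absorb1 max_absorb2 min_absorb1 min_absorb2)
  qed
  then show ?thesis by (metis add.commute)
qed

text \<open>The single quantity through which polarisation changes an interaction that is quadratic
  in \<open>f\<close>: the pairs \<open>(x, y)\<close> and their joint mirror image gain it, and the
  crossed pairs lose it.\<close>

definition pair_gain :: "real^2 \<Rightarrow> real \<Rightarrow> (real^2 \<Rightarrow> real) \<Rightarrow> real^2 \<Rightarrow> real^2 \<Rightarrow> real" where
  "pair_gain e t f x y = polar e t f x * polar e t f y + polar e t f (hrefl e t x) * polar e t f (hrefl e t y)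
     - (f x * f y + f (hrefl e t x) * f (hrefl e t y))"

lemma pair_gain_same_side:
  assumes e: "norm e = 1" and s: "(x \<bullet> e < t) = (y \<bullet> e < t)"
  shows "pair_gain e t f x y = max 0 (- ((f x - f (hrefl e t x)) * (f y - f (hrefl e t y))))"
proof (cases "x \<bullet> e < t")
  case True
  then have y: "y \<bullet> e < t" using s by simp
  note p = conjunct1[OF polar_pair(1)[OF e True, of f]] conjunct2[OF polar_pair(1)[OF e True, of f]]
  note q = conjunct1[OF polar_pair(1)[OF e y, of f]] conjunct2[OF polar_pair(1)[OF e y, of f]]
  show ?thesis unfolding pair_gain_def p q by (rule rearrange_two(1))
next
  case False
  then have y: "\<not> y \<bullet> e < t" using s by simp
  note p = conjunct1[OF polar_pair(2)[OF e False, of f]] conjunct2[OF polar_pair(2)[OF e False, of f]]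
  note q = conjunct1[OF polar_pair(2)[OF e y, of f]] conjunct2[OF polar_pair(2)[OF e y, of f]]
  show ?thesis unfolding pair_gain_def p q
    using rearrange_two(1)[of "f x" "f (hrefl e t x)" "f y" "f (hrefl e t y)"] by linarith
qed

lemma pair_gain_opposite:
  assumes e: "norm e = 1" and s: "(x \<bullet> e < t) \<noteq> (y \<bullet> e < t)"
  shows "pair_gain e t f x y = - max 0 ((f x - f (hrefl e t x)) * (f y - f (hrefl e t y)))"
proof (cases "x \<bullet> e < t")
  case True
  then have y: "\<not> y \<bullet> e < t" using s by simp
  note p = conjunct1[OF polar_pair(1)[OF e True, of f]] conjunct2[OF polar_pair(1)[OF e True, of f]]
  note q = conjunct1[OF polar_pair(2)[OF e y, of f]] conjunct2[OF polar_pair(2)[OF e y, of f]]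
  show ?thesis unfolding pair_gain_def p q by (rule rearrange_two(2))
next
  case False
  then have y: "y \<bullet> e < t" using s by simp
  note p = conjunct1[OF polar_pair(2)[OF e False, of f]] conjunct2[OF polar_pair(2)[OF e False, of f]]
  note q = conjunct1[OF polar_pair(1)[OF e y, of f]] conjunct2[OF polar_pair(1)[OF e y, of f]]
  show ?thesis unfolding pair_gain_def p q
    using rearrange_two(2)[of "f x" "f (hrefl e t x)" "f y" "f (hrefl e t y)"] by linarith
qed

text \<open>Polarisation only permutes the two values on each mirror pair, so the product of the two
  pair sums is unchanged.\<close>

lemma pair_gain_cross:
  assumes "norm e = 1"
  shows "polar e t f x * polar e t f (hrefl e t y) + polar e t f (hrefl e t x) * polar e t f y
     - (f x * f (hrefl e t y) + f (hrefl e t x) * f y) = - pair_gain e t f x y"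
proof -
  have "(polar e t f x + polar e t f (hrefl e t x)) * (polar e t f y + polar e t f (hrefl e t y))
     = (f x + f (hrefl e t x)) * (f y + f (hrefl e t y))"
    using polar_sum[OF assms, of "\<lambda>r. r"] by simp
  then show ?thesis by (simp add: pair_gain_def algebra_simps)
qed

text \<open>On the same side the direct distance is at most the crossed one and the gain is
  nonnegative; on opposite sides both signs flip. Coincidences are excluded because
  \<open>\<kappa>\<close> is assumed monotone at positive distances only.\<close>

lemma pair_gain_sign:
  assumes e: "norm e = 1" and inc: "\<And>r s. 0 < r \<Longrightarrow> r \<le> s \<Longrightarrow> \<kappa> r \<le> \<kappa> s"
    and ne: "x \<noteq> y" "x \<noteq> hrefl e t y"
  shows "0 \<le> (\<kappa> (dist x (hrefl e t y)) - \<kappa> (dist x y)) * pair_gain e t f x y"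
proof (cases "(x \<bullet> e < t) = (y \<bullet> e < t)")
  case True
  have "0 \<le> (x \<bullet> e - t) * (y \<bullet> e - t)" using True by (cases "x \<bullet> e < t") (auto intro: mult_nonpos_nonpos mult_nonneg_nonneg)
  then have "(dist x y)\<^sup>2 \<le> (dist x (hrefl e t y))\<^sup>2" unfolding dist_sq_hrefl[OF e] by linarith
  then have le: "dist x y \<le> dist x (hrefl e t y)" by (rule power2_le_imp_le) simp
  have "\<kappa> (dist x y) \<le> \<kappa> (dist x (hrefl e t y))" by (rule inc[OF _ le]) (use ne in simp)
  then show ?thesis unfolding pair_gain_same_side[OF e True] by (intro mult_nonneg_nonneg) simp_all
next
  case False
  have "(x \<bullet> e - t) * (y \<bullet> e - t) \<le> 0" using False by (cases "x \<bullet> e < t") (auto intro: mult_nonpos_nonneg mult_nonneg_nonpos)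
  then have "(dist x (hrefl e t y))\<^sup>2 \<le> (dist x y)\<^sup>2" unfolding dist_sq_hrefl[OF e] by linarith
  then have le: "dist x (hrefl e t y) \<le> dist x y" by (rule power2_le_imp_le) simp
  have "\<kappa> (dist x (hrefl e t y)) \<le> \<kappa> (dist x y)" by (rule inc[OF _ le]) (use ne in simp)
  then show ?thesis unfolding pair_gain_opposite[OF e False] by (intro mult_nonpos_nonpos) simp_all
qed

section \<open>Effect of polarisation on the two energies\<close>

lemma polar_measurable:
  assumes [measurable]: "v \<in> borel_measurable borel" and "norm e = 1"
  shows "polar e t v \<in> borel_measurable borel"
proof -
  have [measurable]: "hrefl e t \<in> borel_measurable borel" by (rule lborel_iso_measurable[OF hrefl_iso[OF assms(2)]])
  have "(\<lambda>x. if x \<bullet> e < t then max (v x) (v (hrefl e t x)) else min (v x) (v (hrefl e t x))) \<in> borel_measurable borel"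
    by measurable
  then show ?thesis unfolding polar_def[abs_def] .
qed

lemma J_pair:
  assumes [measurable]: "v \<in> borel_measurable borel"
  shows "J \<epsilon> v = (\<integral>\<^sup>+p. ennreal ((if dist (fst p) (snd p) < \<epsilon> then 1 else 0) * (v (fst p) - v (snd p))\<^sup>2) \<partial>(lborel \<Otimes>\<^sub>M lborel))"
proof -
  define F where "F x y = ennreal ((if dist x y < \<epsilon> then 1 else 0) * (v x - v y)\<^sup>2)" for x y
  have "(\<integral>\<^sup>+h. indicator (ball 0 \<epsilon>) h * ennreal ((norm (v (x + h) - v x))\<^sup>2) \<partial>lborel)
     = (\<integral>\<^sup>+y. ennreal ((if dist x y < \<epsilon> then 1 else 0) * (v x - v y)\<^sup>2) \<partial>lborel)" for x
  proof -
    have "(\<integral>\<^sup>+h. indicator (ball 0 \<epsilon>) h * ennreal ((norm (v (x + h) - v x))\<^sup>2) \<partial>lborel) = (\<integral>\<^sup>+h. F x (x + h) \<partial>lborel)"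
    proof (intro nn_integral_cong)
      fix h
      have "(norm (v (x + h) - v x))\<^sup>2 = (v x - v (x + h))\<^sup>2" unfolding real_norm_def power2_abs by (rule power2_commute)
      moreover have "dist x (x + h) = norm h" by (simp add: dist_norm)
      ultimately show "indicator (ball 0 \<epsilon>) h * ennreal ((norm (v (x + h) - v x))\<^sup>2) = F x (x + h)"
        unfolding F_def by (simp add: indicator_def)
    qed
    also have "\<dots> = (\<integral>\<^sup>+y. F x y \<partial>lborel)"
      by (rule lborel_iso_nn_integral[OF lborel_iso_add_left]) (simp add: F_def)
    finally show ?thesis by (simp add: F_def)
  qed
  then have "J \<epsilon> v = (\<integral>\<^sup>+x. \<integral>\<^sup>+y. ennreal ((if dist x y < \<epsilon> then 1 else 0) * (v x - v y)\<^sup>2) \<partial>lborel \<partial>lborel)"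
    by (simp add: J_def)
  also have "\<dots> = (\<integral>\<^sup>+p. ennreal ((if dist (fst p) (snd p) < \<epsilon> then 1 else 0) * (v (fst p) - v (snd p))\<^sup>2) \<partial>(lborel \<Otimes>\<^sub>M lborel))"
    using lborel.nn_integral_fst[of "\<lambda>p. ennreal ((if dist (fst p) (snd p) < \<epsilon> then 1 else 0) * (v (fst p) - v (snd p))\<^sup>2)" lborel]
    by simp
  finally show ?thesis .
qed

lemma lborel_iso_id: "lborel_iso (\<lambda>x. x)"
  using lborel_iso_add[of 0] by simp

text \<open>Summing the integrand over the four mirror images of a pair turns a comparison of
  integrals into a pointwise one.\<close>

lemma nn_four_symmetrise:
  fixes g :: "(real^2) \<times> (real^2) \<Rightarrow> real"
  assumes e: "norm e = 1" and [measurable]: "g \<in> borel_measurable (borel \<Otimes>\<^sub>M borel)" and g0: "\<And>p. g p \<ge> 0"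
  shows "4 * (\<integral>\<^sup>+p. ennreal (g p) \<partial>(lborel \<Otimes>\<^sub>M lborel)) = (\<integral>\<^sup>+p. ennreal
     (g (fst p, snd p) + g (hrefl e t (fst p), hrefl e t (snd p)) + (g (fst p, hrefl e t (snd p)) + g (hrefl e t (fst p), snd p))) \<partial>(lborel \<Otimes>\<^sub>M lborel))"
proof -
  note r = hrefl_iso[OF e, of t]
  have [measurable]: "hrefl e t \<in> borel_measurable borel" by (rule lborel_iso_measurable[OF r])
  have "(\<integral>\<^sup>+p. ennreal (g (fst p, snd p) + g (hrefl e t (fst p), hrefl e t (snd p)) + (g (fst p, hrefl e t (snd p)) + g (hrefl e t (fst p), snd p))) \<partial>(lborel \<Otimes>\<^sub>M lborel))
    = (\<integral>\<^sup>+p. (ennreal (g (fst p, snd p)) + ennreal (g (hrefl e t (fst p), hrefl e t (snd p)))) + (ennreal (g (fst p, hrefl e t (snd p))) + ennreal (g (hrefl e t (fst p), snd p))) \<partial>(lborel \<Otimes>\<^sub>M lborel))"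
    using g0 by simp
  also have "\<dots> = ((\<integral>\<^sup>+p. ennreal (g p) \<partial>(lborel \<Otimes>\<^sub>M lborel)) + (\<integral>\<^sup>+p. ennreal (g p) \<partial>(lborel \<Otimes>\<^sub>M lborel))) + ((\<integral>\<^sup>+p. ennreal (g p) \<partial>(lborel \<Otimes>\<^sub>M lborel)) + (\<integral>\<^sup>+p. ennreal (g p) \<partial>(lborel \<Otimes>\<^sub>M lborel)))"
    using pair_iso_nn_integral[OF r r, of "\<lambda>p. ennreal (g p)"] pair_iso_nn_integral[OF lborel_iso_id r, of "\<lambda>p. ennreal (g p)"]
      pair_iso_nn_integral[OF r lborel_iso_id, of "\<lambda>p. ennreal (g p)"]
    by (simp add: nn_integral_add)
  also have "\<dots> = 4 * (\<integral>\<^sup>+p. ennreal (g p) \<partial>(lborel \<Otimes>\<^sub>M lborel))"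
    by (simp flip: mult_2 add: mult.assoc[symmetric])
  finally show ?thesis by simp
qed

text \<open>Sums of squares over mirror pairs are preserved, so only products matter, and they are
  weighted by a decreasing function of the distance.\<close>

lemma J_polar_le:
  assumes e: "norm e = 1" and [measurable]: "v \<in> borel_measurable borel"
  shows "J \<epsilon> (polar e t v) \<le> J \<epsilon> v"
proof -
  note [measurable] = polar_measurable[OF assms(2) e]
  let ?k = "\<lambda>r::real. if r < \<epsilon> then 1 else 0 :: real"
  let ?g = "\<lambda>v p. ?k (dist (fst p) (snd p)) * (v (fst p) - v (snd p))\<^sup>2 :: real"
  let ?r = "hrefl e t"
  let ?S = "\<lambda>v p. ?g v (fst p, snd p) + ?g v (?r (fst p), ?r (snd p)) + (?g v (fst p, ?r (snd p)) + ?g v (?r (fst p), snd p))"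
  have le: "?S (polar e t v) p \<le> ?S v p" for p :: "(real^2) \<times> (real^2)"
  proof -
    obtain x y where p: "p = (x, y)" by (cases p)
    let ?a = "v x" and ?a' = "v (?r x)" and ?b = "v y" and ?b' = "v (?r y)"
    let ?A = "polar e t v x" and ?A' = "polar e t v (?r x)" and ?B = "polar e t v y" and ?B' = "polar e t v (?r y)"
    define k1 where "k1 = ?k (dist x y)"
    define k2 where "k2 = ?k (dist x (?r y))"
    define G where "G = pair_gain e t v x y"
    have S: "?S u p = k1 * ((u x - u y)\<^sup>2 + (u (?r x) - u (?r y))\<^sup>2) + k2 * ((u x - u (?r y))\<^sup>2 + (u (?r x) - u y)\<^sup>2)" for u
      by (simp add: p k1_def k2_def hrefl_refl[OF e] dist_hrefl_refl[OF e] dist_hrefl_commute[OF e] distrib_left)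
    have sq: "?A\<^sup>2 + ?A'\<^sup>2 = ?a\<^sup>2 + ?a'\<^sup>2" "?B\<^sup>2 + ?B'\<^sup>2 = ?b\<^sup>2 + ?b'\<^sup>2"
      using polar_sum[OF e, of "\<lambda>r. r\<^sup>2"] by auto
    have d1: "(?A - ?B)\<^sup>2 + (?A' - ?B')\<^sup>2 = (?a - ?b)\<^sup>2 + (?a' - ?b')\<^sup>2 - 2 * G"
      using sq by (simp add: G_def pair_gain_def power2_diff algebra_simps)
    have d2: "(?A - ?B')\<^sup>2 + (?A' - ?B)\<^sup>2 = (?a - ?b')\<^sup>2 + (?a' - ?b)\<^sup>2 + 2 * G"
      using sq pair_gain_cross[OF e, of t v x y] by (simp add: G_def power2_diff algebra_simps)
    have sgn: "0 \<le> (k1 - k2) * G"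
    proof (cases "x = y \<or> x = ?r y")
      case False
      \<comment> \<open>\<open>pair_gain_sign\<close> is applied to minus the cutoff kernel, which
        increases with the distance.\<close>
      then show ?thesis
        using pair_gain_sign[OF e, of "\<lambda>r. - ?k r" x y t v] by (auto simp: k1_def k2_def G_def)
    next
      case True
      \<comment> \<open>The integrands are compared at every pair, so coincidences count: for
        \<open>x = y\<close> the gain is nonnegative and the direct distance is 0, and for a mirror
        pair off the line the gain is nonpositive and the crossed distance is 0.\<close>
      then have "G \<ge> 0 \<and> x = y \<or> G \<le> 0 \<and> x = ?r y"
      proof
        assume "x = y"
        then show ?thesis using pair_gain_same_side[OF e, of x t y v] by (simp add: G_def)
      next
        assume xy: "x = ?r y"
        then show ?thesis
        proof (cases "(x \<bullet> e < t) = (y \<bullet> e < t)")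
          case True
          then have "y \<bullet> e = t" using xy hrefl_inner[OF e, of t y] by auto
          then have "x = y" using xy hrefl_boundary by metis
          then show ?thesis using pair_gain_same_side[OF e, of x t y v] by (simp add: G_def)
        next
          case False
          then show ?thesis using pair_gain_opposite[OF e False, of v] xy by (simp add: G_def)
        qed
      qed
      then show ?thesis
      proof
        assume "G \<ge> 0 \<and> x = y"
        then have G0: "G \<ge> 0" and "dist x y \<le> dist x (?r y)" by auto
        then have "k2 \<le> k1" unfolding k1_def k2_def by auto
        with G0 show ?thesis by (intro mult_nonneg_nonneg) auto
      next
        assume "G \<le> 0 \<and> x = ?r y"
        then have G0: "G \<le> 0" and "dist x (?r y) \<le> dist x y" by auto
        then have "k1 \<le> k2" unfolding k1_def k2_def by auto
        with G0 show ?thesis by (intro mult_nonpos_nonpos) auto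
      qed
    qed
    have "?S v p - ?S (polar e t v) p = 2 * ((k1 - k2) * G)" unfolding S d1 d2 by (simp add: algebra_simps)
    with sgn show ?thesis by linarith
  qed
  have "4 * J \<epsilon> (polar e t v) = (\<integral>\<^sup>+p. ennreal (?S (polar e t v) p) \<partial>(lborel \<Otimes>\<^sub>M lborel))"
    unfolding J_pair[OF polar_measurable[OF assms(2) e]]
    by (rule nn_four_symmetrise[OF e, where g="?g (polar e t v)"]) auto
  also have "\<dots> \<le> (\<integral>\<^sup>+p. ennreal (?S v p) \<partial>(lborel \<Otimes>\<^sub>M lborel))"
    by (intro nn_integral_mono ennreal_leI le)
  also have "\<dots> = 4 * J \<epsilon> v"
    unfolding J_pair[OF assms(2)]
    by (rule nn_four_symmetrise[OF e, where g="?g v", symmetric]) auto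
  finally show ?thesis by (subst (asm) ennreal_mult_le_mult_iff) auto
qed

lemma polar_nonneg: "(\<And>x. 0 \<le> v x) \<Longrightarrow> 0 \<le> polar e t v x"
  by (auto simp: polar_def intro: max.coboundedI1)

lemma polar_sq: assumes "\<And>x. 0 \<le> v x" shows "(polar e t v x)\<^sup>2 = polar e t (\<lambda>x. (v x)\<^sup>2) x"
  using assms[of x] assms[of "hrefl e t x"] by (auto simp: polar_def max_def min_def abs_le_square_iff[symmetric] intro: power_mono)

lemma polar_admissible:
  assumes v: "admissible v" and e: "norm e = 1"
  shows "admissible (polar e t v)" "nsq lborel (polar e t v) = nsq lborel v" "DD (polar e t v) \<le> DD v"
proof -
  note ad = admissibleD[OF v] and r = hrefl_iso[OF e, of t]
  have [measurable]: "v \<in> borel_measurable borel" by (rule ad)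
  note [measurable] = polar_measurable[OF ad(2) e] lborel_iso_measurable[OF r]
  let ?p = "polar e t v" and ?r = "hrefl e t"
  have pt: "(?p x)\<^sup>2 \<le> (v x)\<^sup>2 + (v (?r x))\<^sup>2" for x by (auto simp: polar_def max_def min_def)
  have rint: "integrable lborel (\<lambda>x. (v (?r x))\<^sup>2)"
    using lborel_iso_integral(2)[OF r, of "\<lambda>x. (v x)\<^sup>2"] ad(6) by simp
  have pint: "integrable lborel (\<lambda>x. (?p x)\<^sup>2)"
    by (rule Bochner_Integration.integrable_bound[OF Bochner_Integration.integrable_add[OF ad(6) rint]])
      (use pt in \<open>auto intro!: AE_I2\<close>)
  then have pL: "L2 lborel ?p" by (simp add: L2_def)
  have Dn: "Dn ?p \<le> ennreal (DD v)"
    by (rule Dn_le[OF order_trans[OF J_polar_le[OF e ad(2)] Dn_bounds_J[OF ad(1,4) DD_nonneg]] DD_nonneg]) simp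
  then show "DD ?p \<le> DD v" by (rule DD_le[OF _ DD_nonneg])
  have lr: "integrable lborel (\<lambda>x. ln (1 + norm x) * (v (?r x))\<^sup>2)"
  proof -
    have "integrable lborel (\<lambda>x. ln (1 + norm (?r x)) * (v x)\<^sup>2)"
    proof (rule Bochner_Integration.integrable_bound)
      show "integrable lborel (\<lambda>x. ln (1 + norm x) * (v x)\<^sup>2 + ln (1 + norm (?r 0)) * (v x)\<^sup>2)"
        using ad by (intro Bochner_Integration.integrable_add integrable_mult_right)
      show "AE x in lborel. norm (ln (1 + norm (?r x)) * (v x)\<^sup>2) \<le> norm (ln (1 + norm x) * (v x)\<^sup>2 + ln (1 + norm (?r 0)) * (v x)\<^sup>2)"
      proof (intro AE_I2)
        fix x
        have "norm (?r x - ?r 0) = norm x" using dist_hrefl_refl[OF e, of t x 0] by (simp add: dist_norm)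
        then have "ln (1 + norm (?r x)) \<le> ln (1 + norm x) + ln (1 + norm (?r 0))"
          using ln_norm_add_le[of "?r x - ?r 0" "?r 0"] by simp
        then have "ln (1 + norm (?r x)) * (v x)\<^sup>2 \<le> (ln (1 + norm x) + ln (1 + norm (?r 0))) * (v x)\<^sup>2"
          by (rule mult_right_mono) simp
        then show "norm (ln (1 + norm (?r x)) * (v x)\<^sup>2) \<le> norm (ln (1 + norm x) * (v x)\<^sup>2 + ln (1 + norm (?r 0)) * (v x)\<^sup>2)"
          by (simp add: distrib_right)
      qed
    qed measurable
    then have "integrable lborel (\<lambda>x. ln (1 + norm (?r (?r x))) * (v (?r x))\<^sup>2)"
      using lborel_iso_integral(2)[OF r, of "\<lambda>x. ln (1 + norm (?r x)) * (v x)\<^sup>2"] by simp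
    then show ?thesis by (simp add: hrefl_refl[OF e])
  qed
  have "integrable lborel (\<lambda>x. ln (1 + norm x) * (?p x)\<^sup>2)"
  proof (rule Bochner_Integration.integrable_bound[OF Bochner_Integration.integrable_add[OF ad(5) lr]])
    show "AE x in lborel. norm (ln (1 + norm x) * (?p x)\<^sup>2) \<le> norm (ln (1 + norm x) * (v x)\<^sup>2 + ln (1 + norm x) * (v (?r x))\<^sup>2)"
      using mult_left_mono[OF pt, of "ln (1 + norm _)"] by (intro AE_I2) (simp add: distrib_left)
  qed measurable
  with pL Dn show "admissible ?p"
    using polar_nonneg[OF ad(3)] by (auto simp: admissible_def le_less_trans)
  have "2 * nsq lborel ?p = (\<integral>x. (?p x)\<^sup>2 + (?p (?r x))\<^sup>2 \<partial>lborel)"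
    using pint lborel_iso_integral[OF r, of "\<lambda>x. (?p x)\<^sup>2"] by (simp add: nsq_def)
  also have "\<dots> = (\<integral>x. (v x)\<^sup>2 + (v (?r x))\<^sup>2 \<partial>lborel)" using polar_sum[OF e, of "\<lambda>r. r\<^sup>2"] by simp
  also have "\<dots> = 2 * nsq lborel v"
    using ad(6) rint lborel_iso_integral(1)[OF r, of "\<lambda>x. (v x)\<^sup>2"] by (simp add: nsq_def)
  finally show "nsq lborel ?p = nsq lborel v" by simp
qed

lemma four_symmetrise:
  fixes g :: "(real^2) \<times> (real^2) \<Rightarrow> real"
  assumes e: "norm e = 1" and g: "g \<in> borel_measurable (borel \<Otimes>\<^sub>M borel)" "integrable (lborel \<Otimes>\<^sub>M lborel) g"
  shows "integrable (lborel \<Otimes>\<^sub>M lborel)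
     (\<lambda>p. g (fst p, snd p) + g (hrefl e t (fst p), hrefl e t (snd p)) + (g (fst p, hrefl e t (snd p)) + g (hrefl e t (fst p), snd p)))"
    and "4 * (\<integral>p. g p \<partial>(lborel \<Otimes>\<^sub>M lborel)) = (\<integral>p.
     g (fst p, snd p) + g (hrefl e t (fst p), hrefl e t (snd p)) + (g (fst p, hrefl e t (snd p)) + g (hrefl e t (fst p), snd p)) \<partial>(lborel \<Otimes>\<^sub>M lborel))"
proof -
  note r = hrefl_iso[OF e, of t]
  have i: "integrable (lborel \<Otimes>\<^sub>M lborel) (\<lambda>p. g (fst p, snd p))"
     "integrable (lborel \<Otimes>\<^sub>M lborel) (\<lambda>p. g (hrefl e t (fst p), hrefl e t (snd p)))"
     "integrable (lborel \<Otimes>\<^sub>M lborel) (\<lambda>p. g (fst p, hrefl e t (snd p)))"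
     "integrable (lborel \<Otimes>\<^sub>M lborel) (\<lambda>p. g (hrefl e t (fst p), snd p))"
    using g(2) pair_iso_integral(2)[OF r r g(1)] pair_iso_integral(2)[OF lborel_iso_id r g(1)] pair_iso_integral(2)[OF r lborel_iso_id g(1)]
    by simp_all
  then show "integrable (lborel \<Otimes>\<^sub>M lborel)
     (\<lambda>p. g (fst p, snd p) + g (hrefl e t (fst p), hrefl e t (snd p)) + (g (fst p, hrefl e t (snd p)) + g (hrefl e t (fst p), snd p)))"
    by (intro Bochner_Integration.integrable_add)
  show "4 * (\<integral>p. g p \<partial>(lborel \<Otimes>\<^sub>M lborel)) = (\<integral>p.
     g (fst p, snd p) + g (hrefl e t (fst p), hrefl e t (snd p)) + (g (fst p, hrefl e t (snd p)) + g (hrefl e t (fst p), snd p)) \<partial>(lborel \<Otimes>\<^sub>M lborel))"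
    using i pair_iso_integral(1)[OF r r g(1)] pair_iso_integral(1)[OF lborel_iso_id r g(1)] pair_iso_integral(1)[OF r lborel_iso_id g(1)]
    by (simp add: Bochner_Integration.integral_add)
qed

text \<open>With \<open>ln 0 = 0\<close> the logarithm is not monotone at distance 0; the diagonal
  and its mirror image, where this matters, are null sets.\<close>

lemma AE_pair_distinct:
  assumes e: "norm e = 1"
  shows "AE p in lborel \<Otimes>\<^sub>M lborel. fst p \<noteq> snd p \<and> fst p \<noteq> hrefl e t (snd p)"
proof -
  have m [measurable]: "hrefl e t \<in> borel_measurable borel" by (rule lborel_iso_measurable[OF hrefl_iso[OF e]])
  have "AE y in lborel. x \<noteq> y \<and> x \<noteq> hrefl e t y" for x
  proof -
    have "AE y in lborel. y \<noteq> z" for z :: "real^2"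
      by (rule AE_I'[of "{z}"]) (auto simp: null_sets_def)
    from this[of x] this[of "hrefl e t x"] show ?thesis
      by eventually_elim (use hrefl_refl[OF e] in auto)
  qed
  moreover have "{p \<in> space (lborel \<Otimes>\<^sub>M lborel). fst p \<noteq> snd p \<and> fst p \<noteq> hrefl e t (snd p)} \<in> sets (lborel \<Otimes>\<^sub>M lborel)"
  proof -
    have "{p \<in> space (lborel \<Otimes>\<^sub>M lborel). 0 < dist (fst p) (snd p) \<and> 0 < dist (fst p) (hrefl e t (snd p))} \<in> sets (lborel \<Otimes>\<^sub>M lborel)"
      by measurable
    then show ?thesis by simp
  qed
  ultimately show ?thesis
    using lborel_pair.AE_pair_iff[of "\<lambda>x y. x \<noteq> y \<and> x \<noteq> hrefl e t y"] by (simp add: case_prod_unfold)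
qed

text \<open>The polarised function is a competitor with no larger Dirichlet energy, so minimality
  leaves the symmetrised logarithmic integrand unchanged almost everywhere. Strict monotonicity of
  \<open>ln\<close> then forbids opposite orderings at almost all pairs in the half plane: the sets
  where \<open>v\<close> is above and below its reflection have a null product, so one of them is
  null.\<close>

theorem minimiser_polarised:
  assumes c: "c > 0" and v: "admissible v" "nsq lborel v = lam"
    and min: "\<And>w. admissible w \<Longrightarrow> nsq lborel w = lam \<Longrightarrow> FF c v \<le> FF c w"
    and e: "norm e = 1"
  shows "(AE x in lborel. x \<bullet> e < t \<longrightarrow> v (hrefl e t x) \<le> v x) \<or> (AE x in lborel. x \<bullet> e < t \<longrightarrow> v x \<le> v (hrefl e t x))"
proof -
  note ad = admissibleD[OF v(1)] and pa = polar_admissible[OF v(1) e, of t]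
  let ?r = "hrefl e t" and ?p = "polar e t v"
  define f where "f x = (v x)\<^sup>2" for x
  have [measurable]: "v \<in> borel_measurable borel" by (rule ad)
  note [measurable] = polar_measurable[OF ad(2) e] lborel_iso_measurable[OF hrefl_iso[OF e, of t]]
  have [measurable]: "f \<in> borel_measurable borel" unfolding f_def by measurable
  \<comment> \<open>The interaction involves squares, and squaring commutes with polarisation on
    nonnegative functions.\<close>
  have ps: "(?p x)\<^sup>2 = polar e t f x" for x unfolding f_def by (rule polar_sq[OF ad(3)])
  let ?g = "\<lambda>u p. ln (dist (fst p) (snd p)) * (u (fst p))\<^sup>2 * (u (snd p))\<^sup>2 :: real"
  let ?S = "\<lambda>u p. ?g u (fst p, snd p) + ?g u (?r (fst p), ?r (snd p)) + (?g u (fst p, ?r (snd p)) + ?g u (?r (fst p), snd p))"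
  have gi: "integrable (lborel \<Otimes>\<^sub>M lborel) (?g v)" "integrable (lborel \<Otimes>\<^sub>M lborel) (?g ?p)"
    using IK_integrable[OF v(1), of ln 0] IK_integrable[OF pa(1), of ln 0] by auto
  have gm: "?g v \<in> borel_measurable (borel \<Otimes>\<^sub>M borel)" "?g ?p \<in> borel_measurable (borel \<Otimes>\<^sub>M borel)" by measurable
  note s1 = four_symmetrise[OF e gm(1) gi(1), of t] and s2 = four_symmetrise[OF e gm(2) gi(2), of t]
  have diff: "?S v p - ?S ?p p = (ln (dist (fst p) (?r (snd p))) - ln (dist (fst p) (snd p))) * pair_gain e t f (fst p) (snd p)" for p
  proof -
    obtain x y where p: "p = (x, y)" by (cases p)
    define k1 where "k1 = ln (dist x y)"
    define k2 where "k2 = ln (dist x (?r y))"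
    have S: "?S u p = k1 * ((u x)\<^sup>2 * (u y)\<^sup>2 + (u (?r x))\<^sup>2 * (u (?r y))\<^sup>2) + k2 * ((u x)\<^sup>2 * (u (?r y))\<^sup>2 + (u (?r x))\<^sup>2 * (u y)\<^sup>2)" for u
      by (simp add: p k1_def k2_def hrefl_refl[OF e] dist_hrefl_refl[OF e] dist_hrefl_commute[OF e] algebra_simps)
    define G where "G = pair_gain e t f x y"
    let ?P = "polar e t f"
    have Sv: "?S v p = k1 * (f x * f y + f (?r x) * f (?r y)) + k2 * (f x * f (?r y) + f (?r x) * f y)"
      using S[of v] by (simp only: f_def)
    have Sp: "?S ?p p = k1 * (?P x * ?P y + ?P (?r x) * ?P (?r y)) + k2 * (?P x * ?P (?r y) + ?P (?r x) * ?P y)"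
      using S[of ?p] by (simp only: ps)
    have c: "?P x * ?P y + ?P (?r x) * ?P (?r y) = f x * f y + f (?r x) * f (?r y) + G"
      "?P x * ?P (?r y) + ?P (?r x) * ?P y = f x * f (?r y) + f (?r x) * f y - G"
      using pair_gain_cross[OF e, of t f x y] unfolding G_def by (simp add: pair_gain_def, linarith)
    have "?S v p - ?S ?p p = (k2 - k1) * G" unfolding Sv Sp c by (simp add: algebra_simps)
    then show ?thesis by (simp only: p k1_def k2_def G_def fst_conv snd_conv)
  qed
  have nn: "AE p in lborel \<Otimes>\<^sub>M lborel. 0 \<le> ?S v p - ?S ?p p"
    using AE_pair_distinct[OF e, of t]
  proof eventually_elim
    case (elim p)
    show ?case unfolding diff by (rule pair_gain_sign[OF e]) (use elim in auto)
  qed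
  have "FF c v \<le> FF c ?p" by (rule min[OF pa(1)]) (simp add: pa(2) v(2))
  then have "c * IK ln v \<le> c * IK ln ?p" using pa(3) by (simp add: FF_def)
  then have "IK ln v \<le> IK ln ?p" using c by simp
  then have "4 * IK ln v - 4 * IK ln ?p \<le> 0" by simp
  then have "(\<integral>p. ?S v p - ?S ?p p \<partial>(lborel \<Otimes>\<^sub>M lborel)) \<le> 0"
    unfolding IK_def s1(2) s2(2) using Bochner_Integration.integral_diff[OF s1(1) s2(1)] by simp
  moreover have "0 \<le> (\<integral>p. ?S v p - ?S ?p p \<partial>(lborel \<Otimes>\<^sub>M lborel))" by (rule integral_nonneg_AE[OF nn])
  ultimately have "(\<integral>p. ?S v p - ?S ?p p \<partial>(lborel \<Otimes>\<^sub>M lborel)) = 0" by linarith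
  then have "AE p in lborel \<Otimes>\<^sub>M lborel. ?S v p - ?S ?p p = 0"
    using integral_nonneg_eq_0_iff_AE[OF Bochner_Integration.integrable_diff[OF s1(1) s2(1)] nn] by simp
  then have *: "AE p in lborel \<Otimes>\<^sub>M lborel. fst p \<bullet> e < t \<longrightarrow> snd p \<bullet> e < t \<longrightarrow>
     0 \<le> (f (fst p) - f (?r (fst p))) * (f (snd p) - f (?r (snd p)))"
    using AE_pair_distinct[OF e, of t]
  proof eventually_elim
    case (elim p)
    show ?case
    proof (intro impI, rule ccontr)
      assume H: "fst p \<bullet> e < t" "snd p \<bullet> e < t" and neg: "\<not> 0 \<le> (f (fst p) - f (?r (fst p))) * (f (snd p) - f (?r (snd p)))"
      have G: "pair_gain e t f (fst p) (snd p) > 0" using pair_gain_same_side[OF e, of "fst p" t "snd p" f] H neg by simp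
      have "0 < (fst p \<bullet> e - t) * (snd p \<bullet> e - t)" using H by (intro mult_neg_neg) auto
      then have "(dist (fst p) (snd p))\<^sup>2 < (dist (fst p) (?r (snd p)))\<^sup>2" using dist_sq_hrefl[OF e, of "fst p" t "snd p"] by simp
      then have "dist (fst p) (snd p) < dist (fst p) (?r (snd p))" by (rule power2_less_imp_less) simp
      then have "ln (dist (fst p) (snd p)) < ln (dist (fst p) (?r (snd p)))" using elim by simp
      with G have "(ln (dist (fst p) (?r (snd p))) - ln (dist (fst p) (snd p))) * pair_gain e t f (fst p) (snd p) > 0" by simp
      with elim(1) show False unfolding diff by linarith
    qed
  qed
  define P where "P = {x. x \<bullet> e < t \<and> f (?r x) < f x}"
  define N where "N = {x. x \<bullet> e < t \<and> f x < f (?r x)}"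
  have [measurable]: "P \<in> sets borel" "N \<in> sets borel" unfolding P_def N_def by measurable
  have "AE p in lborel \<Otimes>\<^sub>M lborel. p \<notin> P \<times> N"
    using *
  proof eventually_elim
    case (elim p)
    show ?case
    proof
      assume "p \<in> P \<times> N"
      then have "(f (fst p) - f (?r (fst p))) * (f (snd p) - f (?r (snd p))) < 0"
        by (intro mult_pos_neg) (auto simp: P_def N_def)
      with elim \<open>p \<in> P \<times> N\<close> show False by (auto simp: P_def N_def)
    qed
  qed
  then have "emeasure (lborel \<Otimes>\<^sub>M lborel) (P \<times> N) = 0"
    by (subst (asm) AE_iff_measurable[OF _ refl]) (auto simp: space_pair_measure)
  then have "emeasure lborel P * emeasure lborel N = 0" by (simp add: lborel.emeasure_pair_measure_Times)
  then have "emeasure lborel P = 0 \<or> emeasure lborel N = 0" by simp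
  then have PN: "(AE x in lborel. x \<notin> P) \<or> (AE x in lborel. x \<notin> N)"
    by (auto intro!: AE_not_in simp: null_sets_def)
  have fv: "f x < f y \<longleftrightarrow> v x < v y" for x y
    unfolding f_def using ad(3)[of x] ad(3)[of y] by (auto intro: power_strict_mono dest: power2_less_imp_less)
  from PN show ?thesis
  proof
    assume "AE x in lborel. x \<notin> P"
    then have "AE x in lborel. x \<bullet> e < t \<longrightarrow> v x \<le> v (hrefl e t x)"
      by eventually_elim (auto simp: P_def fv not_less)
    then show ?thesis ..
  next
    assume "AE x in lborel. x \<notin> N"
    then have "AE x in lborel. x \<bullet> e < t \<longrightarrow> v (hrefl e t x) \<le> v x"
      by eventually_elim (auto simp: N_def fv not_less)
    then show ?thesis ..
  qed
qed

subsection \<open>Radial symmetry of minimisers\<close>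

lemma J_cong_AE:
  assumes [measurable]: "v \<in> borel_measurable borel" "w \<in> borel_measurable borel"
    and eq: "AE x in lborel. w x = (v x :: real)"
  shows "J \<epsilon> w = J \<epsilon> v"
  unfolding J_def
proof (rule nn_integral_cong_AE, use eq in eventually_elim)
  case (elim x)
  show ?case
    by (rule nn_integral_cong_AE, use lborel_iso_AE[OF lborel_iso_add_left eq, of x] in eventually_elim) (simp add: elim)
qed

lemma admissible_cong_AE:
  assumes v: "admissible v" and w [measurable]: "w \<in> borel_measurable borel" and w0: "\<And>x. 0 \<le> w x"
    and eq: "AE x in lborel. w x = v x"
  shows "admissible w" "nsq lborel w = nsq lborel v" "DD w = DD v" "FF c w = FF c v"
proof -
  note ad = admissibleD[OF v]
  have [measurable]: "v \<in> borel_measurable borel" by (rule ad)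
  have Dn: "Dn w = Dn v" by (simp add: Dn_def J_cong_AE[OF ad(2) w eq])
  have "integrable lborel (\<lambda>x. (w x)\<^sup>2)"
    by (rule integrable_cong_AE[THEN iffD1, OF _ _ _ ad(6)]) (use eq in auto)
  moreover have "integrable lborel (\<lambda>x. ln (1 + norm x) * (w x)\<^sup>2)"
    by (rule integrable_cong_AE[THEN iffD1, OF _ _ _ ad(5)]) (use eq in auto)
  ultimately show "admissible w" using v w0 by (simp add: admissible_def L2_def Dn)
  show "nsq lborel w = nsq lborel v" by (rule nsq_cong_AE[OF _ _ eq]) auto
  show D: "DD w = DD v" by (simp add: DD_def Dn)
  have "IK ln w = IK ln v"
    unfolding IK_def
    by (rule integral_cong_AE; (measurable)?) (use AE_lborel_pair[OF eq] in eventually_elim, simp)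
  then show "FF c w = FF c v" by (simp add: FF_def D)
qed

lemma AE_off_line:
  assumes "norm (e::real^2) = 1" shows "AE x in lborel. x \<bullet> e \<noteq> t"
proof -
  have "e \<noteq> 0" using assms by auto
  then have "negligible {x. e \<bullet> x = t}" by (intro negligible_hyperplane) simp
  then have n: "emeasure lebesgue {x. e \<bullet> x = t} = 0" by (simp add: negligible_iff_null_sets null_sets_def)
  have B: "{x. e \<bullet> x = t} \<in> sets borel" using closed_hyperplane by (rule borel_closed)
  have "emeasure lborel {x. e \<bullet> x = t} = 0" using n B by (simp add: emeasure_completion)
  then have "{x. e \<bullet> x = t} \<in> null_sets lborel" using B by (simp add: null_sets_def)
  then show ?thesis by (rule AE_I') (auto simp: inner_commute)
qed

definition half_mass :: "(real^2 \<Rightarrow> real) \<Rightarrow> real^2 \<Rightarrow> real \<Rightarrow> real" where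
  "half_mass v e t = (\<integral>x. indicator {x. x \<bullet> e < t} x * (v x)\<^sup>2 \<partial>lborel)"

lemma half_plane_measurable [measurable]: "{x. x \<bullet> e < t} \<in> sets (borel :: (real^2) measure)" "{x. t < x \<bullet> e} \<in> sets (borel :: (real^2) measure)"
  by measurable

lemma indicator_sq_integrable:
  assumes "admissible v" "A \<in> sets borel" shows "integrable lborel (\<lambda>x. indicator A x * (v x)\<^sup>2)"
  using integrable_mult_indicator[OF _ admissibleD(6)[OF assms(1)], of A] assms(2) by simp

lemma half_mass_complement:
  assumes v: "admissible v" and e: "norm e = 1"
  shows "(\<integral>x. indicator {x. t < x \<bullet> e} x * (v x)\<^sup>2 \<partial>lborel) = nsq lborel v - half_mass v e t"
proof -
  have [measurable]: "v \<in> borel_measurable borel" by (rule admissibleD[OF v])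
  have "nsq lborel v = (\<integral>x. indicator {x. x \<bullet> e < t} x * (v x)\<^sup>2 + indicator {x. t < x \<bullet> e} x * (v x)\<^sup>2 \<partial>lborel)"
    unfolding nsq_def
    by (rule integral_cong_AE; (measurable)?) (use AE_off_line[OF e, of t] in eventually_elim, auto simp: indicator_def)
  also have "\<dots> = half_mass v e t + (\<integral>x. indicator {x. t < x \<bullet> e} x * (v x)\<^sup>2 \<partial>lborel)"
    unfolding half_mass_def by (intro Bochner_Integration.integral_add indicator_sq_integrable v) measurable
  finally show ?thesis by simp
qed

lemma half_mass_reflected:
  assumes v: "admissible v" and e: "norm e = 1"
  shows "integrable lborel (\<lambda>x. indicator {x. x \<bullet> e < t} x * (v (hrefl e t x))\<^sup>2)"
    "(\<integral>x. indicator {x. x \<bullet> e < t} x * (v (hrefl e t x))\<^sup>2 \<partial>lborel) = nsq lborel v - half_mass v e t"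
proof -
  note r = hrefl_iso[OF e, of t]
  have [measurable]: "v \<in> borel_measurable borel" by (rule admissibleD[OF v])
  have eq: "indicator {x. t < x \<bullet> e} (hrefl e t x) * (v (hrefl e t x))\<^sup>2 = indicator {x. x \<bullet> e < t} x * (v (hrefl e t x))\<^sup>2" for x
    by (simp add: indicator_def hrefl_inner[OF e])
  show "integrable lborel (\<lambda>x. indicator {x. x \<bullet> e < t} x * (v (hrefl e t x))\<^sup>2)"
    using lborel_iso_integral(2)[OF r, of "\<lambda>x. indicator {x. t < x \<bullet> e} x * (v x)\<^sup>2"] indicator_sq_integrable[OF v, of "{x. t < x \<bullet> e}"]
    by (simp add: eq)
  show "(\<integral>x. indicator {x. x \<bullet> e < t} x * (v (hrefl e t x))\<^sup>2 \<partial>lborel) = nsq lborel v - half_mass v e t"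
    using lborel_iso_integral(1)[OF r, of "\<lambda>x. indicator {x. t < x \<bullet> e} x * (v x)\<^sup>2"] half_mass_complement[OF v e, of t]
    by (simp add: eq)
qed

text \<open>Two nonnegative functions ordered one way, whose squares have integrals ordered the
  other way, agree almost everywhere; the sign \<open>s\<close> treats both orderings at
  once.\<close>

lemma AE_half_eq:
  assumes v: "admissible v" and e: "norm e = 1" and s: "s = 1 \<or> s = (-1::real)"
    and le: "AE x in lborel. x \<bullet> e < t \<longrightarrow> s * v (hrefl e t x) \<le> s * v x"
    and mass: "s * (2 * half_mass v e t - nsq lborel v) \<le> 0"
  shows "AE x in lborel. x \<bullet> e < t \<longrightarrow> v (hrefl e t x) = v x"
proof -
  note ad = admissibleD[OF v] and r = half_mass_reflected[OF v e, of t]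
  have [measurable]: "v \<in> borel_measurable borel" by (rule ad)
  note [measurable] = lborel_iso_measurable[OF hrefl_iso[OF e, of t]]
  let ?i = "indicator {x. x \<bullet> e < t} :: real^2 \<Rightarrow> real"
  let ?f = "\<lambda>x. s * (?i x * (v x)\<^sup>2 - ?i x * (v (hrefl e t x))\<^sup>2)"
  have vi: "integrable lborel (\<lambda>x. ?i x * (v x)\<^sup>2)" by (rule indicator_sq_integrable[OF v]) measurable
  have fi: "integrable lborel ?f" by (intro integrable_mult_right Bochner_Integration.integrable_diff vi r(1))
  have nn: "AE x in lborel. 0 \<le> ?f x"
    using le
  proof eventually_elim
    case (elim x)
    show ?case
    proof (cases "x \<bullet> e < t")
      case True
      from s show ?thesis
      proof
        assume "s = 1"
        then show ?thesis using elim True ad(3)[of "hrefl e t x"] by (simp add: power_mono)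
      next
        assume "s = -1"
        then show ?thesis using elim True ad(3)[of x] by (simp add: power_mono)
      qed
    qed simp
  qed
  have "(\<integral>x. ?f x \<partial>lborel) = s * (half_mass v e t - (nsq lborel v - half_mass v e t))"
    using vi r by (simp add: half_mass_def)
  also have "\<dots> \<le> 0" using mass by (simp add: algebra_simps)
  finally have "(\<integral>x. ?f x \<partial>lborel) = 0" using integral_nonneg_AE[OF nn] by linarith
  then have "AE x in lborel. ?f x = 0" using integral_nonneg_eq_0_iff_AE[OF fi nn] by blast
  then show ?thesis
  proof eventually_elim
    case (elim x)
    show ?case
    proof
      assume "x \<bullet> e < t"
      then have "(v (hrefl e t x))\<^sup>2 = (v x)\<^sup>2" using elim s by auto
      then show "v (hrefl e t x) = v x" using ad(3) by (simp add: power2_eq_iff_nonneg)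
    qed
  qed
qed

section \<open>Bisecting lines, centre and radial profile of a minimiser\<close>

locale ground_state =
  fixes c lam :: real and v :: "real^2 \<Rightarrow> real"
  assumes c: "c > 0" and lam: "lam > 0" and adm: "admissible v" and mass: "nsq lborel v = lam"
    and min: "\<And>w. admissible w \<Longrightarrow> nsq lborel w = lam \<Longrightarrow> FF c v \<le> FF c w"
begin

text \<open>Mass decides between the two alternatives left by polarisation: if \<open>v\<close> is
  below its reflection on a half plane holding at least half of the mass, the two agree
  there.\<close>

lemma dominates:
  assumes e: "norm e = 1" and half: "lam \<le> 2 * half_mass v e t"
  shows "AE x in lborel. x \<bullet> e < t \<longrightarrow> v (hrefl e t x) \<le> v x"
  using minimiser_polarised[OF c adm mass min e, of t]
proof
  assume le: "AE x in lborel. x \<bullet> e < t \<longrightarrow> v x \<le> v (hrefl e t x)"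
  have "AE x in lborel. x \<bullet> e < t \<longrightarrow> v (hrefl e t x) = v x"
    by (rule AE_half_eq[OF adm e, of "-1"]) (use le half mass in auto)
  then show ?thesis by eventually_elim simp
qed

lemma balanced_symmetric:
  assumes e: "norm e = 1" and half: "2 * half_mass v e t = lam"
  shows "AE x in lborel. v (hrefl e t x) = v x"
proof -
  have *: "AE x in lborel. x \<bullet> e < t \<longrightarrow> v (hrefl e t x) = v x"
    by (rule AE_half_eq[OF adm e, of 1]) (use dominates[OF e] half mass in auto)
  show ?thesis
    using * lborel_iso_AE[OF hrefl_iso[OF e, of t] *]
  proof eventually_elim
    case (elim x)
    consider "x \<bullet> e < t" | "x \<bullet> e = t" | "x \<bullet> e > t" by linarith
    then show ?case using elim by cases (auto simp: hrefl_boundary hrefl_inner[OF e] hrefl_refl[OF e])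
  qed
qed

lemma half_mass_tendsto:
  assumes e: "norm e = 1"
    and lim: "AE x in lborel. (\<lambda>n. indicator {x. x \<bullet> e < T n} x :: real) \<longlonglongrightarrow> i x" and [measurable]: "i \<in> borel_measurable borel"
  shows "(\<lambda>n. half_mass v e (T n)) \<longlonglongrightarrow> (\<integral>x. i x * (v x)\<^sup>2 \<partial>lborel)"
  unfolding half_mass_def
proof (rule integral_dominated_convergence[OF _ _ admissibleD(6)[OF adm]])
  have [measurable]: "v \<in> borel_measurable borel" by (rule admissibleD[OF adm])
  show "(\<lambda>x. i x * (v x)\<^sup>2) \<in> borel_measurable lborel" by measurable
  show "(\<lambda>x. indicator {x. x \<bullet> e < T n} x * (v x)\<^sup>2) \<in> borel_measurable lborel" for n by measurable
  show "AE x in lborel. (\<lambda>n. indicator {x. x \<bullet> e < T n} x * (v x)\<^sup>2) \<longlonglongrightarrow> i x * (v x)\<^sup>2"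
    using lim by eventually_elim (intro tendsto_mult tendsto_const)
  show "AE x in lborel. norm (indicator {x. x \<bullet> e < T n} x * (v x)\<^sup>2) \<le> (v x)\<^sup>2" for n
    by (auto simp: indicator_def)
qed

text \<open>Intermediate value theorem: the mass of the half plane is continuous in \<open>t\<close>
  because lines are null, and it tends to 0 and to \<open>lam\<close> at the two ends.\<close>

lemma balance_exists:
  assumes e: "norm e = 1"
  shows "\<exists>t. 2 * half_mass v e t = lam"
proof -
  have cont: "continuous_on UNIV (half_mass v e)"
  proof (rule continuous_on_sequentiallyI)
    fix T :: "nat \<Rightarrow> real" and t :: real assume T: "T \<longlonglongrightarrow> t"
    have "(\<lambda>n. half_mass v e (T n)) \<longlonglongrightarrow> (\<integral>x. indicator {x. x \<bullet> e < t} x * (v x)\<^sup>2 \<partial>lborel)"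
    proof (rule half_mass_tendsto[OF e])
      show "AE x in lborel. (\<lambda>n. indicator {x. x \<bullet> e < T n} x :: real) \<longlonglongrightarrow> indicator {x. x \<bullet> e < t} x"
        using AE_off_line[OF e, of t]
      proof eventually_elim
        case (elim x)
        show ?case
        proof (cases "x \<bullet> e < t")
          case True
          from order_tendstoD(1)[OF T True] show ?thesis
            by (intro tendsto_eventually) (auto simp: indicator_def True elim: eventually_mono)
        next
          case False
          with elim have "t < x \<bullet> e" by simp
          from order_tendstoD(2)[OF T this] show ?thesis
            by (intro tendsto_eventually) (auto simp: indicator_def False elim: eventually_mono)
        qed
      qed
    qed measurable
    then show "(\<lambda>n. half_mass v e (T n)) \<longlonglongrightarrow> half_mass v e t" by (simp add: half_mass_def)
  qed
  have "(\<lambda>n. half_mass v e (- real n)) \<longlonglongrightarrow> (\<integral>x. 0 * (v x)\<^sup>2 \<partial>lborel)"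
  proof (rule half_mass_tendsto[OF e], intro AE_I2 tendsto_eventually)
    fix x
    obtain N :: nat where "- (x \<bullet> e) < N" using reals_Archimedean2 by blast
    then show "\<forall>\<^sub>F n in sequentially. indicator {x. x \<bullet> e < - real n} x = (0::real)"
      by (intro eventually_sequentiallyI[of N]) (auto simp: indicator_def)
  qed simp
  then have "(\<lambda>n. half_mass v e (- real n)) \<longlonglongrightarrow> 0" by simp
  from order_tendstoD(2)[OF this, of "lam / 2"] lam obtain N1 where N1: "half_mass v e (- real N1) < lam / 2"
    by (auto simp: eventually_sequentially)
  have "(\<lambda>n. half_mass v e (real n)) \<longlonglongrightarrow> (\<integral>x. 1 * (v x)\<^sup>2 \<partial>lborel)"
  proof (rule half_mass_tendsto[OF e], intro AE_I2 tendsto_eventually)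
    fix x
    obtain N :: nat where "x \<bullet> e < N" using reals_Archimedean2 by blast
    then show "\<forall>\<^sub>F n in sequentially. indicator {x. x \<bullet> e < real n} x = (1::real)"
      by (intro eventually_sequentiallyI[of N]) (auto simp: indicator_def)
  qed simp
  then have "(\<lambda>n. half_mass v e (real n)) \<longlonglongrightarrow> lam" using mass by (simp add: nsq_def)
  from order_tendstoD(1)[OF this, of "lam / 2"] lam obtain N2 where N2: "half_mass v e (real N2) > lam / 2"
    by (auto simp: eventually_sequentially)
  have "- real N1 \<le> real N2" by simp
  from IVT'[of "half_mass v e" "- real N1" "lam / 2" "real N2", OF _ _ this continuous_on_subset[OF cont subset_UNIV]] N1 N2
  obtain t where "half_mass v e t = lam / 2" by (auto simp: less_imp_le)
  then show ?thesis by (intro exI[of _ t]) simp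
qed

text \<open>Reflections in two perpendicular lines compose to the point reflection about their
  intersection.\<close>

lemma symmetric_about_point: "\<exists>p. AE x in lborel. v (p - x) = v (p + x)"
proof -
  have n: "norm (axis i 1 :: real^2) = 1" for i :: 2 by simp
  obtain t1 where t1: "2 * half_mass v (axis 1 1) t1 = lam" using balance_exists[OF n] by blast
  obtain t2 where t2: "2 * half_mass v (axis 2 1) t2 = lam" using balance_exists[OF n] by blast
  note s1 = balanced_symmetric[OF n t1] and s2 = balanced_symmetric[OF n t2]
  define p :: "real^2" where "p = t1 *\<^sub>R axis 1 1 + t2 *\<^sub>R axis 2 1"
  have pt: "hrefl (axis 1 1) t1 (hrefl (axis 2 1) t2 (p + x)) = p - x" for x
  proof -
    have "(axis 1 1 :: real^2)$1 = 1" "(axis 1 1 :: real^2)$2 = 0" "(axis 2 1 :: real^2)$1 = 0" "(axis 2 1 :: real^2)$2 = 1"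
      by (simp_all add: axis_def)
    then show ?thesis by (simp add: vec_eq_iff forall_2 hrefl_def p_def inner_axis)
  qed
  have "AE y in lborel. v (hrefl (axis 1 1) t1 (hrefl (axis 2 1) t2 y)) = v y"
    using s2 lborel_iso_AE[OF hrefl_iso[OF n[of 2], of t2] s1] by eventually_elim simp
  from lborel_iso_AE[OF lborel_iso_add_left this, of p] show ?thesis
    unfolding pt by blast
qed

lemma shifted: "ground_state c lam (\<lambda>x. v (x + p))"
proof
  note m = admissibleD(2)[OF adm]
  show "admissible (\<lambda>x. v (x + p))" by (rule admissible_shift[OF adm])
  show "nsq lborel (\<lambda>x. v (x + p)) = lam" using nsq_shift[OF m] mass by simp
  have "FF c (\<lambda>x. v (x + p)) = FF c v" by (simp add: FF_def DD_def Dn_shift[OF m] IK_shift[OF m])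
  then show "FF c (\<lambda>x. v (x + p)) \<le> FF c w" if "admissible w" "nsq lborel w = lam" for w using min[OF that] by simp
qed (rule c lam)+

text \<open>Evenness makes every line through 0 a bisecting line, so for \<open>t \<ge> 0\<close>
  the half plane holds at least half of the mass, whatever the direction \<open>e\<close>.\<close>

lemma even_dominates:
  assumes even: "AE x in lborel. v (- x) = v x" and e: "norm e = 1" and t: "t \<ge> 0"
  shows "AE x in lborel. x \<bullet> e < t \<longrightarrow> v (hrefl e t x) \<le> v x"
proof (rule dominates[OF e])
  have [measurable]: "v \<in> borel_measurable borel" by (rule admissibleD[OF adm])
  have "half_mass v e 0 = (\<integral>x. indicator {x. x \<bullet> e < 0} (- x) * (v (- x))\<^sup>2 \<partial>lborel)"
    unfolding half_mass_def by (rule lborel_iso_integral(1)[OF lborel_iso_uminus, symmetric]) measurable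
  also have "\<dots> = (\<integral>x. indicator {x. 0 < x \<bullet> e} x * (v x)\<^sup>2 \<partial>lborel)"
    by (rule integral_cong_AE; (measurable)?) (use even in eventually_elim, simp add: indicator_def)
  also have "\<dots> = lam - half_mass v e 0" using half_mass_complement[OF adm e, of 0] mass by simp
  finally have "2 * half_mass v e 0 = lam" by simp
  moreover have "half_mass v e 0 \<le> half_mass v e t"
    unfolding half_mass_def using t
    by (intro integral_mono indicator_sq_integrable[OF adm] half_plane_measurable mult_right_mono) (auto simp: indicator_def)
  ultimately show "lam \<le> 2 * half_mass v e t" by simp
qed

text \<open>The reflecting line is the perpendicular bisector of \<open>x\<close> and
  \<open>y\<close>; since \<open>norm x \<le> norm y\<close> it has \<open>t \<ge> 0\<close>, so
  \<open>v\<close> dominates its reflection on the side of \<open>x\<close>. Integration over discs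
  absorbs the exceptional null set, which depends on the line.\<close>

lemma disc_int_decreasing:
  assumes even: "AE x in lborel. v (- x) = v x" and xy: "norm x \<le> norm y" "x \<noteq> y" and r: "0 < r" "r \<le> norm (y - x) / 2"
  shows "disc_int r v y \<le> disc_int r v x"
proof -
  note m [measurable] = admissibleD(2)[OF adm] and vL = admissibleD(1)[OF adm]
  define l where "l = norm (y - x)"
  have l: "l > 0" using xy(2) by (simp add: l_def)
  define e where "e = (1 / l) *\<^sub>R (y - x)"
  define t where "t = (norm y ^ 2 - norm x ^ 2) / (2 * l)"
  have e: "norm e = 1" using l by (simp add: e_def l_def)
  have t0: "t \<ge> 0" using xy(1) l by (simp add: t_def power_mono)
  have xe: "x \<bullet> e - t = - l / 2"
  proof -
    have "l\<^sup>2 = norm y ^ 2 - 2 * (x \<bullet> y) + norm x ^ 2"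
      unfolding l_def power2_norm_eq_inner by (simp add: inner_diff_left inner_diff_right inner_commute)
    moreover have "x \<bullet> e = (x \<bullet> y - norm x ^ 2) / l"
      by (simp add: e_def inner_diff_right power2_norm_eq_inner)
    ultimately show ?thesis using l by (simp add: t_def field_simps power2_eq_square)
  qed
  have rx: "hrefl e t x = y"
  proof -
    have "hrefl e t x = x + l *\<^sub>R e" unfolding hrefl_def xe by simp
    also have "\<dots> = y" using l by (simp add: e_def)
    finally show ?thesis .
  qed
  note iso = hrefl_iso[OF e, of t]
  note [measurable] = lborel_iso_measurable[OF iso]
  have ball_int: "disc_int r v z = (\<integral>w. indicator (ball z r) w * v w \<partial>lborel)" for z
  proof -
    have "(\<integral>w. indicator (ball z r) w * v w \<partial>lborel) = (\<integral>h. indicator (ball z r) (z + h) * v (z + h) \<partial>lborel)"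
      by (rule lborel_iso_integral(1)[OF lborel_iso_add_left, symmetric]) measurable
    also have "\<dots> = disc_int r v z"
      unfolding disc_int_def by (intro Bochner_Integration.integral_cong) (auto simp: indicator_def dist_norm)
    finally show ?thesis by simp
  qed
  have bi: "integrable lborel (\<lambda>w. indicator (ball z r) w * v w)" for z
  proof -
    have "L2 lborel (\<lambda>w. indicator (ball z r) w :: real)"
      using L2_shift[OF indicator_ball_L2(1)[OF less_imp_le[OF r(1)]], of "- z"]
      by (rule back_subst[of "L2 lborel"]) (auto simp: fun_eq_iff indicator_def dist_norm norm_minus_commute)
    from L2_inner_integrable[OF this vL] show ?thesis by simp
  qed
  have ind: "indicator (ball y r) (hrefl e t w) = (indicator (ball x r) w :: real)" for w
    using dist_hrefl_refl[OF e, of t x w] by (simp add: rx indicator_def)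
  have "disc_int r v y = (\<integral>w. indicator (ball y r) (hrefl e t w) * v (hrefl e t w) \<partial>lborel)"
    unfolding ball_int by (rule lborel_iso_integral(1)[OF iso, symmetric]) measurable
  also have "\<dots> = (\<integral>w. indicator (ball x r) w * v (hrefl e t w) \<partial>lborel)" by (simp add: ind)
  also have "\<dots> \<le> (\<integral>w. indicator (ball x r) w * v w \<partial>lborel)"
  proof (rule integral_mono_AE)
    show "integrable lborel (\<lambda>w. indicator (ball x r) w * v (hrefl e t w))"
      using lborel_iso_integral(2)[OF iso, of "\<lambda>w. indicator (ball y r) w * v w"] bi[of y] by (simp add: ind)
    show "integrable lborel (\<lambda>w. indicator (ball x r) w * v w)" by (rule bi)
    show "AE w in lborel. indicator (ball x r) w * v (hrefl e t w) \<le> indicator (ball x r) w * v w"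
      using even_dominates[OF even e t0]
    proof eventually_elim
      case (elim w)
      show ?case
      proof (cases "w \<in> ball x r")
        case True
        \<comment> \<open>The bound on \<open>r\<close> keeps the disc around \<open>x\<close>
          strictly on its own side of the bisector.\<close>
        have "(w - x) \<bullet> e \<le> norm (w - x) * norm e" by (rule norm_cauchy_schwarz)
        also have "\<dots> < l / 2" using True r(2) e by (simp add: l_def dist_norm norm_minus_commute)
        finally have "w \<bullet> e < t" using xe by (simp add: inner_diff_left)
        then show ?thesis using elim True by simp
      qed simp
    qed
  qed
  also have "\<dots> = disc_int r v x" by (simp add: ball_int)
  finally show ?thesis .
qed

text \<open>The lower limit \<open>L\<close> of disc averages is defined at every point and
  decreases with the norm without exceptional sets, so points of equal norm get equal values. It can
  be infinite only at the origin, which is why \<open>g\<close> is described on positive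
  radii.\<close>

lemma radial_representative:
  assumes even: "AE x in lborel. v (- x) = v x"
  shows "\<exists>g. (\<forall>s>0. 0 \<le> g s) \<and> (\<forall>r s. 0 < r \<and> r \<le> s \<longrightarrow> g s \<le> g r) \<and>
     (\<lambda>x::real^2. if x = 0 then 0 else g (norm x)) \<in> borel_measurable borel \<and>
     (AE x in lborel. v x = g (norm x))"
proof -
  note m [measurable] = admissibleD(2)[OF adm] and vL = admissibleD(1)[OF adm]
  note Dn = admissibleD(4)[OF adm]
  let ?a = "\<lambda>n. disc_avg (1 / real (Suc n)) v"
  have aL: "L2 lborel (?a n)" for n
    using L2_add[OF disc_avg_approx(1)[OF vL Dn DD_nonneg, of "1 / real (Suc n)"] vL] by simp
  have "(\<lambda>n. nsq lborel (\<lambda>x. ?a n x - v x)) \<longlonglongrightarrow> 0"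
  proof (rule tendsto_sandwich[OF _ _ tendsto_const])
    show "\<forall>\<^sub>F n in sequentially. nsq lborel (\<lambda>x. ?a n x - v x) \<le> (1 / real (Suc n))\<^sup>2 * DD v"
      by (intro always_eventually allI disc_avg_approx(2)[OF vL Dn DD_nonneg]) simp
    have "(\<lambda>n. (1 / real (Suc n))\<^sup>2 * DD v) \<longlonglongrightarrow> 0\<^sup>2 * DD v"
      by (intro tendsto_intros LIMSEQ_Suc[OF lim_1_over_n])
    then show "(\<lambda>n. (1 / real (Suc n))\<^sup>2 * DD v) \<longlonglongrightarrow> 0" by simp
  qed (simp add: nsq_nonneg)
  then obtain k where k: "strict_mono (k::nat\<Rightarrow>nat)" and lim: "AE x in lborel. (\<lambda>n. ?a (k n) x) \<longlonglongrightarrow> v x"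
    using L2_AE_subseq[of lborel ?a v, OF aL vL] by blast
  define L where "L x = liminf (\<lambda>n. ereal (?a (k n) x))" for x
  have [measurable]: "L \<in> borel_measurable borel" unfolding L_def by measurable
  have dec: "L y \<le> L x" if "norm x \<le> norm y" for x y
  proof (cases "x = y")
    case False
    have "\<forall>\<^sub>F n in sequentially. 1 / real (Suc n) < norm (y - x) / 2"
      using order_tendstoD(2)[OF LIMSEQ_Suc[OF lim_1_over_n], of "norm (y - x) / 2"] False by simp
    then have ev: "\<forall>\<^sub>F n in sequentially. 1 / real (Suc (k n)) < norm (y - x) / 2"
      using filterlim_subseq[OF k] by (rule eventually_compose_filterlim)
    show ?thesis
      unfolding L_def
    proof (rule Liminf_mono, use ev in eventually_elim)
      case (elim n)
      have "disc_int (1 / real (Suc (k n))) v y \<le> disc_int (1 / real (Suc (k n))) v x"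
        by (rule disc_int_decreasing[OF even that False]) (use elim in auto)
      then show ?case unfolding disc_avg_def by (simp add: divide_right_mono)
    qed
  qed simp
  have Lnn: "0 \<le> L x" for x
  proof -
    have "0 \<le> ?a n x" for n
      unfolding disc_avg_def disc_int_def using admissibleD(3)[OF adm]
      by (intro divide_nonneg_nonneg integral_nonneg_AE AE_I2) auto
    then show ?thesis unfolding L_def by (intro Liminf_bounded always_eventually) simp
  qed
  have LAE: "AE x in lborel. L x = ereal (v x)"
    using lim
  proof eventually_elim
    case (elim x)
    then have "(\<lambda>n. ereal (?a (k n) x)) \<longlonglongrightarrow> ereal (v x)" by simp
    then show ?case unfolding L_def by (rule lim_imp_Liminf[OF sequentially_bot])
  qed
  have fin: "L x < \<infinity>" if "x \<noteq> 0" for x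
  proof -
    \<comment> \<open>Almost every point has a finite value, so some point nearer to the origin
      does; monotonicity hands this bound on to \<open>x\<close>.\<close>
    have "\<exists>y\<in>ball 0 (norm x). L y = ereal (v y)"
    proof (rule ccontr)
      assume no: "\<not> ?thesis"
      from LAE have "AE y in lborel. y \<notin> ball (0::real^2) (norm x)" by eventually_elim (use no in auto)
      then have "emeasure lborel (ball (0::real^2) (norm x)) = 0"
        by (subst (asm) AE_iff_measurable[OF _ refl]) (auto simp: ball_def)
      then show False using emeasure_ball_2[of "norm x" 0] that by simp
    qed
    then obtain y where "norm y < norm x" and y: "L y = ereal (v y)" by auto
    then have "L x \<le> ereal (v y)" using dec[of y x] by simp
    then show ?thesis by (rule le_less_trans) simp
  qed
  define g where "g s = real_of_ereal (L (s *\<^sub>R axis 1 1))" for s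
  have g: "L x = ereal (g (norm x))" if "x \<noteq> 0" for x
  proof -
    let ?z = "norm x *\<^sub>R axis 1 1 :: real^2"
    have nz: "norm ?z = norm x" by simp
    have eq: "L ?z = L x" using dec[of x ?z] dec[of ?z x] nz by (intro antisym) auto
    show ?thesis unfolding g_def eq using fin[OF that] Lnn[of x] by (cases "L x") auto
  qed
  have g1: "L (s *\<^sub>R axis 1 1) = ereal (g s)" if "s > 0" for s
    using g[of "s *\<^sub>R axis 1 1"] that by simp
  show ?thesis
  proof (intro exI[of _ g] conjI allI impI)
    fix s :: real assume "s > 0"
    then show "0 \<le> g s" using Lnn[of "s *\<^sub>R axis 1 1"] g1 by simp
  next
    fix r s :: real assume "0 < r \<and> r \<le> s"
    then show "g s \<le> g r" using dec[of "r *\<^sub>R axis 1 1" "s *\<^sub>R axis 1 1"] g1[of r] g1[of s] by simp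
  next
    have "(\<lambda>x::real^2. if x = 0 then 0 else g (norm x)) = (\<lambda>x. if x = 0 then 0 else real_of_ereal (L x))"
      using g by auto
    then show "(\<lambda>x::real^2. if x = 0 then 0 else g (norm x)) \<in> borel_measurable borel" by simp
  next
    have "AE x in lborel. (x::real^2) \<noteq> 0" by (rule AE_I'[of "{0}"]) (auto simp: null_sets_def)
    then show "AE x in lborel. v x = g (norm x)"
      using LAE by eventually_elim (simp add: g)
  qed
qed

end

subsection \<open>Boundedness of radial minimisers\<close>

text \<open>The lower limits for \<open>a\<close> and \<open>b\<close> give lower bounds at one
  common small scale, while \<open>Dn_bounds_J\<close> bounds \<open>v\<close> from above at that
  same scale.\<close>

lemma DD_superadditive:
  assumes v: "admissible v" and a: "Dn a < \<infinity>" and b: "Dn b < \<infinity>"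
    and J: "\<And>\<epsilon>. J \<epsilon> a + J \<epsilon> b \<le> J \<epsilon> v"
  shows "DD a + DD b \<le> DD v"
proof (rule field_le_epsilon)
  fix \<eta> :: real assume \<eta>: "\<eta> > 0"
  let ?e = "\<lambda>n. 1 / real (Suc n)"
  have ev: "\<forall>\<^sub>F n in sequentially. ennreal (max 0 (DD u - \<eta>/2)) \<le> J (?e n) u / ennreal (mom (?e n))" if "Dn u < \<infinity>" for u
  proof (cases "DD u - \<eta>/2 \<le> 0")
    case True
    then have "max 0 (DD u - \<eta>/2) = 0" by simp
    then show ?thesis by simp
  next
    case False
    then have "max 0 (DD u - \<eta>/2) < DD u" "0 < DD u" using \<eta> by auto
    then have "ennreal (max 0 (DD u - \<eta>/2)) < Dn u"
      unfolding ennreal_DD[OF that, symmetric] by (intro ennreal_lessI)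
    from less_LiminfD[OF this[unfolded Dn_def]] show ?thesis by (rule eventually_mono) simp
  qed
  from eventually_conj[OF ev[OF a] ev[OF b]] obtain n where
    n: "ennreal (max 0 (DD a - \<eta>/2)) \<le> J (?e n) a / ennreal (mom (?e n))" "ennreal (max 0 (DD b - \<eta>/2)) \<le> J (?e n) b / ennreal (mom (?e n))"
    by (auto simp: eventually_sequentially)
  have m: "mom (?e n) > 0" by (rule mom_pos) simp
  have "ennreal (max 0 (DD a - \<eta>/2) + max 0 (DD b - \<eta>/2)) \<le> J (?e n) a / ennreal (mom (?e n)) + J (?e n) b / ennreal (mom (?e n))"
    using n by (subst ennreal_plus) (auto intro: add_mono)
  also have "\<dots> = (J (?e n) a + J (?e n) b) / ennreal (mom (?e n))" by (rule add_divide_distrib_ennreal[symmetric])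
  also have "\<dots> \<le> ennreal (mom (?e n) * DD v) / ennreal (mom (?e n))"
    by (intro divide_right_mono_ennreal order_trans[OF J Dn_bounds_J[OF admissibleD(1,4)[OF v] DD_nonneg]]) simp
  also have "\<dots> = ennreal (DD v)" using m DD_nonneg[of v] by (simp add: divide_ennreal)
  finally have "max 0 (DD a - \<eta>/2) + max 0 (DD b - \<eta>/2) \<le> DD v"
    using DD_nonneg[of v] by (simp only: ennreal_le_iff)
  then show "DD a + DD b \<le> DD v + \<eta>" by (simp add: max_def split: if_splits)
qed

text \<open>The increments of the two parts add up to the whole increment and have the same sign, so
  the mixed term is nonnegative.\<close>

lemma truncation_sq_le:
  "(min a M - min b M)\<^sup>2 + (max 0 (a - M) - max 0 (b - M))\<^sup>2 \<le> (a - b)\<^sup>2" for a b M :: real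
proof -
  define p where "p = min a M - min b M"
  define q where "q = max 0 (a - M) - max 0 (b - M)"
  have "a - b = p + q" by (auto simp: p_def q_def min_def max_def)
  moreover have "0 \<le> p * q"
    by (cases "a \<le> b") (auto simp: p_def q_def min_def max_def intro!: mult_nonneg_nonneg mult_nonpos_nonpos)
  ultimately show ?thesis unfolding p_def[symmetric] q_def[symmetric] by (simp add: power2_eq_square algebra_simps)
qed

lemma truncation_admissible:
  assumes v: "admissible v" and M: "M \<ge> 0"
  shows "admissible (\<lambda>x. min (v x) M)" "admissible (\<lambda>x. max 0 (v x - M))"
    "DD (\<lambda>x. min (v x) M) + DD (\<lambda>x. max 0 (v x - M)) \<le> DD v"
proof -
  note ad = admissibleD[OF v]
  have [measurable]: "v \<in> borel_measurable borel" by (rule ad)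
  let ?a = "\<lambda>x. min (v x) M" and ?b = "\<lambda>x. max 0 (v x - M)"
  have Jsum: "J \<epsilon> ?a + J \<epsilon> ?b \<le> J \<epsilon> v" for \<epsilon>
  proof -
    let ?q = "\<lambda>u x h. indicator (ball 0 \<epsilon>) h * ennreal ((norm (u (x + h) - u x :: real))\<^sup>2)"
    have "J \<epsilon> ?a + J \<epsilon> ?b = (\<integral>\<^sup>+x. \<integral>\<^sup>+h. ?q ?a x h + ?q ?b x h \<partial>lborel \<partial>lborel)"
      unfolding J_def by (simp add: nn_integral_add)
    also have "\<dots> \<le> J \<epsilon> v"
      unfolding J_def
    proof (intro nn_integral_mono)
      fix x h
      have "ennreal ((norm (?a (x + h) - ?a x))\<^sup>2) + ennreal ((norm (?b (x + h) - ?b x))\<^sup>2) \<le> ennreal ((norm (v (x + h) - v x))\<^sup>2)"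
        using truncation_sq_le[of "v (x + h)" M "v x"] by (simp flip: ennreal_plus)
      then show "?q ?a x h + ?q ?b x h \<le> ?q v x h" by (simp add: indicator_def)
    qed
    finally show ?thesis .
  qed
  have adm: "admissible u \<and> Dn u < \<infinity>" if [measurable]: "u \<in> borel_measurable borel" and u: "\<And>x. 0 \<le> u x" "\<And>x. u x \<le> v x" and Ju: "\<And>\<epsilon>. J \<epsilon> u \<le> J \<epsilon> v" for u
  proof -
    have sq: "(u x)\<^sup>2 \<le> (v x)\<^sup>2" for x using u by (intro power_mono)
    have "integrable lborel (\<lambda>x. (u x)\<^sup>2)"
      by (rule Bochner_Integration.integrable_bound[OF ad(6)]) (use sq in auto)
    moreover have "integrable lborel (\<lambda>x. ln (1 + norm x) * (u x)\<^sup>2)"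
    proof (rule Bochner_Integration.integrable_bound[OF ad(5)])
      show "AE x in lborel. norm (ln (1 + norm x) * (u x)\<^sup>2) \<le> norm (ln (1 + norm x) * (v x)\<^sup>2)"
        using mult_left_mono[OF sq, of "ln (1 + norm _)"] by (intro AE_I2) simp
    qed measurable
    moreover have "Dn u \<le> ennreal (DD v)"
      by (rule Dn_le[OF order_trans[OF Ju Dn_bounds_J[OF ad(1,4) DD_nonneg]] DD_nonneg]) simp
    ultimately show ?thesis using u by (auto simp: admissible_def L2_def le_less_trans)
  qed
  have Ja: "J \<epsilon> ?a \<le> J \<epsilon> v" for \<epsilon> by (rule order_trans[OF _ Jsum]) simp
  have Jb: "J \<epsilon> ?b \<le> J \<epsilon> v" for \<epsilon> by (rule order_trans[OF _ Jsum]) simp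
  have A: "admissible ?a \<and> Dn ?a < \<infinity>" by (rule adm[OF _ _ _ Ja]) (use ad(3) M in auto)
  have B: "admissible ?b \<and> Dn ?b < \<infinity>" by (rule adm[OF _ _ _ Jb]) (use ad(3) M in \<open>auto simp: max_def\<close>)
  show "admissible ?a" "admissible ?b" using A B by auto
  show "DD ?a + DD ?b \<le> DD v" by (rule DD_superadditive[OF v _ _ Jsum]) (use A B in auto)
qed

text \<open>Removing mass raises the logarithmic energy only where the kernel is negative. There the
  change is at most the removed density \<open>\<sigma>\<close> against the singular potential of
  \<open>v^2\<close>, bounded by \<open>B\<close> through \<open>log_tail\<close>; each of the two
  variables contributes \<open>B * \<delta>\<close>.\<close>

lemma IK_ln_truncation:
  assumes v: "admissible v" and M: "M \<ge> 0"
  defines "a \<equiv> \<lambda>x. min (v x) M"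
  shows "IK ln a \<le> IK ln v + 8 * (nsq lborel v + DD v) * (nsq lborel v - nsq lborel a)"
proof -
  note ad = admissibleD[OF v]
  have [measurable]: "v \<in> borel_measurable borel" by (rule ad)
  have aa: "admissible a" unfolding a_def by (rule truncation_admissible(1)[OF v M])
  note ada = admissibleD[OF aa]
  have [measurable]: "a \<in> borel_measurable borel" by (rule ada)
  have sq: "(a x)\<^sup>2 \<le> (v x)\<^sup>2" for x unfolding a_def using ad(3)[of x] M by (intro power_mono) auto
  define \<rho> where "\<rho> x = (v x)\<^sup>2" for x
  define \<sigma> where "\<sigma> x = (v x)\<^sup>2 - (a x)\<^sup>2" for x
  have [measurable]: "\<rho> \<in> borel_measurable borel" "\<sigma> \<in> borel_measurable borel" unfolding \<rho>_def \<sigma>_def by measurable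
  have nn: "0 \<le> \<rho> x" "0 \<le> \<sigma> x" "\<sigma> x \<le> \<rho> x" for x using sq[of x] by (auto simp: \<rho>_def \<sigma>_def)
  let ?N = "nsq lborel v" and ?t = "\<lambda>r. max 0 (ln (1 / r))"
  define \<delta> where "\<delta> = ?N - nsq lborel a"
  have \<sigma>i: "integrable lborel \<sigma>" unfolding \<sigma>_def using ad(6) ada(6) by (intro Bochner_Integration.integrable_diff)
  have \<sigma>int: "(\<integral>x. \<sigma> x \<partial>lborel) = \<delta>" unfolding \<sigma>_def \<delta>_def using ad(6) ada(6) by (simp add: nsq_def)
  have \<delta>0: "\<delta> \<ge> 0" unfolding \<sigma>int[symmetric] using nn by (intro integral_nonneg_AE) auto
  define B where "B = 4 * (?N + DD v)"
  have B0: "B \<ge> 0" unfolding B_def using nsq_nonneg[of lborel v] DD_nonneg[of v] by simp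
  have pot: "(\<integral>\<^sup>+x. ennreal (?t (dist x y) * \<rho> x) \<partial>lborel) \<le> ennreal B" for y
    using log_tail[OF ad(1,4) DD_nonneg, of 1 y] by (simp add: B_def \<rho>_def)
  let ?T = "\<lambda>p. ?t (dist (fst p) (snd p)) * \<sigma> (fst p) * \<rho> (snd p)"
  have ti: "integrable (lborel \<Otimes>\<^sub>M lborel) (\<lambda>p. ?t (dist (fst p) (snd p)) * \<rho> (fst p) * \<rho> (snd p))"
    unfolding \<rho>_def by (rule IK_integrable[OF v, where a=0]) (use log_tail_dominated[of 1] in auto)
  have Ti: "integrable (lborel \<Otimes>\<^sub>M lborel) ?T"
  proof (rule Bochner_Integration.integrable_bound[OF ti])
    show "AE p in lborel \<Otimes>\<^sub>M lborel. norm (?T p) \<le> norm (?t (dist (fst p) (snd p)) * \<rho> (fst p) * \<rho> (snd p))"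
      using nn by (intro AE_I2) (simp add: mult_mono mult_nonneg_nonneg)
  qed measurable
  have Tle: "(\<integral>p. ?T p \<partial>(lborel \<Otimes>\<^sub>M lborel)) \<le> B * \<delta>"
  proof -
    have "(\<integral>\<^sup>+p. ennreal (?T p) \<partial>(lborel \<Otimes>\<^sub>M lborel)) = (\<integral>\<^sup>+x. \<integral>\<^sup>+y. ennreal (?T (x, y)) \<partial>lborel \<partial>lborel)"
      by (rule lborel.nn_integral_fst[symmetric]) measurable
    also have "\<dots> = (\<integral>\<^sup>+x. ennreal (\<sigma> x) * (\<integral>\<^sup>+y. ennreal (?t (dist y x) * \<rho> y) \<partial>lborel) \<partial>lborel)"
      using nn by (subst nn_integral_cmult[symmetric])
        (auto simp: ennreal_mult[symmetric] dist_commute mult_ac intro!: nn_integral_cong)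
    also have "\<dots> \<le> (\<integral>\<^sup>+x. ennreal (\<sigma> x) * ennreal B \<partial>lborel)" by (intro nn_integral_mono mult_left_mono pot) auto
    also have "\<dots> = (\<integral>\<^sup>+x. ennreal (\<sigma> x) \<partial>lborel) * ennreal B" by (rule nn_integral_multc) measurable
    also have "(\<integral>\<^sup>+x. ennreal (\<sigma> x) \<partial>lborel) = ennreal \<delta>"
      using \<sigma>int nn nn_integral_eq_integral[OF \<sigma>i] by simp
    also have "ennreal \<delta> * ennreal B = ennreal (B * \<delta>)" using \<delta>0 B0 by (simp add: ennreal_mult mult.commute)
    finally have le: "(\<integral>\<^sup>+p. ennreal (?T p) \<partial>(lborel \<Otimes>\<^sub>M lborel)) \<le> ennreal (B * \<delta>)" .
    have "(\<integral>p. ?T p \<partial>(lborel \<Otimes>\<^sub>M lborel)) = enn2real (\<integral>\<^sup>+p. ennreal (?T p) \<partial>(lborel \<Otimes>\<^sub>M lborel))"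
      using nn by (intro integral_eq_nn_integral) (auto intro!: mult_nonneg_nonneg)
    also have "\<dots> \<le> B * \<delta>" using enn2real_mono[OF le ennreal_less_top] B0 \<delta>0 by simp
    finally show ?thesis .
  qed
  let ?T' = "\<lambda>p. ?T (snd p, fst p)"
  have swap: "integrable (lborel \<Otimes>\<^sub>M lborel) ?T'" "(\<integral>p. ?T' p \<partial>(lborel \<Otimes>\<^sub>M lborel)) = (\<integral>p. ?T p \<partial>(lborel \<Otimes>\<^sub>M lborel))"
    using lborel_pair.integrable_product_swap[OF Ti] lborel_pair.integral_product_swap[of ?T] Ti
    by (auto simp: case_prod_unfold borel_measurable_integrable)
  have i1: "integrable (lborel \<Otimes>\<^sub>M lborel) (\<lambda>p. ln (dist (fst p) (snd p)) * (v (fst p))\<^sup>2 * (v (snd p))\<^sup>2)"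
    by (rule IK_integrable[OF v, where a=0]) auto
  have i2: "integrable (lborel \<Otimes>\<^sub>M lborel) (\<lambda>p. ln (dist (fst p) (snd p)) * (a (fst p))\<^sup>2 * (a (snd p))\<^sup>2)"
    by (rule IK_integrable[OF aa, where a=0]) auto
  have "IK ln a - IK ln v = (\<integral>p. ln (dist (fst p) (snd p)) * (a (fst p))\<^sup>2 * (a (snd p))\<^sup>2 - ln (dist (fst p) (snd p)) * (v (fst p))\<^sup>2 * (v (snd p))\<^sup>2 \<partial>(lborel \<Otimes>\<^sub>M lborel))"
    unfolding IK_def by (rule Bochner_Integration.integral_diff[OF i2 i1, symmetric])
  also have "\<dots> \<le> (\<integral>p. ?T p + ?T' p \<partial>(lborel \<Otimes>\<^sub>M lborel))"
  proof (rule integral_mono[OF Bochner_Integration.integrable_diff[OF i2 i1] Bochner_Integration.integrable_add[OF Ti swap(1)]])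
    fix p :: "(real^2) \<times> (real^2)"
    obtain x y where p: "p = (x, y)" by (cases p)
    define d where "d = (v x)\<^sup>2 * (v y)\<^sup>2 - (a x)\<^sup>2 * (a y)\<^sup>2"
    have d0: "d \<ge> 0" unfolding d_def using sq[of x] sq[of y] by (simp add: mult_mono)
    have d1: "d \<le> \<sigma> x * \<rho> y + \<rho> x * \<sigma> y"
    proof -
      have "\<sigma> x * \<rho> y + \<rho> x * \<sigma> y - d = \<sigma> x * \<sigma> y" by (simp add: d_def \<sigma>_def \<rho>_def algebra_simps)
      then show ?thesis using mult_nonneg_nonneg[OF nn(2)[of x] nn(2)[of y]] by linarith
    qed
    have ln: "- ln (dist x y) \<le> ?t (dist x y)" by (cases "x = y") (auto simp: ln_div)
    have "- ln (dist x y) * d \<le> ?t (dist x y) * d" using ln d0 by (rule mult_right_mono)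
    also have "\<dots> \<le> ?t (dist x y) * (\<sigma> x * \<rho> y + \<rho> x * \<sigma> y)" using d1 by (intro mult_left_mono) auto
    finally show "ln (dist (fst p) (snd p)) * (a (fst p))\<^sup>2 * (a (snd p))\<^sup>2 - ln (dist (fst p) (snd p)) * (v (fst p))\<^sup>2 * (v (snd p))\<^sup>2 \<le> ?T p + ?T' p"
      by (simp add: p d_def algebra_simps dist_commute)
  qed
  also have "\<dots> \<le> B * \<delta> + B * \<delta>" using Ti swap Tle by simp
  finally show ?thesis unfolding B_def \<delta>_def by (simp add: algebra_simps)
qed

section \<open>Truncation of a minimiser near its centre\<close>

context ground_state
begin

text \<open>The terms come, in order, from restoring the mass in the Dirichlet energy, from the mass
  removed in the logarithmic energy, and from the factor
  \<open>q^2 - 1 \<le> 6 * \<delta> / lam\<close> in the rescaled logarithmic energy.\<close>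

definition C1 :: real where
  "C1 = 2 * DD v / lam + c * (8 * (lam + DD v) + 6 * IK (\<lambda>r. max 0 (ln r)) v / lam)"

lemma C1_nonneg: "C1 \<ge> 0"
  unfolding C1_def using lam c DD_nonneg[of v] IK_pos_nonneg[of v]
  by (intro add_nonneg_nonneg mult_nonneg_nonneg divide_nonneg_nonneg) auto

text \<open>The truncation at height \<open>M\<close>, multiplied by \<open>sqrt q\<close> to
  restore the mass, is a competitor. It saves the Dirichlet energy of the part above
  \<open>M\<close>, while every other change is of the order of the removed mass, so minimality
  bounds the saving.\<close>

lemma truncation_energy:
  assumes M: "M \<ge> 0"
  defines "\<delta> \<equiv> lam - nsq lborel (\<lambda>x. min (v x) M)"
  assumes small: "\<delta> \<le> lam / 2"
  shows "DD (\<lambda>x. max 0 (v x - M)) \<le> C1 * \<delta>"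
proof -
  let ?a = "\<lambda>x. min (v x) M" and ?w = "\<lambda>x. max 0 (v x - M)" and ?p = "\<lambda>r. max 0 (ln r)"
  note tr = truncation_admissible[OF adm M] and ad = admissibleD[OF adm]
  define P where "P = IK ?p v"
  have P0: "P \<ge> 0" unfolding P_def by (rule IK_pos_nonneg)
  have sq: "(?a x)\<^sup>2 \<le> (v x)\<^sup>2" for x using ad(3)[of x] M by (intro power_mono) auto
  have "nsq lborel ?a \<le> nsq lborel v"
    unfolding nsq_def using admissibleD(6)[OF tr(1)] ad(6) sq by (intro integral_mono) auto
  then have \<delta>0: "\<delta> \<ge> 0" by (simp add: \<delta>_def mass)
  \<comment> \<open>Square of the scaling factor; \<open>\<delta> \<le> lam / 2\<close> keeps it
    between 1 and 2.\<close>
  define q where "q = lam / (lam - \<delta>)"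
  have ld: "lam - \<delta> \<ge> lam / 2" using small by (simp add: field_simps)
  have ld0: "lam - \<delta> > 0" using ld lam by (simp add: field_simps)
  have q1: "q \<ge> 1" using \<delta>0 ld0 lam by (simp add: q_def)
  have q2: "q - 1 \<le> 2 * \<delta> / lam"
  proof -
    have "q - 1 = \<delta> / (lam - \<delta>)" using ld0 by (simp add: q_def field_simps)
    also have "\<dots> \<le> \<delta> / (lam / 2)" using ld lam \<delta>0 by (intro divide_left_mono) auto
    finally show ?thesis by (simp add: mult.commute)
  qed
  have q3: "q \<le> 2"
  proof -
    have "2 * \<delta> / lam \<le> 1" using small lam by (simp add: field_simps)
    then show ?thesis using q2 by linarith
  qed
  have qq: "q\<^sup>2 - 1 \<le> 6 * \<delta> / lam"
  proof -
    have "q\<^sup>2 - 1 = (q - 1) * (q + 1)" by (simp add: power2_eq_square algebra_simps)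
    also have "\<dots> \<le> (2 * \<delta> / lam) * 3" using q1 q2 q3 \<delta>0 lam by (intro mult_mono) auto
    finally show ?thesis by simp
  qed
  let ?s = "sqrt q"
  have s: "?s \<ge> 0" "?s\<^sup>2 = q" using q1 by auto
  have s4: "?s ^ 4 = q\<^sup>2" using q1 by (simp add: power4_eq_xxxx power2_eq_square)
  note sc = admissible_scale[OF tr(1) s(1)]
  have "nsq lborel (\<lambda>x. ?s * ?a x) = q * nsq lborel ?a" using sc(3) unfolding s(2) .
  also have "\<dots> = lam" using ld0 by (simp add: q_def \<delta>_def)
  finally have "nsq lborel (\<lambda>x. ?s * ?a x) = lam" .
  from min[OF sc(1) this] have "DD v + c * IK ln v \<le> DD (\<lambda>x. ?s * ?a x) + c * IK ln (\<lambda>x. ?s * ?a x)"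
    by (simp add: FF_def)
  also have "\<dots> \<le> q * DD ?a + c * (q\<^sup>2 * IK ln ?a)" using sc(2) unfolding sc(4) s(2) s4 by simp
  finally have main: "DD v + c * IK ln v \<le> q * DD ?a + c * (q\<^sup>2 * IK ln ?a)" .
  have DDa: "q * DD ?a \<le> DD v - DD ?w + (2 * \<delta> / lam) * DD v"
  proof -
    have le: "DD ?a \<le> DD v - DD ?w" using tr(3) by linarith
    have "(q - 1) * DD ?a \<le> (2 * \<delta> / lam) * DD v"
      using q1 q2 le DD_nonneg[of ?w] DD_nonneg[of ?a] \<delta>0 lam by (intro mult_mono) auto
    then show ?thesis using le by (simp add: algebra_simps)
  qed
  have IKa: "q\<^sup>2 * IK ln ?a \<le> IK ln v + 8 * (lam + DD v) * \<delta> + (6 * \<delta> / lam) * P"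
  proof -
    have "IK ln ?a \<le> IK ?p ?a"
      by (rule IK_mono[OF tr(1), where a=0 and b=0]) auto
    also have "\<dots> \<le> P"
      unfolding P_def IK_def
    proof (rule integral_mono)
      show "integrable (lborel \<Otimes>\<^sub>M lborel) (\<lambda>p. ?p (dist (fst p) (snd p)) * (?a (fst p))\<^sup>2 * (?a (snd p))\<^sup>2)"
        by (rule IK_integrable[OF tr(1), where a=0]) auto
      show "integrable (lborel \<Otimes>\<^sub>M lborel) (\<lambda>p. ?p (dist (fst p) (snd p)) * (v (fst p))\<^sup>2 * (v (snd p))\<^sup>2)"
        by (rule IK_integrable[OF adm, where a=0]) auto
      fix p :: "(real^2) \<times> (real^2)"
      show "?p (dist (fst p) (snd p)) * (?a (fst p))\<^sup>2 * (?a (snd p))\<^sup>2 \<le> ?p (dist (fst p) (snd p)) * (v (fst p))\<^sup>2 * (v (snd p))\<^sup>2"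
        using sq by (intro mult_mono) auto
    qed
    finally have aP: "IK ln ?a \<le> P" .
    have "q\<^sup>2 * IK ln ?a = IK ln ?a + (q\<^sup>2 - 1) * IK ln ?a" by (simp add: algebra_simps)
    also have "(q\<^sup>2 - 1) * IK ln ?a \<le> (q\<^sup>2 - 1) * P" using aP q1 by (intro mult_left_mono) auto
    also have "(q\<^sup>2 - 1) * P \<le> (6 * \<delta> / lam) * P" using qq P0 by (intro mult_right_mono)
    finally have "q\<^sup>2 * IK ln ?a \<le> IK ln ?a + (6 * \<delta> / lam) * P" by simp
    moreover have "IK ln ?a \<le> IK ln v + 8 * (lam + DD v) * \<delta>"
      using IK_ln_truncation[OF adm M] by (simp add: \<delta>_def mass)
    ultimately show ?thesis by linarith
  qed
  have "c * (q\<^sup>2 * IK ln ?a) \<le> c * (IK ln v + 8 * (lam + DD v) * \<delta> + (6 * \<delta> / lam) * P)"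
    using IKa c by (intro mult_left_mono) auto
  with main DDa have "DD ?w \<le> (2 * \<delta> / lam) * DD v + c * (8 * (lam + DD v) * \<delta> + (6 * \<delta> / lam) * P)"
    by (simp add: distrib_left)
  also have "\<dots> = C1 * \<delta>" by (simp add: C1_def P_def algebra_simps)
  finally show ?thesis .
qed

text \<open>The part \<open>w\<close> of \<open>v\<close> above \<open>g R\<close> lives in the disc
  of radius \<open>R\<close>. A Poincare inequality, \<open>DD w \<le> C1 * \<delta>\<close> and
  \<open>\<delta> = n^2 + 2 * M * (\<integral> w)\<close> make its norm \<open>n\<close> of order
  \<open>C1 * M * R^3\<close>. Since \<open>w\<close> is at least \<open>g (R/2) - M\<close> on the
  half-size disc, \<open>g\<close> grows by a relative amount of order \<open>R^2\<close>.\<close>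

lemma radial_step:
  assumes g: "\<And>s. s > 0 \<Longrightarrow> 0 \<le> g s" "\<And>r s. 0 < r \<Longrightarrow> r \<le> s \<Longrightarrow> g s \<le> g r"
    and vg: "v = (\<lambda>x. if x = 0 then 0 else g (norm x))"
    and R: "R > 0" "4 * R\<^sup>2 * C1 \<le> 1" "4 * R * (lam + DD v) \<le> lam"
  shows "g (R / 2) \<le> (1 + 16 * C1 * R\<^sup>2) * g R"
proof -
  note ad = admissibleD[OF adm]
  have [measurable]: "v \<in> borel_measurable borel" by (rule ad)
  define M where "M = g R"
  have M: "M \<ge> 0" unfolding M_def using g(1) R(1) by simp
  define w where "w = (\<lambda>x. max 0 (v x - M))"
  have wa: "admissible w" unfolding w_def by (rule truncation_admissible(2)[OF adm M])
  note adw = admissibleD[OF wa]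
  have [measurable]: "w \<in> borel_measurable borel" by (rule adw)
  have supp: "norm x < R" if "w x \<noteq> 0" for x
  proof (rule ccontr)
    assume "\<not> norm x < R"
    then have "x \<noteq> 0" "g (norm x) \<le> M" using R(1) g(2)[of R "norm x"] by (auto simp: M_def)
    then show False using that by (simp add: w_def vg)
  qed
  define n where "n = sqrt (nsq lborel w)"
  have n0: "n \<ge> 0" "n\<^sup>2 = nsq lborel w" using nsq_nonneg[of lborel w] by (auto simp: n_def)
  have poincare: "n\<^sup>2 \<le> 2 * R\<^sup>2 * DD w"
  proof -
    \<comment> \<open>A shift by the diameter makes the supports disjoint, so the translation
      estimate reads \<open>2 * n^2 \<le> 4 * R^2 * DD w\<close>.\<close>
    let ?h = "(2 * R) *\<^sub>R axis 1 1 :: real^2"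
    have nh: "norm ?h = 2 * R" using R(1) by simp
    have "nsq lborel (\<lambda>x. w (x + ?h) - w x) \<le> (norm ?h)\<^sup>2 * DD w"
      by (rule Dn_translate[OF adw(1,4) DD_nonneg])
    moreover have "nsq lborel (\<lambda>x. w (x + ?h) - w x) = nsq lborel (\<lambda>x. w (x + ?h)) + nsq lborel w"
    proof -
      have "(norm (w (x + ?h) - w x))\<^sup>2 = (norm (w (x + ?h)))\<^sup>2 + (norm (w x))\<^sup>2" for x
      proof -
        have "w (x + ?h) = 0 \<or> w x = 0"
        proof (rule ccontr)
          assume "\<not> ?thesis"
          then have "norm (x + ?h) < R" "norm x < R" using supp by auto
          moreover have "norm ?h \<le> norm (x + ?h) + norm x" using norm_triangle_ineq4[of "x + ?h" x] by simp
          ultimately show False using nh by linarith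
        qed
        then show ?thesis by auto
      qed
      then show ?thesis
        unfolding nsq_def using L2_integrable[OF adw(1)] L2_integrable[OF L2_shift[OF adw(1), of ?h]] by simp
    qed
    moreover have "nsq lborel (\<lambda>x. w (x + ?h)) = nsq lborel w" by (rule nsq_shift) measurable
    ultimately show ?thesis unfolding nh n0(2) by (simp add: power2_eq_square)
  qed
  have wint: "integrable lborel w" "(\<integral>x. w x \<partial>lborel) \<le> sqrt pi * R * n"
  proof -
    have eq: "indicator (ball 0 R) x * w x = w x" for x using supp[of x] by (cases "w x = 0") auto
    note i = indicator_ball_L2[OF less_imp_le[OF R(1)]]
    show "integrable lborel w" using L2_inner_integrable[OF i(1) adw(1)] by (simp add: eq)
    show "(\<integral>x. w x \<partial>lborel) \<le> sqrt pi * R * n"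
      using L2_Cauchy_Schwarz[OF i(1) adw(1)] R(1) by (simp add: eq i(2) n_def real_sqrt_mult)
  qed
  define \<delta> where "\<delta> = lam - nsq lborel (\<lambda>x. min (v x) M)"
  have \<delta>eq: "\<delta> = n\<^sup>2 + 2 * M * (\<integral>x. w x \<partial>lborel)"
  proof -
    have "\<delta> = (\<integral>x. (v x)\<^sup>2 - (min (v x) M)\<^sup>2 \<partial>lborel)"
      unfolding \<delta>_def mass[symmetric] using ad(6) admissibleD(6)[OF truncation_admissible(1)[OF adm M]] by (simp add: nsq_def)
    also have "\<dots> = (\<integral>x. (w x)\<^sup>2 + 2 * M * w x \<partial>lborel)"
      by (intro Bochner_Integration.integral_cong) (auto simp: w_def min_def max_def power2_eq_square algebra_simps)
    also have "\<dots> = n\<^sup>2 + 2 * M * (\<integral>x. w x \<partial>lborel)"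
      using adw(6) wint(1) unfolding n0(2) by (simp add: nsq_def)
    finally show ?thesis .
  qed
  \<comment> \<open>The removed mass lies in the disc of radius \<open>R\<close>, where
    \<open>local_mass_ball\<close> and the third condition on \<open>R\<close> leave at most
    \<open>lam / 2\<close>.\<close>
  have small: "\<delta> \<le> lam / 2"
  proof -
    have "\<delta> = (\<integral>x. (v x)\<^sup>2 - (min (v x) M)\<^sup>2 \<partial>lborel)"
      unfolding \<delta>_def mass[symmetric] using ad(6) admissibleD(6)[OF truncation_admissible(1)[OF adm M]] by (simp add: nsq_def)
    also have "\<dots> \<le> (\<integral>x. indicator (ball 0 R) x * (v x)\<^sup>2 \<partial>lborel)"
    proof (rule integral_mono)
      show "integrable lborel (\<lambda>x. (v x)\<^sup>2 - (min (v x) M)\<^sup>2)"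
        using ad(6) admissibleD(6)[OF truncation_admissible(1)[OF adm M]] by (rule Bochner_Integration.integrable_diff)
      show "integrable lborel (\<lambda>x. indicator (ball 0 R) x * (v x)\<^sup>2)" by (rule indicator_sq_integrable[OF adm]) simp
      fix x
      show "(v x)\<^sup>2 - (min (v x) M)\<^sup>2 \<le> indicator (ball 0 R) x * (v x)\<^sup>2"
      proof (cases "norm x < R")
        case False
        then have "w x = 0" using supp by blast
        then have "v x \<le> M" by (simp add: w_def max_def split: if_splits)
        then show ?thesis using False by simp
      qed simp
    qed
    also have "\<dots> \<le> 2 * R * (lam + DD v)"
    proof -
      have "ennreal (\<integral>x. indicator (ball 0 R) x * (v x)\<^sup>2 \<partial>lborel) = (\<integral>\<^sup>+x. ennreal (indicator (ball 0 R) x * (v x)\<^sup>2) \<partial>lborel)"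
        by (rule nn_integral_eq_integral[symmetric]) (auto intro!: indicator_sq_integrable[OF adm])
      also have "\<dots> = (\<integral>\<^sup>+x. indicator (ball 0 R) x * ennreal ((v x)\<^sup>2) \<partial>lborel)"
        by (intro nn_integral_cong) (auto simp: indicator_def)
      also have "\<dots> \<le> ennreal (2 * R * (nsq lborel v + DD v))"
        by (rule local_mass_ball[OF ad(1,4) DD_nonneg R(1)])
      finally show ?thesis
        using R(1) lam DD_nonneg[of v] unfolding mass by (subst (asm) ennreal_le_iff) (auto intro!: mult_nonneg_nonneg)
    qed
    also have "\<dots> \<le> lam / 2" using R(3) by (simp add: algebra_simps)
    finally show ?thesis .
  qed
  have "DD w \<le> C1 * \<delta>" unfolding w_def \<delta>_def by (rule truncation_energy[OF M small[unfolded \<delta>_def]])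
  then have "2 * R\<^sup>2 * DD w \<le> 2 * R\<^sup>2 * (C1 * \<delta>)" by (intro mult_left_mono) auto
  with poincare have "n\<^sup>2 \<le> 2 * R\<^sup>2 * C1 * \<delta>" by (simp add: mult.assoc)
  also have "\<dots> \<le> 2 * R\<^sup>2 * C1 * (n\<^sup>2 + 2 * M * (sqrt pi * R * n))"
    unfolding \<delta>eq using wint(2) M C1_nonneg by (intro mult_left_mono add_left_mono) auto
  also have "\<dots> = 2 * R\<^sup>2 * C1 * n\<^sup>2 + 4 * C1 * M * sqrt pi * R ^ 3 * n"
    by (simp add: algebra_simps power3_eq_cube power2_eq_square)
  \<comment> \<open>The condition \<open>4 * R^2 * C1 \<le> 1\<close> lets this half of
    \<open>n^2\<close> be absorbed on the left.\<close>
  also have "2 * R\<^sup>2 * C1 * n\<^sup>2 \<le> (1/2) * n\<^sup>2" using R(2) by (intro mult_right_mono) auto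
  finally have "n\<^sup>2 \<le> 8 * C1 * M * sqrt pi * R ^ 3 * n" by simp
  then have nb: "n \<le> 8 * C1 * M * sqrt pi * R ^ 3"
  proof (cases "n = 0")
    case True
    then show ?thesis using C1_nonneg M R(1) by simp
  next
    case False
    assume "n\<^sup>2 \<le> 8 * C1 * M * sqrt pi * R ^ 3 * n"
    then show ?thesis using False n0(1) by (simp add: power2_eq_square)
  qed
  define k where "k = g (R / 2) - M"
  have k0: "k \<ge> 0" unfolding k_def M_def using g(2)[of "R/2" R] R(1) by simp
  have "sqrt pi * (R / 2) * k \<le> n"
  proof -
    have "(\<integral>x. indicator (ball (0::real^2) (R/2)) x * k\<^sup>2 \<partial>lborel) \<le> (\<integral>x. (w x)\<^sup>2 \<partial>lborel)"
    proof (rule integral_mono_AE)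
      show "integrable lborel (\<lambda>x. indicator (ball (0::real^2) (R/2)) x * k\<^sup>2)"
        by (rule integrable_ball_mult[where C="k\<^sup>2"]) auto
      show "integrable lborel (\<lambda>x. (w x)\<^sup>2)" by (rule adw)
      have "AE x in lborel. (x::real^2) \<noteq> 0" by (rule AE_I'[of "{0}"]) (auto simp: null_sets_def)
      then show "AE x in lborel. indicator (ball (0::real^2) (R/2)) x * k\<^sup>2 \<le> (w x)\<^sup>2"
      proof eventually_elim
        case (elim x)
        show ?case
        proof (cases "norm x < R / 2")
          case True
          have "g (R / 2) \<le> v x" using elim True g(2)[of "norm x" "R/2"] by (simp add: vg)
          then have "k \<le> w x" by (simp add: k_def w_def)
          then show ?thesis using True k0 by (simp add: power_mono)
        qed simp
      qed
    qed
    also have "(\<integral>x. (w x)\<^sup>2 \<partial>lborel) = nsq lborel w" by (simp add: nsq_def)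
    also have "(\<integral>x. indicator (ball (0::real^2) (R/2)) x * k\<^sup>2 \<partial>lborel) = pi * (R/2)\<^sup>2 * k\<^sup>2"
      using emeasure_ball_2[of "R/2" 0] R(1) by (simp add: measure_def)
    finally have "pi * (R/2)\<^sup>2 * k\<^sup>2 \<le> nsq lborel w" .
    moreover have "(sqrt pi * (R / 2) * k)\<^sup>2 = pi * (R/2)\<^sup>2 * k\<^sup>2" by (simp add: power_mult_distrib power_divide)
    ultimately have "(sqrt pi * (R / 2) * k)\<^sup>2 \<le> n\<^sup>2" unfolding n0(2) by (simp only:)
    then show ?thesis by (rule power2_le_imp_le[OF _ n0(1)])
  qed
  with nb have "sqrt pi * (R / 2) * k \<le> sqrt pi * (R / 2) * (16 * C1 * R\<^sup>2 * M)"
    by (simp add: power3_eq_cube power2_eq_square mult.assoc mult.left_commute mult.commute)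
  then have "k \<le> 16 * C1 * R\<^sup>2 * M" using R(1) by (subst (asm) mult_le_cancel_left_pos) auto
  then show ?thesis by (simp add: k_def M_def algebra_simps)
qed

text \<open>Along the radii \<open>R0 / 2^n\<close> the growth factors are at most
  \<open>1 + K / 4^n\<close>, and their product stays bounded.\<close>

lemma radial_bounded:
  assumes g: "\<And>s. s > 0 \<Longrightarrow> 0 \<le> g s" "\<And>r s. 0 < r \<Longrightarrow> r \<le> s \<Longrightarrow> g s \<le> g r"
    and vg: "v = (\<lambda>x. if x = 0 then 0 else g (norm x))"
  shows "\<exists>B. \<forall>s>0. g s \<le> B"
proof -
  \<comment> \<open>The minima provide the two smallness conditions of \<open>radial_step\<close>;
    \<open>4 * C1 + 1\<close> avoids a division by zero.\<close>
  define R0 where "R0 = min 1 (min (1 / (4 * C1 + 1)) (lam / (4 * (lam + DD v))))"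
  have lD: "lam + DD v > 0" using lam DD_nonneg[of v] by simp
  have R0: "R0 > 0" "R0 \<le> 1" unfolding R0_def using C1_nonneg lam lD by auto
  have b1: "R0 * (4 * C1 + 1) \<le> 1"
  proof -
    have "R0 * (4 * C1 + 1) \<le> (1 / (4 * C1 + 1)) * (4 * C1 + 1)" using C1_nonneg by (intro mult_right_mono) (auto simp: R0_def)
    then show ?thesis using C1_nonneg by simp
  qed
  have b2: "R0 * (4 * (lam + DD v)) \<le> lam"
  proof -
    have "R0 * (4 * (lam + DD v)) \<le> (lam / (4 * (lam + DD v))) * (4 * (lam + DD v))" using lD by (intro mult_right_mono) (auto simp: R0_def)
    then show ?thesis using lD by simp
  qed
  have step: "g (R / 2) \<le> (1 + 16 * C1 * R\<^sup>2) * g R" if R: "0 < R" "R \<le> R0" for R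
  proof (rule radial_step[OF g vg R(1)])
    have "4 * R\<^sup>2 * C1 \<le> R * (4 * C1)"
      using R R0 C1_nonneg by (simp add: power2_eq_square mult_left_le_one_le mult_ac)
    also have "\<dots> \<le> R0 * (4 * C1 + 1)" using R C1_nonneg by (intro mult_mono) auto
    finally show "4 * R\<^sup>2 * C1 \<le> 1" using b1 by simp
    have "4 * R * (lam + DD v) \<le> 4 * R0 * (lam + DD v)" using R lD by (intro mult_right_mono) auto
    then show "4 * R * (lam + DD v) \<le> lam" using b2 by (simp add: mult_ac)
  qed
  define K where "K = 16 * C1 * R0\<^sup>2"
  have K0: "K \<ge> 0" unfolding K_def using C1_nonneg by simp
  \<comment> \<open>The exponent is the partial sum of \<open>K * (1/2)^k\<close>; the weaker rate
    1/2 in place of 1/4 suffices.\<close>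
  have it: "g (R0 / 2 ^ n) \<le> exp (K * (2 - 2 * (1/2) ^ n)) * g R0" for n
  proof (induction n)
    case (Suc n)
    let ?R = "R0 / 2 ^ n"
    have R: "0 < ?R" "?R \<le> R0" using R0 by (auto simp: field_simps)
    have KR: "16 * C1 * ?R\<^sup>2 \<le> K * (1/2) ^ n"
    proof -
      have "16 * C1 * ?R\<^sup>2 = K * ((1/2) ^ n * (1/2) ^ n)" by (simp add: K_def power2_eq_square power_divide)
      also have "\<dots> \<le> K * (1/2) ^ n" using K0 by (intro mult_left_mono mult_left_le) (auto intro: power_le_one)
      finally show ?thesis .
    qed
    have "g (R0 / 2 ^ Suc n) = g (?R / 2)" by (simp add: mult.commute)
    also have "\<dots> \<le> (1 + 16 * C1 * ?R\<^sup>2) * g ?R" by (rule step[OF R])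
    also have "\<dots> \<le> exp (K * (1/2) ^ n) * (exp (K * (2 - 2 * (1/2) ^ n)) * g R0)"
    proof (rule mult_mono[OF _ Suc.IH])
      have "1 + 16 * C1 * ?R\<^sup>2 \<le> 1 + K * (1/2) ^ n" using KR by simp
      also have "\<dots> \<le> exp (K * (1/2) ^ n)" by (rule exp_ge_add_one_self)
      finally show "1 + 16 * C1 * ?R\<^sup>2 \<le> exp (K * (1/2) ^ n)" .
    qed (use g(1)[OF R(1)] in auto)
    also have "\<dots> = exp (K * (2 - 2 * (1/2) ^ Suc n)) * g R0"
    proof -
      have "K * (2 - 2 * (1/2) ^ Suc n) = K * (1/2) ^ n + K * (2 - 2 * (1/2) ^ n)" by (simp add: algebra_simps)
      then show ?thesis by (simp only: exp_add mult.assoc)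
    qed
    finally show ?case .
  qed simp
  show ?thesis
  proof (intro exI[of _ "exp (K * 2) * g R0"] allI impI)
    fix s :: real assume s: "s > 0"
    obtain n :: nat where "R0 / s < 2 ^ n" using real_arch_pow[of 2 "R0 / s"] by auto
    then have "R0 / 2 ^ n \<le> s" using s by (simp add: field_simps)
    then have "g s \<le> g (R0 / 2 ^ n)" using g(2)[of "R0 / 2 ^ n" s] R0 by simp
    also have "\<dots> \<le> exp (K * (2 - 2 * (1/2) ^ n)) * g R0" by (rule it)
    also have "\<dots> \<le> exp (K * 2) * g R0" using K0 g(1)[OF R0(1)] by (intro mult_right_mono) (auto intro!: mult_left_mono)
    finally show "g s \<le> exp (K * 2) * g R0" .
  qed
qed

end

section \<open>Assembly of the radial minimiser and comparison with complex competitors\<close>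

lemma radial_minimiser_exists:
  assumes c: "c > 0" and lam: "lam > 0"
  shows "\<exists>f. (\<forall>r s. 0 \<le> r \<and> r \<le> s \<longrightarrow> f s \<le> f r) \<and> admissible (\<lambda>x. f (norm x)) \<and>
     nsq lborel (\<lambda>x::real^2. f (norm x)) = lam \<and>
     (\<forall>w. admissible w \<longrightarrow> nsq lborel w = lam \<longrightarrow> FF c (\<lambda>x. f (norm x)) \<le> FF c w)"
proof -
  obtain v0 where "admissible v0" "nsq lborel v0 = lam" "\<And>w. admissible w \<Longrightarrow> nsq lborel w = lam \<Longrightarrow> FF c v0 \<le> FF c w"
    using minimiser_exists[OF c lam] by blast
  then interpret g0: ground_state c lam v0 using c lam by unfold_locales auto
  obtain p where p: "AE x in lborel. v0 (p - x) = v0 (p + x)" using g0.symmetric_about_point by blast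
  define v1 where "v1 x = v0 (x + p)" for x
  interpret g1: ground_state c lam v1 unfolding v1_def by (rule g0.shifted)
  have "AE x in lborel. v1 (- x) = v1 x" using p by (simp add: v1_def add.commute)
  from g1.radial_representative[OF this] obtain g where
    g: "\<And>s. s > 0 \<Longrightarrow> 0 \<le> g s" "\<And>r s. 0 < r \<Longrightarrow> r \<le> s \<Longrightarrow> g s \<le> g r"
    and gm: "(\<lambda>x::real^2. if x = 0 then 0 else g (norm x)) \<in> borel_measurable borel"
    and gv: "AE x in lborel. v1 x = g (norm x)" by blast
  \<comment> \<open>A representative that is radial at every point; its value 0 at the origin is
    provisional and serves the boundedness argument.\<close>
  define v2 where "v2 = (\<lambda>x::real^2. if x = 0 then 0 else g (norm x))"
  have nz: "AE x in lborel. (x::real^2) \<noteq> 0" by (rule AE_I'[of "{0}"]) (auto simp: null_sets_def)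
  have e2: "AE x in lborel. v2 x = v1 x" using gv nz by eventually_elim (simp add: v2_def)
  have v2m: "v2 \<in> borel_measurable borel" unfolding v2_def by (rule gm)
  have v2n: "0 \<le> v2 x" for x using g(1) by (simp add: v2_def)
  note c2 = admissible_cong_AE[OF g1.adm v2m v2n e2]
  interpret g2: ground_state c lam v2
    using c lam c2 g1.mass g1.min by unfold_locales auto
  obtain B where B: "\<And>s. s > 0 \<Longrightarrow> g s \<le> B" using g2.radial_bounded[OF g v2_def] by blast
  \<comment> \<open>At radius 0 a bound of the profile is inserted, so that \<open>f\<close>
    decreases from 0 on; the maximum with 0 keeps it nonnegative there, and only a null set is
    changed.\<close>
  define f where "f s = (if s > 0 then g s else max 0 B)" for s
  define v3 where "v3 = (\<lambda>x::real^2. f (norm x))"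
  have v3: "v3 = (\<lambda>x. if x = 0 then max 0 B else v2 x)" by (simp add: fun_eq_iff v3_def f_def v2_def)
  have v3m: "v3 \<in> borel_measurable borel" unfolding v3 using v2m by measurable
  have v3n: "0 \<le> v3 x" for x unfolding v3 using v2n by simp
  have e3: "AE x in lborel. v3 x = v2 x" using nz by eventually_elim (simp add: v3)
  note c3 = admissible_cong_AE[OF g2.adm v3m v3n e3]
  have "f s \<le> f r" if "0 \<le> r \<and> r \<le> s" for r s
    using that g(2)[of r s] B[of s] by (auto simp: f_def)
  moreover have "admissible v3" "nsq lborel v3 = lam" using c3 g2.mass by auto
  moreover have "FF c v3 \<le> FF c w" if "admissible w" "nsq lborel w = lam" for w
    using c3(4)[of c] g2.min[OF that] by simp
  ultimately show ?thesis unfolding v3_def by (intro exI[of _ f]) auto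
qed

theorem theorem3p1:
  fixes \<gamma> lam :: real
  assumes "\<gamma> > 0" and "lam > 0"
  shows "\<exists>u \<in> X_space. sym_decreasing u \<and> mass u = lam \<and> ereal (energy \<gamma> u) = e0 \<gamma> lam"
proof -
  define c where "c = \<gamma> / (4 * pi)"
  have c: "c > 0" using assms by (simp add: c_def)
  obtain f where dec: "\<And>r s. 0 \<le> r \<and> r \<le> s \<Longrightarrow> f s \<le> f r" and adm: "admissible (\<lambda>x. f (norm x))"
    and mass: "nsq lborel (\<lambda>x::real^2. f (norm x)) = lam"
    and min: "\<And>w. admissible w \<Longrightarrow> nsq lborel w = lam \<Longrightarrow> FF c (\<lambda>x. f (norm x)) \<le> FF c w"
    using radial_minimiser_exists[OF c assms(2)] by blast
  define u where "u x = complex_of_real (f (norm x))" for x :: "real^2"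
  have u: "u = (\<lambda>x. complex_of_real (f (norm x)))" by (simp add: u_def fun_eq_iff)
  have pos: "nsq lborel (\<lambda>x::real^2. f (norm x)) > 0" using mass assms by simp
  note X = admissible_in_X[OF adm pos, folded u]
  have cu: "(\<lambda>x. cmod (u x)) = (\<lambda>x. f (norm x))" using admissibleD(3)[OF adm] by (auto simp: u_def fun_eq_iff)
  have Eu: "energy \<gamma> u = FF c (\<lambda>x. f (norm x))"
    using energy_eq[of u \<gamma>] adm X(2) by (simp add: cu FF_def c_def)
  have "ereal (energy \<gamma> u) = e0 \<gamma> lam"
    unfolding e0_def
  proof (rule antisym)
    show "ereal (energy \<gamma> u) \<le> (INF u\<in>{u \<in> X_space. mass u = lam}. ereal (energy \<gamma> u))"
    proof (rule INF_greatest)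
      fix w assume "w \<in> {u \<in> X_space. mass u = lam}"
      then have w: "w \<in> X_space" "mass w = lam" by auto
      \<comment> \<open>A complex competitor is compared through its modulus: the interaction
        depends on the modulus only, and the Dirichlet energy does not increase.\<close>
      note cm = cmod_admissible[OF w(1)]
      have wpos: "mass w > 0" using w assms by simp
      have "energy \<gamma> u \<le> FF c (\<lambda>x. cmod (w x))" unfolding Eu by (rule min) (use cm[OF wpos] w in auto)
      also have "\<dots> \<le> energy \<gamma> w"
        using energy_eq[OF cm(1)[OF wpos], of \<gamma>] cm(3)[OF wpos] by (simp add: FF_def c_def)
      finally show "ereal (energy \<gamma> u) \<le> ereal (energy \<gamma> w)" by simp
    qed
    show "(INF u\<in>{u \<in> X_space. mass u = lam}. ereal (energy \<gamma> u)) \<le> ereal (energy \<gamma> u)"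
      by (rule INF_lower) (use X mass in auto)
  qed
  moreover have "sym_decreasing u" unfolding sym_decreasing_def u using dec by (intro exI[of _ f]) auto
  ultimately show ?thesis using X mass by (intro bexI[of _ u]) auto
qed

end
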